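(* Consider on $[0,T]$ the partitioned SDE with additive noise $$dX^{(q)}=g^{(q)}_0(X^{(1)},X^{(2)},t)\,dt+\sum_{m=1}^M g^{(q)}_m(t)\,dW_m(t),\qquad q=1,2,$$ with deterministic initial values. Let it be solved by the stochastic partitioned Runge–Kutta method which, in a step from $t_n$ to $t_{n+1}=t_n+h$, computes $$H_1^{(q)}=Y_n^{(q)}\quad(q=1,2),$$ $$H_2^{(1)}=Y_n^{(1)}+\tfrac h2\Big(g_0^{(1)}(H_1^{(1)},H_1^{(2)},t_n)+g_0^{(1)}(H_2^{(1)},H_2^{(2)},t_{n+1})\Big)+\sum_{m=1}^M\tfrac{\Delta W_m}{2}\Big(g^{(1)}_m(t_n)+g^{(1)}_m(t_{n+1})\Big),$$ $$H_2^{(2)}=Y_n^{(2)}+h\,g_0^{(2)}(H_1^{(1)},H_1^{(2)},t_n)+\sum_{m=1}^M\Delta W_m\,g_m^{(2)}(t_n),$$ $$Y_{n+1}^{(q)}=Y_n^{(q)}+\tfrac h2\Big(g_0^{(q)}(H_1^{(1)},H_1^{(2)},t_n)+g_0^{(q)}(H_2^{(1)},H_2^{(2)},t_{n+1})\Big)+\sum_{m=1}^M\tfrac{\Delta W_m}{2}\Big(g^{(q)}_m(t_n)+g^{(q)}_m(t_{n+1})\Big),\quad q=1,2,$$ where $\Delta W_m=W_m(t_{n+1})-W_m(t_n)$. Then the method is of strong order $1$ and of weak order $2$.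
   Context: $W_1,\dots,W_M$ are independent one-dimensional Wiener processes, $X^{(q)}$ takes values in $\mathbb R^{d_q}$. The coefficients are assumed sufficiently smooth, understood here as: all $g^{(q)}_m$ are $C^\infty$ with all partial derivatives of order $\ge1$ bounded (so that existence and uniqueness hold, and $H_2^{(1)}$ is uniquely defined for all sufficiently small $h$). $Y_0^{(q)}=X^{(q)}(0)$. For a grid $0=t_0<\dots<t_N=T$ with maximal step size $h$, write $X=(X^{(1)},X^{(2)})$, $Y_n=(Y^{(1)}_n,Y^{(2)}_n)$. Strong (mean square) order $p$ means $\max_{n}\big(E\|Y_n-X(t_n)\|^2\big)^{1/2}=\mathcal O(h^p)$ as $h\to0$. Weak order $p$ means that for every $C^\infty$ function $f$ which together with all its derivatives has polynomial growth, $\max_n|E f(Y_n)-E f(X(t_n))|=\mathcal O(h^p)$ as $h\to0$. *)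

theory Defs
  imports "HOL-Probability.Probability"
begin

section \<open>Smoothness\<close>

text \<open>
  The list \<open>is\<close> of basis vectors is a multi-index: \<open>D (i # is)\<close> is the partial derivative
  of \<open>D is\<close> in direction \<open>i\<close>.  Every \<open>D is\<close> is required to be (Frechet) differentiable, hence all
  partial derivatives exist and are continuous.  Derivatives are taken within \<open>S\<close>, so that
  they are one-sided at the end points of a time interval.
\<close>

definition partial_derivatives_on ::
  "'v::euclidean_space set \<Rightarrow> ('v \<Rightarrow> 'w::real_normed_vector) \<Rightarrow> ('v list \<Rightarrow> 'v \<Rightarrow> 'w) \<Rightarrow> bool" where
  "partial_derivatives_on S f D \<longleftrightarrow>
     (\<forall>x\<in>S. D [] x = f x) \<and>
     (\<forall>is\<in>lists Basis. \<forall>x\<in>S.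
        (D is has_derivative (\<lambda>v. \<Sum>i\<in>Basis. (v \<bullet> i) *\<^sub>R D (i # is) x)) (at x within S))"

definition smooth_bounded_derivatives_on ::
  "'v::euclidean_space set \<Rightarrow> ('v \<Rightarrow> 'w::real_normed_vector) \<Rightarrow> bool" where
  "smooth_bounded_derivatives_on S f \<longleftrightarrow>
     (\<exists>D. partial_derivatives_on S f D \<and>
          (\<forall>is\<in>lists Basis. is \<noteq> [] \<longrightarrow> bounded (D is ` S)))"

definition smooth_polynomial_growth ::
  "('v::euclidean_space \<Rightarrow> 'w::real_normed_vector) \<Rightarrow> bool" where
  "smooth_polynomial_growth f \<longleftrightarrow>
     (\<exists>D. partial_derivatives_on UNIV f D \<and>
          (\<forall>is\<in>lists Basis. \<exists>C. \<exists>r::nat. \<forall>x. norm (D is x) \<le> C * (1 + norm x ^ r)))"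

section \<open>Wiener processes and stochastic integrals of deterministic integrands\<close>

definition wiener_process :: "'o measure \<Rightarrow> (real \<Rightarrow> 'o \<Rightarrow> real) \<Rightarrow> bool" where
  "wiener_process P W \<longleftrightarrow>
     (\<forall>t\<ge>0. W t \<in> borel_measurable P) \<and>
     (AE \<omega> in P. W 0 \<omega> = 0) \<and>
     (\<forall>n. \<forall>s::nat \<Rightarrow> real. 0 \<le> s 0 \<and> (\<forall>i<n. s i \<le> s (Suc i)) \<longrightarrow>
        prob_space.indep_vars P (\<lambda>_. borel) (\<lambda>i \<omega>. W (s (Suc i)) \<omega> - W (s i) \<omega>) {..<n}) \<and>
     (\<forall>s t. 0 \<le> s \<and> s < t \<longrightarrow>
        distributed P lborel (\<lambda>\<omega>. W t \<omega> - W s \<omega>) (normal_density 0 (sqrt (t - s)))) \<and>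
     (AE \<omega> in P. continuous_on {0..} (\<lambda>t. W t \<omega>))"

definition independent_wiener_processes ::
  "'o measure \<Rightarrow> nat \<Rightarrow> (nat \<Rightarrow> real \<Rightarrow> 'o \<Rightarrow> real) \<Rightarrow> bool" where
  "independent_wiener_processes P M W \<longleftrightarrow>
     (\<forall>m\<in>{1..M}. wiener_process P (W m)) \<and>
     prob_space.indep_vars P (\<lambda>_. PiM {0..} (\<lambda>_. borel))
       (\<lambda>m \<omega>. \<lambda>t\<in>{0..}. W m t \<omega>) {1..M}"

definition step_function ::
  "nat \<Rightarrow> (nat \<Rightarrow> real) \<Rightarrow> (nat \<Rightarrow> 'v::real_vector) \<Rightarrow> real \<Rightarrow> 'v" where
  "step_function n s c u = (\<Sum>i<n. indicator {s i<..s (Suc i)} u *\<^sub>R c i)"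

definition step_integral ::
  "(real \<Rightarrow> 'o \<Rightarrow> real) \<Rightarrow> nat \<Rightarrow> (nat \<Rightarrow> real) \<Rightarrow> (nat \<Rightarrow> 'v::real_vector) \<Rightarrow> 'o \<Rightarrow> 'v" where
  "step_integral W n s c \<omega> = (\<Sum>i<n. (W (s (Suc i)) \<omega> - W (s i) \<omega>) *\<^sub>R c i)"

text \<open>
  \<open>I\<close> is (a version of) the integral over \<open>[0,t]\<close> of the deterministic function \<open>\<sigma>\<close> with respect
  to \<open>W\<close>, i.e. the mean square limit of the integrals of step functions converging to \<open>\<sigma>\<close>
  in \<open>L\<^sup>2[0,t]\<close>.  For deterministic integrands the Ito and the Stratonovich integral both
  coincide with this integral.
\<close>

definition has_wiener_integral ::
  "'o measure \<Rightarrow> (real \<Rightarrow> 'o \<Rightarrow> real) \<Rightarrow> (real \<Rightarrow> 'v::euclidean_space) \<Rightarrow> real \<Rightarrow> ('o \<Rightarrow> 'v) \<Rightarrow> bool" where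
  "has_wiener_integral P W \<sigma> t I \<longleftrightarrow>
     set_borel_measurable lborel {0..t} \<sigma> \<and>
     I \<in> borel_measurable P \<and>
     (\<exists>(n :: nat \<Rightarrow> nat) (s :: nat \<Rightarrow> nat \<Rightarrow> real) (c :: nat \<Rightarrow> nat \<Rightarrow> 'v).
        (\<forall>k. s k 0 = 0 \<and> s k (n k) = t \<and> (\<forall>i<n k. s k i \<le> s k (Suc i))) \<and>
        (\<lambda>k. \<integral>\<^sup>+u\<in>{0..t}. ennreal ((norm (\<sigma> u - step_function (n k) (s k) (c k) u))\<^sup>2) \<partial>lborel)
          \<longlonglongrightarrow> 0 \<and>
        (\<lambda>k. \<integral>\<^sup>+\<omega>. ennreal ((norm (I \<omega> - step_integral W (n k) (s k) (c k) \<omega>))\<^sup>2) \<partial>P)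
          \<longlonglongrightarrow> 0)"

text \<open>
  \<open>X\<close> is a continuous process on \<open>[0,T]\<close> with
  \<open>dX = b(t) dt + (\<Sum>m=1..M. \<sigma> m t dW m t)\<close> and \<open>X 0 = x0\<close>; the drift \<open>b\<close> may be random
  and, in a differential equation, depend on the solution.
\<close>

definition additive_noise_dynamics ::
  "'o measure \<Rightarrow> nat \<Rightarrow> (nat \<Rightarrow> real \<Rightarrow> 'o \<Rightarrow> real) \<Rightarrow> real \<Rightarrow>
   (real \<Rightarrow> 'o \<Rightarrow> 'v::euclidean_space) \<Rightarrow> (nat \<Rightarrow> real \<Rightarrow> 'v) \<Rightarrow> 'v \<Rightarrow> (real \<Rightarrow> 'o \<Rightarrow> 'v) \<Rightarrow> bool" where
  "additive_noise_dynamics P M W T b \<sigma> x0 X \<longleftrightarrow>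
     (\<forall>t\<in>{0..T}. X t \<in> borel_measurable P) \<and>
     (AE \<omega> in P. continuous_on {0..T} (\<lambda>t. X t \<omega>)) \<and>
     (AE \<omega> in P. X 0 \<omega> = x0) \<and>
     (\<exists>I :: nat \<Rightarrow> real \<Rightarrow> 'o \<Rightarrow> 'v.
        (\<forall>m\<in>{1..M}. \<forall>t\<in>{0..T}. has_wiener_integral P (W m) (\<sigma> m) t (I m t)) \<and>
        (\<forall>t\<in>{0..T}. AE \<omega> in P.
           (\<lambda>u. b u \<omega>) integrable_on {0..t} \<and>
           X t \<omega> = x0 + integral {0..t} (\<lambda>u. b u \<omega>) + (\<Sum>m=1..M. I m t \<omega>)))"

section \<open>The stochastic partitioned Runge--Kutta method\<close>

text \<open>
  One step from time \<open>s\<close> to time \<open>s'\<close> with Wiener increments \<open>dW\<close>.  The stage \<open>H21\<close> is implicit;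
  its equation has exactly one solution when the step size is small enough, and
  only the limit of vanishing step size matters for the orders of convergence below.
\<close>

definition sprk_step ::
  "nat \<Rightarrow> ('a::euclidean_space \<Rightarrow> 'b::euclidean_space \<Rightarrow> real \<Rightarrow> 'a) \<Rightarrow> (nat \<Rightarrow> real \<Rightarrow> 'a) \<Rightarrow>
   ('a \<Rightarrow> 'b \<Rightarrow> real \<Rightarrow> 'b) \<Rightarrow> (nat \<Rightarrow> real \<Rightarrow> 'b) \<Rightarrow>
   real \<Rightarrow> real \<Rightarrow> (nat \<Rightarrow> real) \<Rightarrow> 'a \<times> 'b \<Rightarrow> 'a \<times> 'b" where
  "sprk_step M g01 g1 g02 g2 s s' dW y =
     (let h = s' - s;
          H11 = fst y;
          H12 = snd y;
          H22 = snd y + h *\<^sub>R g02 H11 H12 s + (\<Sum>m=1..M. dW m *\<^sub>R g2 m s);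
          H21 = (THE H. H = fst y + (h / 2) *\<^sub>R (g01 H11 H12 s + g01 H H22 s')
                            + (\<Sum>m=1..M. (dW m / 2) *\<^sub>R (g1 m s + g1 m s')))
      in (fst y + (h / 2) *\<^sub>R (g01 H11 H12 s + g01 H21 H22 s')
            + (\<Sum>m=1..M. (dW m / 2) *\<^sub>R (g1 m s + g1 m s')),
          snd y + (h / 2) *\<^sub>R (g02 H11 H12 s + g02 H21 H22 s')
            + (\<Sum>m=1..M. (dW m / 2) *\<^sub>R (g2 m s + g2 m s'))))"

primrec sprk ::
  "nat \<Rightarrow> ('a::euclidean_space \<Rightarrow> 'b::euclidean_space \<Rightarrow> real \<Rightarrow> 'a) \<Rightarrow> (nat \<Rightarrow> real \<Rightarrow> 'a) \<Rightarrow>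
   ('a \<Rightarrow> 'b \<Rightarrow> real \<Rightarrow> 'b) \<Rightarrow> (nat \<Rightarrow> real \<Rightarrow> 'b) \<Rightarrow>
   (nat \<Rightarrow> real \<Rightarrow> 'o \<Rightarrow> real) \<Rightarrow> 'a \<times> 'b \<Rightarrow> (nat \<Rightarrow> real) \<Rightarrow> nat \<Rightarrow> 'o \<Rightarrow> 'a \<times> 'b" where
  "sprk M g01 g1 g02 g2 W y0 t 0 = (\<lambda>\<omega>. y0)"
| "sprk M g01 g1 g02 g2 W y0 t (Suc n) =
     (\<lambda>\<omega>. sprk_step M g01 g1 g02 g2 (t n) (t (Suc n))
            (\<lambda>m. W m (t (Suc n)) \<omega> - W m (t n) \<omega>) (sprk M g01 g1 g02 g2 W y0 t n \<omega>))"

section \<open>Orders of convergence\<close>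

definition time_grid :: "real \<Rightarrow> nat \<Rightarrow> (nat \<Rightarrow> real) \<Rightarrow> bool" where
  "time_grid T N t \<longleftrightarrow> t 0 = 0 \<and> t N = T \<and> (\<forall>n<N. t n < t (Suc n))"

definition max_step :: "nat \<Rightarrow> (nat \<Rightarrow> real) \<Rightarrow> real" where
  "max_step N t = (MAX n\<in>{..<N}. t (Suc n) - t n)"

text \<open>
  A numerical method is given by its approximations \<open>Y t n\<close> on the grid points \<open>t n\<close> of a grid \<open>t\<close>.
  The existence of the expectations is part of the claims, because the Bochner
  integral of a non-integrable function is 0.  The constants are uniform over all grids.
\<close>

definition strong_order ::
  "'o measure \<Rightarrow> real \<Rightarrow> (real \<Rightarrow> 'o \<Rightarrow> 'v::euclidean_space) \<Rightarrow>
   ((nat \<Rightarrow> real) \<Rightarrow> nat \<Rightarrow> 'o \<Rightarrow> 'v) \<Rightarrow> real \<Rightarrow> bool" where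
  "strong_order P T X Y p \<longleftrightarrow>
     (\<exists>C \<delta>. \<delta> > 0 \<and>
       (\<forall>N t. time_grid T N t \<and> max_step N t \<le> \<delta> \<longrightarrow>
          (\<forall>n\<le>N. Y t n \<in> borel_measurable P \<and>
                  integrable P (\<lambda>\<omega>. (norm (Y t n \<omega> - X (t n) \<omega>))\<^sup>2)) \<and>
          (MAX n\<in>{..N}. sqrt (\<integral>\<omega>. (norm (Y t n \<omega> - X (t n) \<omega>))\<^sup>2 \<partial>P))
            \<le> C * max_step N t powr p))"

definition weak_order ::
  "'o measure \<Rightarrow> real \<Rightarrow> (real \<Rightarrow> 'o \<Rightarrow> 'v::euclidean_space) \<Rightarrow>
   ((nat \<Rightarrow> real) \<Rightarrow> nat \<Rightarrow> 'o \<Rightarrow> 'v) \<Rightarrow> real \<Rightarrow> bool" where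
  "weak_order P T X Y p \<longleftrightarrow>
     (\<forall>f :: 'v \<Rightarrow> real. smooth_polynomial_growth f \<longrightarrow>
       (\<exists>C \<delta>. \<delta> > 0 \<and>
         (\<forall>N t. time_grid T N t \<and> max_step N t \<le> \<delta> \<longrightarrow>
            (\<forall>n\<le>N. integrable P (\<lambda>\<omega>. f (Y t n \<omega>)) \<and> integrable P (\<lambda>\<omega>. f (X (t n) \<omega>))) \<and>
            (MAX n\<in>{..N}. \<bar>(\<integral>\<omega>. f (Y t n \<omega>) \<partial>P) - (\<integral>\<omega>. f (X (t n) \<omega>) \<partial>P)\<bar>)
              \<le> C * max_step N t powr p)))"

end

theory Submission
  imports Defs
begin

text \<open>
  Compare one step of size \<open>h\<close> with two steps of size \<open>h / 2\<close> driven by the same two Wiener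
  increments.  The difference is of third order in \<open>rho = sqrt h + |dW|\<close>, up to a leading part that is
  antisymmetric in the two increments, and its parts of odd order change sign with the noise.  As the law of
  the increments is invariant under exchanging them and under sign changes, the second moment and the
  mean of the difference, and its effect on smooth observables, are all \<open>O(h^3)\<close>.  Summation over the
  steps shows that bisecting a grid of mesh \<open>h\<close> changes the result by \<open>O(h)\<close> in mean square and by
  \<open>O(h\<^sup>2)\<close> weakly; these changes form geometric series over repeated bisections, whose limit is the
  solution.  No Kolmogorov equation is needed: smoothness of observables is measured by first, second and
  third differences, which one step of the method propagates.
\<close>

text \<open>Orders are counted in powers of \<open>rho\<close>, so order six means a contribution
  h^3 per step. The leading part is antisymmetric because the drift values of two half steps and of
  one full step combine with the weights 1, 1, 1 and -2: the terms proportional to the step cancel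
  and the noise enters only through x1 - x2. The terms quadratic in the noise vanish after
  exchanging the increments and changing the sign of one of them; these two operations generate a
  group of eight, and the sum over its orbits has order six. For a nonlinear observable this average
  cannot be taken inside: the even part of the difference, of order four, acts at points that are
  themselves displaced by noise of order one. Pairing opposite displacements gains the two missing
  orders, and this is what third differences are for. The remaining linear functional of the even
  part is then treated by the single sign change. The given solution enters late: the dyadic
  refinements are shown to converge to it almost surely, path by path and without a rate, and all
  rates come from bisection. Thus no uniqueness theorem for the equation is invoked.\<close>

notation scaleR (infixr "*R" 75)

section \<open>Mixed differences of smooth functions\<close>

definition d2 :: "(bool => bool => 'v::real_vector) => 'v" where
 "d2 x = x True True - x True False - x False True + x False False"

definition d3 :: "(bool => bool => bool => 'v::real_vector) => 'v" where
 "d3 x = d2 (x True) - d2 (x False)"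

text \<open>Four points that need not form a parallelogram: \<open>al1\<close> and
  \<open>al2\<close> bound the edges and \<open>be\<close> the parallelogram defect. The defect has
  to be carried along because a nonlinear step destroys parallelograms.\<close>

definition sqb :: "(bool => bool => 'v::real_normed_vector) => real => real => real => bool" where
 "sqb x al1 al2 be \<longleftrightarrow> (\<forall>j. norm (x True j - x False j) <= al1) \<and> (\<forall>i. norm (x i True - x i False) <= al2) \<and>
   norm (d2 x) <= be"

text \<open>\<open>be12\<close>, \<open>be13\<close>, \<open>be23\<close> bound the defects of the
  three pairs of opposite faces and \<open>ga\<close> that of the whole cube, so that the data match
  the terms of the chain rule for third derivatives.\<close>

definition cubeb :: "(bool => bool => bool => 'v::real_normed_vector) =>
  real => real => real => real => real => real => real => bool" where
 "cubeb x al1 al2 al3 be12 be13 be23 ga \<longleftrightarrow>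
   (\<forall>k. sqb (%i j. x i j k) al1 al2 be12) \<and> (\<forall>j. sqb (%i k. x i j k) al1 al3 be13) \<and>
   (\<forall>i. sqb (%j k. x i j k) al2 al3 be23) \<and> norm (d3 x) <= ga"

text \<open>One product for each set partition of the three directions, as in Faa di Bruno's
  formula; the analogue for squares is \<open>be + al1 * al2\<close>.\<close>

abbreviation b3 :: "real => real => real => real => real => real => real => real" where
 "b3 al1 al2 al3 be12 be13 be23 ga \<equiv> ga + al1 * be23 + al2 * be13 + al3 * be12 + al1 * al2 * al3"

lemma sqb_nonneg: assumes "sqb x al1 al2 be" shows "0 <= al1" "0 <= al2" "0 <= be"
 using assms norm_ge_zero order_trans unfolding sqb_def by metis+

lemma cubeb_nonneg: assumes "cubeb x al1 al2 al3 be12 be13 be23 ga"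
 shows "0 <= al1" "0 <= al2" "0 <= al3" "0 <= be12" "0 <= be13" "0 <= be23" "0 <= ga"
 using assms sqb_nonneg norm_ge_zero order_trans unfolding cubeb_def by metis+

lemma norm_mvt01:
 fixes ph :: "real => 'w::real_normed_vector"
 assumes "\<And>s. s \<in> {0..1} ==> (ph has_vector_derivative ph' s) (at s within {0..1})"
  and "\<And>s. s \<in> {0..1} ==> norm (ph' s) <= B"
 shows "norm (ph 1 - ph 0) <= B"
proof -
 have "norm (ph 1 - ph 0) <= B * norm (1 - 0 :: real)"
 proof (rule differentiable_bound[where S="{0..1::real}" and f'="%s h. h *R ph' s"])
  fix s :: real assume s: "s \<in> {0..1}"
  show "(ph has_derivative (%h. h *R ph' s)) (at s within {0..1})"
   using assms(1)[OF s] by (simp add: has_vector_derivative_def)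
  have "norm (h *R ph' s) <= B * norm h" for h
   using mult_left_mono[OF assms(2)[OF s], of "\<bar>h\<bar>"] by (simp add: mult.commute)
  then show "onorm (%h. h *R ph' s) <= B" by (rule onorm_le)
 qed auto
 then show ?thesis by simp
qed

text \<open>A finite stock of derivatives with a common bound, on a convex set so that segments stay
  inside. The empty list is exempt from the bound, as the coefficients may grow linearly.
  Derivatives within \<open>S\<close> cover the one-sided derivatives in time.\<close>

locale pd_family =
 fixes S :: "'v::euclidean_space set" and D :: "'v list => 'v => 'w::banach"
  and n :: nat and K :: real
 assumes convex_S: "convex S"
  and deriv: "\<And>is x. is \<in> lists Basis ==> x \<in> S ==>
    (D is has_derivative (%v. \<Sum>i\<in>Basis. (v \<bullet> i) *R D (i # is) x)) (at x within S)"
  and bound: "\<And>is x. is \<in> lists Basis ==> is \<noteq> [] ==> length is <= n ==> x \<in> S ==> norm (D is x) <= K"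
  and K_nonneg: "0 <= K"
begin

definition dm :: real where "dm = real DIM('v)"

lemma dm_ge1: "1 <= dm"
 using DIM_positive[where 'a='v] unfolding dm_def by linarith

lemma dm_nonneg [simp]: "0 <= dm"
 using dm_ge1 by linarith

lemma segment_in: "x \<in> S ==> x + d \<in> S ==> s \<in> {0..1} ==> x + s *R d \<in> S"
proof -
 assume a: "x \<in> S" "x + d \<in> S" "s \<in> {0..1}"
 have "(1 - s) *R x + s *R (x + d) \<in> S"
  using a convex_S by (intro convexD) auto
 then show ?thesis by (simp add: algebra_simps)
qed

lemma line_deriv:
 assumes "is \<in> lists Basis" "x \<in> S" "x + d \<in> S" "s \<in> {0..1}"
 shows "((%s. D is (x + s *R d)) has_vector_derivative (\<Sum>i\<in>Basis. (d \<bullet> i) *R D (i # is) (x + s *R d)))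
     (at s within {0..1})"
proof -
 have 1: "((%s. x + s *R d) has_derivative (%h. h *R d)) (at s within {0..1})"
  by (auto intro!: derivative_eq_intros)
 have img: "(%s. x + s *R d) ` {0..1} \<subseteq> S"
  using segment_in assms by auto
 have 2: "(D is has_derivative (%v. \<Sum>i\<in>Basis. (v \<bullet> i) *R D (i # is) (x + s *R d)))
   (at (x + s *R d) within (%s. x + s *R d) ` {0..1})"
  using deriv[OF assms(1) segment_in[OF assms(2-4)]] img by (rule has_derivative_subset)
 show ?thesis
  using has_derivative_in_compose[OF 1 2]
  by (simp add: has_vector_derivative_def scaleR_sum_right)
qed

lemma norm_sum_Basis:
 assumes "\<And>i. i \<in> Basis ==> norm (f i) <= B"
 shows "norm (\<Sum>i\<in>(Basis::'v set). (d \<bullet> i) *R f i) <= norm d * (dm * B)"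
proof -
 have "norm (\<Sum>i\<in>(Basis::'v set). (d \<bullet> i) *R f i) <= (\<Sum>i\<in>(Basis::'v set). norm d * B)"
 proof (rule sum_norm_le)
  fix i :: 'v assume i: "i \<in> Basis"
  show "norm ((d \<bullet> i) *R f i) <= norm d * B"
   using assms[OF i] Basis_le_norm[OF i, of d] by (simp add: mult_mono')
 qed
 then show ?thesis by (simp add: ac_simps dm_def)
qed

lemma seg_bound:
 assumes "is \<in> lists Basis" "length is < n" "x \<in> S" "y \<in> S"
 shows "norm (D is y - D is x) <= norm (y - x) * (dm * K)"
proof -
 have "norm (D is (x + 1 *R (y - x)) - D is (x + 0 *R (y - x))) <= norm (y - x) * (dm * K)"
 proof (rule norm_mvt01[where ph="%s. D is (x + s *R (y - x))"])
  fix s :: real assume s: "s \<in> {0..1}"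
  show "((%s. D is (x + s *R (y - x))) has_vector_derivative (\<Sum>i\<in>Basis. ((y-x) \<bullet> i) *R D (i # is) (x + s *R (y-x))))
     (at s within {0..1})"
   using assms s by (intro line_deriv) auto
  show "norm (\<Sum>i\<in>Basis. ((y-x) \<bullet> i) *R D (i # is) (x + s *R (y-x))) <= norm (y - x) * (dm * K)"
   by (rule norm_sum_Basis) (use assms segment_in[of x "y-x" s] s in \<open>auto intro!: bound\<close>)
 qed
 then show ?thesis by simp
qed

lemma convex_comb_le:
 fixes u v :: "'x::real_normed_vector"
 assumes "norm u <= a" "norm v <= a" "s \<in> {0..1}"
 shows "norm ((1 - s) *R u + s *R v) <= a"
proof -
 have "norm ((1 - s) *R u + s *R v) <= (1-s) * norm u + s * norm v"
  using assms(3) norm_triangle_ineq[of "(1-s) *R u" "s *R v"] by simp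
 also have "... <= (1-s) * a + s * a"
  using assms by (intro add_mono mult_left_mono) auto
 finally show ?thesis by (simp add: algebra_simps)
qed

text \<open>Join the edges in the second direction by segments and differentiate the difference of
  \<open>D is\<close> along them. The derivative has two contributions: the direction varies, at
  cost \<open>be\<close>, and the base point varies, at cost \<open>al1 * al2\<close>. Two further
  derivatives are consumed, hence the condition on the length.\<close>

lemma sq_bound:
 assumes "is \<in> lists Basis" "length is + 1 < n" "\<And>i j. x i j \<in> S" "sqb x al1 al2 be"
 shows "norm (d2 (%i j. D is (x i j))) <= dm^2 * K * (be + al1 * al2)"
proof -
 note nn = sqb_nonneg[OF assms(4)]
 define d where "d i = x i True - x i False" for i
 define p where "p i s = x i False + s *R d i" for i and s :: real
 have p_in: "p i s \<in> S" if "s \<in> {0..1}" for i s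
  unfolding p_def using that assms(3)[of i True] assms(3)[of i False] by (intro segment_in) (auto simp: d_def)
 have p_diff: "norm (p True s - p False s) <= al1" if "s \<in> {0..1}" for s
 proof -
  have "p True s - p False s = (1 - s) *R (x True False - x False False) + s *R (x True True - x False True)"
   by (simp add: p_def d_def algebra_simps)
  then show ?thesis using assms(4) that by (simp add: convex_comb_le sqb_def)
 qed
 have dd: "norm (d True - d False) <= be"
  using assms(4) by (simp add: sqb_def d_def d2_def algebra_simps)
 have d0: "norm (d i) <= al2" for i using assms(4) by (simp add: sqb_def d_def)
 have "norm ((D is (p True 1) - D is (p False 1)) - (D is (p True 0) - D is (p False 0))) <= dm^2 * K * (be + al1 * al2)"
 proof (rule norm_mvt01[where ph="%s. D is (p True s) - D is (p False s)"])
  fix s :: real assume s: "s \<in> {0..1}"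
  let ?G = "%i. \<Sum>b\<in>Basis. (d i \<bullet> b) *R D (b # is) (p i s)"
  show "((%s. D is (p True s) - D is (p False s)) has_vector_derivative (?G True - ?G False)) (at s within {0..1})"
   unfolding p_def
   by (intro has_vector_derivative_diff line_deriv assms s) (auto simp: d_def assms)
  \<comment> \<open>Product rule for differences: first the direction is changed, then the base
    point.\<close>
  have "?G True - ?G False = (\<Sum>b\<in>Basis. ((d True - d False) \<bullet> b) *R D (b # is) (p True s))
    + (\<Sum>b\<in>Basis. (d False \<bullet> b) *R (D (b # is) (p True s) - D (b # is) (p False s)))"
   by (simp add: sum_subtractf[symmetric] sum.distrib[symmetric] algebra_simps)
  also have "norm ... <= be * (dm * K) + al2 * (dm * (al1 * (dm * K)))"
  proof (intro norm_triangle_mono)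
   have "norm (\<Sum>b\<in>Basis. ((d True - d False) \<bullet> b) *R D (b # is) (p True s)) <= norm (d True - d False) * (dm * K)"
    by (rule norm_sum_Basis) (use assms p_in s in \<open>auto intro!: bound\<close>)
   also have "... <= be * (dm * K)" using dd K_nonneg by (intro mult_right_mono) auto
   finally show "norm (\<Sum>b\<in>Basis. ((d True - d False) \<bullet> b) *R D (b # is) (p True s)) <= be * (dm * K)" .
   have "norm (\<Sum>b\<in>Basis. (d False \<bullet> b) *R (D (b # is) (p True s) - D (b # is) (p False s)))
     <= norm (d False) * (dm * (al1 * (dm * K)))"
   proof (rule norm_sum_Basis)
    fix b :: 'v assume "b \<in> Basis"
    then have "norm (D (b # is) (p True s) - D (b # is) (p False s)) <= norm (p True s - p False s) * (dm * K)"
     using assms p_in s by (intro seg_bound) auto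
    also have "... <= al1 * (dm * K)" using p_diff[OF s] K_nonneg by (intro mult_right_mono) auto
    finally show "norm (D (b # is) (p True s) - D (b # is) (p False s)) <= al1 * (dm * K)" .
   qed
   also have "... <= al2 * (dm * (al1 * (dm * K)))"
    using d0 nn K_nonneg by (intro mult_right_mono) auto
   finally show "norm (\<Sum>b\<in>Basis. (d False \<bullet> b) *R (D (b # is) (p True s) - D (b # is) (p False s)))
     <= al2 * (dm * (al1 * (dm * K)))" .
  qed
  also have "... <= dm^2 * K * (be + al1 * al2)"
  proof -
   have "be * (dm * K) <= be * (dm^2 * K)"
    using nn K_nonneg dm_ge1 by (intro mult_left_mono mult_right_mono) (auto simp: power2_eq_square)
   then show ?thesis by (simp add: power2_eq_square algebra_simps)
  qed
  finally show "norm (?G True - ?G False) <= dm^2 * K * (be + al1 * al2)" .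
 qed
 then show ?thesis by (simp add: p_def d_def d2_def algebra_simps)
qed

text \<open>The same interpolation, now in the third direction and for the second difference over
  the first two. It reduces the claim to \<open>sq_bound\<close>, \<open>seg_bound\<close> and
  \<open>bound\<close>, with one more derivative than for squares.\<close>

lemma cube_bound:
 assumes "is \<in> lists Basis" "length is + 2 < n" "\<And>i j k. x i j k \<in> S"
  "cubeb x al1 al2 al3 be12 be13 be23 ga"
 shows "norm (d3 (%i j k. D is (x i j k))) <= dm^3 * K * b3 al1 al2 al3 be12 be13 be23 ga"
proof -
 note nn = cubeb_nonneg[OF assms(4)]
 define d where "d i j = x i j True - x i j False" for i j
 define p where "p i j s = x i j False + s *R d i j" for i j and s :: real
 have p_in: "p i j s \<in> S" if "s \<in> {0..1}" for i j s
  unfolding p_def using that assms(3)[of i j True] assms(3)[of i j False] by (intro segment_in) (auto simp: d_def)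
 have pc: "p i j s = (1 - s) *R x i j False + s *R x i j True" for i j s
  by (simp add: p_def d_def algebra_simps)
 have p1: "norm (p True j s - p False j s) <= al1" if "s \<in> {0..1}" for j s
 proof -
  have "p True j s - p False j s = (1 - s) *R (x True j False - x False j False) + s *R (x True j True - x False j True)"
   by (simp add: pc algebra_simps)
  then show ?thesis using assms(4) that by (simp add: convex_comb_le sqb_def cubeb_def)
 qed
 have p2: "norm (p i True s - p i False s) <= al2" if "s \<in> {0..1}" for i s
 proof -
  have "p i True s - p i False s = (1 - s) *R (x i True False - x i False False) + s *R (x i True True - x i False True)"
   by (simp add: pc algebra_simps)
  then show ?thesis using assms(4) that by (simp add: convex_comb_le sqb_def cubeb_def)
 qed
 have p12: "norm (d2 (%i j. p i j s)) <= be12" if "s \<in> {0..1}" for s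
 proof -
  have "d2 (%i j. p i j s) = (1 - s) *R d2 (%i j. x i j False) + s *R d2 (%i j. x i j True)"
   by (simp add: pc d2_def algebra_simps)
  then show ?thesis using assms(4) that by (simp add: convex_comb_le sqb_def cubeb_def)
 qed
 have psq: "sqb (%i j. p i j s) al1 al2 be12" if "s \<in> {0..1}" for s
  using p1 p2 p12 that by (auto simp: sqb_def)
 have a3: "norm (d i j) <= al3" for i j using assms(4) by (simp add: cubeb_def sqb_def d_def)
 have b13: "norm (d True j - d False j) <= be13" for j
 proof -
  have "d True j - d False j = d2 (%i k. x i j k)" by (simp add: d_def d2_def algebra_simps)
  then show ?thesis using assms(4) by (simp add: cubeb_def sqb_def)
 qed
 have b23: "norm (d i True - d i False) <= be23" for i
 proof -
  have "d i True - d i False = d2 (%j k. x i j k)" by (simp add: d_def d2_def algebra_simps)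
  then show ?thesis using assms(4) by (simp add: cubeb_def sqb_def)
 qed
 have c: "norm (d2 d) <= ga"
 proof -
  have "d2 d = d3 x" by (simp add: d_def d2_def d3_def algebra_simps)
  then show ?thesis using assms(4) by (simp add: cubeb_def)
 qed
 have "norm (d2 (%i j. D is (p i j 1)) - d2 (%i j. D is (p i j 0))) <= dm^3 * K * b3 al1 al2 al3 be12 be13 be23 ga"
 proof (rule norm_mvt01[where ph="%s. d2 (%i j. D is (p i j s))"])
  fix s :: real assume s: "s \<in> {0..1}"
  let ?A = "%b i j. D (b # is) (p i j s)"
  let ?G = "%i j. \<Sum>b\<in>Basis. (d i j \<bullet> b) *R ?A b i j"
  show "((%s. d2 (%i j. D is (p i j s))) has_vector_derivative d2 ?G) (at s within {0..1})"
   unfolding p_def d2_def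
   by (intro has_vector_derivative_diff has_vector_derivative_add line_deriv assms s) (auto simp: d_def assms)
  \<comment> \<open>Leibniz rule for mixed second differences: the four groups distribute the two
    differences over the directions \<open>d\<close> and the derivatives \<open>?A\<close>,
    evaluated at suitable corners.\<close>
  have "d2 ?G = (\<Sum>b\<in>Basis. (d False False \<bullet> b) *R d2 (?A b))
    + (\<Sum>b\<in>Basis. ((d True False - d False False) \<bullet> b) *R (?A b True True - ?A b True False))
    + (\<Sum>b\<in>Basis. ((d False True - d False False) \<bullet> b) *R (?A b True True - ?A b False True))
    + (\<Sum>b\<in>Basis. (d2 d \<bullet> b) *R ?A b True True)"
   by (simp add: d2_def sum_subtractf[symmetric] sum.distrib[symmetric] algebra_simps)
  also have "norm ... <= al3 * (dm * (dm^2 * K * (be12 + al1 * al2))) + be13 * (dm * (al2 * (dm * K)))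
    + be23 * (dm * (al1 * (dm * K))) + ga * (dm * K)"
  proof (intro norm_triangle_mono)
   have "norm (\<Sum>b\<in>Basis. (d False False \<bullet> b) *R d2 (?A b)) <= norm (d False False) * (dm * (dm^2 * K * (be12 + al1 * al2)))"
    by (rule norm_sum_Basis, rule sq_bound[where x="%i j. p i j s"]) (use assms p_in psq s in auto)
   also have "... <= al3 * (dm * (dm^2 * K * (be12 + al1 * al2)))"
    using a3 K_nonneg nn by (intro mult_right_mono) auto
   finally show "norm (\<Sum>b\<in>Basis. (d False False \<bullet> b) *R d2 (?A b)) <= al3 * (dm * (dm^2 * K * (be12 + al1 * al2)))" .
   have seg: "norm (D (b # is) u - D (b # is) v) <= al * (dm * K)" if "b \<in> Basis" "u \<in> S" "v \<in> S" "norm (u - v) <= al" for b u v al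
   proof -
    have "norm (D (b # is) u - D (b # is) v) <= norm (u - v) * (dm * K)"
     using assms that by (intro seg_bound) auto
    also have "... <= al * (dm * K)" using that K_nonneg by (intro mult_right_mono) auto
    finally show ?thesis .
   qed
   have "norm (\<Sum>b\<in>Basis. ((d True False - d False False) \<bullet> b) *R (?A b True True - ?A b True False))
    <= norm (d True False - d False False) * (dm * (al2 * (dm * K)))"
    by (rule norm_sum_Basis) (use p_in p2 s in \<open>auto intro!: seg\<close>)
   also have "... <= be13 * (dm * (al2 * (dm * K)))"
    using b13 K_nonneg nn by (intro mult_right_mono) auto
   finally show "norm (\<Sum>b\<in>Basis. ((d True False - d False False) \<bullet> b) *R (?A b True True - ?A b True False))
    <= be13 * (dm * (al2 * (dm * K)))" .
   have "norm (\<Sum>b\<in>Basis. ((d False True - d False False) \<bullet> b) *R (?A b True True - ?A b False True))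
    <= norm (d False True - d False False) * (dm * (al1 * (dm * K)))"
    by (rule norm_sum_Basis) (use p_in p1 s in \<open>auto intro!: seg\<close>)
   also have "... <= be23 * (dm * (al1 * (dm * K)))"
    using b23 K_nonneg nn by (intro mult_right_mono) auto
   finally show "norm (\<Sum>b\<in>Basis. ((d False True - d False False) \<bullet> b) *R (?A b True True - ?A b False True))
    <= be23 * (dm * (al1 * (dm * K)))" .
   have "norm (\<Sum>b\<in>Basis. (d2 d \<bullet> b) *R ?A b True True) <= norm (d2 d) * (dm * K)"
    by (rule norm_sum_Basis) (use assms p_in s in \<open>auto intro!: bound\<close>)
   also have "... <= ga * (dm * K)" using c K_nonneg by (intro mult_right_mono) auto
   finally show "norm (\<Sum>b\<in>Basis. (d2 d \<bullet> b) *R ?A b True True) <= ga * (dm * K)" .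
  qed
  also have "... <= dm^3 * K * b3 al1 al2 al3 be12 be13 be23 ga"
  proof -
   have e: "dm <= dm^3" "dm^2 <= dm^3"
    using dm_ge1 power_increasing[of 1 3 dm] power_increasing[of 2 3 dm] by auto
   have "ga * (dm * K) <= ga * (dm^3 * K)"
    using nn K_nonneg e by (intro mult_left_mono mult_right_mono) auto
   moreover have "(be13 * al2 + be23 * al1) * (dm^2 * K) <= (be13 * al2 + be23 * al1) * (dm^3 * K)"
    using nn K_nonneg e by (intro mult_left_mono mult_right_mono) auto
   ultimately show ?thesis by (simp add: power2_eq_square power3_eq_cube algebra_simps)
  qed
  finally show "norm (d2 ?G) <= dm^3 * K * b3 al1 al2 al3 be12 be13 be23 ga" .
 qed
 then show ?thesis by (simp add: p_def d_def d2_def d3_def algebra_simps)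
qed

end

section \<open>Taylor expansion with an odd term of third order\<close>

text \<open>
 A second order expansion whose remainder is odd up to order four: two increments that nearly
 cancel have remainders that nearly cancel.
\<close>

definition quad_approx ::
 "real => 'v set => ('v::real_normed_vector => 'w::real_normed_vector) => ('v => 'w) => ('v => 'v => 'w) => bool" where
 "quad_approx C V A L B \<longleftrightarrow> linear L \<and> bilinear B \<and> (\<forall>v. norm (L v) <= C * norm v) \<and>
   (\<forall>u v. norm (B u v) <= C * norm u * norm v) \<and>
   (\<forall>v\<in>V. norm (A v - L v - B v v) <= C * norm v ^ 3) \<and>
   (\<forall>u\<in>V. \<forall>v\<in>V. norm ((A u - L u - B u u) + (A v - L v - B v v))
    <= C * (norm (u + v) * (norm u + norm v)^2 + (norm u + norm v) ^ 4))"

context pd_family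
begin

text \<open>The \<open>j\<close>-fold derivative in the direction \<open>v\<close>, a homogeneous
  polynomial of degree \<open>j\<close> in \<open>v\<close>. As an iterated sum it has a derivative
  along the line in direction \<open>v\<close> that is again of this form.\<close>

primrec dd :: "'v => nat => 'v list => 'v => 'w" where
 "dd v 0 is x = D is x"
| "dd v (Suc j) is x = (\<Sum>i\<in>Basis. (v \<bullet> i) *R dd v j (i # is) x)"

lemma dd_line:
 assumes "is \<in> lists Basis" "x \<in> S" "x + v \<in> S" "s \<in> {0..1}"
 shows "((%s. dd v j is (x + s *R v)) has_vector_derivative dd v (Suc j) is (x + s *R v)) (at s within {0..1})"
 using assms(1)
proof (induction j arbitrary: "is")
 case 0
 then show ?case using line_deriv assms by simp
next
 case (Suc j)
 have "((%s. \<Sum>i\<in>Basis. (v \<bullet> i) *R dd v j (i # is) (x + s *R v)) has_vector_derivative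
   (\<Sum>i\<in>Basis. (v \<bullet> i) *R dd v (Suc j) (i # is) (x + s *R v))) (at s within {0..1})"
 proof (intro has_vector_derivative_sum)
  fix i :: 'v assume i: "i \<in> Basis"
  have "((%s. dd v j (i # is) (x + s *R v)) has_vector_derivative dd v (Suc j) (i # is) (x + s *R v)) (at s within {0..1})"
   using Suc i by auto
  then show "((%s. (v \<bullet> i) *R dd v j (i # is) (x + s *R v)) has_vector_derivative
    (v \<bullet> i) *R dd v (Suc j) (i # is) (x + s *R v)) (at s within {0..1})"
   by (rule bounded_linear.has_vector_derivative[OF bounded_linear_scaleR_right])
 qed
 then show ?case by simp
qed

lemma dd_bound:
 assumes "is \<in> lists Basis" "x \<in> S" "length is + j <= n" "0 < length is + j"
 shows "norm (dd v j is x) <= (norm v * dm) ^ j * K"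
 using assms(1,3,4)
proof (induction j arbitrary: "is")
 case 0
 then show ?case using bound assms by auto
next
 case (Suc j)
 have "norm (dd v (Suc j) is x) <= norm v * (dm * ((norm v * dm) ^ j * K))"
  unfolding dd.simps by (rule norm_sum_Basis) (use Suc in auto)
 then show ?case by (simp add: ac_simps)
qed

text \<open>Exchange \<open>u\<close> for \<open>v\<close> in one factor at a time; each exchange
  costs \<open>norm (u - v)\<close>. Applied to \<open>- v\<close>, this shows that the cubic Taylor
  terms of \<open>u\<close> and \<open>v\<close> nearly cancel when \<open>u + v\<close> is
  small.\<close>

lemma dd_diff:
 assumes "is \<in> lists Basis" "x \<in> S" "length is + Suc j <= n"
 shows "norm (dd u (Suc j) is x - dd v (Suc j) is x) <= real (Suc j) * norm (u - v) * (norm u + norm v) ^ j * (dm ^ Suc j * K)"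
 using assms(1,3)
proof (induction j arbitrary: "is")
 case 0
 have "dd u (Suc 0) is x - dd v (Suc 0) is x = (\<Sum>i\<in>Basis. ((u - v) \<bullet> i) *R D (i # is) x)"
  by (simp add: sum_subtractf[symmetric] algebra_simps)
 also have "norm ... <= norm (u - v) * (dm * K)"
  by (rule norm_sum_Basis) (use 0 assms in \<open>auto intro!: bound\<close>)
 finally show ?case by simp
next
 case (Suc j)
 let ?m = "norm u + norm v"
 have "dd u (Suc (Suc j)) is x - dd v (Suc (Suc j)) is x =
   (\<Sum>i\<in>Basis. (u \<bullet> i) *R (dd u (Suc j) (i # is) x - dd v (Suc j) (i # is) x))
   + (\<Sum>i\<in>Basis. ((u - v) \<bullet> i) *R dd v (Suc j) (i # is) x)"
  unfolding dd.simps(2)[of _ "Suc j"] sum_subtractf[symmetric] sum.distrib[symmetric]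
  by (intro sum.cong refl) (simp add: scaleR_diff_right inner_diff_left scaleR_diff_left del: dd.simps(2))
 also have "norm ... <= ?m * (dm * (real (Suc j) * norm (u - v) * ?m ^ j * (dm ^ Suc j * K)))
   + norm (u - v) * (dm * ((?m * dm) ^ Suc j * K))"
 proof (intro norm_triangle_mono)
  have "norm (\<Sum>i\<in>Basis. (u \<bullet> i) *R (dd u (Suc j) (i # is) x - dd v (Suc j) (i # is) x))
   <= norm u * (dm * (real (Suc j) * norm (u - v) * ?m ^ j * (dm ^ Suc j * K)))"
   by (rule norm_sum_Basis, rule Suc.IH) (use Suc.prems in auto)
  also have "... <= ?m * (dm * (real (Suc j) * norm (u - v) * ?m ^ j * (dm ^ Suc j * K)))"
   using K_nonneg by (intro mult_right_mono) auto
  finally show "norm (\<Sum>i\<in>Basis. (u \<bullet> i) *R (dd u (Suc j) (i # is) x - dd v (Suc j) (i # is) x)) <= ..." .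
  show "norm (\<Sum>i\<in>Basis. ((u - v) \<bullet> i) *R dd v (Suc j) (i # is) x) <= norm (u - v) * (dm * ((?m * dm) ^ Suc j * K))"
  proof (rule norm_sum_Basis)
   fix i :: 'v assume i: "i \<in> Basis"
   have "norm (dd v (Suc j) (i # is) x) <= (norm v * dm) ^ Suc j * K"
    by (rule dd_bound) (use Suc.prems i assms in auto)
   also have "... <= (?m * dm) ^ Suc j * K"
    using K_nonneg by (intro mult_right_mono power_mono) auto
   finally show "norm (dd v (Suc j) (i # is) x) <= (?m * dm) ^ Suc j * K" .
  qed
 qed
 also have "... = real (Suc (Suc j)) * norm (u - v) * ?m ^ Suc j * (dm ^ Suc (Suc j) * K)"
 proof -
  have "m * (dm * (real (Suc j) * d * m ^ j * (dm ^ Suc j * K))) + d * (dm * ((m * dm) ^ Suc j * K))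
   = real (Suc (Suc j)) * d * m ^ Suc j * (dm ^ Suc (Suc j) * K)" for m d :: real
   by (simp add: power_mult_distrib algebra_simps)
  then show ?thesis .
 qed
 finally show ?case .
qed

lemma taylor:
 assumes "x \<in> S" "x + v \<in> S" "0 < p" "p <= n"
 shows "norm (D [] (x + v) - (\<Sum>i<p. (1 / fact i) *R dd v i [] x)) <= (norm v * dm) ^ p * K"
proof -
 let ?Df = "%m s. dd v m [] (x + s *R v)"
 have *: "((%s. ((1 - s) ^ (p - 1) / fact (p - 1)) *R ?Df p s) has_integral
   ?Df 0 1 - (\<Sum>i<p. ((1 - 0) ^ i / fact i) *R ?Df i 0)) {0..1}"
  by (rule Taylor_has_integral) (use assms dd_line in auto)
 have "norm (?Df 0 1 - (\<Sum>i<p. ((1 - 0) ^ i / fact i) *R ?Df i 0)) <= ((norm v * dm) ^ p * K) * measure lborel (cbox 0 (1::real))"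
 proof (rule has_integral_bound[OF _ *[unfolded box_real[symmetric]]])
  show "0 <= (norm v * dm) ^ p * K" using K_nonneg by simp
  fix s :: real assume s: "s \<in> cbox 0 1"
  have 1: "norm (?Df p s) <= (norm v * dm) ^ p * K"
   by (rule dd_bound) (use s assms segment_in in auto)
  \<comment> \<open>The kernel is at most 1, so the bound of the derivative passes to the
    remainder.\<close>
  have 2: "\<bar>(1 - s) ^ (p - 1) / fact (p - 1)\<bar> <= 1"
  proof -
   have "(1 - s) ^ (p - 1) <= 1" using s by (intro power_le_one) auto
   moreover have "(1::real) <= fact (p - 1)" by (rule fact_ge_1)
   ultimately have "(1 - s) ^ (p - 1) <= fact (p - 1)" by linarith
   then show ?thesis using s by (auto simp: abs_mult)
  qed
  show "norm (((1 - s) ^ (p - 1) / fact (p - 1)) *R ?Df p s) <= (norm v * dm) ^ p * K"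
   using mult_mono[OF 2 1] by (simp)
 qed
 then show ?thesis by simp
qed

text \<open>\<open>L\<close> is the first derivative and \<open>B\<close> half of the second. The
  remainder is an odd cubic term plus one of fourth order, hence four derivatives; the factor 8 is
  slack that lets one constant serve all estimates.\<close>

lemma quad_approx_D:
 assumes n: "4 <= n" and x: "x \<in> S"
 shows "\<exists>L B. quad_approx (8 * dm ^ 4 * K) {v. x + v \<in> S} (%v. D [] (x + v) - D [] x) L B"
proof -
 define L where "L v = dd v 1 [] x" for v
 define B where "B u v = (\<Sum>i\<in>Basis. (u \<bullet> i) *R (\<Sum>k\<in>Basis. (v \<bullet> k) *R ((1/2) *R D [k, i] x)))" for u v
 define R where "R v = D [] (x + v) - D [] x - L v - B v v" for v
 have dK: "dm ^ j * K <= dm ^ 4 * K" if "j <= 4" for j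
  using that dm_ge1 K_nonneg by (intro mult_right_mono power_increasing) auto
 have dK8: "dm ^ j * K <= 8 * (dm ^ 4 * K)" if "j <= 4" for j
 proof -
  have "0 <= dm ^ 4 * K" using K_nonneg by simp
  then show ?thesis using dK[OF that] by linarith
 qed
 have two: "(1 / 2) *R dd v 2 [] x = B v v" for v
  unfolding B_def numeral_2_eq_2 dd.simps scaleR_sum_right
  by (intro sum.cong refl) (simp add: mult.left_commute)
 have "linear L"
  by (rule linearI) (auto simp: L_def inner_add_left scaleR_add_left sum.distrib scaleR_sum_right)
 moreover have "bilinear B"
  unfolding bilinear_def
 proof (intro conjI allI linearI)
  show "B u (v + w) = B u v + B u w" "B (v + w) u = B v u + B w u" for u v w
   by (simp_all only: B_def inner_add_left scaleR_add_left scaleR_add_right sum.distrib)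
  show "B u (r *R v) = r *R B u v" "B (r *R v) u = r *R B v u" for r u v
   by (simp_all only: B_def inner_scaleR_left scaleR_sum_right scaleR_scaleR mult.left_commute mult.assoc)
 qed
 moreover have "norm (L v) <= 8 * dm ^ 4 * K * norm v" for v
 proof -
  have "norm (L v) <= (norm v * dm) ^ 1 * K" unfolding L_def by (rule dd_bound) (use x n in auto)
  also have "... = norm v * (dm ^ 1 * K)" by simp
  also have "... <= norm v * (8 * (dm ^ 4 * K))" by (intro mult_left_mono dK8) auto
  finally show ?thesis by (simp add: ac_simps)
 qed
 moreover have "norm (B u v) <= 8 * dm ^ 4 * K * norm u * norm v" for u v
 proof -
  have "norm (B u v) <= norm u * (dm * (norm v * (dm * K)))"
   unfolding B_def
  proof (intro norm_sum_Basis)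
   fix i k :: 'v assume "i \<in> Basis" "k \<in> Basis"
   then have "norm (D [k,i] x) <= K" using n x by (intro bound) auto
   then show "norm ((1 / 2) *R D [k, i] x) <= K" using norm_ge_zero[of "D [k,i] x"] unfolding norm_scaleR by (simp; linarith)
  qed
  also have "... = (norm u * norm v) * (dm ^ 2 * K)" by (simp add: power2_eq_square)
  also have "... <= (norm u * norm v) * (8 * (dm ^ 4 * K))" by (intro mult_left_mono dK8) auto
  finally show ?thesis by (simp add: ac_simps)
 qed
 moreover have "norm (R v) <= 8 * dm ^ 4 * K * norm v ^ 3" if "x + v \<in> S" for v
 proof -
  have "R v = D [] (x + v) - (\<Sum>i<3. (1 / fact i) *R dd v i [] x)"
   by (simp add: R_def L_def two[symmetric] numeral_3_eq_3 del: dd.simps(2)) (simp add: numeral_2_eq_2)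
  also have "norm ... <= (norm v * dm) ^ 3 * K" using x that n by (intro taylor) auto
  also have "... = norm v ^ 3 * (dm ^ 3 * K)" by (simp add: power_mult_distrib)
  also have "... <= norm v ^ 3 * (8 * (dm ^ 4 * K))" by (intro mult_left_mono dK8) auto
  finally show ?thesis by (simp add: ac_simps)
 qed
 moreover have "norm (R u + R v) <= 8 * dm ^ 4 * K * (norm (u + v) * (norm u + norm v)^2 + (norm u + norm v) ^ 4)"
  if uv: "x + u \<in> S" "x + v \<in> S" for u v
 proof -
  define Q where "Q v = D [] (x + v) - (\<Sum>i<4. (1 / fact i) *R dd v i [] x)" for v
  have R: "R v = (1/6) *R dd v 3 [] x + Q v" for v
   by (simp add: R_def L_def Q_def two[symmetric] eval_nat_numeral del: dd.simps(2))
  have neg: "dd (- v) 3 [] x = - dd v 3 [] x"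
   by (simp add: numeral_3_eq_3 sum_negf)
  have Q: "norm (Q v) <= norm v ^ 4 * (dm ^ 4 * K)" if "x + v \<in> S" for v
   using taylor[OF x that, of 4] n by (simp add: Q_def power_mult_distrib)
  \<comment> \<open>Comparison with \<open>- v\<close>, whose cubic term is the negative of that of
    \<open>v\<close>.\<close>
  have "norm (dd u 3 [] x - dd (- v) 3 [] x) <= 3 * norm (u + v) * (norm u + norm v)^2 * (dm ^ 3 * K)"
   using dd_diff[of "[]" x 2 u "-v"] x n by (simp add: numeral_3_eq_3 numeral_2_eq_2 del: dd.simps(2))
  also have "... <= 3 * norm (u + v) * (norm u + norm v)^2 * (dm ^ 4 * K)"
   using dK[of 3] by (intro mult_left_mono) auto
  finally have T: "norm (dd u 3 [] x + dd v 3 [] x) <= 3 * norm (u + v) * (norm u + norm v)^2 * (dm ^ 4 * K)"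
   by (simp add: neg)
  have "R u + R v = (1/6) *R (dd u 3 [] x + dd v 3 [] x) + Q u + Q v"
   by (simp add: R scaleR_add_right)
  also have "norm ... <= norm (u + v) * (norm u + norm v)^2 * (dm ^ 4 * K) + norm u ^ 4 * (dm ^ 4 * K) + norm v ^ 4 * (dm ^ 4 * K)"
  proof (intro norm_triangle_mono Q uv)
   have "norm ((1/6) *R (dd u 3 [] x + dd v 3 [] x)) = (1/6) * norm (dd u 3 [] x + dd v 3 [] x)" by simp
   also have "... <= norm (u + v) * (norm u + norm v)^2 * (dm ^ 4 * K)"
    using T norm_ge_zero[of "dd u 3 [] x + dd v 3 [] x"] by linarith
   finally show "norm ((1/6) *R (dd u 3 [] x + dd v 3 [] x)) <= ..." .
  qed
  also have "... <= norm (u + v) * (norm u + norm v)^2 * (dm ^ 4 * K) + (norm u + norm v) ^ 4 * (dm ^ 4 * K) + (norm u + norm v) ^ 4 * (dm ^ 4 * K)"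
   using K_nonneg by (intro add_mono mult_right_mono power_mono) auto
  also have "... <= 8 * dm ^ 4 * K * (norm (u + v) * (norm u + norm v)^2 + (norm u + norm v) ^ 4)"
  proof -
   have "0 <= norm (u + v) * (norm u + norm v)^2 * (dm ^ 4 * K)" "0 <= (norm u + norm v) ^ 4 * (dm ^ 4 * K)"
    using K_nonneg by auto
   then show ?thesis by (simp add: algebra_simps)
  qed
  finally show ?thesis .
 qed
 ultimately have "quad_approx (8 * dm ^ 4 * K) {v. x + v \<in> S} (%v. D [] (x + v) - D [] x) L B"
  unfolding quad_approx_def R_def by auto
 then show ?thesis by blast
qed

end

section \<open>Uniform bounds for finitely many derivatives\<close>

lemma finite_lists_Basis: "finite {is \<in> lists (Basis :: 'v::euclidean_space set). length is <= n}"
 using finite_lists_length_le[OF finite_Basis, of n] by (simp add: lists_eq_set conj_commute)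

text \<open>Only finitely many multi-indices have length at most \<open>n\<close>, so their separate
  bounds have a common one.\<close>

lemma smooth_bounded_pd_family:
 fixes f :: "'v::euclidean_space => 'w::banach"
 assumes "smooth_bounded_derivatives_on S f" "convex S"
 shows "\<exists>D K. pd_family S D n K \<and> (\<forall>x\<in>S. D [] x = f x)"
proof -
 obtain D where D: "partial_derivatives_on S f D" and b: "\<And>is. is \<in> lists Basis ==> is \<noteq> [] ==> bounded (D is ` S)"
  using assms(1) unfolding smooth_bounded_derivatives_on_def by auto
 let ?I = "{is \<in> lists (Basis :: 'v set). length is <= n} - {[]}"
 have "bounded (\<Union>is\<in>?I. D is ` S)"
  using b finite_lists_Basis[of n] by (intro bounded_UN) auto
 then obtain K where K: "\<And>y. y \<in> (\<Union>is\<in>?I. D is ` S) ==> norm y <= K" and "0 < K"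
  unfolding bounded_pos by blast
 have "pd_family S D n K"
 proof
  show "norm (D is x) <= K" if "is \<in> lists Basis" "is \<noteq> []" "length is <= n" "x \<in> S" for "is" x
   using K[of "D is x"] that by auto
 qed (use assms D \<open>0 < K\<close> in \<open>auto simp: partial_derivatives_on_def\<close>)
 then show ?thesis using D by (auto simp: partial_derivatives_on_def)
qed

lemma pd_family_Pair:
 assumes "pd_family S D1 n K1" "pd_family S D2 n K2"
 shows "pd_family S (%is x. (D1 is x, D2 is x)) n (K1 + K2)"
proof -
 interpret f1: pd_family S D1 n K1 by fact
 interpret f2: pd_family S D2 n K2 by fact
 show ?thesis
 proof
  fix "is" :: "'a list" and x assume a: "is \<in> lists Basis" "x \<in> S"
  have "((%x. (D1 is x, D2 is x)) has_derivative
    (%v. (\<Sum>i\<in>Basis. (v \<bullet> i) *R D1 (i # is) x, \<Sum>i\<in>Basis. (v \<bullet> i) *R D2 (i # is) x))) (at x within S)"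
   by (intro has_derivative_Pair f1.deriv f2.deriv a)
  then show "((%x. (D1 is x, D2 is x)) has_derivative
    (%v. \<Sum>i\<in>Basis. (v \<bullet> i) *R (D1 (i # is) x, D2 (i # is) x))) (at x within S)"
   by (simp add: sum_prod)
 next
  fix "is" :: "'a list" and x assume a: "is \<in> lists Basis" "is \<noteq> []" "length is <= n" "x \<in> S"
  show "norm (D1 is x, D2 is x) <= K1 + K2"
   using f1.bound[OF a] f2.bound[OF a] norm_Pair_le[of "D1 is x" "D2 is x"] by linarith
 qed (use f1.convex_S f1.K_nonneg f2.K_nonneg in auto)
qed

section \<open>The partitioned equation on the product space\<close>

definition drift :: "('a => 'b => real => 'a) => ('a => 'b => real => 'b) => 'a \<times> 'b => real => 'a \<times> 'b" where
 "drift g01 g02 y t = (g01 (fst y) (snd y) t, g02 (fst y) (snd y) t)"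

definition noise :: "nat => (nat => real => 'a::real_vector) => (nat => real => 'b::real_vector) => real => (nat => real) => 'a \<times> 'b" where
 "noise M g1 g2 t xi = (\<Sum>m=1..M. xi m *R (g1 m t, g2 m t))"

text \<open>The l1 size of the noise. Noise vectors are functions on all naturals, with the product
  topology used for measurability later on, but only the indices 1 to \<open>M\<close> are
  felt.\<close>

definition nz :: "nat => (nat => real) => real" where
 "nz M xi = (\<Sum>m=1..M. \<bar>xi m\<bar>)"

lemma nz_nonneg [simp]: "0 <= nz M xi" by (simp add: nz_def sum_nonneg)

lemma nz_uminus [simp]: "nz M (%m. - xi m) = nz M xi" by (simp add: nz_def)

lemma nz_0 [simp]: "nz M (%m. 0) = 0" by (simp add: nz_def)

lemma nz_add: "nz M (%m. xi m + et m) <= nz M xi + nz M et"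
 by (simp add: nz_def sum.distrib[symmetric] sum_mono)

lemma noise_add: "noise M g1 g2 t (%m. xi m + et m) = noise M g1 g2 t xi + noise M g1 g2 t et"
 by (simp only: noise_def sum.distrib[symmetric] scaleR_add_left)

lemma noise_diff: "noise M g1 g2 t (%m. xi m - et m) = noise M g1 g2 t xi - noise M g1 g2 t et"
 by (simp only: noise_def sum_subtractf[symmetric] scaleR_diff_left)

lemma noise_uminus: "noise M g1 g2 t (%m. - xi m) = - noise M g1 g2 t xi"
 by (simp only: noise_def sum_negf[symmetric] scaleR_minus_left)

lemma noise_0 [simp]: "noise M g1 g2 t (%m. 0) = 0"
 unfolding noise_def by (intro sum.neutral) (simp add: zero_prod_def)

lemma norm_mixed_pair_le: "norm (fst p, snd q) <= norm p + norm q"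
 using norm_Pair_le[of "fst p" "snd q"] norm_fst_le[of "fst p" "snd p"] norm_snd_le[of "snd q" "fst q"]
 by (simp)

text \<open>What the error analysis uses of the coefficients, under one constant \<open>K\<close>.
  Differences of states are followed at a fixed time and with common noise, so
  \<open>drift_sq\<close> and \<open>drift_cube\<close> freeze the time; \<open>drift_quad\<close>,
  which serves the local expansion, treats state and time as one variable.\<close>

locale scheme =
 fixes M :: nat
  and g01 :: "'a::euclidean_space => 'b::euclidean_space => real => 'a"
  and g1 :: "nat => real => 'a"
  and g02 :: "'a => 'b => real => 'b"
  and g2 :: "nat => real => 'b"
  and T K :: real
 assumes T_pos: "0 < T" and K_ge1: "1 <= K"
  and drift_lipschitz: "\<And>x y s s'. s \<in> {0..T} ==> s' \<in> {0..T} ==>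
    norm (drift g01 g02 x s - drift g01 g02 y s') <= K * (norm (x - y) + \<bar>s - s'\<bar>)"
  and drift_growth: "\<And>y s. s \<in> {0..T} ==> norm (drift g01 g02 y s) <= K * (1 + norm y)"
  and drift_sq: "\<And>x s al1 al2 be. s \<in> {0..T} ==> sqb x al1 al2 be ==>
    norm (d2 (%i j. drift g01 g02 (x i j) s)) <= K * (be + al1 * al2)"
  and drift_cube: "\<And>x s al1 al2 al3 be12 be13 be23 ga. s \<in> {0..T} ==> cubeb x al1 al2 al3 be12 be13 be23 ga ==>
    norm (d3 (%i j k. drift g01 g02 (x i j k) s)) <= K * b3 al1 al2 al3 be12 be13 be23 ga"
  and drift_quad: "\<And>y s. s \<in> {0..T} ==> \<exists>L B. quad_approx K {v. s + snd v \<in> {0..T}}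
    (%v. drift g01 g02 (y + fst v) (s + snd v) - drift g01 g02 y s) L B"
  and noise_bound: "\<And>s xi. s \<in> {0..T} ==> norm (noise M g1 g2 s xi) <= K * nz M xi"
  and noise_lipschitz: "\<And>s s' xi. s \<in> {0..T} ==> s' \<in> {0..T} ==>
    norm (noise M g1 g2 s xi - noise M g1 g2 s' xi) <= K * \<bar>s - s'\<bar> * nz M xi"
  and noise_sq: "\<And>s k xi. 0 <= k ==> s \<in> {0..T} ==> s + 2 * k \<in> {0..T} ==>
    norm (noise M g1 g2 s xi - 2 *R noise M g1 g2 (s + k) xi + noise M g1 g2 (s + 2 * k) xi) <= K * k^2 * nz M xi"
begin

abbreviation "a \<equiv> drift g01 g02"
abbreviation "Sg \<equiv> noise M g1 g2"
abbreviation "n \<equiv> nz M"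
abbreviation "stp \<equiv> sprk_step M g01 g1 g02 g2"

section \<open>Solvability and stability of one step\<close>

text \<open>The second stage; its first component solves the implicit equation and equals that of the new value.\<close>

definition stg :: "real => real => (nat => real) => 'a \<times> 'b => 'a \<times> 'b" where
 "stg s s' xi y = (fst (stp s s' xi y), snd y + (s' - s) *R snd (a y s) + snd (Sg s xi))"

text \<open>The factor 1 / 4 makes the implicit equation a contraction and leaves room to absorb
  into the left side all terms that contain the unknown stage. As \<open>1 <= K\<close>, it also
  bounds the step by 1 / 4.\<close>

definition admissible :: "real => real => bool" where
 "admissible s s' \<longleftrightarrow> 0 <= s \<and> s <= s' \<and> s' <= T \<and> (s' - s) * K <= 1 / 4"

lemma admissibleD:
 assumes "admissible s s'"
 shows "s \<in> {0..T}" "s' \<in> {0..T}" "s <= s'" "(s' - s) * K <= 1 / 4" "s' - s <= 1 / 4" "0 <= (s' - s) * K"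
proof -
 show "s \<in> {0..T}" "s' \<in> {0..T}" "s <= s'" "(s' - s) * K <= 1 / 4"
  using assms by (auto simp: admissible_def)
 then show "s' - s <= 1 / 4" "0 <= (s' - s) * K"
  using K_ge1 mult_left_mono[of 1 K "s' - s"] by auto
qed

lemma fst_drift [simp]: "fst (a y s) = g01 (fst y) (snd y) s"
 and snd_drift [simp]: "snd (a y s) = g02 (fst y) (snd y) s"
 by (auto simp: drift_def)

lemma fst_noise: "fst (Sg s xi) = (\<Sum>m=1..M. xi m *R g1 m s)"
 and snd_noise: "snd (Sg s xi) = (\<Sum>m=1..M. xi m *R g2 m s)"
 by (auto simp: noise_def fst_sum snd_sum)

text \<open>Banach's fixed point theorem gives the implicit stage a unique value, so that the
  definite description denotes it. The formula of the new first component is the fixed point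
  equation itself; this is why \<open>stg\<close> may read its first component off the step.\<close>

lemma stp_eq:
 assumes "admissible s s'"
 shows "stp s s' xi y = y + ((s' - s) / 2) *R (a y s + a (stg s s' xi y) s') + (1/2) *R (Sg s xi + Sg s' xi)"
proof -
 note ad = admissibleD[OF assms]
 define h where "h = s' - s"
 define z where "z = snd y + h *R g02 (fst y) (snd y) s + (\<Sum>m=1..M. xi m *R g2 m s)"
 define F where "F H = fst y + (h / 2) *R (g01 (fst y) (snd y) s + g01 H z s')
              + (\<Sum>m=1..M. (xi m / 2) *R (g1 m s + g1 m s'))" for H
 have half: "(\<Sum>m=1..M. (xi m / 2) *R (g m s + g m s'))
   = (1/2) *R ((\<Sum>m=1..M. xi m *R g m s) + (\<Sum>m=1..M. xi m *R g m s'))" for g :: "nat => real => 'c::real_vector"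
  by (simp add: scaleR_add_right scaleR_sum_right sum.distrib)
 have "\<exists>!H. F H = H"
 proof (rule banach_fix_type[where c="1/2"], simp, simp, intro allI)
  show "dist (F x) (F x') <= 1 / 2 * dist x x'" for x x'
  proof -
   have "F x - F x' = (h / 2) *R (g01 x z s' - g01 x' z s')"
    by (simp add: F_def algebra_simps)
   then have "norm (F x - F x') = (h / 2) * norm (fst (a (x, z) s' - a (x', z) s'))"
    using ad by (simp add: h_def)
   also have "... <= (h / 2) * (K * norm (x - x'))"
   proof (intro mult_left_mono)
    have "norm (fst (a (x, z) s' - a (x', z) s')) <= norm (a (x, z) s' - a (x', z) s')"
     by (metis norm_fst_le prod.collapse)
    also have "... <= K * (norm ((x,z) - (x',z)) + \<bar>s' - s'\<bar>)"
     using ad by (intro drift_lipschitz) auto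
    finally show "norm (fst (a (x, z) s' - a (x', z) s')) <= K * norm (x - x')"
     by (simp add: norm_Pair)
   qed (use ad in \<open>simp add: h_def\<close>)
   also have "... = (h * K) * norm (x - x') / 2" by simp
   also have "... <= 1 * norm (x - x') / 2"
    using ad by (intro divide_right_mono mult_right_mono) (auto simp: h_def)
   finally show ?thesis by (simp add: dist_norm)
  qed
 qed
 then have ex: "\<exists>!H. H = F H" by metis
 define H where "H = (THE H. H = F H)"
 have H: "H = F H" unfolding H_def using ex by (rule theI')
 have s: "stp s s' xi y = (F H, snd y + (h / 2) *R (g02 (fst y) (snd y) s + g02 H z s')
      + (\<Sum>m=1..M. (xi m / 2) *R (g2 m s + g2 m s')))"
  unfolding sprk_step_def Let_def H_def F_def z_def h_def ..
 have g: "stg s s' xi y = (H, z)"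
  using H by (simp add: stg_def s z_def h_def snd_noise)
 show ?thesis
  unfolding g by (simp add: s F_def half[unfolded One_nat_def] prod_eq_iff fst_noise snd_noise h_def)
qed

text \<open>The stage mixes two rules, trapezoidal in the first component and explicit Euler in the
  second. This is why pairs composed of components of different vectors occur from here on.\<close>

lemma stg_eq:
 assumes "admissible s s'"
 shows "stg s s' xi y = y + (fst (((s' - s) / 2) *R (a y s + a (stg s s' xi y) s')), snd ((s' - s) *R a y s))
   + (fst ((1/2) *R (Sg s xi + Sg s' xi)), snd (Sg s xi))"
proof -
 have "fst (stg s s' xi y) = fst (stp s s' xi y)" by (simp add: stg_def)
 then show ?thesis
  unfolding stp_eq[OF assms] by (simp add: prod_eq_iff) (simp add: stg_def)
qed

lemma norm_half_noise: "s \<in> {0..T} ==> s' \<in> {0..T} ==> norm ((1/2) *R (Sg s xi + Sg s' xi)) <= K * n xi"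
 using norm_triangle_ineq[of "Sg s xi" "Sg s' xi"] noise_bound[of s xi] noise_bound[of s' xi] by simp

lemma stg_disp:
 assumes "admissible s s'"
 shows "norm (stg s s' xi y - y) <= 4 * K * ((s' - s) * (1 + norm y) + n xi)"
proof -
 note ad = admissibleD[OF assms]
 define h v where "h = s' - s" and "v = norm (stg s s' xi y - y)"
 have hK: "0 <= h" "h * K <= 1/4" "h <= 1/4" "0 <= h * K" using ad by (auto simp: h_def)
 have ay: "norm (a y s) <= K * (1 + norm y)" using drift_growth ad by auto
 have "norm (a (stg s s' xi y) s' - a y s) <= K * (v + h)"
  using drift_lipschitz[of s' s "stg s s' xi y" y] ad by (simp add: v_def h_def)
 then have aH: "norm (a y s + a (stg s s' xi y) s') <= 2 * (K * (1 + norm y)) + K * (v + h)"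
  using ay norm_triangle_ineq[of "a y s + a y s" "a (stg s s' xi y) s' - a y s"] norm_triangle_ineq[of "a y s" "a y s"]
  by (simp add: algebra_simps)
 have "v = norm ((fst ((h / 2) *R (a y s + a (stg s s' xi y) s')), snd (h *R a y s))
   + (fst ((1/2) *R (Sg s xi + Sg s' xi)), snd (Sg s xi)))"
  unfolding v_def h_def by (subst (1) stg_eq[OF assms]) simp
 also have "... <= (norm ((h / 2) *R (a y s + a (stg s s' xi y) s')) + norm (h *R a y s))
   + (norm ((1/2) *R (Sg s xi + Sg s' xi)) + norm (Sg s xi))"
  by (intro norm_triangle_mono norm_mixed_pair_le)
 also have "... <= ((h/2) * (2 * (K * (1 + norm y)) + K * (v + h)) + h * (K * (1 + norm y))) + (K * n xi + K * n xi)"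
 proof (intro add_mono norm_half_noise noise_bound ad)
  show "norm ((h / 2) *R (a y s + a (stg s s' xi y) s')) <= (h/2) * (2 * (K * (1 + norm y)) + K * (v + h))"
   using mult_left_mono[OF aH, of "h/2"] hK by simp
  show "norm (h *R a y s) <= h * (K * (1 + norm y))" using mult_left_mono[OF ay, of h] hK by simp
 qed
 also have "... = 2 * (h * K * (1 + norm y)) + (h * K) * v / 2 + (h * K) * h / 2 + 2 * (K * n xi)"
  by (simp add: field_simps)
 finally have 1: "v <= 2 * (h * K * (1 + norm y)) + (h * K) * v / 2 + (h * K) * h / 2 + 2 * (K * n xi)" .
 \<comment> \<open>\<open>v\<close> also occurs on the right, with the factor h K / 2, which is at
   most 1 / 8 and can be absorbed.\<close>
 have 2: "(h * K) * v <= (1/4) * v" using hK by (intro mult_right_mono) (auto simp: v_def)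
 have 3: "(h * K) * h <= h * K * (1 + norm y)" using hK norm_ge_zero[of y] by (intro mult_left_mono) linarith+
 have 4: "0 <= h * K * (1 + norm y)" "0 <= K * n xi" using hK K_ge1 by auto
 have "v <= 4 * (h * K * (1 + norm y)) + 4 * (K * n xi)" using 1 2 3 4 by linarith
 then show ?thesis by (simp add: v_def h_def algebra_simps)
qed

lemma stp_disp:
 assumes "admissible s s'"
 shows "norm (stp s s' xi y - y) <= 4 * K * ((s' - s) * (1 + norm y) + n xi)"
proof -
 note ad = admissibleD[OF assms]
 define h v where "h = s' - s" and "v = norm (stg s s' xi y - y)"
 have v: "v <= 4 * K * (h * (1 + norm y) + n xi)" using stg_disp[OF assms] by (simp add: h_def v_def)
 have hK: "0 <= h" "h * K <= 1/4" "h <= 1/4" "0 <= h * K" using ad by (auto simp: h_def)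
 have ay: "norm (a y s) <= K * (1 + norm y)" using drift_growth ad by auto
 have "norm (a (stg s s' xi y) s' - a y s) <= K * (v + h)"
  using drift_lipschitz[of s' s "stg s s' xi y" y] ad by (simp add: v_def h_def)
 then have aH: "norm (a y s + a (stg s s' xi y) s') <= 2 * (K * (1 + norm y)) + K * (v + h)"
  using ay norm_triangle_ineq[of "a y s + a y s" "a (stg s s' xi y) s' - a y s"] norm_triangle_ineq[of "a y s" "a y s"]
  by (simp add: algebra_simps)
 have "norm (stp s s' xi y - y) <= norm ((h/2) *R (a y s + a (stg s s' xi y) s')) + norm ((1/2) *R (Sg s xi + Sg s' xi))"
  unfolding stp_eq[OF assms] h_def[symmetric] by (simp add: add.assoc del: scaleR_add_right norm_scaleR) (rule norm_triangle_ineq)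
 also have "... <= (h/2) * (2 * (K * (1 + norm y)) + K * (v + h)) + K * n xi"
  using mult_left_mono[OF aH, of "h/2"] hK ad by (intro add_mono norm_half_noise) auto
 also have "... = (h * K * (1 + norm y)) + (h * K) * v / 2 + (h * K) * h / 2 + (K * n xi)"
  by (simp add: field_simps)
 finally have 1: "norm (stp s s' xi y - y) <= (h * K * (1 + norm y)) + (h * K) * v / 2 + (h * K) * h / 2 + (K * n xi)" .
 have 2: "(h * K) * v <= (1/4) * v" using hK by (intro mult_right_mono) (auto simp: v_def)
 have 3: "(h * K) * h <= h * K * (1 + norm y)" using hK norm_ge_zero[of y] by (intro mult_left_mono) linarith+
 have 4: "0 <= h * K * (1 + norm y)" "0 <= K * n xi" using hK K_ge1 by auto
 have 5: "v <= 4 * (h * K * (1 + norm y)) + 4 * (K * n xi)" using v by (simp add: algebra_simps)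
 have "norm (stp s s' xi y - y) <= 4 * (h * K * (1 + norm y)) + 4 * (K * n xi)" using 1 2 3 4 5 by linarith
 then show ?thesis by (simp add: h_def algebra_simps)
qed

lemma stg_diff:
 assumes "admissible s s'"
 shows "norm (stg s s' xi y - stg s s' et x) <= 2 * norm (y - x) + 4 * K * n (%m. xi m - et m)"
proof -
 note ad = admissibleD[OF assms]
 define h where "h = s' - s"
 define Hy Hx where "Hy = stg s s' xi y" and "Hx = stg s s' et x"
 have hK: "0 <= h" "h * K <= 1/4" "h <= 1/4" "0 <= h * K" using ad by (auto simp: h_def)
 let ?w = "%m. xi m - et m"
 have 1: "norm (a y s - a x s) <= K * norm (y - x)" using drift_lipschitz[of s s y x] ad by simp
 have 2: "norm (a Hy s' - a Hx s') <= K * norm (Hy - Hx)" using drift_lipschitz[of s' s' Hy Hx] ad by simp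
 let ?R = "%xi y H. y + (fst ((h / 2) *R (a y s + a H s')), snd (h *R a y s))
   + (fst ((1/2) *R (Sg s xi + Sg s' xi)), snd (Sg s xi))"
 have eq: "Hy = ?R xi y Hy" "Hx = ?R et x Hx"
  unfolding Hy_def Hx_def h_def by (rule stg_eq[OF assms])+
 have "Hy - Hx = ?R xi y Hy - ?R et x Hx"
  by (rule arg_cong2[where f=minus, OF eq])
 then have "Hy - Hx = (y - x) + ((fst ((h / 2) *R ((a y s - a x s) + (a Hy s' - a Hx s'))), snd (h *R (a y s - a x s)))
   + (fst ((1/2) *R (Sg s ?w + Sg s' ?w)), snd (Sg s ?w)))" (is "_ = ?L")
  unfolding noise_diff by (rule trans) (simp add: prod_eq_iff algebra_simps)
 then have "norm (Hy - Hx) = norm ?L" by (rule arg_cong)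
 also have "norm ?L <= norm (y - x) + ((norm ((h / 2) *R ((a y s - a x s) + (a Hy s' - a Hx s'))) + norm (h *R (a y s - a x s)))
   + (norm ((1/2) *R (Sg s ?w + Sg s' ?w)) + norm (Sg s ?w)))"
  by (intro norm_triangle_mono norm_mixed_pair_le order_refl)
 also have "... <= norm (y - x) + (((h/2) * (K * norm (y - x) + K * norm (Hy - Hx)) + h * (K * norm (y - x)))
   + (K * n ?w + K * n ?w))"
 proof -
  have "norm ((h / 2) *R ((a y s - a x s) + (a Hy s' - a Hx s'))) <= (h/2) * (K * norm (y - x) + K * norm (Hy - Hx))"
   using mult_left_mono[OF norm_triangle_mono[OF 1 2], of "h/2"] hK(1) by simp
  moreover have "norm (h *R (a y s - a x s)) <= h * (K * norm (y - x))" using mult_left_mono[OF 1, of h] hK(1) by simp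
  ultimately show ?thesis
   using norm_half_noise[OF ad(1,2), of ?w] noise_bound[OF ad(1), of ?w] by linarith
 qed
 also have "... = norm (y - x) + (3/2) * ((h * K) * norm (y - x)) + (1/2) * ((h * K) * norm (Hy - Hx)) + 2 * (K * n ?w)"
  by (simp add: field_simps)
 finally have 3: "norm (Hy - Hx) <= ..." .
 have 4: "(h * K) * norm (y - x) <= (1/4) * norm (y - x)" "(h * K) * norm (Hy - Hx) <= (1/4) * norm (Hy - Hx)"
  by (rule mult_right_mono[OF hK(2)], simp)+
 have "0 <= K * n ?w" using K_ge1 by auto
 then show ?thesis using 3 4 norm_ge_zero[of "y-x"] unfolding Hy_def Hx_def by linarith
qed

text \<open>Subtracting \<open>y - x\<close> leaves only differences of drift and noise, so that the
  factor of \<open>norm (y - x)\<close> is proportional to the step. Iterated, this gives stability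
  uniformly in the number of steps.\<close>

lemma stp_diff:
 assumes "admissible s s'"
 shows "norm (stp s s' xi y - stp s s' et x - (y - x)) <= 2 * ((s' - s) * K) * norm (y - x) + 2 * K * n (%m. xi m - et m)"
proof -
 note ad = admissibleD[OF assms]
 define h where "h = s' - s"
 define Hy Hx where "Hy = stg s s' xi y" and "Hx = stg s s' et x"
 have hK: "0 <= h" "h * K <= 1/4" "h <= 1/4" "0 <= h * K" using ad by (auto simp: h_def)
 let ?w = "%m. xi m - et m"
 have H: "norm (Hy - Hx) <= 2 * norm (y - x) + 4 * K * n ?w" unfolding Hy_def Hx_def by (rule stg_diff[OF assms])
 have 1: "norm (a y s - a x s) <= K * norm (y - x)" using drift_lipschitz[of s s y x] ad by simp
 have 2: "norm (a Hy s' - a Hx s') <= K * norm (Hy - Hx)" using drift_lipschitz[of s' s' Hy Hx] ad by simp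
 have "stp s s' xi y - stp s s' et x - (y - x) = (h / 2) *R ((a y s - a x s) + (a Hy s' - a Hx s'))
   + (1/2) *R (Sg s ?w + Sg s' ?w)"
  unfolding noise_diff stp_eq[OF assms] Hy_def Hx_def h_def by (simp add: algebra_simps)
 also have "norm ... <= (h/2) * (K * norm (y - x) + K * norm (Hy - Hx)) + K * n ?w"
 proof (intro norm_triangle_mono norm_half_noise ad)
  show "norm ((h / 2) *R ((a y s - a x s) + (a Hy s' - a Hx s'))) <= (h/2) * (K * norm (y - x) + K * norm (Hy - Hx))"
   using mult_left_mono[OF norm_triangle_mono[OF 1 2], of "h/2"] hK by simp
 qed
 also have "... = (1/2) * ((h * K) * norm (y - x)) + (1/2) * ((h * K) * norm (Hy - Hx)) + K * n ?w"
  by (simp add: field_simps)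
 also have "... <= (1/2) * ((h * K) * norm (y - x)) + (1/2) * ((h * K) * (2 * norm (y - x) + 4 * K * n ?w)) + K * n ?w"
  using mult_left_mono[OF H hK(4)] by simp
 also have "... = (3/2) * ((h * K) * norm (y - x)) + 2 * ((h * K) * (K * n ?w)) + K * n ?w" by (simp add: field_simps)
 also have "... <= 2 * ((h * K) * norm (y - x)) + 2 * ((1/4) * (K * n ?w)) + K * n ?w"
  using hK K_ge1 by (intro add_mono mult_left_mono mult_right_mono) auto
 also have "... <= 2 * (h * K) * norm (y - x) + 2 * K * n ?w" using K_ge1 by simp
 finally show ?thesis unfolding h_def .
qed

lemma stp_lip:
 assumes "admissible s s'"
 shows "norm (stp s s' xi y - stp s s' xi x) <= (1 + 2 * ((s' - s) * K)) * norm (y - x)"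
 using stp_diff[OF assms, of xi y xi x] norm_triangle_ineq[of "stp s s' xi y - stp s s' xi x - (y - x)" "y - x"]
 by (simp add: algebra_simps)

lemma d2_stg:
 assumes "admissible s s'"
 shows "d2 (%i j. stg s s' xi (y i j)) = d2 y +
  (fst (((s' - s) / 2) *R (d2 (%i j. a (y i j) s) + d2 (%i j. a (stg s s' xi (y i j)) s'))), snd ((s' - s) *R d2 (%i j. a (y i j) s)))"
proof -
 have "d2 (%i j. stg s s' xi (y i j)) = d2 (%i j. y i j + (fst (((s' - s) / 2) *R (a (y i j) s + a (stg s s' xi (y i j)) s')), snd ((s' - s) *R a (y i j) s))
   + (fst ((1/2) *R (Sg s xi + Sg s' xi)), snd (Sg s xi)))"
  using stg_eq[OF assms] by presburger
 then show ?thesis by (simp add: d2_def prod_eq_iff algebra_simps)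
qed

lemma d3_stg:
 assumes "admissible s s'"
 shows "d3 (%i j k. stg s s' xi (y i j k)) = d3 y +
  (fst (((s' - s) / 2) *R (d3 (%i j k. a (y i j k) s) + d3 (%i j k. a (stg s s' xi (y i j k)) s'))), snd ((s' - s) *R d3 (%i j k. a (y i j k) s)))"
 unfolding d3_def d2_stg[OF assms] by (simp add: prod_eq_iff algebra_simps)

lemma d2_stp:
 assumes "admissible s s'"
 shows "d2 (%i j. stp s s' xi (y i j)) = d2 y + ((s' - s) / 2) *R (d2 (%i j. a (y i j) s) + d2 (%i j. a (stg s s' xi (y i j)) s'))"
 unfolding stp_eq[OF assms] by (simp add: d2_def algebra_simps)

lemma d3_stp:
 assumes "admissible s s'"
 shows "d3 (%i j k. stp s s' xi (y i j k)) = d3 y + ((s' - s) / 2) *R (d3 (%i j k. a (y i j k) s) + d3 (%i j k. a (stg s s' xi (y i j k)) s'))"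
 unfolding d3_def d2_stp[OF assms] by (simp add: algebra_simps)

text \<open>Absorption for mixed differences of stages: \<open>x\<close> is such a difference over
  the vertices, \<open>p\<close> and \<open>q\<close> are those of the drift at the start and at the
  stage. The last one is controlled only through \<open>x\<close> itself.\<close>

lemma implicit_absorb:
 fixes x :: "'a \<times> 'b"
 assumes "x = y + (fst ((h / 2) *R (p + q)), snd (h *R p))" "0 <= h" "h * K <= 1/4"
  "norm p <= K * P" "norm q <= K * (norm x + Q)" "0 <= P" "0 <= Q"
 shows "norm x <= (4/3) * norm y + P / 2 + Q / 3"
proof -
 have hK: "0 <= h * K" using assms K_ge1 by auto
 have "norm x <= norm y + (norm ((h/2) *R (p + q)) + norm (h *R p))"
  unfolding assms(1) by (intro norm_triangle_mono norm_mixed_pair_le order_refl)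
 also have "... <= norm y + ((h/2) * (K * P + K * (norm x + Q)) + h * (K * P))"
  using mult_left_mono[OF norm_triangle_mono[OF assms(4,5)], of "h/2"] mult_left_mono[OF assms(4), of h] assms(2)
  by simp
 also have "... = norm y + (3/2) * ((h * K) * P) + (1/2) * ((h * K) * norm x) + (1/2) * ((h * K) * Q)"
  by (simp add: field_simps)
 finally have 1: "norm x <= ..." .
 have 2: "(h * K) * P <= (1/4) * P" "(h * K) * norm x <= (1/4) * norm x" "(h * K) * Q <= (1/4) * Q"
  using mult_right_mono[OF assms(3), of P] mult_right_mono[OF assms(3), of "norm x"] mult_right_mono[OF assms(3), of Q] assms(6,7)
  by auto
 show ?thesis using 1 2 norm_ge_zero[of y] assms(6,7) by argo
qed

lemma stg_sq:
 assumes "admissible s s'" "sqb y al1 al2 be"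
 shows "sqb (%i j. stg s s' xi (y i j)) (2 * al1) (2 * al2) (4 * (be + al1 * al2))"
proof -
 note ad = admissibleD[OF assms(1)]
 note nn = sqb_nonneg[OF assms(2)]
 have e: "norm (stg s s' xi u - stg s s' xi v) <= 2 * norm (u - v)" for u v
  using stg_diff[OF assms(1), of xi u xi v] by simp
 let ?H = "%i j. stg s s' xi (y i j)"
 have e1: "norm (?H True j - ?H False j) <= 2 * al1" and e2: "norm (?H i True - ?H i False) <= 2 * al2" for i j
  using e[of "y True j" "y False j"] e[of "y i True" "y i False"] assms(2) unfolding sqb_def by (smt (verit))+
 have "sqb ?H (2 * al1) (2 * al2) (norm (d2 ?H))" using e1 e2 by (simp add: sqb_def)
 then have q: "norm (d2 (%i j. a (?H i j) s')) <= K * (norm (d2 ?H) + 2 * al1 * (2 * al2))"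
  using ad by (intro drift_sq)
 have "norm (d2 ?H) <= (4/3) * norm (d2 y) + (be + al1 * al2) / 2 + (2 * al1 * (2 * al2)) / 3"
  using d2_stg[OF assms(1)]
  by (rule implicit_absorb) (use ad nn q drift_sq[OF ad(1) assms(2)] in auto)
 moreover have "norm (d2 y) <= be" using assms by (simp add: sqb_def)
 ultimately have "norm (d2 ?H) <= 4 * (be + al1 * al2)"
  using nn mult_nonneg_nonneg[OF nn(1,2)] by argo
 then show ?thesis using e1 e2 by (simp add: sqb_def)
qed

text \<open>The noise is additive, hence the same at all vertices, and drops out of every
  difference. A step only adds differences of the drift, which carry the step size as a
  factor.\<close>

lemma stp_d2:
 assumes "admissible s s'" "sqb y al1 al2 be"
 shows "norm (d2 (%i j. stp s s' xi (y i j)) - d2 y) <= 8 * ((s' - s) * K) * (be + al1 * al2)"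
proof -
 note ad = admissibleD[OF assms(1)]
 note nn = sqb_nonneg[OF assms(2)]
 let ?p = "d2 (%i j. a (y i j) s)" and ?q = "d2 (%i j. a (stg s s' xi (y i j)) s')"
 have "norm (?p + ?q) <= K * (be + al1 * al2) + K * (4 * (be + al1 * al2) + 2 * al1 * (2 * al2))"
  by (intro norm_triangle_mono drift_sq stg_sq ad assms)
 also have "... = K * (5 * be + 9 * (al1 * al2))" by (simp add: algebra_simps)
 also have "... <= K * (16 * (be + al1 * al2))" using K_ge1 nn by (intro mult_left_mono) auto
 finally have "((s' - s)/2) * norm (?p + ?q) <= ((s' - s)/2) * (K * (16 * (be + al1 * al2)))"
  using ad by (intro mult_left_mono) auto
 moreover have "norm (d2 (%i j. stp s s' xi (y i j)) - d2 y) = ((s' - s)/2) * norm (?p + ?q)"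
  unfolding d2_stp[OF assms(1)] using ad(3) by (simp del: scaleR_add_right)
 ultimately show ?thesis by (simp add: field_simps)
qed

lemma stp_d3:
 assumes "admissible s s'" "cubeb y al1 al2 al3 be12 be13 be23 ga"
 shows "norm (d3 (%i j k. stp s s' xi (y i j k)) - d3 y) <= 40 * ((s' - s) * K) * b3 al1 al2 al3 be12 be13 be23 ga"
proof -
 note ad = admissibleD[OF assms(1)]
 note nn = cubeb_nonneg[OF assms(2)]
 let ?H = "%i j k. stg s s' xi (y i j k)"
 let ?b12 = "4 * (be12 + al1 * al2)" and ?b13 = "4 * (be13 + al1 * al3)" and ?b23 = "4 * (be23 + al2 * al3)"
 define P where "P = b3 al1 al2 al3 be12 be13 be23 ga"
 define s1 s2 s3 pr where "s1 = al1 * be23" and "s2 = al2 * be13" and "s3 = al3 * be12" and "pr = al1 * al2 * al3"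
 have pos: "0 <= s1" "0 <= s2" "0 <= s3" "0 <= pr" using nn by (auto simp: s1_def s2_def s3_def pr_def)
 have P: "P = ga + s1 + s2 + s3 + pr" by (simp add: P_def s1_def s2_def s3_def pr_def)
 have P0: "0 <= P" using P pos nn by simp
 \<comment> \<open>Doubled edges and quadrupled face bounds give 2 * 4 for each product of an edge
   and a face, and 3 * 8 + 8 for the product of the three edges.\<close>
 define Q where "Q = 8 * (s1 + s2 + s3) + 32 * pr"
 have Q: "b3 (2 * al1) (2 * al2) (2 * al3) ?b12 ?b13 ?b23 g = g + Q" for g
  by (simp add: Q_def s1_def s2_def s3_def pr_def algebra_simps)
 have c: "cubeb ?H (2 * al1) (2 * al2) (2 * al3) ?b12 ?b13 ?b23 g" if "norm (d3 ?H) <= g" for g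
  unfolding cubeb_def
 proof (intro conjI allI that)
  fix l :: bool
  show "sqb (%i j. ?H i j l) (2 * al1) (2 * al2) ?b12" "sqb (%i k. ?H i l k) (2 * al1) (2 * al3) ?b13"
   "sqb (%j k. ?H l j k) (2 * al2) (2 * al3) ?b23"
   by (rule stg_sq[OF assms(1)], use assms(2) in \<open>simp add: cubeb_def\<close>)+
 qed
 have p: "norm (d3 (%i j k. a (y i j k) s)) <= K * P" unfolding P_def by (rule drift_cube[OF ad(1) assms(2)])
 have q: "norm (d3 (%i j k. a (?H i j k) s')) <= K * (g + Q)" if "norm (d3 ?H) <= g" for g
  using drift_cube[OF ad(2) c[OF that]] unfolding Q .
 have "norm (d3 ?H) <= (4/3) * norm (d3 y) + P / 2 + Q / 3"
  using d3_stg[OF assms(1)]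
  by (rule implicit_absorb) (use ad p q[OF order_refl] P0 pos in \<open>auto simp: Q_def\<close>)
 also have "norm (d3 y) <= ga" using assms by (simp add: cubeb_def)
 finally have g: "norm (d3 ?H) <= (4/3) * ga + P / 2 + Q / 3" by simp
 have "norm (d3 (%i j k. a (y i j k) s) + d3 (%i j k. a (?H i j k) s')) <= K * P + K * ((4/3) * ga + P / 2 + Q / 3 + Q)"
  by (intro norm_triangle_mono p q g)
 also have "... = K * (P + ((4/3) * ga + P / 2 + Q / 3 + Q))" by (simp add: algebra_simps)
 \<comment> \<open>The coefficient 80 is generous; the trapezoidal weight halves it to the 40 of the
   claim.\<close>
 also have "... <= K * (80 * P)" using K_ge1 pos nn(7) unfolding P Q_def by (intro mult_left_mono) argo+
 finally have "((s' - s)/2) * norm (d3 (%i j k. a (y i j k) s) + d3 (%i j k. a (?H i j k) s')) <= ((s' - s)/2) * (K * (80 * P))"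
  using ad by (intro mult_left_mono) auto
 moreover have "norm (d3 (%i j k. stp s s' xi (y i j k)) - d3 y) =
   ((s' - s)/2) * norm (d3 (%i j k. a (y i j k) s) + d3 (%i j k. a (?H i j k) s'))"
  unfolding d3_stp[OF assms(1)] using ad(3) by (simp del: scaleR_add_right)
 ultimately show ?thesis unfolding P_def[symmetric] by (simp add: field_simps)
qed

end

section \<open>Calculus of orders of magnitude\<close>

context scheme
begin

text \<open>Brownian scaling: an increment over a step of size k counts as sqrt k. The factor
  \<open>1 + norm y\<close> accounts for the linear growth of the drift.\<close>

definition rho :: "real => 'a \<times> 'b => (nat => real) => (nat => real) => real" where
 "rho k y x1 x2 = (sqrt k + n x1 + n x2) * (1 + norm y)"

text \<open>
 Orders of magnitude of functions of the time \<open>t\<close>, the half step size \<open>k\<close>, the state \<open>y\<close> and the noise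
 \<open>x1, x2\<close> of the two half steps. The noise counts as \<open>sqrt k\<close>; the power of \<open>1 + rho\<close> makes
 the orders decreasing.
\<close>

definition ord :: "nat => (real => real => 'a \<times> 'b => (nat => real) => (nat => real) => 'w::real_normed_vector) => bool" where
 "ord p f \<longleftrightarrow> (\<exists>C q. 0 <= C \<and> (\<forall>t k y x1 x2. 0 <= k --> admissible t (t + 2 * k) -->
   norm (f t k y x1 x2) <= C * rho k y x1 x2 ^ p * (1 + rho k y x1 x2) ^ q))"

lemma rho_nonneg: "0 <= k ==> 0 <= rho k y x1 x2"
 by (simp add: rho_def)

lemma ordI:
 assumes "0 <= C" "\<And>t k y x1 x2. 0 <= k ==> admissible t (t + 2 * k) ==> 0 <= rho k y x1 x2 ==> norm (f t k y x1 x2) <= C * rho k y x1 x2 ^ p"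
 shows "ord p f"
 unfolding ord_def using assms rho_nonneg by (intro exI[of _ C] exI[of _ 0]) auto

lemma ord_mono:
 assumes "ord p f" "p' <= p" shows "ord p' f"
proof -
 obtain C q where C: "0 <= C" "\<And>t k y x1 x2. 0 <= k ==> admissible t (t + 2 * k) ==>
   norm (f t k y x1 x2) <= C * rho k y x1 x2 ^ p * (1 + rho k y x1 x2) ^ q"
  using assms(1) unfolding ord_def by blast
 have "norm (f t k y x1 x2) <= C * rho k y x1 x2 ^ p' * (1 + rho k y x1 x2) ^ (q + (p - p'))"
  if "0 <= k" "admissible t (t + 2 * k)" for t k y x1 x2
 proof -
  let ?r = "rho k y x1 x2"
  have r: "0 <= ?r" using that rho_nonneg by auto
  have "?r ^ p = ?r ^ p' * ?r ^ (p - p')" using assms(2) by (simp add: power_add[symmetric])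
  also have "... <= ?r ^ p' * (1 + ?r) ^ (p - p')" using r by (intro mult_left_mono power_mono) auto
  finally have "C * ?r ^ p * (1 + ?r) ^ q <= C * (?r ^ p' * (1 + ?r) ^ (p - p')) * (1 + ?r) ^ q"
   using C r by (intro mult_right_mono mult_left_mono) auto
  then show ?thesis using C(2)[OF that, of y x1 x2] by (simp add: power_add mult_ac)
 qed
 then show ?thesis unfolding ord_def using C(1) by blast
qed

lemma ord_le:
 assumes "ord p f" "0 <= B" "\<And>t k y x1 x2. 0 <= k ==> admissible t (t + 2 * k) ==> norm (g t k y x1 x2) <= B * norm (f t k y x1 x2)"
 shows "ord p g"
proof -
 obtain C q where C: "0 <= C" "\<And>t k y x1 x2. 0 <= k ==> admissible t (t + 2 * k) ==>
   norm (f t k y x1 x2) <= C * rho k y x1 x2 ^ p * (1 + rho k y x1 x2) ^ q"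
  using assms(1) unfolding ord_def by blast
 have "norm (g t k y x1 x2) <= (B * C) * rho k y x1 x2 ^ p * (1 + rho k y x1 x2) ^ q"
  if "0 <= k" "admissible t (t + 2 * k)" for t k y x1 x2
  using order_trans[OF assms(3)[OF that] mult_left_mono[OF C(2)[OF that] assms(2)]] by (simp add: mult_ac)
 then show ?thesis unfolding ord_def using C(1) assms(2) by (intro exI[of _ "B * C"] exI[of _ q]) auto
qed

lemma ord_cong:
 assumes "ord p f" "\<And>t k y x1 x2. 0 <= k ==> admissible t (t + 2 * k) ==> g t k y x1 x2 = f t k y x1 x2"
 shows "ord p g"
 using assms by (intro ord_le[OF assms(1), of 1]) auto

lemma ord_add:
 assumes "ord p f" "ord p g" shows "ord p (%t k y x1 x2. f t k y x1 x2 + g t k y x1 x2)"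
proof -
 obtain C q where C: "0 <= C" "\<And>t k y x1 x2. 0 <= k ==> admissible t (t + 2 * k) ==>
   norm (f t k y x1 x2) <= C * rho k y x1 x2 ^ p * (1 + rho k y x1 x2) ^ q"
  using assms(1) unfolding ord_def by blast
 obtain C' q' where C': "0 <= C'" "\<And>t k y x1 x2. 0 <= k ==> admissible t (t + 2 * k) ==>
   norm (g t k y x1 x2) <= C' * rho k y x1 x2 ^ p * (1 + rho k y x1 x2) ^ q'"
  using assms(2) unfolding ord_def by blast
 have "norm (f t k y x1 x2 + g t k y x1 x2) <= (C + C') * rho k y x1 x2 ^ p * (1 + rho k y x1 x2) ^ (q + q')"
  if "0 <= k" "admissible t (t + 2 * k)" for t k y x1 x2
 proof -
  let ?r = "rho k y x1 x2"
  have r: "0 <= ?r" using that rho_nonneg by auto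
  have "norm (f t k y x1 x2 + g t k y x1 x2) <= C * ?r ^ p * (1 + ?r) ^ q + C' * ?r ^ p * (1 + ?r) ^ q'"
   by (intro norm_triangle_mono C C' that)
  also have "... <= C * ?r ^ p * (1 + ?r) ^ (q + q') + C' * ?r ^ p * (1 + ?r) ^ (q + q')"
   using r C C' by (intro add_mono mult_left_mono power_increasing) auto
  finally show ?thesis by (simp add: algebra_simps)
 qed
 then show ?thesis unfolding ord_def using C(1) C'(1) by (intro exI[of _ "C + C'"] exI[of _ "q + q'"]) auto
qed

lemma ord_mult_gen:
 assumes "ord p f" "ord p' g" "0 <= B"
  "\<And>t k y x1 x2. 0 <= k ==> admissible t (t + 2 * k) ==> norm (h t k y x1 x2) <= B * (norm (f t k y x1 x2) * norm (g t k y x1 x2))"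
 shows "ord (p + p') h"
proof -
 obtain C q where C: "0 <= C" "\<And>t k y x1 x2. 0 <= k ==> admissible t (t + 2 * k) ==>
   norm (f t k y x1 x2) <= C * rho k y x1 x2 ^ p * (1 + rho k y x1 x2) ^ q"
  using assms(1) unfolding ord_def by blast
 obtain C' q' where C': "0 <= C'" "\<And>t k y x1 x2. 0 <= k ==> admissible t (t + 2 * k) ==>
   norm (g t k y x1 x2) <= C' * rho k y x1 x2 ^ p' * (1 + rho k y x1 x2) ^ q'"
  using assms(2) unfolding ord_def by blast
 have "norm (h t k y x1 x2) <= (B * C * C') * rho k y x1 x2 ^ (p + p') * (1 + rho k y x1 x2) ^ (q + q')"
  if "0 <= k" "admissible t (t + 2 * k)" for t k y x1 x2
 proof -
  let ?r = "rho k y x1 x2"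
  have r: "0 <= ?r" using that rho_nonneg by auto
  have "B * (norm (f t k y x1 x2) * norm (g t k y x1 x2)) <= B * ((C * ?r ^ p * (1 + ?r) ^ q) * (C' * ?r ^ p' * (1 + ?r) ^ q'))"
   using assms(3) C C' that r by (intro mult_left_mono mult_mono) auto
  then show ?thesis using assms(4)[OF that, of y x1 x2] by (simp add: power_add mult_ac)
 qed
 then show ?thesis unfolding ord_def using C(1) C'(1) assms(3)
  by (intro exI[of _ "B * C * C'"] exI[of _ "q + q'"]) auto
qed

lemma ord_scaleR: "ord p f ==> ord p (%t k y x1 x2. (c::real) *R f t k y x1 x2)"
 by (rule ord_le[where B="\<bar>c\<bar>"]) auto

lemma ord_uminus: "ord p f ==> ord p (%t k y x1 x2. - f t k y x1 x2)"
 by (rule ord_le[where B=1]) auto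

lemma ord_diff: "ord p f ==> ord p g ==> ord p (%t k y x1 x2. f t k y x1 x2 - g t k y x1 x2)"
 using ord_add[OF _ ord_uminus, of p f g] by simp

lemma sqrt_facts:
 assumes "0 <= k" "admissible t (t + 2 * k)"
 shows "k <= sqrt k" "k <= rho k y x1 x2 ^ 2" "k * (1 + norm y) <= rho k y x1 x2 ^ 2" "n x1 <= rho k y x1 x2" "n x2 <= rho k y x1 x2"
  "k * (1 + norm y) + n x1 + n x2 <= rho k y x1 x2" "k <= rho k y x1 x2" "k * K <= 1 / 8"
proof -
 have k1: "k <= 1" "k * K <= 1 / 8" using admissibleD(4,5)[OF assms(2)] by auto
 then show "k * K <= 1 / 8" by simp
 have "sqrt k <= 1" using k1 by simp
 then have "sqrt k * sqrt k <= sqrt k * 1" using assms by (intro mult_left_mono) auto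
 then show ks: "k <= sqrt k" using assms by simp
 have s: "sqrt k <= sqrt k + n x1 + n x2" by simp
 have e: "(sqrt k + n x1 + n x2) * 1 <= rho k y x1 x2"
  unfolding rho_def using assms by (intro mult_left_mono) auto
 then have "sqrt k + n x1 + n x2 <= rho k y x1 x2" by simp
 note e' = this ks nz_nonneg[of M x1] nz_nonneg[of M x2] real_sqrt_ge_zero[OF assms(1)]
 show "n x1 <= rho k y x1 x2" using e' by linarith
 show "n x2 <= rho k y x1 x2" using e' by linarith
 show "k <= rho k y x1 x2" using e' by linarith
 have "(k + n x1 + n x2) * (1 + norm y) <= rho k y x1 x2"
  unfolding rho_def using ks by (intro mult_right_mono) auto
 moreover have "(k + n x1 + n x2) * (1 + norm y) = k * (1 + norm y) + n x1 + n x2 + (n x1 + n x2) * norm y"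
  by (simp add: algebra_simps)
 moreover have "0 <= (n x1 + n x2) * norm y" by simp
 ultimately show "k * (1 + norm y) + n x1 + n x2 <= rho k y x1 x2" by linarith
 have "(sqrt k * (1 + norm y))^2 <= rho k y x1 x2 ^ 2"
  unfolding rho_def using assms by (intro power_mono mult_right_mono) auto
 then have 1: "k * (1 + norm y)^2 <= rho k y x1 x2 ^ 2" using assms by (simp add: power_mult_distrib)
 have "(1 + norm y) * 1 <= (1 + norm y) * (1 + norm y)" by (intro mult_left_mono) auto
 then have 2: "k * (1 + norm y) <= k * (1 + norm y)^2" using assms by (intro mult_left_mono) (auto simp: power2_eq_square)
 show 3: "k * (1 + norm y) <= rho k y x1 x2 ^ 2" using 1 2 by linarith
 have "k * 1 <= k * (1 + norm y)" using assms by (intro mult_left_mono) auto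
 then show "k <= rho k y x1 x2 ^ 2" using 3 by linarith
qed

lemma ord_k: "ord 2 (%t k y x1 x2. k)"
 by (rule ordI[of 1]) (use sqrt_facts in auto)

lemma ord_k_scaleR: "ord p f ==> q = p + 2 ==> ord q (%t k y x1 x2. k *R f t k y x1 x2)"
 by (simp only:, rule ord_mult_gen[OF _ ord_k, where B=1]) (auto simp: mult.commute)

text \<open>As for \<open>ord_flip\<close> and \<open>ord_swap\<close>: an order depends on the
  noise only through \<open>n x1\<close> and \<open>n x2\<close>, and symmetrically, so it survives
  all changes of sign and the exchange.\<close>

lemma ord_neg: "ord p f ==> ord p (%t k y x1 x2. f t k y (%m. - x1 m) (%m. - x2 m))"
 unfolding ord_def rho_def using nz_uminus by metis

lemma ord_flip: "ord p f ==> ord p (%t k y x1 x2. f t k y x1 (%m. - x2 m))"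
 unfolding ord_def rho_def using nz_uminus by metis

lemma ord_swap: "ord p f ==> ord p (%t k y x1 x2. f t k y x2 x1)"
proof -
 have "rho k y x2 x1 = rho k y x1 x2" for k y x1 x2 by (simp add: rho_def)
 then show "ord p f ==> ord p (%t k y x1 x2. f t k y x2 x1)"
  unfolding ord_def by metis
qed

lemma ord_zero:
 assumes "ord p f" shows "ord p (%t k y x1 x2. f t k y (%m. 0) (%m. 0))"
proof -
 obtain C q where C: "0 <= C" "\<And>t k y x1 x2. 0 <= k ==> admissible t (t + 2 * k) ==>
   norm (f t k y x1 x2) <= C * rho k y x1 x2 ^ p * (1 + rho k y x1 x2) ^ q"
  using assms(1) unfolding ord_def by blast
 have "norm (f t k y (%m. 0) (%m. 0)) <= C * rho k y x1 x2 ^ p * (1 + rho k y x1 x2) ^ q"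
  if "0 <= k" "admissible t (t + 2 * k)" for t k y x1 x2
 proof -
  have r: "0 <= rho k y (%m. 0) (%m. 0)" "rho k y (%m. 0) (%m. 0) <= rho k y x1 x2"
   using that by (auto simp: rho_def intro!: mult_right_mono)
  have "C * rho k y (%m. 0) (%m. 0) ^ p * (1 + rho k y (%m. 0) (%m. 0)) ^ q <= C * rho k y x1 x2 ^ p * (1 + rho k y x1 x2) ^ q"
   using r C by (intro mult_mono mult_left_mono power_mono) auto
  then show ?thesis using C(2)[OF that, of y "%m. 0" "%m. 0"] by linarith
 qed
 then show ?thesis unfolding ord_def using C(1) by blast
qed

lemma ord_fst: "ord p f ==> ord p (%t k y x1 x2. (fst (f t k y x1 x2), 0))"
 by (rule ord_le[where B=1]) (auto simp: norm_Pair, metis norm_fst_le prod.collapse)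

lemma ord_snd: "ord p f ==> ord p (%t k y x1 x2. (0, snd (f t k y x1 x2)))"
 by (rule ord_le[where B=1]) (auto simp: norm_Pair, metis norm_snd_le prod.collapse)

lemma ord_mixed: "ord p f ==> ord p g ==> ord p (%t k y x1 x2. (fst (f t k y x1 x2), snd (g t k y x1 x2)))"
 using ord_add[OF ord_fst ord_snd, of p f g] by simp

lemma ord_Pair0: "ord p f ==> ord p (%t k y x1 x2. (f t k y x1 x2, 0))"
 by (rule ord_le[where B=1]) (auto simp: norm_Pair)

section \<open>Expansion of two half steps and of one full step\<close>

definition half :: "real => real => 'a \<times> 'b => (nat => real) => 'a \<times> 'b" where
 "half t k y x1 = stp t (t + k) x1 y"

text \<open>\<open>k\<close> is half of the coarse step. \<open>Psi\<close> and \<open>Phi\<close>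
  are driven by the same pair of increments, which couples the two resolutions path by path.\<close>

definition Psi :: "real => real => 'a \<times> 'b => (nat => real) => (nat => real) => 'a \<times> 'b" where
 "Psi t k y x1 x2 = stp (t + k) (t + 2 * k) x2 (half t k y x1)"

definition Phi :: "real => real => 'a \<times> 'b => (nat => real) => (nat => real) => 'a \<times> 'b" where
 "Phi t k y x1 x2 = stp t (t + 2 * k) (%m. x1 m + x2 m) y"

text \<open>Displacements of the four points, other than (y, t), at which the drift is evaluated:
  the stage of the first half step, the midpoint value, the stage of the second half step and the
  coarse stage. The elapsed time is carried as a last component.\<close>

definition vA where "vA t k y x1 (x2 :: nat => real) = (stg t (t + k) x1 y - y, k)"
definition vB where "vB t k y x1 (x2 :: nat => real) = (half t k y x1 - y, k)"
definition vC where "vC t k y x1 x2 = (stg (t + k) (t + 2 * k) x2 (half t k y x1) - y, 2 * k)"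
definition vD where "vD t k y x1 x2 = (stg t (t + 2 * k) (%m. x1 m + x2 m) y - y, 2 * k)"

definition A :: "real => 'a \<times> 'b => ('a \<times> 'b) \<times> real => 'a \<times> 'b" where
 "A t y v = a (y + fst v) (t + snd v) - a y t"

lemma admissible_halves:
 assumes "0 <= k" "admissible t (t + 2 * k)"
 shows "admissible t (t + k)" "admissible (t + k) (t + 2 * k)"
 using assms K_ge1 mult_right_mono[of k "2 * k" K] by (auto simp: admissible_def algebra_simps)

lemma norm_Pair_real_le: "0 <= c ==> norm (u, c::real) <= norm u + c"
 using norm_Pair_le[of u c] by simp

lemma ord_vABCD: "ord 1 vA" "ord 1 vB" "ord 1 vC" "ord 1 vD"
proof -
 have K0: "0 <= K" using K_ge1 by simp
 have 1: "norm (stg t (t + k) x1 y - y) <= 4 * K * rho k y x1 x2" "norm (half t k y x1 - y) <= 4 * K * rho k y x1 x2"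
  if a: "0 <= k" "admissible t (t + 2 * k)" for t k y x1 x2
 proof -
  have "4 * K * (k * (1 + norm y) + n x1) <= 4 * K * rho k y x1 x2"
   using sqrt_facts(6)[OF a, of y x1 x2] nz_nonneg[of M x2] K0 by (intro mult_left_mono) linarith+
  then show "norm (stg t (t + k) x1 y - y) <= 4 * K * rho k y x1 x2" "norm (half t k y x1 - y) <= 4 * K * rho k y x1 x2"
   using stg_disp[OF admissible_halves(1)[OF a], of x1 y] stp_disp[OF admissible_halves(1)[OF a], of x1 y]
   by (auto simp: half_def)
 qed
 show "ord 1 vA" "ord 1 vB"
 proof -
  have "norm (vA t k y x1 x2) <= (4 * K + 1) * rho k y x1 x2 ^ 1" "norm (vB t k y x1 x2) <= (4 * K + 1) * rho k y x1 x2 ^ 1"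
   if a: "0 <= k" "admissible t (t + 2 * k)" for t k y x1 x2
   using 1(1)[OF a, of x1 y x2] 1(2)[OF a, of y x1 x2] sqrt_facts(7)[OF a, of y x1 x2] norm_Pair_real_le[OF a(1), of "stg t (t + k) x1 y - y"]
    norm_Pair_real_le[OF a(1), of "half t k y x1 - y"]
   by (auto simp: vA_def vB_def algebra_simps)
  then show "ord 1 vA" "ord 1 vB" using K0 by (auto intro!: ordI[of "4 * K + 1"])
 qed
 have "norm (vC t k y x1 x2) <= (12 * K + 2) * rho k y x1 x2 ^ 1" if a: "0 <= k" "admissible t (t + 2 * k)" for t k y x1 x2
 proof -
  let ?r = "rho k y x1 x2" and ?y = "half t k y x1"
  have "norm ?y <= norm y + 4 * K * ?r" using 1(2)[OF a, of y x1 x2] norm_triangle_ineq[of "?y - y" y] by simp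
  then have "k * (1 + norm ?y) <= k * (1 + (norm y + 4 * K * ?r))" using a by (intro mult_left_mono) auto
  also have "... = k * (1 + norm y) + 4 * ((k * K) * ?r)" by (simp add: algebra_simps)
  also have "... <= k * (1 + norm y) + 4 * ((1/8) * ?r)"
   using sqrt_facts(8)[OF a] rho_nonneg[OF a(1)] by (intro add_left_mono mult_left_mono mult_right_mono) auto
  finally have "k * (1 + norm ?y) + n x2 <= 2 * ?r"
   using sqrt_facts(6)[OF a, of y x1 x2] nz_nonneg[of M x1] rho_nonneg[OF a(1), of y x1 x2] by linarith
  then have "4 * K * (k * (1 + norm ?y) + n x2) <= 4 * K * (2 * ?r)" using K0 by (intro mult_left_mono) auto
  then have 3: "norm (stg (t + k) (t + 2 * k) x2 ?y - ?y) <= 8 * K * ?r"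
   using stg_disp[OF admissible_halves(2)[OF a], of x2 ?y] by simp
  have "norm (stg (t + k) (t + 2 * k) x2 ?y - y) <= 12 * K * ?r"
   using 3 1(2)[OF a, of y x1 x2] norm_triangle_ineq[of "stg (t + k) (t + 2 * k) x2 ?y - ?y" "?y - y"] by simp
  then show ?thesis
   using sqrt_facts(7)[OF a, of y x1 x2] norm_Pair_real_le[of "2 * k" "stg (t + k) (t + 2 * k) x2 ?y - y"] a
   by (simp add: vC_def algebra_simps)
 qed
 then show "ord 1 vC" using K0 by (intro ordI[of "12 * K + 2"]) auto
 have "norm (vD t k y x1 x2) <= (8 * K + 2) * rho k y x1 x2 ^ 1" if a: "0 <= k" "admissible t (t + 2 * k)" for t k y x1 x2
 proof -
  let ?r = "rho k y x1 x2"
  have "2 * k * (1 + norm y) + n (%m. x1 m + x2 m) <= 2 * ?r"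
   using sqrt_facts(6)[OF a, of y x1 x2] nz_add[of M x1 x2] nz_nonneg[of M x1] nz_nonneg[of M x2] by linarith
  then have "4 * K * (2 * k * (1 + norm y) + n (%m. x1 m + x2 m)) <= 4 * K * (2 * ?r)" using K0 by (intro mult_left_mono) auto
  then have "norm (stg t (t + 2 * k) (%m. x1 m + x2 m) y - y) <= 8 * K * ?r"
   using stg_disp[OF a(2), of "%m. x1 m + x2 m" y] by simp
  then show ?thesis
   using sqrt_facts(7)[OF a, of y x1 x2] norm_Pair_real_le[of "2 * k" "stg t (t + 2 * k) (%m. x1 m + x2 m) y - y"] a
   by (simp add: vD_def algebra_simps)
 qed
 then show "ord 1 vD" using K0 by (intro ordI[of "8 * K + 2"]) auto
qed

lemma ord_A:
 assumes "ord p v" "\<And>t k y x1 x2. 0 <= k ==> admissible t (t + 2 * k) ==> t + snd (v t k y x1 x2) \<in> {0..T}"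
 shows "ord p (%t k y x1 x2. A t y (v t k y x1 x2))"
proof (rule ord_le[OF assms(1), of "2 * K"])
 show "0 <= 2 * K" using K_ge1 by simp
 fix t k y x1 x2 assume a: "0 <= k" "admissible t (t + 2 * k)"
 let ?v = "v t k y x1 x2"
 have "norm (A t y ?v) <= K * (norm (fst ?v) + norm (snd ?v))"
  using drift_lipschitz[of "t + snd ?v" t "y + fst ?v" y] assms(2)[OF a, of y x1 x2] admissibleD(1)[OF a(2)]
  by (simp add: A_def)
 also have "... <= K * (norm ?v + norm ?v)"
  using K_ge1 norm_fst_le[of "fst ?v" "snd ?v"] norm_snd_le[of "snd ?v" "fst ?v"]
  by (intro mult_left_mono add_mono) auto
 finally show "norm (A t y ?v) <= 2 * K * norm ?v" by (simp add: algebra_simps)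
qed

lemma time_in:
 assumes "0 <= k" "admissible t (t + 2 * k)"
 shows "t + snd (vA t k y x1 x2) \<in> {0..T}" "t + snd (vB t k y x1 x2) \<in> {0..T}"
  "t + snd (vC t k y x1 x2) \<in> {0..T}" "t + snd (vD t k y x1 x2) \<in> {0..T}"
  "t \<in> {0..T}" "t + k \<in> {0..T}" "t + 2 * k \<in> {0..T}"
 using assms by (auto simp: vA_def vB_def vC_def vD_def admissible_def)

text \<open>An increment has order 1 and a time step counts 2, so a difference in time of the noise
  coefficients gives 1 + 2 and a second difference 1 + 4.\<close>

lemma ord_noise:
 shows "ord 1 (%t k y x1 x2. Sg t x1)" "ord 3 (%t k y x1 x2. Sg (t + k) x1 - Sg t x1)"
  "ord 3 (%t k y x1 x2. Sg (t + 2 * k) x1 - Sg t x1)"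
  "ord 5 (%t k y x1 x2. Sg t x1 - 2 *R Sg (t + k) x1 + Sg (t + 2 * k) x1)"
proof -
 have K0: "0 <= K" using K_ge1 by simp
 have nn: "ord 1 (%t k y x1 x2. n x1)" by (rule ordI[of 1]) (use sqrt_facts(4) in auto)
 have kn: "ord 3 (%t k y x1 x2. k *R n x1)" by (rule ord_k_scaleR[OF nn]) simp
 have kkn: "ord 5 (%t k y x1 x2. k *R k *R n x1)" by (rule ord_k_scaleR[OF kn]) simp
 show "ord 1 (%t k y x1 x2. Sg t x1)"
  by (rule ord_le[OF nn K0]) (use noise_bound time_in in \<open>simp\<close>)
 show "ord 3 (%t k y x1 x2. Sg (t + k) x1 - Sg t x1)"
 proof (rule ord_le[OF kn K0])
  fix t k y x1 and x2 :: "nat => real" assume a: "0 <= k" "admissible t (t + 2 * k)"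
  show "norm (Sg (t + k) x1 - Sg t x1) <= K * norm (k *R n x1)"
   using noise_lipschitz[OF time_in(6,5)[OF a], of x1] a by (simp add: mult_ac)
 qed
 show "ord 3 (%t k y x1 x2. Sg (t + 2 * k) x1 - Sg t x1)"
 proof (rule ord_le[OF kn, of "2 * K"])
  fix t k y x1 and x2 :: "nat => real" assume a: "0 <= k" "admissible t (t + 2 * k)"
  show "norm (Sg (t + 2 * k) x1 - Sg t x1) <= 2 * K * norm (k *R n x1)"
   using noise_lipschitz[OF time_in(7,5)[OF a], of x1] a by (simp add: mult_ac)
 qed (use K0 in simp)
 show "ord 5 (%t k y x1 x2. Sg t x1 - 2 *R Sg (t + k) x1 + Sg (t + 2 * k) x1)"
 proof (rule ord_le[OF kkn, of K])
  fix t k y x1 and x2 :: "nat => real" assume a: "0 <= k" "admissible t (t + 2 * k)"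
  show "norm (Sg t x1 - 2 *R Sg (t + k) x1 + Sg (t + 2 * k) x1) <= K * norm (k *R k *R n x1)"
   using noise_sq[OF a(1) time_in(5,7)[OF a], of x1] a by (simp add: mult_ac power2_eq_square)
 qed (use K0 in simp)
qed

text \<open>The pair is the drift of state and time taken together.\<close>

lemma ord_ka: "ord 2 (%t k y x1 x2. k *R (a y t, 1::real))"
proof (rule ordI[of "K + 1"])
 fix t k y x1 x2 assume k: "0 <= k" "admissible t (t + 2 * k)"
 have "norm (a y t, 1::real) <= K * (1 + norm y) + 1 * (1 + norm y)"
  using drift_growth[OF time_in(5)[OF k], of y] norm_Pair_le[of "a y t" "1::real"] norm_ge_zero[of y]
  unfolding norm_one mult_1 by linarith
 then have "k * norm (a y t, 1::real) <= k * ((K + 1) * (1 + norm y))"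
  using k by (intro mult_left_mono) (auto simp: algebra_simps)
 also have "... = (K + 1) * (k * (1 + norm y))" by simp
 also have "... <= (K + 1) * rho k y x1 x2 ^ 2" using sqrt_facts(3)[OF k, of y x1 x2] K_ge1 by (intro mult_left_mono) auto
 finally show "norm (k *R (a y t, 1::real)) <= (K + 1) * rho k y x1 x2 ^ 2" using k by (simp del: scaleR_Pair)
qed (use K_ge1 in simp)

abbreviation "AA \<equiv> %t k y x1 x2. A t y (vA t k y x1 x2)"
abbreviation "AB \<equiv> %t k y x1 x2. A t y (vB t k y x1 x2)"
abbreviation "AC \<equiv> %t k y x1 x2. A t y (vC t k y x1 x2)"
abbreviation "AD \<equiv> %t k y x1 x2. A t y (vD t k y x1 x2)"

lemma ord_AX: "ord 1 AA" "ord 1 AB" "ord 1 AC" "ord 1 AD"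
 by (rule ord_A; use ord_vABCD time_in in blast)+

text \<open>Remainders of the stage increments beyond \<open>noise + c k (drift, 1)\<close>.\<close>

definition nH where "nH t k x = (1/2) *R (Sg (t + k) x - Sg t x)" for t k :: real and x
definition nC where "nC t k x = (1/2) *R ((Sg (t + k) x - Sg t x) + (Sg (t + 2 * k) x - Sg t x))" for t k :: real and x

definition rB where "rB t k y x1 x2 = (k/2) *R AA t k y x1 x2 + nH t k x1"
definition rC1 where "rC1 t k y x1 x2 = (k/2) *R (AA t k y x1 x2 + AB t k y x1 x2 + AC t k y x1 x2) + (nH t k x1 + nC t k x2)"
definition rC2 where "rC2 t k y x1 x2 = (k/2) *R (AA t k y x1 x2 + 2 *R AB t k y x1 x2) + (nH t k x1 + (Sg (t + k) x2 - Sg t x2))"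
definition rD where "rD t k y x1 x2 = (k/2) *R (2 *R AD t k y x1 x2) + (1/2) *R (Sg (t + 2 * k) (%m. x1 m + x2 m) - Sg t (%m. x1 m + x2 m))"

definition sA where "sA t k y x1 x2 = ((fst (rB t k y x1 x2), 0::'b), 0::real)"
definition sB where "sB t k y x1 x2 = (rB t k y x1 x2, 0::real)"
definition sC where "sC t k y x1 x2 = ((fst (rC1 t k y x1 x2), snd (rC2 t k y x1 x2)), 0::real)"
definition sD where "sD t k y x1 x2 = ((fst (rD t k y x1 x2), 0::'b), 0::real)"

lemma half_eq:
 assumes "0 <= k" "admissible t (t + 2 * k)"
 shows "half t k y x1 = y + k *R a y t + Sg t x1 + rB t k y x1 x2"
proof -
 have "half t k y x1 = y + (k/2) *R (a y t + (AA t k y x1 x2 + a y t)) + (1/2) *R (Sg t x1 + Sg (t + k) x1)"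
  unfolding half_def using stp_eq[OF admissible_halves(1)[OF assms], of x1 y] by (simp add: A_def vA_def)
 also have "... = y + (k/2 + k/2) *R a y t + (1/2 + 1/2) *R Sg t x1 + rB t k y x1 x2"
  unfolding scaleR_add_left by (simp add: rB_def nH_def scaleR_add_right scaleR_diff_right)
 finally show ?thesis by simp
qed

text \<open>The leading terms are those of \<open>Phi_eq\<close>, so that the local difference is
  \<open>rC1\<close> minus \<open>rD\<close>.\<close>

lemma Psi_eq:
 assumes "0 <= k" "admissible t (t + 2 * k)"
 shows "Psi t k y x1 x2 = y + (2 * k) *R a y t + (Sg t x1 + Sg t x2) + rC1 t k y x1 x2"
proof -
 have "Psi t k y x1 x2 = half t k y x1 + (k/2) *R ((AB t k y x1 x2 + a y t) + (AC t k y x1 x2 + a y t)) + (1/2) *R (Sg (t + k) x2 + Sg (t + 2 * k) x2)"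
  unfolding Psi_def using stp_eq[OF admissible_halves(2)[OF assms], of x2 "half t k y x1"] by (simp add: A_def vB_def vC_def)
 also have "... = half t k y x1 + (k/2 + k/2) *R a y t + (1/2 + 1/2) *R Sg t x2 + (k/2) *R (AB t k y x1 x2 + AC t k y x1 x2) + nC t k x2"
  unfolding scaleR_add_left by (simp add: nC_def scaleR_add_right scaleR_diff_right)
 also have "... = half t k y x1 + k *R a y t + Sg t x2 + (k/2) *R (AB t k y x1 x2 + AC t k y x1 x2) + nC t k x2" by simp
 also have "... = y + (2 * k) *R a y t + (Sg t x1 + Sg t x2) + rC1 t k y x1 x2"
 proof -
  have "y + k *R p + s + ((k/2) *R u + v) + k *R p + s' + (k/2) *R w + z
   = y + (2 * k) *R p + (s + s') + ((k/2) *R (u + w) + (v + z))" for p s u v w z s' :: "'a \<times> 'b"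
  proof -
   have "(2 * k) *R p = k *R p + k *R p" by (simp add: scaleR_add_left[symmetric])
   then show ?thesis by (simp add: scaleR_add_right)
  qed
  then show ?thesis unfolding half_eq[OF assms, of y x1 x2] rB_def rC1_def add.assoc .
 qed
 finally show ?thesis .
qed

lemma Phi_eq:
 assumes "0 <= k" "admissible t (t + 2 * k)"
 shows "Phi t k y x1 x2 = y + (2 * k) *R a y t + (Sg t x1 + Sg t x2) + rD t k y x1 x2"
proof -
 let ?x = "%m. x1 m + x2 m"
 have "Phi t k y x1 x2 = y + k *R (a y t + (AD t k y x1 x2 + a y t)) + (1/2) *R (Sg t ?x + Sg (t + 2 * k) ?x)"
  unfolding Phi_def using stp_eq[OF assms(2), of ?x y] by (simp add: A_def vD_def)
 also have "... = y + (k + k) *R a y t + (1/2 + 1/2) *R Sg t ?x + rD t k y x1 x2"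
  unfolding scaleR_add_left by (simp add: rD_def scaleR_add_right scaleR_diff_right)
 also have "... = y + (2 * k) *R a y t + Sg t ?x + rD t k y x1 x2" by simp
 finally show ?thesis by (simp only: noise_add)
qed

text \<open>In \<open>sA\<close> and \<open>sD\<close> the second component vanishes because the
  second component of a stage is an explicit Euler step. In \<open>sC\<close> it remains, as the
  second half step starts from the midpoint value.\<close>

lemma v_eq:
 assumes "0 <= k" "admissible t (t + 2 * k)"
 shows "vA t k y x1 x2 = (Sg t x1, 0) + 1 *R k *R (a y t, 1) + sA t k y x1 x2"
  "vB t k y x1 x2 = (Sg t x1, 0) + 1 *R k *R (a y t, 1) + sB t k y x1 x2"
  "vC t k y x1 x2 = (Sg t x1 + Sg t x2, 0) + 2 *R k *R (a y t, 1) + sC t k y x1 x2"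
  "vD t k y x1 x2 = (Sg t x1 + Sg t x2, 0) + 2 *R k *R (a y t, 1) + sD t k y x1 x2"
proof -
 note h = half_eq[OF assms, of y x1 x2]
 show "vB t k y x1 x2 = (Sg t x1, 0) + 1 *R k *R (a y t, 1) + sB t k y x1 x2"
  by (simp add: vB_def h sB_def)
 have fA: "fst (stp t (t + k) x1 y) = fst (y + k *R a y t + Sg t x1 + rB t k y x1 x2)"
  using h unfolding half_def by (rule arg_cong)
 show "vA t k y x1 x2 = (Sg t x1, 0) + 1 *R k *R (a y t, 1) + sA t k y x1 x2"
  unfolding vA_def stg_def sA_def fA by (simp add: prod_eq_iff)
 have fD: "fst (stp t (t + 2 * k) (%m. x1 m + x2 m) y) = fst (y + (2 * k) *R a y t + (Sg t x1 + Sg t x2) + rD t k y x1 x2)"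
  using Phi_eq[OF assms, of y x1 x2] unfolding Phi_def by (rule arg_cong)
 show "vD t k y x1 x2 = (Sg t x1 + Sg t x2, 0) + 2 *R k *R (a y t, 1) + sD t k y x1 x2"
  unfolding vD_def stg_def sD_def fD noise_add by (simp add: prod_eq_iff)
 have fC: "fst (stp (t + k) (t + 2 * k) x2 (half t k y x1)) = fst (y + (2 * k) *R a y t + (Sg t x1 + Sg t x2) + rC1 t k y x1 x2)"
  using Psi_eq[OF assms, of y x1 x2] unfolding Psi_def by (rule arg_cong)
 have aB: "a (half t k y x1) (t + k) = AB t k y x1 x2 + a y t" by (simp add: A_def vB_def)
 have "half t k y x1 + k *R (AB t k y x1 x2 + a y t) + Sg (t + k) x2
   = y + (2 * k) *R a y t + (Sg t x1 + Sg t x2) + rC2 t k y x1 x2"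
 proof -
  have "y + k *R p + s + ((k/2) *R u + v) + k *R (w + p) + z
   = y + (2 * k) *R p + (s + z') + ((k/2) *R (u + 2 *R w) + (v + (z - z')))" for p s u v w z z' :: "'a \<times> 'b"
  proof -
   have "(2 * k) *R p = k *R p + k *R p" by (simp add: scaleR_add_left[symmetric])
   then show ?thesis by (simp add: scaleR_add_right)
  qed
  then show ?thesis unfolding h rB_def rC2_def .
 qed
 then have sC: "snd (half t k y x1) + k *R snd (AB t k y x1 x2 + a y t) + snd (Sg (t + k) x2)
   = snd (y + (2 * k) *R a y t + (Sg t x1 + Sg t x2) + rC2 t k y x1 x2)"
  by (metis snd_add snd_scaleR)
 have k2: "t + 2 * k - (t + k) = k" by simp
 show "vC t k y x1 x2 = (Sg t x1 + Sg t x2, 0) + 2 *R k *R (a y t, 1) + sC t k y x1 x2"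
  unfolding vC_def stg_def sC_def fC k2 aB sC by (simp add: prod_eq_iff)
qed

end

section \<open>Cancellations in the local difference\<close>

context scheme
begin

abbreviation ng :: "(nat => real) => nat => real" where "ng x \<equiv> (%m. - x m)"

text \<open>Linear and quadratic part of the drift at (y, t), selected once for all stages: the
  cancellations between the stages need the same maps in every expansion.\<close>

definition Lf where "Lf t y = (SOME L. \<exists>B. quad_approx K {v. t + snd v \<in> {0..T}} (A t y) L B)" for t y
definition Bf where "Bf t y = (SOME B. quad_approx K {v. t + snd v \<in> {0..T}} (A t y) (Lf t y) B)" for t y
definition Rf where "Rf t y v = A t y v - Lf t y v - Bf t y v v" for t y v

lemma quad:
 assumes "t \<in> {0..T}"
 shows "quad_approx K {v. t + snd v \<in> {0..T}} (A t y) (Lf t y) (Bf t y)"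
proof -
 have "\<exists>L B. quad_approx K {v. t + snd v \<in> {0..T}} (A t y) L B"
  using drift_quad[OF assms, of y] unfolding A_def[abs_def] .
 then have "\<exists>B. quad_approx K {v. t + snd v \<in> {0..T}} (A t y) (Lf t y) B"
  unfolding Lf_def by (rule someI_ex)
 then show ?thesis unfolding Bf_def by (rule someI_ex)
qed

lemma quad_bounds:
 assumes "0 <= k" "admissible t (t + 2 * k)"
 shows "norm (Lf t y v) <= K * norm v" "norm (Bf t y u v) <= K * norm u * norm v"
  "t + snd v \<in> {0..T} ==> norm (Rf t y v) <= K * norm v ^ 3"
  "t + snd u \<in> {0..T} ==> t + snd v \<in> {0..T} ==>
   norm (Rf t y u + Rf t y v) <= K * (norm (u + v) * (norm u + norm v)^2 + (norm u + norm v) ^ 4)"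
 using quad[OF time_in(5)[OF assms], of y] unfolding quad_approx_def Rf_def by blast+

lemma ord_kh: "ord p f ==> q = p + 2 ==> ord q (%t k y x1 x2. (k/2) *R f t k y x1 x2)"
 using ord_scaleR[OF ord_k_scaleR, of p f q "1/2"] by simp

lemma ord_mult: "ord p f ==> ord p' g ==> q = p + p' ==> ord q (%t k y x1 x2. f t k y x1 x2 * (g t k y x1 x2 :: real))"
 using ord_mult_gen[where B=1, of p f p' g "%t k y x1 x2. f t k y x1 x2 * g t k y x1 x2"]
 by (simp add: abs_mult)

lemma ord_norm: "ord p f ==> ord p (%t k y x1 x2. norm (f t k y x1 x2))"
 by (rule ord_le[where B=1]) auto

lemma linear_Lf: "0 <= k ==> admissible t (t + 2 * k) ==> linear (Lf t y)"
 using quad[OF time_in(5)] unfolding quad_approx_def by blast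

lemma bilinear_Bf: "0 <= k ==> admissible t (t + 2 * k) ==> bilinear (Bf t y)"
 using quad[OF time_in(5)] unfolding quad_approx_def by blast

lemma ord_L: "ord p v ==> ord p (%t k y x1 x2. Lf t y (v t k y x1 x2))"
 by (rule ord_le[where B=K]) (use quad_bounds(1) K_ge1 in \<open>simp_all\<close>)

lemma ord_B: "ord p u ==> ord p' v ==> q = p + p' ==> ord q (%t k y x1 x2. Bf t y (u t k y x1 x2) (v t k y x1 x2))"
proof -
 assume a: "ord p u" "ord p' v" "q = p + p'"
 show ?thesis unfolding a(3)
 proof (rule ord_mult_gen[OF a(1,2), of K])
  show "0 <= K" using K_ge1 by simp
  fix t k y and x1 x2 :: "nat => real" assume k: "0 <= k" "admissible t (t + 2 * k)"
  show "norm (Bf t y (u t k y x1 x2) (v t k y x1 x2)) <= K * (norm (u t k y x1 x2) * norm (v t k y x1 x2))"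
   using quad_bounds(2)[OF k] by (simp add: mult.assoc)
 qed
qed

lemma ord_R:
 assumes "ord 1 v" "\<And>t k y x1 x2. 0 <= k ==> admissible t (t + 2 * k) ==> t + snd (v t k y x1 x2) \<in> {0..T}"
 shows "ord 3 (%t k y x1 x2. Rf t y (v t k y x1 x2))"
proof -
 let ?n = "%t k y x1 x2. norm (v t k y x1 x2)"
 note n = ord_norm[OF assms(1)]
 have "ord 3 (%t k y x1 x2. ?n t k y x1 x2 * (?n t k y x1 x2 * ?n t k y x1 x2))"
  by (rule ord_mult[OF n ord_mult[OF n n refl]]) simp
 then show ?thesis
 proof (rule ord_le[where B=K])
  show "0 <= K" using K_ge1 by simp
  fix t k y and x1 x2 :: "nat => real" assume k: "0 <= k" "admissible t (t + 2 * k)"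
  show "norm (Rf t y (v t k y x1 x2)) <= K * norm (?n t k y x1 x2 * (?n t k y x1 x2 * ?n t k y x1 x2))"
   using quad_bounds(3)[OF k assms(2)[OF k], of y y x1 x2] by (simp add: power3_eq_cube mult.assoc)
 qed
qed

text \<open>The third order remainders are odd to leading order. If the displacements cancel up to
  order 2, the sum of the remainders therefore gains an order.\<close>

lemma ord_RR:
 assumes "ord 1 u" "ord 1 v" "ord 2 (%t k y x1 x2. u t k y x1 x2 + v t k y x1 x2)"
  "\<And>t k y x1 x2. 0 <= k ==> admissible t (t + 2 * k) ==> t + snd (u t k y x1 x2) \<in> {0..T}"
  "\<And>t k y x1 x2. 0 <= k ==> admissible t (t + 2 * k) ==> t + snd (v t k y x1 x2) \<in> {0..T}"
 shows "ord 4 (%t k y x1 x2. Rf t y (u t k y x1 x2) + Rf t y (v t k y x1 x2))"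
proof -
 let ?m = "%t k y x1 x2. norm (u t k y x1 x2) + norm (v t k y x1 x2)"
 have m: "ord 1 ?m" by (intro ord_add ord_norm assms)
 have m2: "ord 2 (%t k y x1 x2. ?m t k y x1 x2 * ?m t k y x1 x2)" by (rule ord_mult[OF m m]) simp
 have "ord 4 (%t k y x1 x2. norm (u t k y x1 x2 + v t k y x1 x2) * (?m t k y x1 x2 * ?m t k y x1 x2)
  + (?m t k y x1 x2 * ?m t k y x1 x2) * (?m t k y x1 x2 * ?m t k y x1 x2))"
  by (rule ord_add[OF ord_mult[OF ord_norm[OF assms(3)] m2] ord_mult[OF m2 m2]]) auto
 then show ?thesis
 proof (rule ord_le[where B=K])
  show "0 <= K" using K_ge1 by simp
  fix t k y and x1 x2 :: "nat => real" assume k: "0 <= k" "admissible t (t + 2 * k)"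
  have "norm (Rf t y (u t k y x1 x2) + Rf t y (v t k y x1 x2)) <=
   K * (norm (u t k y x1 x2 + v t k y x1 x2) * (?m t k y x1 x2)^2 + ?m t k y x1 x2 ^ 4)"
   by (rule quad_bounds(4)[OF k assms(4,5)[OF k]])
  then show "norm (Rf t y (u t k y x1 x2) + Rf t y (v t k y x1 x2)) <= K * norm (norm (u t k y x1 x2 + v t k y x1 x2) * (?m t k y x1 x2 * ?m t k y x1 x2)
  + (?m t k y x1 x2 * ?m t k y x1 x2) * (?m t k y x1 x2 * ?m t k y x1 x2))"
   by (simp add: power2_eq_square eval_nat_numeral mult.assoc)
 qed
qed

lemma A_eq: "A t y v = Lf t y v + Bf t y v v + Rf t y v"
 by (simp add: Rf_def)

lemma scaleR_double: "(2 * c) *R (g :: 'w::real_vector) = c *R g + c *R g"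
 by (simp add: scaleR_add_left[symmetric])

text \<open>\<open>e\<close> is the noise part of the displacement and changes sign with the noise.
  Adding the value at reversed noise removes the part linear in \<open>e\<close>; subtracting it
  removes the drift part and the square of \<open>e\<close>. One order is gained each time. The
  fourth statement keeps the second order terms explicitly, and for this the even part of
  \<open>s\<close> has to be of order 4.\<close>

lemma stage_expansion:
 fixes v e s :: "real => real => 'a \<times> 'b => (nat => real) => (nat => real) => ('a \<times> 'b) \<times> real" and c :: real
 assumes v: "ord 1 v" and e: "ord 1 e" and s: "ord 3 s"
  and tin0: "\<forall>t k y x1 x2. 0 <= k --> admissible t (t + 2 * k) --> t + snd (v t k y x1 x2) \<in> {0..T}"
  and eq0: "\<forall>t k y x1 x2. 0 <= k --> admissible t (t + 2 * k) -->
    v t k y x1 x2 = e t k y x1 x2 + c *R k *R (a y t, 1) + s t k y x1 x2"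
  and odd: "\<And>t k y x1 x2. e t k y (ng x1) (ng x2) = - e t k y x1 x2"
 shows "ord 2 (%t k y x1 x2. A t y (v t k y x1 x2) + A t y (v t k y (ng x1) (ng x2)))" (is ?P1)
  and "ord 2 (%t k y x1 x2. A t y (v t k y x1 x2) - Lf t y (e t k y x1 x2))" (is ?P2)
  and "ord 3 (%t k y x1 x2. A t y (v t k y x1 x2) - A t y (v t k y (ng x1) (ng x2)) - 2 *R Lf t y (e t k y x1 x2))" (is ?P3)
  and "ord 4 (%t k y x1 x2. s t k y x1 x2 + s t k y (ng x1) (ng x2)) ==>
   ord 4 (%t k y x1 x2. A t y (v t k y x1 x2) + A t y (v t k y (ng x1) (ng x2))
    - (2 * c) *R Lf t y (k *R (a y t, 1)) - 2 *R Bf t y (e t k y x1 x2) (e t k y x1 x2))" (is "?Q ==> ?P4")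
proof -
 note tin = tin0[rule_format] and eq = eq0[rule_format]
 let ?v = "%t k y x1 x2. v t k y (ng x1) (ng x2)" and ?s = "%t k y x1 x2. s t k y (ng x1) (ng x2)"
 let ?g = "%t k y x1 x2. c *R k *R (a y t, 1::real)"
 have v': "ord 1 ?v" and s': "ord 3 ?s" using ord_neg v s by blast+
 have g: "ord 2 ?g" by (intro ord_scaleR ord_ka)
 have tin': "\<And>t k y x1 x2. 0 <= k ==> admissible t (t + 2 * k) ==> t + snd (?v t k y x1 x2) \<in> {0..T}"
  using tin by blast
 have eq': "?v t k y x1 x2 = - e t k y x1 x2 + ?g t k y x1 x2 + ?s t k y x1 x2" if "0 <= k" "admissible t (t + 2 * k)" for t k y x1 x2
  using eq[OF that, of y "ng x1" "ng x2"] by (simp only: odd)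
 have s2: "ord 2 s" "ord 2 ?s" using s s' ord_mono by force+
 have sum: "ord 2 (%t k y x1 x2. v t k y x1 x2 + ?v t k y x1 x2)"
 proof (rule ord_cong[OF ord_add[OF ord_add[OF g g] ord_add[OF s2]]])
  fix t k y and x1 x2 :: "nat => real" assume k: "0 <= k" "admissible t (t + 2 * k)"
  show "v t k y x1 x2 + ?v t k y x1 x2 = ?g t k y x1 x2 + ?g t k y x1 x2 + (s t k y x1 x2 + ?s t k y x1 x2)"
   unfolding eq[OF k, of y x1 x2] eq'[OF k, of y x1 x2] by (simp add: algebra_simps del: scaleR_Pair)
 qed
 have R: "ord 3 (%t k y x1 x2. Rf t y (v t k y x1 x2))" "ord 3 (%t k y x1 x2. Rf t y (?v t k y x1 x2))"
  using ord_R[OF v tin] ord_R[OF v' tin'] by auto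
 have R2: "ord 2 (%t k y x1 x2. Rf t y (v t k y x1 x2))" "ord 2 (%t k y x1 x2. Rf t y (?v t k y x1 x2))"
  using R ord_mono by force+
 have B2: "ord 2 (%t k y x1 x2. Bf t y (v t k y x1 x2) (v t k y x1 x2))" "ord 2 (%t k y x1 x2. Bf t y (?v t k y x1 x2) (?v t k y x1 x2))"
  by (rule ord_B[OF v v], simp, rule ord_B[OF v' v'], simp)
 show ?P1
 proof (rule ord_cong[OF ord_add[OF ord_L[OF sum] ord_add[OF ord_add[OF B2] ord_add[OF R2]]]])
  fix t k y and x1 x2 :: "nat => real" assume k: "0 <= k" "admissible t (t + 2 * k)"
  show "A t y (v t k y x1 x2) + A t y (?v t k y x1 x2) = Lf t y (v t k y x1 x2 + ?v t k y x1 x2) +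
    (Bf t y (v t k y x1 x2) (v t k y x1 x2) + Bf t y (?v t k y x1 x2) (?v t k y x1 x2) + (Rf t y (v t k y x1 x2) + Rf t y (?v t k y x1 x2)))"
   unfolding A_eq linear_add[OF linear_Lf[OF k]] by simp
 qed
 show ?P2
 proof (rule ord_cong[OF ord_add[OF ord_L[OF ord_add[OF g s2(1)]] ord_add[OF B2(1) R2(1)]]])
  fix t k y and x1 x2 :: "nat => real" assume k: "0 <= k" "admissible t (t + 2 * k)"
  have "Lf t y (v t k y x1 x2) - Lf t y (e t k y x1 x2) = Lf t y (?g t k y x1 x2 + s t k y x1 x2)"
   unfolding linear_diff[OF linear_Lf[OF k], symmetric] eq[OF k, of y x1 x2] by (simp add: add.assoc)
  then show "A t y (v t k y x1 x2) - Lf t y (e t k y x1 x2) = Lf t y (?g t k y x1 x2 + s t k y x1 x2) +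
    (Bf t y (v t k y x1 x2) (v t k y x1 x2) + Rf t y (v t k y x1 x2))"
   unfolding A_eq by (simp add: algebra_simps)
 qed
 have Bd: "ord 3 (%t k y x1 x2. Bf t y (v t k y x1 x2 + ?v t k y x1 x2) (v t k y x1 x2))"
  "ord 3 (%t k y x1 x2. Bf t y (?v t k y x1 x2) (v t k y x1 x2 + ?v t k y x1 x2))"
  by (rule ord_B[OF sum v], simp, rule ord_B[OF v' sum], simp)
 show ?P3
 proof (rule ord_cong[OF ord_add[OF ord_L[OF ord_diff[OF s s']] ord_add[OF ord_diff[OF Bd] ord_diff[OF R]]]])
  fix t k y and x1 x2 :: "nat => real" assume k: "0 <= k" "admissible t (t + 2 * k)"
  have "Lf t y (v t k y x1 x2) - Lf t y (?v t k y x1 x2) - 2 *R Lf t y (e t k y x1 x2) = Lf t y (s t k y x1 x2 - ?s t k y x1 x2)"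
   unfolding linear_diff[OF linear_Lf[OF k], symmetric] linear_scale[OF linear_Lf[OF k], symmetric] eq[OF k, of y x1 x2] eq'[OF k, of y x1 x2]
   by (rule arg_cong[where f="Lf t y"]) (simp add: scaleR_2 algebra_simps del: scaleR_Pair)
  moreover have "Bf t y (v t k y x1 x2) (v t k y x1 x2) - Bf t y (?v t k y x1 x2) (?v t k y x1 x2)
   = Bf t y (v t k y x1 x2 + ?v t k y x1 x2) (v t k y x1 x2) - Bf t y (?v t k y x1 x2) (v t k y x1 x2 + ?v t k y x1 x2)"
   by (simp add: bilinear_ladd[OF bilinear_Bf[OF k]] bilinear_radd[OF bilinear_Bf[OF k]])
  ultimately show "A t y (v t k y x1 x2) - A t y (?v t k y x1 x2) - 2 *R Lf t y (e t k y x1 x2) =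
   Lf t y (s t k y x1 x2 - ?s t k y x1 x2) +
    (Bf t y (v t k y x1 x2 + ?v t k y x1 x2) (v t k y x1 x2) - Bf t y (?v t k y x1 x2) (v t k y x1 x2 + ?v t k y x1 x2) +
    (Rf t y (v t k y x1 x2) - Rf t y (?v t k y x1 x2)))"
   unfolding A_eq by (simp add: algebra_simps)
 qed
 show ?P4 if q: ?Q
 proof -
  let ?h = "%t k y x1 x2. ?g t k y x1 x2 + s t k y x1 x2" and ?h' = "%t k y x1 x2. ?g t k y x1 x2 + ?s t k y x1 x2"
  have h: "ord 2 ?h" "ord 2 ?h'" by (intro ord_add g s2)+
  have B4: "ord 4 (%t k y x1 x2. Bf t y (?h t k y x1 x2) (?h t k y x1 x2))" "ord 4 (%t k y x1 x2. Bf t y (?h' t k y x1 x2) (?h' t k y x1 x2))"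
   by (rule ord_B[OF h(1) h(1)], simp, rule ord_B[OF h(2) h(2)], simp)
  have d: "ord 3 (%t k y x1 x2. s t k y x1 x2 - ?s t k y x1 x2)" by (rule ord_diff[OF s s'])
  \<comment> \<open>Products of \<open>e\<close> with the remainders survive the addition only
    through the difference of the two remainders, since \<open>e\<close> changes sign.\<close>
  have Be: "ord 4 (%t k y x1 x2. Bf t y (e t k y x1 x2) (s t k y x1 x2 - ?s t k y x1 x2))"
   "ord 4 (%t k y x1 x2. Bf t y (s t k y x1 x2 - ?s t k y x1 x2) (e t k y x1 x2))"
   by (rule ord_B[OF e d], simp, rule ord_B[OF d e], simp)
  have RR: "ord 4 (%t k y x1 x2. Rf t y (v t k y x1 x2) + Rf t y (?v t k y x1 x2))"
   by (rule ord_RR[OF v v' sum tin tin'])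
  show ?P4
  proof (rule ord_cong[OF ord_add[OF ord_L[OF q] ord_add[OF ord_add[OF ord_add[OF B4] ord_add[OF Be]] RR]]])
   fix t k y and x1 x2 :: "nat => real" assume k: "0 <= k" "admissible t (t + 2 * k)"
   define g e' s1 s2 where "g = (k *R (a y t, 1::real))" and "e' = e t k y x1 x2" and "s1 = s t k y x1 x2" and "s2 = ?s t k y x1 x2"
   note lin = linear_add[OF linear_Lf[OF k]] linear_scale[OF linear_Lf[OF k]]
   note bl = bilinear_ladd[OF bilinear_Bf[OF k]] bilinear_radd[OF bilinear_Bf[OF k]]
    bilinear_lneg[OF bilinear_Bf[OF k]] bilinear_rneg[OF bilinear_Bf[OF k]]
    bilinear_lsub[OF bilinear_Bf[OF k]] bilinear_rsub[OF bilinear_Bf[OF k]]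
   have L: "Lf t y (e' + c *R g + s1) + Lf t y (- e' + c *R g + s2) - (2 * c) *R Lf t y g = Lf t y (s1 + s2)"
   proof -
    have "Lf t y (e' + c *R g + s1) + Lf t y (- e' + c *R g + s2) = Lf t y ((2 * c) *R g + (s1 + s2))"
     unfolding linear_add[OF linear_Lf[OF k], symmetric]
     by (rule arg_cong[where f="Lf t y"]) (simp add: scaleR_double)
    then show ?thesis by (simp add: lin)
   qed
   have B: "Bf t y (e' + (c *R g + s1)) (e' + (c *R g + s1)) + Bf t y (- e' + (c *R g + s2)) (- e' + (c *R g + s2)) - 2 *R Bf t y e' e'
    = (Bf t y (c *R g + s1) (c *R g + s1) + Bf t y (c *R g + s2) (c *R g + s2)) + (Bf t y e' (s1 - s2) + Bf t y (s1 - s2) e')"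
    by (simp add: bl scaleR_2)
   have ve: "v t k y x1 x2 = e' + c *R g + s1" "?v t k y x1 x2 = - e' + c *R g + s2"
    unfolding e'_def g_def s1_def s2_def by (rule eq[OF k], rule eq'[OF k])
   show "A t y (v t k y x1 x2) + A t y (?v t k y x1 x2) - (2 * c) *R Lf t y (k *R (a y t, 1)) - 2 *R Bf t y (e t k y x1 x2) (e t k y x1 x2)
    = Lf t y (s t k y x1 x2 + ?s t k y x1 x2) + ((Bf t y (?h t k y x1 x2) (?h t k y x1 x2) + Bf t y (?h' t k y x1 x2) (?h' t k y x1 x2))
    + (Bf t y (e t k y x1 x2) (s t k y x1 x2 - ?s t k y x1 x2) + Bf t y (s t k y x1 x2 - ?s t k y x1 x2) (e t k y x1 x2))
    + (Rf t y (v t k y x1 x2) + Rf t y (?v t k y x1 x2)))"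
    using L B unfolding A_eq e'_def[symmetric] g_def[symmetric] s1_def[symmetric] s2_def[symmetric] ve
    by (simp add: algebra_simps)
  qed
 qed
qed

abbreviation "e1 \<equiv> %t k y x1 (x2::nat => real). (Sg t x1, 0::real)"
abbreviation "e12 \<equiv> %t k y x1 x2. (Sg t x1 + Sg t x2, 0::real)"

lemma ord_e: "ord 1 e1" "ord 1 e12"
 by (intro ord_Pair0 ord_noise(1), intro ord_Pair0 ord_add ord_noise(1) ord_swap[OF ord_noise(1)])

lemma ord_nH: "ord 3 (%t k y x1 x2. nH t k x1)" "ord 3 (%t k y x1 x2. nC t k x1)"
 "ord 3 (%t k y x1 x2. nC t k x2)" "ord 3 (%t k y x1 x2. Sg (t + k) x2 - Sg t x2)"
 "ord 3 (%t k y x1 x2. (1/2) *R (Sg (t + 2 * k) (%m. x1 m + x2 m) - Sg t (%m. x1 m + x2 m)))"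
proof -
 show "ord 3 (%t k y x1 x2. nH t k x1)" unfolding nH_def by (intro ord_scaleR ord_noise)
 show 1: "ord 3 (%t k y x1 x2. nC t k x1)" unfolding nC_def by (intro ord_scaleR ord_add ord_noise)
 show "ord 3 (%t k y x1 x2. nC t k x2)" by (rule ord_swap[OF 1])
 show "ord 3 (%t k y x1 x2. Sg (t + k) x2 - Sg t x2)" by (rule ord_swap[OF ord_noise(2)])
 show "ord 3 (%t k y x1 x2. (1/2) *R (Sg (t + 2 * k) (%m. x1 m + x2 m) - Sg t (%m. x1 m + x2 m)))"
  by (rule ord_cong[OF ord_scaleR[OF ord_add[OF ord_noise(3) ord_swap[OF ord_noise(3)]], of "1/2"]]) (simp add: noise_add)
qed

lemma noise_uminus_diff [simp]: "Sg t (%m. - x m - y m) = - Sg t x - Sg t y"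
 using noise_uminus[of M g1 g2 t "%m. x m + y m"] by (simp add: noise_add)

lemma n_odd: "nH t k (ng x) = - nH t k x" "nC t k (ng x) = - nC t k x"
 by (simp_all add: nH_def nC_def noise_uminus algebra_simps)

lemma ord_r: "ord 3 rB" "ord 3 rC1" "ord 3 rC2" "ord 3 rD"
proof -
 have "ord 3 (%t k y x1 x2. rB t k y x1 x2)" unfolding rB_def
  by (intro ord_add ord_nH, rule ord_kh[where p=1], intro ord_AX, simp)
 then show "ord 3 rB" .
 have "ord 3 (%t k y x1 x2. rC1 t k y x1 x2)" unfolding rC1_def
  by (intro ord_add ord_nH, rule ord_kh[where p=1], intro ord_add ord_AX, simp)
 then show "ord 3 rC1" .
 have "ord 3 (%t k y x1 x2. rC2 t k y x1 x2)" unfolding rC2_def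
  by (intro ord_add ord_nH, rule ord_kh[where p=1], intro ord_add ord_scaleR ord_AX, simp)
 then show "ord 3 rC2" .
 have "ord 3 (%t k y x1 x2. rD t k y x1 x2)" unfolding rD_def
  by (rule ord_add[OF _ ord_nH(5)], rule ord_kh[where p=1], intro ord_add ord_scaleR ord_AX, simp)
 then show "ord 3 rD" .
qed

lemma ord_s: "ord 3 sA" "ord 3 sB" "ord 3 sC" "ord 3 sD"
proof -
 have "ord 3 (%t k y x1 x2. sA t k y x1 x2)" unfolding sA_def by (intro ord_Pair0 ord_fst ord_r)
 then show "ord 3 sA" .
 have "ord 3 (%t k y x1 x2. sB t k y x1 x2)" unfolding sB_def by (intro ord_Pair0 ord_r)
 then show "ord 3 sB" .
 have "ord 3 (%t k y x1 x2. sC t k y x1 x2)" unfolding sC_def by (intro ord_Pair0 ord_mixed ord_r)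
 then show "ord 3 sC" .
 have "ord 3 (%t k y x1 x2. sD t k y x1 x2)" unfolding sD_def by (intro ord_Pair0 ord_fst ord_r)
 then show "ord 3 sD" .
qed

lemma e_odd: "e1 t k y (ng x1) (ng x2) = - e1 t k y x1 x2" "e12 t k y (ng x1) (ng x2) = - e12 t k y x1 x2"
 by (simp_all add: noise_uminus)

lemma v_all:
 "\<forall>t k y x1 x2. 0 <= k --> admissible t (t + 2 * k) --> t + snd (vA t k y x1 x2) \<in> {0..T}"
 "\<forall>t k y x1 x2. 0 <= k --> admissible t (t + 2 * k) --> t + snd (vB t k y x1 x2) \<in> {0..T}"
 "\<forall>t k y x1 x2. 0 <= k --> admissible t (t + 2 * k) --> t + snd (vC t k y x1 x2) \<in> {0..T}"
 "\<forall>t k y x1 x2. 0 <= k --> admissible t (t + 2 * k) --> t + snd (vD t k y x1 x2) \<in> {0..T}"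
 "\<forall>t k y x1 x2. 0 <= k --> admissible t (t + 2 * k) --> vA t k y x1 x2 = e1 t k y x1 x2 + 1 *R k *R (a y t, 1) + sA t k y x1 x2"
 "\<forall>t k y x1 x2. 0 <= k --> admissible t (t + 2 * k) --> vB t k y x1 x2 = e1 t k y x1 x2 + 1 *R k *R (a y t, 1) + sB t k y x1 x2"
 "\<forall>t k y x1 x2. 0 <= k --> admissible t (t + 2 * k) --> vC t k y x1 x2 = e12 t k y x1 x2 + 2 *R k *R (a y t, 1) + sC t k y x1 x2"
 "\<forall>t k y x1 x2. 0 <= k --> admissible t (t + 2 * k) --> vD t k y x1 x2 = e12 t k y x1 x2 + 2 *R k *R (a y t, 1) + sD t k y x1 x2"
 by (intro allI impI time_in v_eq; assumption)+

lemmas expA = stage_expansion[where v=vA and e=e1 and s=sA and c=1, OF ord_vABCD(1) ord_e(1) ord_s(1) v_all(1) v_all(5) e_odd(1)]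
lemmas expB = stage_expansion[where v=vB and e=e1 and s=sB and c=1, OF ord_vABCD(2) ord_e(1) ord_s(2) v_all(2) v_all(6) e_odd(1)]
lemmas expC = stage_expansion[where v=vC and e=e12 and s=sC and c=2, OF ord_vABCD(3) ord_e(2) ord_s(3) v_all(3) v_all(7) e_odd(2)]
lemmas expD = stage_expansion[where v=vD and e=e12 and s=sD and c=2, OF ord_vABCD(4) ord_e(2) ord_s(4) v_all(4) v_all(8) e_odd(2)]

text \<open>A bootstrap: the even parts of the drift values have order 2 by the first statement of
  \<open>stage_expansion\<close>, and the factor \<open>k\<close> lifts them to the order 4 that its
  last statement asks for. The noise parts of the remainders are odd and drop out.\<close>

lemma ord_r_even:
 "ord 4 (%t k y x1 x2. rB t k y x1 x2 + rB t k y (ng x1) (ng x2))"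
 "ord 4 (%t k y x1 x2. rC1 t k y x1 x2 + rC1 t k y (ng x1) (ng x2))"
 "ord 4 (%t k y x1 x2. rC2 t k y x1 x2 + rC2 t k y (ng x1) (ng x2))"
 "ord 4 (%t k y x1 x2. rD t k y x1 x2 + rD t k y (ng x1) (ng x2))"
proof -
 let ?E = "%f t k y x1 x2. f t k y x1 x2 + f t k y (ng x1) (ng x2) :: 'a \<times> 'b"
 have E: "ord 2 (?E AA)" "ord 2 (?E AB)" "ord 2 (?E AC)" "ord 2 (?E AD)"
  by (rule expA(1) expB(1) expC(1) expD(1))+
 note simps = scaleR_add_right noise_uminus noise_add n_odd
 show "ord 4 (%t k y x1 x2. rB t k y x1 x2 + rB t k y (ng x1) (ng x2))"
  by (rule ord_cong[OF ord_kh[OF E(1)]]) (auto simp: rB_def simps)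
 show "ord 4 (%t k y x1 x2. rC1 t k y x1 x2 + rC1 t k y (ng x1) (ng x2))"
  by (rule ord_cong[OF ord_kh[OF ord_add[OF E(1) ord_add[OF E(2,3)]]]]) (auto simp: rC1_def simps)
 show "ord 4 (%t k y x1 x2. rC2 t k y x1 x2 + rC2 t k y (ng x1) (ng x2))"
  by (rule ord_cong[OF ord_kh[OF ord_add[OF E(1) ord_scaleR[OF E(2), of 2]]]]) (auto simp: rC2_def simps)
 show "ord 4 (%t k y x1 x2. rD t k y x1 x2 + rD t k y (ng x1) (ng x2))"
  by (rule ord_cong[OF ord_kh[OF ord_scaleR[OF E(4), of 2]]]) (auto simp: rD_def simps scaleR_diff_right)
qed

lemma ord_s_even:
 "ord 4 (%t k y x1 x2. sA t k y x1 x2 + sA t k y (ng x1) (ng x2))"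
 "ord 4 (%t k y x1 x2. sB t k y x1 x2 + sB t k y (ng x1) (ng x2))"
 "ord 4 (%t k y x1 x2. sC t k y x1 x2 + sC t k y (ng x1) (ng x2))"
 "ord 4 (%t k y x1 x2. sD t k y x1 x2 + sD t k y (ng x1) (ng x2))"
proof -
 show "ord 4 (%t k y x1 x2. sA t k y x1 x2 + sA t k y (ng x1) (ng x2))"
  by (rule ord_cong[OF ord_Pair0[OF ord_fst[OF ord_r_even(1)]]]) (simp add: sA_def)
 show "ord 4 (%t k y x1 x2. sB t k y x1 x2 + sB t k y (ng x1) (ng x2))"
  by (rule ord_cong[OF ord_Pair0[OF ord_r_even(1)]]) (simp add: sB_def)
 show "ord 4 (%t k y x1 x2. sC t k y x1 x2 + sC t k y (ng x1) (ng x2))"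
  by (rule ord_cong[OF ord_Pair0[OF ord_mixed[OF ord_r_even(2,3)]]]) (simp add: sC_def)
 show "ord 4 (%t k y x1 x2. sD t k y x1 x2 + sD t k y (ng x1) (ng x2))"
  by (rule ord_cong[OF ord_Pair0[OF ord_fst[OF ord_r_even(4)]]]) (simp add: sD_def)
qed

text \<open>The drift values of the two half steps against twice that of the coarse stage, after the
  values at (y, t) have cancelled.\<close>

definition Br where "Br t k y x1 x2 = AA t k y x1 x2 + AB t k y x1 x2 + AC t k y x1 x2 - 2 *R AD t k y x1 x2"

text \<open>In the linear part the weight of \<open>x1\<close> is 1 + 1 + 1 - 2 = 1 and that of
  \<open>x2\<close> is 1 - 2 = -1, which is antisymmetric; the weight of the drift is 1 + 1 + 2 - 2
  * 2 = 0. In the quadratic part the two squares have opposite signs, so that exchange removes them,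
  and the products of \<open>x1\<close> with \<open>x2\<close> change sign with one of them.\<close>

lemma Br_expansion:
 "ord 2 (%t k y x1 x2. Br t k y x1 x2 + Br t k y x2 x1)"
 "ord 3 (%t k y x1 x2. (Br t k y x1 x2 - Br t k y (ng x1) (ng x2)) + (Br t k y x2 x1 - Br t k y (ng x2) (ng x1)))"
 "ord 4 (%t k y x1 x2. Br t k y x1 x2 + Br t k y (ng x1) (ng x2)
   - (2 *R Bf t y (Sg t x1, 0) (Sg t x1, 0) - 2 *R Bf t y (Sg t x2, 0) (Sg t x2, 0)
    - 2 *R Bf t y (Sg t x1, 0) (Sg t x2, 0) - 2 *R Bf t y (Sg t x2, 0) (Sg t x1, 0)))"
proof -
 have split: "(u + v, 0::real) = (u, 0) + (v, 0)" for u v :: "'a \<times> 'b" by simp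
 have "ord 2 (%t k y x1 x2. Br t k y x1 x2 - (Lf t y (Sg t x1, 0) - Lf t y (Sg t x2, 0)))"
 proof (rule ord_cong[OF ord_add[OF ord_add[OF expA(2) expB(2)] ord_diff[OF expC(2) ord_scaleR[OF expD(2), of 2]]]])
  fix t k y and x1 x2 :: "nat => real" assume k: "0 <= k" "admissible t (t + 2 * k)"
  show "Br t k y x1 x2 - (Lf t y (Sg t x1, 0) - Lf t y (Sg t x2, 0)) =
   (AA t k y x1 x2 - Lf t y (e1 t k y x1 x2)) + (AB t k y x1 x2 - Lf t y (e1 t k y x1 x2)) +
   ((AC t k y x1 x2 - Lf t y (e12 t k y x1 x2)) - 2 *R (AD t k y x1 x2 - Lf t y (e12 t k y x1 x2)))"
   unfolding split linear_add[OF linear_Lf[OF k]] Br_def by (simp add: scaleR_2 algebra_simps)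
 qed
 from ord_add[OF this ord_swap[OF this]]
 show "ord 2 (%t k y x1 x2. Br t k y x1 x2 + Br t k y x2 x1)"
  by (rule ord_cong) (simp add: algebra_simps)
 have "ord 3 (%t k y x1 x2. (Br t k y x1 x2 - Br t k y (ng x1) (ng x2)) - 2 *R (Lf t y (Sg t x1, 0) - Lf t y (Sg t x2, 0)))"
 proof (rule ord_cong[OF ord_add[OF ord_add[OF expA(3) expB(3)] ord_diff[OF expC(3) ord_scaleR[OF expD(3), of 2]]]])
  fix t k y and x1 x2 :: "nat => real" assume k: "0 <= k" "admissible t (t + 2 * k)"
  show "(Br t k y x1 x2 - Br t k y (ng x1) (ng x2)) - 2 *R (Lf t y (Sg t x1, 0) - Lf t y (Sg t x2, 0)) =
   (AA t k y x1 x2 - AA t k y (ng x1) (ng x2) - 2 *R Lf t y (e1 t k y x1 x2)) + (AB t k y x1 x2 - AB t k y (ng x1) (ng x2) - 2 *R Lf t y (e1 t k y x1 x2)) +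
   ((AC t k y x1 x2 - AC t k y (ng x1) (ng x2) - 2 *R Lf t y (e12 t k y x1 x2)) - 2 *R (AD t k y x1 x2 - AD t k y (ng x1) (ng x2) - 2 *R Lf t y (e12 t k y x1 x2)))"
   unfolding split linear_add[OF linear_Lf[OF k]] Br_def by (simp add: scaleR_2 algebra_simps)
 qed
 from ord_add[OF this ord_swap[OF this]]
 show "ord 3 (%t k y x1 x2. (Br t k y x1 x2 - Br t k y (ng x1) (ng x2)) + (Br t k y x2 x1 - Br t k y (ng x2) (ng x1)))"
  by (rule ord_cong) (simp add: algebra_simps)
 show "ord 4 (%t k y x1 x2. Br t k y x1 x2 + Br t k y (ng x1) (ng x2)
   - (2 *R Bf t y (Sg t x1, 0) (Sg t x1, 0) - 2 *R Bf t y (Sg t x2, 0) (Sg t x2, 0)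
    - 2 *R Bf t y (Sg t x1, 0) (Sg t x2, 0) - 2 *R Bf t y (Sg t x2, 0) (Sg t x1, 0)))"
 proof (rule ord_cong[OF ord_add[OF ord_add[OF expA(4)[OF ord_s_even(1)] expB(4)[OF ord_s_even(2)]]
     ord_diff[OF expC(4)[OF ord_s_even(3)] ord_scaleR[OF expD(4)[OF ord_s_even(4)], of 2]]]])
  fix t k y and x1 x2 :: "nat => real" assume k: "0 <= k" "admissible t (t + 2 * k)"
  have B: "Bf t y (e12 t k y x1 x2) (e12 t k y x1 x2) = Bf t y (Sg t x1, 0) (Sg t x1, 0) + Bf t y (Sg t x2, 0) (Sg t x2, 0)
    + Bf t y (Sg t x1, 0) (Sg t x2, 0) + Bf t y (Sg t x2, 0) (Sg t x1, 0)"
   unfolding split bilinear_ladd[OF bilinear_Bf[OF k]] bilinear_radd[OF bilinear_Bf[OF k]] by simp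
  \<comment> \<open>Expresses the coefficient 4 of the later stages through the coefficient 2 of the
    earlier ones, so that the terms proportional to \<open>k\<close> cancel.\<close>
  have L: "(2 * 2) *R (l :: 'a \<times> 'b) = (2 * 1) *R l + (2 * 1) *R l" for l by (simp add: scaleR_add_left[symmetric])
  show "Br t k y x1 x2 + Br t k y (ng x1) (ng x2)
   - (2 *R Bf t y (Sg t x1, 0) (Sg t x1, 0) - 2 *R Bf t y (Sg t x2, 0) (Sg t x2, 0)
    - 2 *R Bf t y (Sg t x1, 0) (Sg t x2, 0) - 2 *R Bf t y (Sg t x2, 0) (Sg t x1, 0)) =
   (AA t k y x1 x2 + AA t k y (ng x1) (ng x2) - (2 * 1) *R Lf t y (k *R (a y t, 1)) - 2 *R Bf t y (e1 t k y x1 x2) (e1 t k y x1 x2)) +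
   (AB t k y x1 x2 + AB t k y (ng x1) (ng x2) - (2 * 1) *R Lf t y (k *R (a y t, 1)) - 2 *R Bf t y (e1 t k y x1 x2) (e1 t k y x1 x2)) +
   ((AC t k y x1 x2 + AC t k y (ng x1) (ng x2) - (2 * 2) *R Lf t y (k *R (a y t, 1)) - 2 *R Bf t y (e12 t k y x1 x2) (e12 t k y x1 x2)) -
    2 *R (AD t k y x1 x2 + AD t k y (ng x1) (ng x2) - (2 * 2) *R Lf t y (k *R (a y t, 1)) - 2 *R Bf t y (e12 t k y x1 x2) (e12 t k y x1 x2)))"
   unfolding B L Br_def by (simp add: scaleR_2 algebra_simps del: scaleR_Pair)
 qed
qed

definition del where "del t k y x1 x2 = Psi t k y x1 x2 - Phi t k y x1 x2"

text \<open>Defect between the trapezoidal weights of the noise at the two resolutions.\<close>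

definition Nn where "Nn t k x1 x2 = (nH t k x1 + nC t k x2) - (1/2) *R (Sg (t + 2 * k) (%m. x1 m + x2 m) - Sg t (%m. x1 m + x2 m))"

lemma del_eq:
 assumes "0 <= k" "admissible t (t + 2 * k)"
 shows "del t k y x1 x2 = (k/2) *R Br t k y x1 x2 + Nn t k x1 x2"
 unfolding del_def Psi_eq[OF assms] Phi_eq[OF assms] rC1_def rD_def Br_def Nn_def by (simp add: algebra_simps)

lemma Nn_odd: "Nn t k (ng x1) (ng x2) = - Nn t k x1 x2"
 by (simp add: Nn_def n_odd noise_add noise_uminus algebra_simps)

text \<open>After adding the exchanged term each increment carries the sum of its two weights, and
  its total defect is minus half of a second difference in time of the noise coefficient.\<close>

lemma ord_Nn: "ord 3 (%t k y x1 x2. Nn t k x1 x2)" "ord 5 (%t k y x1 x2. Nn t k x1 x2 + Nn t k x2 x1)"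
proof -
 show "ord 3 (%t k y x1 x2. Nn t k x1 x2)" unfolding Nn_def by (intro ord_diff ord_add ord_nH)
 have hh: "(1/2) *R x + (1/2) *R x = x" for x :: "'a \<times> 'b" by (simp add: scaleR_add_left[symmetric])
 have 1: "nH t k x + nC t k x - (Sg (t + 2 * k) x - Sg t x) = - (1/2) *R (Sg t x - 2 *R Sg (t + k) x + Sg (t + 2 * k) x)" for t k x
 proof -
  have "(1/2) *R (p - q) + (1/2) *R ((p - q) + (r - q)) - (r - q) = - (1/2) *R (q - 2 *R p + r)" for p q r :: "'a \<times> 'b"
  proof -
   have "(P - Q) + ((P - Q) + (R - Q)) - ((R + R) - (Q + Q)) = - (Q - (P + P) + R)" for P Q R :: "'a \<times> 'b"
    by (simp add: algebra_simps)
   from this[of "(1/2) *R p" "(1/2) *R q" "(1/2) *R r", unfolded hh] show ?thesis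
    by (simp add: scaleR_add_right scaleR_diff_right)
  qed
  then show ?thesis unfolding nH_def nC_def .
 qed
 have d: "(1/2) *R (u + v) + (1/2) *R (v + u) = u + (v::'a \<times> 'b)" for u v
  using hh[of "u + v"] by (simp add: add.commute)
 note o4 = ord_scaleR[OF ord_noise(4), of "- (1/2)"]
 show "ord 5 (%t k y x1 x2. Nn t k x1 x2 + Nn t k x2 x1)"
 proof (rule ord_cong[OF ord_add[OF o4 ord_swap[OF o4]]])
  fix t k y and x1 x2 :: "nat => real"
  have "Nn t k x1 x2 + Nn t k x2 x1 = (nH t k x1 + nC t k x1 + (nH t k x2 + nC t k x2))
    - ((1/2) *R ((Sg (t + 2 * k) x1 - Sg t x1) + (Sg (t + 2 * k) x2 - Sg t x2)) + (1/2) *R ((Sg (t + 2 * k) x2 - Sg t x2) + (Sg (t + 2 * k) x1 - Sg t x1)))"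
   unfolding Nn_def noise_add by (simp add: algebra_simps)
  then show "Nn t k x1 x2 + Nn t k x2 x1 = - (1/2) *R (Sg t x1 - 2 *R Sg (t + k) x1 + Sg (t + 2 * k) x1) +
    - (1/2) *R (Sg t x2 - 2 *R Sg (t + k) x2 + Sg (t + 2 * k) x2)"
   unfolding d 1[symmetric] by (simp add: algebra_simps)
 qed
qed

text \<open>The factor \<open>k\<close> lifts \<open>Br_expansion\<close> by two orders.
  \<open>Nn\<close> is odd in the noise: it is estimated in the first three statements and cancels
  in the last, which runs over all eight symmetries. Order 3 makes the second moment O(k^3), and
  order 6 does the same for the mean.\<close>

theorem ord_del:
 "ord 3 (%t k y x1 x2. del t k y x1 x2)"
 "ord 4 (%t k y x1 x2. del t k y x1 x2 + del t k y x2 x1)"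
 "ord 5 (%t k y x1 x2. (del t k y x1 x2 + del t k y x2 x1) - (del t k y (ng x1) (ng x2) + del t k y (ng x2) (ng x1)))"
 "ord 6 (%t k y x1 x2. (del t k y x1 x2 + del t k y (ng x1) (ng x2)) + (del t k y x1 (ng x2) + del t k y (ng x1) x2)
   + ((del t k y x2 x1 + del t k y (ng x2) (ng x1)) + (del t k y x2 (ng x1) + del t k y (ng x2) x1)))"
proof -
 have "ord 1 (%t k y x1 x2. Br t k y x1 x2)"
  unfolding Br_def by (intro ord_add ord_diff ord_scaleR ord_AX)
 note B1 = ord_kh[OF this, of 3]
 show "ord 3 (%t k y x1 x2. del t k y x1 x2)"
  by (rule ord_cong[OF ord_add[OF B1 ord_Nn(1)]]) (auto simp: del_eq)
 show "ord 4 (%t k y x1 x2. del t k y x1 x2 + del t k y x2 x1)"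
  by (rule ord_cong[OF ord_add[OF ord_kh[OF Br_expansion(1)] ord_mono[OF ord_Nn(2)]]]) (auto simp: del_eq scaleR_add_right)
 show "ord 5 (%t k y x1 x2. (del t k y x1 x2 + del t k y x2 x1) - (del t k y (ng x1) (ng x2) + del t k y (ng x2) (ng x1)))"
  by (rule ord_cong[OF ord_add[OF ord_kh[OF Br_expansion(2)] ord_scaleR[OF ord_Nn(2), of 2]]])
   (auto simp: del_eq scaleR_add_right scaleR_diff_right Nn_odd scaleR_2)
 note f = Br_expansion(3)
 note g = ord_add[OF f ord_flip[OF f]]
 have six: "6 = 4 + (2 :: nat)" by simp
 note h = ord_kh[OF ord_add[OF g ord_swap[OF g]] six]
 show "ord 6 (%t k y x1 x2. (del t k y x1 x2 + del t k y (ng x1) (ng x2)) + (del t k y x1 (ng x2) + del t k y (ng x1) x2)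
   + ((del t k y x2 x1 + del t k y (ng x2) (ng x1)) + (del t k y x2 (ng x1) + del t k y (ng x2) x1)))"
 proof (rule ord_cong[OF h])
  fix t k y and x1 x2 :: "nat => real" assume k: "0 <= k" "admissible t (t + 2 * k)"
  have neg: "(- u, 0::real) = - (u, 0)" for u :: "'a \<times> 'b" by simp
  have E: "del t k y x1 x2 + del t k y (ng x1) (ng x2) = (k/2) *R (Br t k y x1 x2 + Br t k y (ng x1) (ng x2))" for x1 x2
   by (simp add: del_eq[OF k] Nn_odd scaleR_add_right)
  note E' = E[of x1 x2] E[of x1 "ng x2", simplified] E[of x2 x1] E[of x2 "ng x1", simplified]
  show "(del t k y x1 x2 + del t k y (ng x1) (ng x2)) + (del t k y x1 (ng x2) + del t k y (ng x1) x2)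
   + ((del t k y x2 x1 + del t k y (ng x2) (ng x1)) + (del t k y x2 (ng x1) + del t k y (ng x2) x1)) =
   (k / 2) *R (Br t k y x1 x2 + Br t k y (ng x1) (ng x2)
   - (2 *R Bf t y (Sg t x1, 0) (Sg t x1, 0) - 2 *R Bf t y (Sg t x2, 0) (Sg t x2, 0)
    - 2 *R Bf t y (Sg t x1, 0) (Sg t x2, 0) - 2 *R Bf t y (Sg t x2, 0) (Sg t x1, 0)) +
   (Br t k y x1 (ng x2) + Br t k y (ng x1) (ng (ng x2))
   - (2 *R Bf t y (Sg t x1, 0) (Sg t x1, 0) - 2 *R Bf t y (Sg t (ng x2), 0) (Sg t (ng x2), 0)
    - 2 *R Bf t y (Sg t x1, 0) (Sg t (ng x2), 0) - 2 *R Bf t y (Sg t (ng x2), 0) (Sg t x1, 0))) +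
   (Br t k y x2 x1 + Br t k y (ng x2) (ng x1)
   - (2 *R Bf t y (Sg t x2, 0) (Sg t x2, 0) - 2 *R Bf t y (Sg t x1, 0) (Sg t x1, 0)
    - 2 *R Bf t y (Sg t x2, 0) (Sg t x1, 0) - 2 *R Bf t y (Sg t x1, 0) (Sg t x2, 0)) +
   (Br t k y x2 (ng x1) + Br t k y (ng x2) (ng (ng x1))
   - (2 *R Bf t y (Sg t x2, 0) (Sg t x2, 0) - 2 *R Bf t y (Sg t (ng x1), 0) (Sg t (ng x1), 0)
    - 2 *R Bf t y (Sg t x2, 0) (Sg t (ng x1), 0) - 2 *R Bf t y (Sg t (ng x1), 0) (Sg t x2, 0)))))"
   unfolding E' noise_uminus neg bilinear_lneg[OF bilinear_Bf[OF k]] bilinear_rneg[OF bilinear_Bf[OF k]] scaleR_add_right[symmetric] minus_minus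
   by (rule arg_cong[where f="scaleR (k/2)"]) simp
 qed
qed

text \<open>For the third statement, the part linear in the noise is odd around the noise-free step
  and \<open>rD\<close> is of higher order.\<close>

lemma ord_Phi:
 "ord 1 (%t k y x1 x2. Phi t k y x1 x2 - y)"
 "ord 1 (%t k y x1 x2. Phi t k y x1 x2 - Phi t k y (%m. 0) (%m. 0))"
 "ord 2 (%t k y x1 x2. Phi t k y x1 x2 + Phi t k y (ng x1) (ng x2) - 2 *R Phi t k y (%m. 0) (%m. 0))"
proof -
 have f: "ord 1 (%t k y x1 x2. fst (k *R (a y t, 1::real)))"
 proof (rule ord_le[OF ord_mono[OF ord_ka, of 1], of 1])
  show "norm (fst (k *R (a y t, 1::real))) <= 1 * norm (k *R (a y t, 1::real))" for k y t
   by (metis mult_1 norm_fst_le prod.collapse)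
 qed auto
 have S: "ord 1 (%t k y x1 x2. Sg t x1 + Sg t x2)"
  by (intro ord_add ord_noise(1) ord_swap[OF ord_noise(1)])
 have r1: "ord 1 rD" by (rule ord_mono[OF ord_r(4)]) simp
 show 1: "ord 1 (%t k y x1 x2. Phi t k y x1 x2 - y)"
  by (rule ord_cong[OF ord_add[OF ord_scaleR[OF f, of 2] ord_add[OF S r1]]]) (auto simp: Phi_eq)
 show "ord 1 (%t k y x1 x2. Phi t k y x1 x2 - Phi t k y (%m. 0) (%m. 0))"
  by (rule ord_cong[OF ord_diff[OF 1 ord_zero[OF 1]]]) auto
 have r2: "ord 2 rD" by (rule ord_mono[OF ord_r(4)]) simp
 show "ord 2 (%t k y x1 x2. Phi t k y x1 x2 + Phi t k y (ng x1) (ng x2) - 2 *R Phi t k y (%m. 0) (%m. 0))"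
 proof (rule ord_cong[OF ord_diff[OF ord_add[OF r2 ord_neg[OF r2]] ord_scaleR[OF ord_zero[OF r2], of 2]]])
  fix t k y and x1 x2 :: "nat => real" assume k: "0 <= k" "admissible t (t + 2 * k)"
  have "(y + p + (s + s') + r) + (y + p + (- s + - s') + r') - 2 *R (y + p + (0 + 0) + r0) = r + r' - 2 *R r0"
   for p s s' r r' r0 :: "'a \<times> 'b"
   by (simp add: scaleR_2 algebra_simps)
  then show "Phi t k y x1 x2 + Phi t k y (ng x1) (ng x2) - 2 *R Phi t k y (%m. 0) (%m. 0) =
   rD t k y x1 x2 + rD t k y (ng x1) (ng x2) - 2 *R rD t k y (%m. 0) (%m. 0)"
   unfolding Phi_eq[OF k] noise_uminus noise_0 .
 qed
qed

end

section \<open>Observables with controlled differences\<close>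

definition wR :: "nat => real => real" where "wR r R = (1 + R^2) ^ r"

abbreviation w :: "nat => 'v::real_normed_vector => real" where "w r x \<equiv> wR r (norm x)"

lemma wR_ge1 [simp]: "1 <= wR r R" by (simp add: wR_def one_le_power)

lemma wR_nonneg [simp]: "0 <= wR r R" using wR_ge1[of r R] by linarith

lemma wR_mono: "0 <= R ==> R <= R' ==> wR r R <= wR r R'"
 unfolding wR_def by (intro power_mono add_left_mono) auto

lemma w_le_wR: "norm x <= R ==> w r x <= wR r R"
 by (rule wR_mono) auto

text \<open>The weights are summed over the vertices instead of being taken on their convex hull,
  because the expectation of each vertex weight after a step is controlled separately. One constant
  \<open>C\<close> covers all differences; it is the quantity that later grows by a factor 1 + O(h)
  per step.\<close>

definition wcl :: "nat => real => ('v::real_normed_vector => real) => bool" where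
 "wcl r C ph \<longleftrightarrow> 0 <= C \<and> (\<forall>x. \<bar>ph x\<bar> <= C * w r x) \<and>
   (\<forall>x y. \<bar>ph x - ph y\<bar> <= C * (w r x + w r y) * norm (x - y)) \<and>
   (\<forall>x al1 al2 be. sqb x al1 al2 be -->
    \<bar>d2 (%i j. ph (x i j))\<bar> <= C * (\<Sum>i\<in>UNIV. \<Sum>j\<in>UNIV. w r (x i j)) * (be + al1 * al2)) \<and>
   (\<forall>x al1 al2 al3 be12 be13 be23 ga. cubeb x al1 al2 al3 be12 be13 be23 ga -->
    \<bar>d3 (%i j k. ph (x i j k))\<bar> <= C * (\<Sum>i\<in>UNIV. \<Sum>j\<in>UNIV. \<Sum>k\<in>UNIV. w r (x i j k)) * b3 al1 al2 al3 be12 be13 be23 ga)"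

lemma wcl_nonneg: "wcl r C ph ==> 0 <= C"
 unfolding wcl_def by blast

lemma wcl_abs: "wcl r C ph ==> \<bar>ph x\<bar> <= C * w r x"
 unfolding wcl_def by blast

lemma wcl_diff: "wcl r C ph ==> \<bar>ph x - ph y\<bar> <= C * (w r x + w r y) * norm (x - y)"
 unfolding wcl_def by blast

lemma wcl_sq: "wcl r C ph ==> sqb x al1 al2 be ==>
  \<bar>d2 (%i j. ph (x i j))\<bar> <= C * (\<Sum>i\<in>UNIV. \<Sum>j\<in>UNIV. w r (x i j)) * (be + al1 * al2)"
 unfolding wcl_def by blast

lemma wcl_cube: "wcl r C ph ==> cubeb x al1 al2 al3 be12 be13 be23 ga ==>
  \<bar>d3 (%i j k. ph (x i j k))\<bar> <= C * (\<Sum>i\<in>UNIV. \<Sum>j\<in>UNIV. \<Sum>k\<in>UNIV. w r (x i j k)) * b3 al1 al2 al3 be12 be13 be23 ga"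
 unfolding wcl_def by blast

lemma wcl_sq_ball:
 assumes "wcl r C ph" "sqb x al1 al2 be" "\<And>i j. norm (x i j) <= R"
 shows "\<bar>d2 (%i j. ph (x i j))\<bar> <= 4 * C * wR r R * (be + al1 * al2)"
proof -
 have "\<bar>d2 (%i j. ph (x i j))\<bar> <= C * (\<Sum>i\<in>UNIV. \<Sum>j\<in>UNIV. w r (x i j)) * (be + al1 * al2)"
  by (rule wcl_sq[OF assms(1,2)])
 also have "... <= C * (\<Sum>i\<in>(UNIV::bool set). \<Sum>j\<in>(UNIV::bool set). wR r R) * (be + al1 * al2)"
  using sqb_nonneg[OF assms(2)] wcl_nonneg[OF assms(1)] assms(3)
  by (intro mult_right_mono mult_left_mono sum_mono w_le_wR) auto
 finally show ?thesis by (simp add: UNIV_bool mult_ac)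
qed

lemma wcl_cube_ball:
 assumes "wcl r C ph" "cubeb x al1 al2 al3 be12 be13 be23 ga" "\<And>i j k. norm (x i j k) <= R"
 shows "\<bar>d3 (%i j k. ph (x i j k))\<bar> <= 8 * C * wR r R * b3 al1 al2 al3 be12 be13 be23 ga"
proof -
 have "\<bar>d3 (%i j k. ph (x i j k))\<bar> <= C * (\<Sum>i\<in>UNIV. \<Sum>j\<in>UNIV. \<Sum>k\<in>UNIV. w r (x i j k)) * b3 al1 al2 al3 be12 be13 be23 ga"
  by (rule wcl_cube[OF assms(1,2)])
 also have "... <= C * (\<Sum>i\<in>(UNIV::bool set). \<Sum>j\<in>(UNIV::bool set). \<Sum>k\<in>(UNIV::bool set). wR r R) * b3 al1 al2 al3 be12 be13 be23 ga"
  using cubeb_nonneg[OF assms(2)] wcl_nonneg[OF assms(1)] assms(3)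
  by (intro mult_right_mono mult_left_mono sum_mono w_le_wR) auto
 finally show ?thesis by (simp add: UNIV_bool mult_ac)
qed

lemma wcl_parallelogram:
 assumes "wcl r C ph" "norm p + norm u + norm v <= R"
 shows "\<bar>ph (p + u + v) - ph (p + u) - ph (p + v) + ph p\<bar> <= 4 * C * wR r R * (norm u * norm v)"
proof -
 define x where "x i j = p + (if i then u else 0) + (if j then v else 0)" for i j
 have "norm (x i j) <= R" for i j
 proof -
  have "norm (x i j) <= norm p + norm (if i then u else 0) + norm (if j then v else 0)"
   unfolding x_def by (intro norm_triangle_mono order_refl)
  also have "... <= norm p + norm u + norm v" by auto
  finally show ?thesis using assms by simp
 qed
 moreover have "sqb x (norm u) (norm v) 0" by (auto simp: sqb_def x_def d2_def)
 ultimately have "\<bar>d2 (%i j. ph (x i j))\<bar> <= 4 * C * wR r R * (0 + norm u * norm v)"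
  using assms by (intro wcl_sq_ball)
 then show ?thesis by (simp add: d2_def x_def)
qed

text \<open>Cauchy's functional equation: additivity gives homogeneity over the integers, and
  boundedness on segments extends it to the reals.\<close>

lemma additive_locally_bounded_imp_linear:
 fixes l :: "'v::real_normed_vector => real"
 assumes add: "\<And>u v. l (u + v) = l u + l v"
  and bd: "\<And>v. \<exists>B. \<forall>s\<in>{0..1}. \<bar>l (s *R v)\<bar> <= B"
 shows "linear l"
proof (rule linearI)
 show "l (u + v) = l u + l v" for u v by (rule add)
 have l0: "l 0 = 0" using add[of 0 0] by simp
 have nat_scale: "l (of_nat k *R v) = of_nat k * l v" for k v
  by (induction k) (auto simp: l0 add algebra_simps)
 have int_scale: "l (of_int k *R v) = of_int k * l v" for k v
 proof (cases "0 <= k")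
  case True
  then show ?thesis using nat_scale[of "nat k" v] by simp
 next
  case False
  have "l (of_int k *R v) + l (of_nat (nat (- k)) *R v) = 0"
   using False by (simp add: add[symmetric] l0 scaleR_add_left[symmetric])
  then show ?thesis using nat_scale[of "nat (- k)" v] False by (simp)
 qed
 show "l (t *R v) = t *R l v" for t v
 proof -
  obtain B where B: "\<And>s. s \<in> {0..1} ==> \<bar>l (s *R v)\<bar> <= B" using bd by blast
  define D where "D = \<bar>l (t *R v) - t * l v\<bar>"
  \<comment> \<open>Split \<open>real N * t\<close> into its integer part and a rest in the unit
    interval. The deviation from homogeneity, magnified by \<open>N\<close>, stays bounded, hence it
    vanishes.\<close>
  have "real N * D <= \<bar>l v\<bar> + B" for N
  proof -
   define k where "k = \<lfloor>real N * t\<rfloor>"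
   define s where "s = real N * t - of_int k"
   have s: "s \<in> {0..1}" unfolding s_def k_def by (simp, linarith)
   have "real N *R t *R v = of_int k *R v + s *R v"
    by (simp add: s_def algebra_simps flip: scaleR_add_left)
   then have "real N * l (t *R v) = of_int k * l v + l (s *R v)"
    using nat_scale[of N "t *R v"] int_scale[of k v] by (simp add: add)
   then have "real N * (l (t *R v) - t * l v) = l (s *R v) - s * l v"
    by (simp add: s_def algebra_simps)
   then have "real N * D = \<bar>l (s *R v) - s * l v\<bar>"
    unfolding D_def by (metis abs_mult abs_of_nat)
   also have "... <= \<bar>l (s *R v)\<bar> + \<bar>s * l v\<bar>" by simp
   also have "\<bar>s * l v\<bar> <= 1 * \<bar>l v\<bar>" unfolding abs_mult using s by (intro mult_right_mono) auto
   finally show ?thesis using B[OF s] by simp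
  qed
  then have "D <= 0" by (metis D_def abs_ge_zero ex_less_of_nat_mult linorder_not_le order.antisym)
  then show ?thesis by (simp add: D_def)
 qed
qed

text \<open>The dyadic difference quotients converge because each halving changes them by a second
  difference, of size 4^-n against the factor 2^n; the remainder bound sums a geometric series. A
  truly linear map is wanted, since the even displacement becomes of order six only after summation
  over the symmetries.\<close>

lemma wcl_linearisation:
 fixes ph :: "'v::real_normed_vector => real"
 assumes cl: "wcl r C ph"
 shows "\<exists>l. linear l \<and> (\<forall>v. \<bar>l v\<bar> <= 2 * C * wR r (norm p + 1) * norm v) \<and>
   (\<forall>v. \<bar>ph (p + v) - ph p - l v\<bar> <= 2 * C * wR r (norm p + norm v) * (norm v)^2)"
proof -
 note C0 = wcl_nonneg[OF cl]
 define G where "G v n = 2 ^ n * (ph (p + (1 / 2 ^ n) *R v) - ph p)" for v and n :: nat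
 have half: "norm ((1 / 2 ^ n) *R v) = norm v / 2 ^ n" for v :: 'v and n :: nat by simp
 have le: "norm v / 2 ^ n <= norm v" for v :: 'v and n :: nat
 proof -
  have "norm v / 2 ^ n <= norm v / 1" by (intro divide_left_mono) auto
  then show ?thesis by simp
 qed
 have step: "norm (G v (Suc n) - G v n) <= (C * wR r (norm p + norm v) * (norm v)^2) * (1/2) ^ n" for v n
 proof -
  let ?u = "(1 / 2 ^ Suc n) *R v"
  have u2: "?u + ?u = (1 / 2 ^ n) *R v" by (simp add: scaleR_add_left[symmetric])
  have "norm p + norm ?u + norm ?u <= norm p + norm v" using le[of v n] by (simp add: field_simps)
  from wcl_parallelogram[OF cl this]
  have "\<bar>ph (p + (1 / 2 ^ n) *R v) - 2 * ph (p + ?u) + ph p\<bar> <= 4 * C * wR r (norm p + norm v) * (norm ?u * norm ?u)"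
   unfolding add.assoc u2 by simp
  then have "2 ^ n * \<bar>ph (p + (1 / 2 ^ n) *R v) - 2 * ph (p + ?u) + ph p\<bar> <= 2 ^ n * (4 * C * wR r (norm p + norm v) * (norm ?u * norm ?u))"
   by (intro mult_left_mono) auto
  moreover have "G v n - G v (Suc n) = 2 ^ n * (ph (p + (1 / 2 ^ n) *R v) - 2 * ph (p + ?u) + ph p)"
   by (simp add: G_def algebra_simps)
  ultimately have "\<bar>G v n - G v (Suc n)\<bar> <= 2 ^ n * (4 * C * wR r (norm p + norm v) * (norm ?u * norm ?u))"
   by (simp add: abs_mult)
  also have "... = (C * wR r (norm p + norm v) * (norm v)^2) * (1/2) ^ n"
   by (simp add: power2_eq_square field_simps)
  finally show ?thesis by (simp add: abs_minus_commute)
 qed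
 have summ: "summable (%n. G v (Suc n) - G v n)" for v
  by (rule summable_comparison_test'[OF _ step[of v]]) (intro summable_mult summable_geometric, simp)
 define l where "l v = lim (G v)" for v
 have lim: "G v \<longlonglongrightarrow> l v" for v
 proof -
  have "convergent (%n. G v 0 + (\<Sum>i<n. G v (Suc i) - G v i))"
   using summ[of v] by (intro convergent_add convergent_const) (simp add: summable_iff_convergent)
  then have "convergent (G v)" by (simp add: sum_lessThan_telescope)
  then show ?thesis by (simp add: l_def convergent_LIMSEQ_iff)
 qed
 have rem: "\<bar>ph (p + v) - ph p - l v\<bar> <= 2 * C * wR r (norm p + norm v) * (norm v)^2" for v
 proof -
  let ?B = "C * wR r (norm p + norm v) * (norm v)^2"
  have B0: "0 <= ?B" using C0 by simp
  have "\<bar>G v n - G v 0\<bar> <= 2 * ?B" for n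
  proof -
   have "\<bar>G v n - G v 0\<bar> = \<bar>\<Sum>i<n. G v (Suc i) - G v i\<bar>" by (simp add: sum_lessThan_telescope)
   also have "... <= (\<Sum>i<n. ?B * (1/2) ^ i)"
    by (rule order_trans[OF sum_abs sum_mono]) (use step in auto)
   also have "... = ?B * (\<Sum>i<n. (1/2) ^ i)" by (simp add: sum_distrib_left)
   also have "... <= ?B * 2"
   proof (rule mult_left_mono[OF _ B0])
    have "(\<Sum>i<n. (1/2::real) ^ i) <= (\<Sum>i. (1/2) ^ i)"
     by (rule sum_le_suminf) (auto intro: summable_geometric)
    then show "(\<Sum>i<n. (1/2::real) ^ i) <= 2" by (simp add: suminf_geometric)
   qed
   finally show ?thesis by simp
  qed
  moreover have "(%n. \<bar>G v n - G v 0\<bar>) \<longlonglongrightarrow> \<bar>l v - G v 0\<bar>" by (intro tendsto_intros lim)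
  ultimately have "\<bar>l v - G v 0\<bar> <= 2 * ?B" by (intro LIMSEQ_le_const2) auto
  then show ?thesis by (simp add: G_def abs_minus_commute)
 qed
 have bd1: "\<bar>l v\<bar> <= 2 * C * wR r (norm p + norm v) * norm v" for v
 proof -
  have "\<bar>G v n\<bar> <= 2 * C * wR r (norm p + norm v) * norm v" for n
  proof -
   let ?x = "p + (1 / 2 ^ n) *R v"
   have "norm ?x <= norm p + norm v"
    using norm_triangle_ineq[of p "(1 / 2 ^ n) *R v"] le[of v n] unfolding half by linarith
   then have x: "w r ?x <= wR r (norm p + norm v)" "w r p <= wR r (norm p + norm v)"
    by (auto intro: w_le_wR)
   have "\<bar>ph ?x - ph p\<bar> <= C * (w r ?x + w r p) * norm (?x - p)" by (rule wcl_diff[OF cl])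
   also have "... <= C * (wR r (norm p + norm v) + wR r (norm p + norm v)) * norm (?x - p)"
    using C0 x by (intro mult_right_mono mult_left_mono add_mono) auto
   also have "norm (?x - p) = norm v / 2 ^ n" by simp
   finally have "2 ^ n * \<bar>ph ?x - ph p\<bar> <= 2 ^ n * (C * (wR r (norm p + norm v) + wR r (norm p + norm v)) * (norm v / 2 ^ n))"
    by (intro mult_left_mono) auto
   then show ?thesis by (simp add: G_def abs_mult)
  qed
  moreover have "(%n. \<bar>G v n\<bar>) \<longlonglongrightarrow> \<bar>l v\<bar>" by (intro tendsto_intros lim)
  ultimately show ?thesis by (intro LIMSEQ_le_const2) auto
 qed
 have "linear l"
 proof (rule additive_locally_bounded_imp_linear)
  fix u v :: 'v
  let ?B = "4 * C * wR r (norm p + norm u + norm v) * (norm u * norm v)"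
  have "\<bar>G (u + v) n - G u n - G v n\<bar> <= ?B * (1/2) ^ n" for n
  proof -
   let ?u = "(1 / 2 ^ n) *R u" and ?v = "(1 / 2 ^ n) *R v"
   have "norm p + norm ?u + norm ?v <= norm p + norm u + norm v"
    using le[of u n] le[of v n] unfolding half by linarith
   from wcl_parallelogram[OF cl this]
   have "2 ^ n * \<bar>ph (p + ?u + ?v) - ph (p + ?u) - ph (p + ?v) + ph p\<bar> <= 2 ^ n * (4 * C * wR r (norm p + norm u + norm v) * (norm ?u * norm ?v))"
    by (intro mult_left_mono) auto
   moreover have "G (u + v) n - G u n - G v n = 2 ^ n * (ph (p + ?u + ?v) - ph (p + ?u) - ph (p + ?v) + ph p)"
    by (simp add: G_def algebra_simps)
   ultimately have "\<bar>G (u + v) n - G u n - G v n\<bar> <= 2 ^ n * (4 * C * wR r (norm p + norm u + norm v) * (norm ?u * norm ?v))"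
    by (simp add: abs_mult)
   also have "... = ?B * (1/2) ^ n" by (simp add: field_simps)
   finally show ?thesis .
  qed
  moreover have "(%n. ?B * (1/2) ^ n) \<longlonglongrightarrow> ?B * 0"
   by (intro tendsto_intros) (simp add: LIMSEQ_power_zero)
  moreover have "(%n. \<bar>G (u + v) n - G u n - G v n\<bar>) \<longlonglongrightarrow> \<bar>l (u + v) - l u - l v\<bar>" by (intro tendsto_intros lim)
  ultimately have "\<bar>l (u + v) - l u - l v\<bar> <= ?B * 0" by (intro LIMSEQ_le) auto
  then show "l (u + v) = l u + l v" by simp
 next
  fix v :: 'v
  have "\<bar>l (s *R v)\<bar> <= 2 * C * wR r (norm p + norm v) * norm v" if "s \<in> {0..1}" for s
  proof -
   have s: "norm (s *R v) <= norm v" using that by (simp add: mult_left_le_one_le)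
   have "\<bar>l (s *R v)\<bar> <= 2 * C * wR r (norm p + norm (s *R v)) * norm (s *R v)" by (rule bd1)
   also have "... <= 2 * C * wR r (norm p + norm v) * norm v"
    using s C0 by (intro mult_mono mult_left_mono wR_mono add_left_mono) auto
   finally show ?thesis .
  qed
  then show "\<exists>B. \<forall>s\<in>{0..1}. \<bar>l (s *R v)\<bar> <= B" by blast
 qed
 moreover have "\<bar>l v\<bar> <= 2 * C * wR r (norm p + 1) * norm v" for v
 proof (cases "v = 0")
  case True
  then show ?thesis using linear_0[OF \<open>linear l\<close>] by simp
 next
  \<comment> \<open>By homogeneity it is enough to bound \<open>l\<close> at a unit vector, which
    gives a weight independent of \<open>v\<close>.\<close>
  case False
  have "\<bar>l v\<bar> = norm v * \<bar>l ((1 / norm v) *R v)\<bar>"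
   using False by (simp add: linear_scale[OF \<open>linear l\<close>] abs_mult)
  also have "... <= norm v * (2 * C * wR r (norm p + norm ((1 / norm v) *R v)) * norm ((1 / norm v) *R v))"
   by (intro mult_left_mono bd1) auto
  finally show ?thesis using False by (simp add: mult_ac)
 qed
 ultimately show ?thesis using rem by blast
qed

text \<open>
 The leading, antisymmetric part of the perturbations cancels between \<open>d1\<close> and \<open>d2'\<close>; the
 remainder is split into an even part \<open>m\<close> and an odd part \<open>d\<close> under the change of sign of the noise.
\<close>

lemma four_point:
 fixes ph :: "'v::real_normed_vector => real" and p q p0 de1 de2 de3 de4 :: 'v
 assumes cl: "wcl r C ph"
  and m: "m = (1/2) *R ((de1 + de2) + (de3 + de4))" and d: "d = (1/2) *R ((de1 + de2) - (de3 + de4))"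
  and R: "norm p + norm q + norm p0 + norm de1 + norm de2 + norm de3 + norm de4 <= R"
 shows "\<bar>ph (p + de1) + ph (p + de2) - 2 * ph p + (ph (q + de3) + ph (q + de4) - 2 * ph q) - 2 * (ph (p0 + m) - ph p0)\<bar>
  <= 8 * C * wR r R * (norm de1 * norm de2 + norm de3 * norm de4 + 2 * (norm m * norm d)
    + (norm (p - q) + norm d) * norm d
    + norm m * (norm (p + q - 2 *R p0) + (norm (p - p0) + norm (q - p0))^2))"
proof -
 note C0 = wcl_nonneg[OF cl]
 have md: "de1 + de2 = m + d" "de3 + de4 = m - d"
  unfolding m d by (simp_all add: scaleR_add_right scaleR_diff_right scaleR_add_left[symmetric] algebra_simps)
 have nmd: "2 * norm m <= norm de1 + norm de2 + norm de3 + norm de4" "2 * norm d <= norm de1 + norm de2 + norm de3 + norm de4"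
  using norm_triangle_ineq[of "de1 + de2" "de3 + de4"] norm_triangle_ineq4[of "de1 + de2" "de3 + de4"] norm_triangle_ineq[of de1 de2] norm_triangle_ineq[of de3 de4]
  unfolding m d by auto
 note nn = norm_ge_zero[of p] norm_ge_zero[of q] norm_ge_zero[of p0] norm_ge_zero[of de1] norm_ge_zero[of de2] norm_ge_zero[of de3] norm_ge_zero[of de4]
  norm_ge_zero[of m] norm_ge_zero[of d]
 define c where "c = 4 * C * wR r R"
 have c0: "0 <= c" using C0 by (simp add: c_def)
 have "norm p + norm de1 + norm de2 <= R" using R nn by linarith
 from wcl_parallelogram[OF cl this]
 have T1: "\<bar>ph (p + (m + d)) - ph (p + de1) - ph (p + de2) + ph p\<bar> <= c * (norm de1 * norm de2)"
  unfolding add.assoc md c_def by simp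
 have "norm q + norm de3 + norm de4 <= R" using R nn by linarith
 from wcl_parallelogram[OF cl this]
 have T2: "\<bar>ph (q + (m - d)) - ph (q + de3) - ph (q + de4) + ph q\<bar> <= c * (norm de3 * norm de4)"
  unfolding add.assoc md c_def by simp
 have "norm p + norm m + norm d <= R" using R nn nmd by linarith
 from wcl_parallelogram[OF cl this]
 have T3: "\<bar>ph (p + (m + d)) - ph (p + m) - ph (p + d) + ph p\<bar> <= c * (norm m * norm d)"
  unfolding add.assoc c_def by simp
 have "norm q + norm m + norm (- d) <= R" unfolding norm_minus_cancel using R nn nmd by linarith
 from wcl_parallelogram[OF cl this]
 have T4: "\<bar>ph (q + (m - d)) - ph (q + m) - ph (q - d) + ph q\<bar> <= c * (norm m * norm d)"
  unfolding add.assoc c_def by simp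
 \<comment> \<open>The odd part enters with opposite signs at \<open>p\<close> and \<open>q\<close>.
   On this parallelogram the two contributions form a second difference, with \<open>d\<close> in
   one direction and roughly \<open>p - q\<close> in the other.\<close>
 define x where "x i j = (if i then p + (if j then d else 0) else q - (if j then 0 else d))" for i j
 note R' = R nn nmd norm_triangle_ineq[of p d] norm_triangle_ineq4[of q d]
  norm_triangle_ineq[of p m] norm_triangle_ineq[of q m] norm_triangle_ineq[of p0 m]
 have pR: "norm p <= R" using R' by linarith
 have qR: "norm q <= R" using R' by linarith
 have p0R: "norm p0 <= R" using R' by linarith
 have pdR: "norm (p + d) <= R" using R' by linarith
 have qdR: "norm (q - d) <= R" using R' by linarith
 have pmR: "norm (p + m) <= R" using R' by linarith
 have qmR: "norm (q + m) <= R" using R' by linarith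
 have p0mR: "norm (p0 + m) <= R" using R' by linarith
 have xR: "norm (x i j) <= R" for i j
  using pR qR pdR qdR by (auto simp: x_def)
 have pq: "norm (p + d - q) <= norm (p - q) + norm d"
  using norm_triangle_ineq[of "p - q" d] by (simp add: algebra_simps)
 have "sqb x (norm (p - q) + norm d) (norm d) 0"
  unfolding sqb_def using pq by (auto simp: x_def d2_def all_bool_eq algebra_simps)
 from wcl_sq_ball[OF cl this xR]
 have T5: "\<bar>ph (p + d) - ph p - ph q + ph (q - d)\<bar> <= c * ((norm (p - q) + norm d) * norm d)"
  by (simp add: d2_def x_def c_def)
 \<comment> \<open>A square collapsed to \<open>p\<close>, \<open>p0\<close>, \<open>p0\<close>,
   \<open>q\<close>. Moving it by \<open>m\<close> yields a third difference that compares the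
   effects of the shift at \<open>p\<close> and \<open>q\<close> with twice the effect at
   \<open>p0\<close>; the defect \<open>p + q - 2 *R p0\<close> supplies the two missing
   orders.\<close>
 define z where "z i j = (if i then (if j then p else p0) else (if j then p0 else q))" for i j
 define X where "X i j k = z i j + (if k then m else 0)" for i j k
 let ?a = "norm (p - p0) + norm (q - p0)"
 have XR: "norm (X i j k) <= R" for i j k
  using pR qR p0R pmR qmR p0mR by (auto simp: X_def z_def)
 have e: "norm (p0 - q) <= ?a" "norm (p - p0) <= ?a" by (auto simp: norm_minus_commute)
 have "sqb (%i j. X i j k) ?a ?a (norm (p + q - 2 *R p0))" for k
  unfolding sqb_def all_bool_eq using e by (auto simp: X_def z_def d2_def scaleR_2 algebra_simps)
 moreover have "sqb (%i k. X i j k) ?a (norm m) 0" for j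
  unfolding sqb_def all_bool_eq using e by (auto simp: X_def z_def d2_def algebra_simps)
 moreover have "sqb (%j k. X i j k) ?a (norm m) 0" for i
  unfolding sqb_def all_bool_eq using e by (auto simp: X_def z_def d2_def algebra_simps)
 moreover have "norm (d3 X) <= 0" by (simp add: d3_def d2_def X_def z_def algebra_simps)
 ultimately have "cubeb X ?a ?a (norm m) (norm (p + q - 2 *R p0)) 0 0 0" unfolding cubeb_def by blast
 from wcl_cube_ball[OF cl this XR]
 have T6: "\<bar>(ph (p + m) - ph p) - 2 * (ph (p0 + m) - ph p0) + (ph (q + m) - ph q)\<bar>
   <= 2 * c * (norm m * (norm (p + q - 2 *R p0) + ?a^2))"
  by (simp add: d3_def d2_def X_def z_def c_def power2_eq_square algebra_simps)
 have nonneg: "0 <= c * (norm de1 * norm de2)" "0 <= c * (norm de3 * norm de4)" "0 <= c * (norm m * norm d)"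
   "0 <= c * ((norm (p - q) + norm d) * norm d)"
  using c0 by auto
 have "\<bar>ph (p + de1) + ph (p + de2) - 2 * ph p + (ph (q + de3) + ph (q + de4) - 2 * ph q) - 2 * (ph (p0 + m) - ph p0)\<bar>
  <= 2 * (c * (norm de1 * norm de2)) + 2 * (c * (norm de3 * norm de4)) + 4 * (c * (norm m * norm d))
    + 2 * (c * ((norm (p - q) + norm d) * norm d)) + 2 * c * (norm m * (norm (p + q - 2 *R p0) + ?a^2))"
  using nonneg abs_le_D1[OF T1] abs_le_D2[OF T1] abs_le_D1[OF T2] abs_le_D2[OF T2] abs_le_D1[OF T3] abs_le_D2[OF T3]
   abs_le_D1[OF T4] abs_le_D2[OF T4] abs_le_D1[OF T5] abs_le_D2[OF T5] abs_le_D1[OF T6] abs_le_D2[OF T6]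
  by (intro abs_leI) linarith+
 then show ?thesis by (simp add: c_def algebra_simps)
qed

section \<open>The local difference seen by an observable\<close>

context scheme
begin

definition D where "D ph t k y x1 x2 = (ph (Psi t k y x1 x2) - ph (Phi t k y x1 x2) :: real)"

text \<open>Sum over the orbit under the symmetry group of a square, generated by the exchange of
  the increments and the change of one sign.\<close>

definition sym8 :: "((nat => real) => (nat => real) => 'w::real_vector) => (nat => real) => (nat => real) => 'w" where
 "sym8 f x1 x2 = (f x1 x2 + f x2 x1 + (f (ng x1) (ng x2) + f (ng x2) (ng x1)))
   + (f x1 (ng x2) + f (ng x2) x1 + (f (ng x1) x2 + f x2 (ng x1)))"

text \<open>The even part, under reversal of the noise, of the local difference symmetrised by
  exchange; \<open>dd'\<close> is the odd part. They are the \<open>m\<close> and \<open>d\<close>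
  of \<open>four_point\<close>.\<close>

definition mm where "mm t k y x1 x2 = (1/2) *R ((del t k y x1 x2 + del t k y x2 x1) + (del t k y (ng x1) (ng x2) + del t k y (ng x2) (ng x1)))"
definition dd' where "dd' t k y x1 x2 = (1/2) *R ((del t k y x1 x2 + del t k y x2 x1) - (del t k y (ng x1) (ng x2) + del t k y (ng x2) (ng x1)))"

abbreviation "p0 t k y \<equiv> Phi t k y (%m. 0) (%m. 0)"

text \<open>The bracket of \<open>four_point\<close> at the present points, plus the quadratic error
  of linearising at \<open>p0\<close>.\<close>

definition Qf where "Qf t k y x1 x2 = norm (del t k y x1 x2) * norm (del t k y x2 x1)
  + norm (del t k y (ng x1) (ng x2)) * norm (del t k y (ng x2) (ng x1)) + 2 * (norm (mm t k y x1 x2) * norm (dd' t k y x1 x2))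
  + (norm (Phi t k y x1 x2 - Phi t k y (ng x1) (ng x2)) + norm (dd' t k y x1 x2)) * norm (dd' t k y x1 x2)
  + norm (mm t k y x1 x2) * (norm (Phi t k y x1 x2 + Phi t k y (ng x1) (ng x2) - 2 *R p0 t k y)
   + (norm (Phi t k y x1 x2 - p0 t k y) + norm (Phi t k y (ng x1) (ng x2) - p0 t k y))^2)
  + norm (mm t k y x1 x2) * norm (mm t k y x1 x2)"

text \<open>Together with three times \<open>norm y\<close>, a bound for the sum of norms that
  \<open>four_point\<close> requires.\<close>

definition Rf0 where "Rf0 t k y x1 x2 = norm (Phi t k y x1 x2 - y) + norm (Phi t k y (ng x1) (ng x2) - y) + norm (p0 t k y - y)
  + norm (del t k y x1 x2) + norm (del t k y x2 x1) + norm (del t k y (ng x1) (ng x2)) + norm (del t k y (ng x2) (ng x1))"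

lemma ord_mm: "ord 4 (%t k y x1 x2. mm t k y x1 x2)" "ord 5 (%t k y x1 x2. dd' t k y x1 x2)"
 unfolding mm_def dd'_def by (intro ord_scaleR ord_add ord_del(2) ord_neg[OF ord_del(2)], intro ord_scaleR ord_del(3))

lemma ord_Qf: "ord 6 (%t k y x1 x2. Qf t k y x1 x2)"
proof -
 note dl = ord_norm[OF ord_del(1)]
 note dl' = ord_norm[OF ord_swap[OF ord_del(1)]]
 note m = ord_norm[OF ord_mm(1)] and d = ord_norm[OF ord_mm(2)]
 have 1: "ord 6 (%t k y x1 x2. norm (del t k y x1 x2) * norm (del t k y x2 x1))" by (rule ord_mult[OF dl dl']) simp
 have 2: "ord 6 (%t k y x1 x2. norm (del t k y (ng x1) (ng x2)) * norm (del t k y (ng x2) (ng x1)))"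
  by (rule ord_neg[OF 1])
 have 3: "ord 6 (%t k y x1 x2. 2 * (norm (mm t k y x1 x2) * norm (dd' t k y x1 x2)))"
  using ord_scaleR[OF ord_mono[OF ord_mult[OF m d refl]], of 6 2] by simp
 have P: "ord 1 (%t k y x1 x2. Phi t k y (ng x1) (ng x2) - p0 t k y)" by (rule ord_neg[OF ord_Phi(2)])
 have pq: "ord 1 (%t k y x1 x2. Phi t k y x1 x2 - Phi t k y (ng x1) (ng x2))"
  by (rule ord_cong[OF ord_diff[OF ord_Phi(2) P]]) simp
 have d1: "ord 1 (%t k y x1 x2. norm (dd' t k y x1 x2))" by (rule ord_mono[OF d]) simp
 have 4: "ord 6 (%t k y x1 x2. (norm (Phi t k y x1 x2 - Phi t k y (ng x1) (ng x2)) + norm (dd' t k y x1 x2)) * norm (dd' t k y x1 x2))"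
  by (rule ord_mult[OF ord_add[OF ord_norm[OF pq] d1] d]) simp
 have s: "ord 1 (%t k y x1 x2. norm (Phi t k y x1 x2 - p0 t k y) + norm (Phi t k y (ng x1) (ng x2) - p0 t k y))"
  by (intro ord_add ord_norm ord_Phi(2) P)
 have s2: "ord 2 (%t k y x1 x2. (norm (Phi t k y x1 x2 - p0 t k y) + norm (Phi t k y (ng x1) (ng x2) - p0 t k y))\<^sup>2)"
  unfolding power2_eq_square by (rule ord_mult[OF s s]) simp
 have 5: "ord 6 (%t k y x1 x2. norm (mm t k y x1 x2) * (norm (Phi t k y x1 x2 + Phi t k y (ng x1) (ng x2) - 2 *R p0 t k y)
   + (norm (Phi t k y x1 x2 - p0 t k y) + norm (Phi t k y (ng x1) (ng x2) - p0 t k y))^2))"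
  by (rule ord_mult[OF m ord_add[OF ord_norm[OF ord_Phi(3)] s2]]) simp
 have 6: "ord 6 (%t k y x1 x2. norm (mm t k y x1 x2) * norm (mm t k y x1 x2))"
  by (rule ord_mono[OF ord_mult[OF m m refl]]) simp
 show ?thesis unfolding Qf_def by (intro ord_add 1 2 3 4 5 6)
qed

lemma ord_Rf0: "ord 1 (%t k y x1 x2. Rf0 t k y x1 x2)"
proof -
 have d: "ord 1 (%t k y x1 x2. del t k y x1 x2)" by (rule ord_mono[OF ord_del(1)]) simp
 show ?thesis unfolding Rf0_def
  by (intro ord_add ord_norm ord_Phi(1) ord_neg[OF ord_Phi(1)] ord_zero[OF ord_Phi(1)] d ord_swap[OF d] ord_neg[OF d] ord_swap[OF ord_neg[OF d]])
qed

lemma Phi_swap: "Phi t k y x2 x1 = Phi t k y x1 x2"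
 by (simp add: Phi_def add.commute)

text \<open>Reduces four of the eight terms to a linear functional of \<open>mm\<close>, up to order
  six. The base point \<open>p0\<close> uses zero noise and is thus common to both halves of the
  orbit.\<close>

lemma sym4_bound:
 assumes "wcl r C ph" "linear l" "\<And>v. \<bar>ph (p0 t k y + v) - ph (p0 t k y) - l v\<bar> <= 2 * C * wR r (norm (p0 t k y) + norm v) * (norm v)^2"
 shows "\<bar>D ph t k y x1 x2 + D ph t k y x2 x1 + (D ph t k y (ng x1) (ng x2) + D ph t k y (ng x2) (ng x1)) - 2 * l (mm t k y x1 x2)\<bar>
  <= 8 * C * wR r (3 * norm y + Rf0 t k y x1 x2) * Qf t k y x1 x2"
proof -
 let ?p = "Phi t k y x1 x2" and ?q = "Phi t k y (ng x1) (ng x2)" and ?pz = "p0 t k y"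
 let ?R = "3 * norm y + Rf0 t k y x1 x2" and ?m = "mm t k y x1 x2" and ?d = "dd' t k y x1 x2"
 note C0 = wcl_nonneg[OF assms(1)]
 have R: "norm ?p + norm ?q + norm ?pz + norm (del t k y x1 x2) + norm (del t k y x2 x1) + norm (del t k y (ng x1) (ng x2)) + norm (del t k y (ng x2) (ng x1)) <= ?R"
  using norm_triangle_sub[of ?p y] norm_triangle_sub[of ?q y] norm_triangle_sub[of ?pz y] unfolding Rf0_def by linarith
 note four = four_point[OF assms(1) mm_def[of t k y x1 x2] dd'_def[of t k y x1 x2] R]
 have Psi: "Phi t k y x1 x2 + del t k y x1 x2 = Psi t k y x1 x2" "Phi t k y x1 x2 + del t k y x2 x1 = Psi t k y x2 x1" for x1 x2
  using Phi_swap[of t k y x1 x2] by (simp_all add: del_def)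
 have Dsum: "D ph t k y x1 x2 + D ph t k y x2 x1 + (D ph t k y (ng x1) (ng x2) + D ph t k y (ng x2) (ng x1))
  = ph (?p + del t k y x1 x2) + ph (?p + del t k y x2 x1) - 2 * ph ?p + (ph (?q + del t k y (ng x1) (ng x2)) + ph (?q + del t k y (ng x2) (ng x1)) - 2 * ph ?q)"
  unfolding Psi D_def using Phi_swap[of t k y x1 x2] Phi_swap[of t k y "ng x1" "ng x2"] by simp
 have "norm ?m <= norm (del t k y x1 x2) + norm (del t k y x2 x1) + norm (del t k y (ng x1) (ng x2)) + norm (del t k y (ng x2) (ng x1))"
  using norm_triangle_ineq[of "del t k y x1 x2 + del t k y x2 x1" "del t k y (ng x1) (ng x2) + del t k y (ng x2) (ng x1)"]
   norm_triangle_ineq[of "del t k y x1 x2" "del t k y x2 x1"] norm_triangle_ineq[of "del t k y (ng x1) (ng x2)" "del t k y (ng x2) (ng x1)"]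
   norm_ge_zero[of "del t k y x1 x2 + del t k y x2 x1 + (del t k y (ng x1) (ng x2) + del t k y (ng x2) (ng x1))"]
  unfolding mm_def norm_scaleR by linarith
 then have "norm ?pz + norm ?m <= ?R" using R norm_ge_zero[of ?p] norm_ge_zero[of ?q] by linarith
 then have "2 * C * wR r (norm ?pz + norm ?m) * (norm ?m)^2 <= 2 * C * wR r ?R * (norm ?m)^2"
  using C0 by (intro mult_right_mono mult_left_mono wR_mono) auto
 then have lin: "\<bar>ph (?pz + ?m) - ph ?pz - l ?m\<bar> <= 2 * C * wR r ?R * (norm ?m)^2"
  using assms(3)[of ?m] by linarith
 have "0 <= C * wR r ?R * (norm ?m)^2" using C0 by simp
 moreover define Q0 where "Q0 = norm (del t k y x1 x2) * norm (del t k y x2 x1)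
  + norm (del t k y (ng x1) (ng x2)) * norm (del t k y (ng x2) (ng x1)) + 2 * (norm ?m * norm ?d) + (norm (?p - ?q) + norm ?d) * norm ?d
  + norm ?m * (norm (?p + ?q - 2 *R ?pz) + (norm (?p - ?pz) + norm (?q - ?pz))^2)"
 have "Qf t k y x1 x2 = Q0 + norm ?m * norm ?m" unfolding Qf_def Q0_def ..
 then have "8 * C * wR r ?R * Qf t k y x1 x2 = 8 * C * wR r ?R * Q0 + 8 * (C * wR r ?R * (norm ?m)^2)"
  by (simp add: power2_eq_square distrib_left)
 moreover have tri: "\<bar>s - 2 * c\<bar> <= q + 8 * x" if "\<bar>s - 2 * b\<bar> <= q" "\<bar>b - c\<bar> <= 2 * x" "0 <= x" for s b c q x :: real
  using that by linarith
 have "\<bar>D ph t k y x1 x2 + D ph t k y x2 x1 + (D ph t k y (ng x1) (ng x2) + D ph t k y (ng x2) (ng x1)) - 2 * l (mm t k y x1 x2)\<bar>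
  <= 8 * C * wR r ?R * Q0 + 8 * (C * wR r ?R * (norm ?m)^2)"
 proof (rule tri)
  show "\<bar>D ph t k y x1 x2 + D ph t k y x2 x1 + (D ph t k y (ng x1) (ng x2) + D ph t k y (ng x2) (ng x1)) - 2 * (ph (?pz + ?m) - ph ?pz)\<bar> <= 8 * C * wR r ?R * Q0"
   unfolding Dsum Q0_def by (rule four)
  show "\<bar>ph (?pz + ?m) - ph ?pz - l ?m\<bar> <= 2 * (C * wR r ?R * (norm ?m)^2)"
   using lin by (simp only: mult.assoc)
  show "0 <= C * wR r ?R * (norm ?m)^2" using C0 by simp
 qed
 ultimately show ?thesis by simp
qed

lemma ordE:
 assumes "ord p f"
 obtains C q where "0 <= C" "\<And>t k y x1 x2. 0 <= k ==> admissible t (t + 2 * k) ==>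
   norm (f t k y x1 x2) <= C * rho k y x1 x2 ^ p * (1 + rho k y x1 x2) ^ q"
 using assms unfolding ord_def by blast

text \<open>\<open>sym4_bound\<close> at \<open>(x1, x2)\<close> and at \<open>(x1, - x2)\<close>
  leaves the values of \<open>l\<close> at two even parts, each known only to order four. By
  linearity they combine to \<open>l\<close> of the local difference summed over the whole orbit,
  which is of order six.\<close>

theorem weak_pathwise:
 "\<exists>c a b. 0 <= c \<and> (\<forall>ph C t k y x1 x2. wcl r C ph --> 0 <= k --> admissible t (t + 2 * k) -->
   \<bar>sym8 (D ph t k y) x1 x2\<bar> <= C * c * (1 + norm y) ^ a * (rho k y x1 x2 ^ 6 * (1 + rho k y x1 x2) ^ b))"
proof -
 let ?Q = "%t k y x1 x2. Qf t k y x1 x2 + Qf t k y x1 (ng x2) + norm (sym8 (del t k y) x1 x2)"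
 have s8: "ord 6 (%t k y x1 x2. sym8 (del t k y) x1 x2)"
  by (rule ord_cong[OF ord_del(4)]) (simp add: sym8_def algebra_simps)
 have "ord 6 ?Q" by (intro ord_add ord_norm s8 ord_Qf ord_flip[OF ord_Qf])
 then obtain C1 q1 where C1: "0 <= C1" "\<And>t k y x1 x2. 0 <= k ==> admissible t (t + 2 * k) ==>
   norm (?Q t k y x1 x2) <= C1 * rho k y x1 x2 ^ 6 * (1 + rho k y x1 x2) ^ q1"
  by (erule_tac ordE) blast
 let ?R = "%t k y x1 x2. Rf0 t k y x1 x2 + Rf0 t k y x1 (ng x2)"
 have "ord 1 ?R" by (intro ord_add ord_Rf0 ord_flip[OF ord_Rf0])
 then obtain C2 q2 where C2: "0 <= C2" "\<And>t k y x1 x2. 0 <= k ==> admissible t (t + 2 * k) ==>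
   norm (?R t k y x1 x2) <= C2 * rho k y x1 x2 ^ 1 * (1 + rho k y x1 x2) ^ q2"
  by (erule_tac ordE) blast
 \<comment> \<open>In \<open>1 + RR\<close> there are three copies of \<open>norm y\<close> and two
   summands 1, hence 5; \<open>C2\<close> bounds the remaining part of the radius.\<close>
 define B where "B = 5 + C2"
 have B0: "0 <= B" using C2 by (simp add: B_def)
 have "\<bar>sym8 (D ph t k y) x1 x2\<bar> <= C * (8 * B ^ (2 * r) * C1) * (1 + norm y) ^ (2 * r) * (rho k y x1 x2 ^ 6 * (1 + rho k y x1 x2) ^ (q1 + (q2 + 1) * (2 * r)))"
  if cl: "wcl r C ph" and k: "0 <= k" "admissible t (t + 2 * k)" for ph C t k y x1 x2
 proof -
  note C0 = wcl_nonneg[OF cl]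
  let ?r = "rho k y x1 x2" and ?pz = "p0 t k y"
  have r0: "0 <= ?r" using rho_nonneg[OF k(1)] by simp
  have Qn: "0 <= Qf t k y x1 x2" for x1 x2 by (simp add: Qf_def)
  have Rn: "0 <= Rf0 t k y x1 x2" for x1 x2 by (simp add: Rf0_def)
  obtain l where l: "linear l" "\<And>v. \<bar>l v\<bar> <= 2 * C * wR r (norm ?pz + 1) * norm v"
   "\<And>v. \<bar>ph (?pz + v) - ph ?pz - l v\<bar> <= 2 * C * wR r (norm ?pz + norm v) * (norm v)^2"
   using wcl_linearisation[OF cl, of ?pz] by blast
  define RR where "RR = 3 * norm y + ?R t k y x1 x2 + 1"
  have RR0: "0 <= RR" using Rn[of x1 x2] Rn[of x1 "ng x2"] by (simp add: RR_def)
  have mono: "8 * C * wR r (3 * norm y + Rf0 t k y x1 z) * Qf t k y x1 z <= 8 * C * wR r RR * Qf t k y x1 z" if "z = x2 \<or> z = ng x2" for z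
   using that Rn[of x1 x2] Rn[of x1 "ng x2"] C0 Qn unfolding RR_def
   by (intro mult_right_mono mult_left_mono wR_mono) auto
  have a1: "\<bar>D ph t k y x1 x2 + D ph t k y x2 x1 + (D ph t k y (ng x1) (ng x2) + D ph t k y (ng x2) (ng x1)) - 2 * l (mm t k y x1 x2)\<bar>
   <= 8 * C * wR r RR * Qf t k y x1 x2"
   using sym4_bound[OF cl l(1,3), of x1 x2] mono[of x2] by simp
  have a2: "\<bar>D ph t k y x1 (ng x2) + D ph t k y (ng x2) x1 + (D ph t k y (ng x1) x2 + D ph t k y x2 (ng x1)) - 2 * l (mm t k y x1 (ng x2))\<bar>
   <= 8 * C * wR r RR * Qf t k y x1 (ng x2)"
   using sym4_bound[OF cl l(1,3), of x1 "ng x2"] mono[of "ng x2"] by simp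
  have "2 * l (mm t k y x1 x2) + 2 * l (mm t k y x1 (ng x2)) = l (2 *R mm t k y x1 x2 + 2 *R mm t k y x1 (ng x2))"
   by (simp add: linear_add[OF l(1)] linear_scale[OF l(1)])
  also have "2 *R mm t k y x1 x2 + 2 *R mm t k y x1 (ng x2) = sym8 (del t k y) x1 x2"
   by (simp add: mm_def sym8_def)
  finally have a3: "\<bar>2 * l (mm t k y x1 x2) + 2 * l (mm t k y x1 (ng x2))\<bar> <= 8 * C * wR r RR * norm (sym8 (del t k y) x1 x2)"
  proof -
   assume e: "2 * l (mm t k y x1 x2) + 2 * l (mm t k y x1 (ng x2)) = l (sym8 (del t k y) x1 x2)"
   have "norm ?pz <= norm y + Rf0 t k y x1 x2"
    using norm_triangle_sub[of ?pz y] norm_ge_zero[of "Phi t k y x1 x2 - y"] norm_ge_zero[of "Phi t k y (ng x1) (ng x2) - y"]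
     norm_ge_zero[of "del t k y x1 x2"] norm_ge_zero[of "del t k y x2 x1"] norm_ge_zero[of "del t k y (ng x1) (ng x2)"]
     norm_ge_zero[of "del t k y (ng x2) (ng x1)"] unfolding Rf0_def by linarith
   then have "norm ?pz + 1 <= RR" using Rn[of x1 "ng x2"] norm_ge_zero[of y] unfolding RR_def by linarith
   then have "2 * C * wR r (norm ?pz + 1) * norm (sym8 (del t k y) x1 x2) <= 8 * C * wR r RR * norm (sym8 (del t k y) x1 x2)"
    using C0 by (intro mult_right_mono mult_mono wR_mono) auto
   then show ?thesis using l(2)[of "sym8 (del t k y) x1 x2"] unfolding e by linarith
  qed
  have "\<bar>sym8 (D ph t k y) x1 x2\<bar> <= 8 * C * wR r RR * Qf t k y x1 x2 + 8 * C * wR r RR * Qf t k y x1 (ng x2) + 8 * C * wR r RR * norm (sym8 (del t k y) x1 x2)"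
   using a1 a2 a3 unfolding sym8_def[of "D ph t k y"] by linarith
  also have "... = 8 * C * wR r RR * ?Q t k y x1 x2" by (simp add: algebra_simps)
  also have "... <= 8 * C * wR r RR * (C1 * ?r ^ 6 * (1 + ?r) ^ q1)"
   using C1(2)[OF k, of y x1 x2] C0 by (intro mult_left_mono) auto
  also have "... <= 8 * C * (B ^ (2 * r) * (1 + norm y) ^ (2 * r) * (1 + ?r) ^ ((q2 + 1) * (2 * r))) * (C1 * ?r ^ 6 * (1 + ?r) ^ q1)"
  proof -
   have "?R t k y x1 x2 <= C2 * ?r ^ 1 * (1 + ?r) ^ q2" using C2(2)[OF k, of y x1 x2] by simp
   also have "... <= C2 * (1 + ?r) * (1 + ?r) ^ q2" using r0 C2 by (intro mult_right_mono mult_left_mono) auto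
   finally have R2: "?R t k y x1 x2 <= C2 * (1 + ?r) ^ (q2 + 1)" by (simp add: mult_ac)
   have p1: "1 <= (1 + ?r) ^ (q2 + 1)" using r0 by (intro one_le_power) auto
   have "1 + RR <= 3 * (norm y * 1) + C2 * (1 + ?r) ^ (q2 + 1) + 2 * 1" using R2 unfolding RR_def by simp
   also have "... <= 3 * (norm y * (1 + ?r) ^ (q2 + 1)) + C2 * (1 + ?r) ^ (q2 + 1) + 2 * (1 + ?r) ^ (q2 + 1)"
    using p1 C2(1) by (intro add_mono mult_left_mono) auto
   also have "... = (3 * norm y + C2 + 2) * (1 + ?r) ^ (q2 + 1)" by (simp add: algebra_simps)
   also have "... <= (B * (1 + norm y)) * (1 + ?r) ^ (q2 + 1)"
   proof (rule mult_right_mono)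
    have "0 <= C2 * norm y" using C2 by simp
    then show "3 * norm y + C2 + 2 <= B * (1 + norm y)" unfolding B_def by (simp add: algebra_simps)
   qed (use r0 in auto)
   finally have b: "1 + RR <= B * (1 + norm y) * (1 + ?r) ^ (q2 + 1)" .
   have "1 + RR^2 <= (1 + RR)^2" using RR0 by (simp add: power2_eq_square algebra_simps)
   then have "wR r RR <= ((1 + RR)^2) ^ r" unfolding wR_def by (intro power_mono) auto
   also have "... = (1 + RR) ^ (2 * r)" by (simp add: power_mult)
   also have "... <= (B * (1 + norm y) * (1 + ?r) ^ (q2 + 1)) ^ (2 * r)" using b RR0 by (intro power_mono) auto
   also have "... = B ^ (2 * r) * (1 + norm y) ^ (2 * r) * (1 + ?r) ^ ((q2 + 1) * (2 * r))"
    by (simp only: power_mult_distrib power_mult[symmetric])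
   finally show ?thesis using C0 C1(1) r0 by (intro mult_right_mono mult_left_mono) auto
  qed
  also have "... = C * (8 * B ^ (2 * r) * C1) * (1 + norm y) ^ (2 * r) * (?r ^ 6 * (1 + ?r) ^ (q1 + (q2 + 1) * (2 * r)))"
   unfolding power_add by (simp add: mult_ac)
  finally show ?thesis .
 qed
 then show ?thesis using B0 C1(1)
  by (intro exI[of _ "8 * B ^ (2 * r) * C1"] exI[of _ "2 * r"] exI[of _ "q1 + (q2 + 1) * (2 * r)"]) auto
qed

subsection \<open>Growth of the weights in one step\<close>

text \<open>A one-sided Bernoulli-type bound that keeps the linear term with its sign: the noise
  part of that term has mean zero and must not be estimated in absolute value.\<close>

lemma one_plus_power_le:
 fixes e :: real assumes "0 <= 1 + e"
 shows "(1 + e) ^ r <= 1 + real r * e + (real r)^2 * e^2 * (1 + \<bar>e\<bar>) ^ r"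
proof (induction r)
 case (Suc r)
 let ?X = "(1 + \<bar>e\<bar>) ^ Suc r"
 have X: "1 <= ?X" by (intro one_le_power) simp
 have "(1 + e) ^ Suc r <= (1 + e) * (1 + real r * e + (real r)^2 * e^2 * (1 + \<bar>e\<bar>) ^ r)"
  using Suc assms by (simp add: mult_left_mono)
 also have "... = 1 + real (Suc r) * e + real r * e^2 + (real r)^2 * e^2 * ((1 + e) * (1 + \<bar>e\<bar>) ^ r)"
  by (simp add: algebra_simps power2_eq_square)
 also have "... <= 1 + real (Suc r) * e + real r * e^2 * ?X + (real r)^2 * e^2 * ?X"
 proof (intro add_mono order_refl)
  show "real r * e^2 <= real r * e^2 * ?X" using mult_left_mono[OF X, of "real r * e^2"] by simp
  show "(real r)^2 * e^2 * ((1 + e) * (1 + \<bar>e\<bar>) ^ r) <= (real r)^2 * e^2 * ?X"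
   unfolding power_Suc by (intro mult_left_mono mult_right_mono) auto
 qed
 also have "... <= 1 + real (Suc r) * e + (real (Suc r))^2 * e^2 * ?X"
 proof -
  have "real r + (real r)^2 <= (real (Suc r))^2" by (simp add: power2_eq_square algebra_simps)
  then have "(real r + (real r)^2) * (e^2 * ?X) <= (real (Suc r))^2 * (e^2 * ?X)"
   by (intro mult_right_mono) auto
  then show ?thesis by (simp add: algebra_simps)
 qed
 finally show ?case .
qed simp

text \<open>Expand the power of \<open>1 + e\<close>, where \<open>e\<close> is the relative change
  of \<open>1 + (norm y)^2\<close>. Dividing by this quantity makes the bounds uniform in
  \<open>y\<close>, as the displacement grows linearly in \<open>norm y\<close>. Only the scalar
  product with the noise is of first order; the rest is quadratic, since h <= u^2 for u = sqrt h + n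
  xi.\<close>

theorem growth_pathwise:
 "\<exists>c b. 0 <= c \<and> (\<forall>s s' xi y. admissible s s' -->
  w r (stp s s' xi y) <= w r y * (1 + (2 * real r / (1 + (norm y)^2)) * (y \<bullet> ((1/2) *R (Sg s xi + Sg s' xi)))
    + c * ((sqrt (s' - s) + n xi)^2 * (1 + (sqrt (s' - s) + n xi)) ^ b)))"
proof -
 define A where "A = 8 * K^2"
 define E where "E = 4 * A + 4 * A^2"
 have K2: "K <= K^2" using K_ge1 by (simp add: power2_eq_square)
 have A1: "0 <= A" "4 * K <= A" "K <= A" using K_ge1 K2 by (auto simp: A_def)
 have E0: "0 <= E" using A1 by (auto simp: E_def)
 define c where "c = real r * E + (real r)^2 * E^2 * (1 + E) ^ r"
 have "w r (stp s s' xi y) <= w r y * (1 + (2 * real r / (1 + (norm y)^2)) * (y \<bullet> ((1/2) *R (Sg s xi + Sg s' xi)))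
    + c * ((sqrt (s' - s) + n xi)^2 * (1 + (sqrt (s' - s) + n xi)) ^ (2 * r + 2)))" if ad: "admissible s s'" for s s' xi y
 proof -
  note ad' = admissibleD[OF ad]
  define h u N where "h = s' - s" and "u = sqrt h + n xi" and "N = (1/2) *R (Sg s xi + Sg s' xi)"
  define q where "q = stp s s' xi y - y"
  \<comment> \<open>Without the noise only the drift part of the displacement remains, which carries
    the full factor h.\<close>
  define g where "g = q - N"
  define Y where "Y = 1 + (norm y)^2"
  have Y1: "1 <= Y" "0 < Y" by (auto simp: Y_def intro: add_pos_nonneg)
  have h: "0 <= h" "h <= 1" using ad' by (auto simp: h_def)
  have hs: "h <= sqrt h" using sqrt_le_D h by (metis mult_left_le real_sqrt_ge_zero real_sqrt_le_1_iff real_sqrt_mult_self abs_of_nonneg)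
  have u0: "0 <= u" using h by (simp add: u_def)
  have hu: "h <= u^2"
  proof -
   have "(sqrt h)^2 <= u^2" using h by (intro power_mono) (auto simp: u_def)
   then show ?thesis using h by simp
  qed
  have hn: "h + n xi <= u" using hs by (simp add: u_def)
  have y1: "norm y <= 1 + norm y" by simp
  have hyn: "h * (1 + norm y) + n xi <= u * (1 + norm y)"
  proof -
   have "n xi * 1 <= n xi * (1 + norm y)" by (intro mult_left_mono) auto
   then have "h * (1 + norm y) + n xi <= (h + n xi) * (1 + norm y)" by (simp add: algebra_simps)
   also have "... <= u * (1 + norm y)" using hn by (intro mult_right_mono) auto
   finally show ?thesis .
  qed
  have q1: "norm q <= A * (u * (1 + norm y))"
  proof -
   have "norm q <= 4 * K * (h * (1 + norm y) + n xi)" unfolding q_def h_def by (rule stp_disp[OF ad])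
   also have "... <= 4 * K * (u * (1 + norm y))" using hyn K_ge1 by (intro mult_left_mono) auto
   also have "... <= A * (u * (1 + norm y))" using A1 u0 by (intro mult_right_mono) auto
   finally show ?thesis .
  qed
  have g1: "norm g <= A * (h * ((1 + norm y) * (1 + u)))"
  proof -
   define H where "H = stg s s' xi y"
   have "g = (h/2) *R (a y s + a H s')"
    unfolding g_def q_def N_def h_def H_def by (subst stp_eq[OF ad]) simp
   then have "norm g = (h/2) * norm (a y s + a H s')" using h by simp
   also have "norm (a y s + a H s') <= K * (1 + norm y) + K * (1 + norm H)"
    using ad' by (intro norm_triangle_mono drift_growth) auto
   also have "norm H <= norm y + 4 * K * (u * (1 + norm y))"
   proof -
    have "norm (H - y) <= 4 * K * (h * (1 + norm y) + n xi)" unfolding H_def h_def by (rule stg_disp[OF ad])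
    also have "... <= 4 * K * (u * (1 + norm y))" using hyn K_ge1 by (intro mult_left_mono) auto
    finally show ?thesis using norm_triangle_sub[of H y] by linarith
   qed
   finally have *: "norm g <= (h/2) * (K * (1 + norm y) + K * (1 + (norm y + 4 * K * (u * (1 + norm y)))))"
    using h K_ge1 by (simp add: mult_left_mono)
   also have "... = K * (h * (1 + norm y)) + 2 * K^2 * (h * (u * (1 + norm y)))" by (simp add: field_simps power2_eq_square)
   also have "... <= A * (h * (1 + norm y)) + A * (h * (u * (1 + norm y)))"
    using A1 h u0 by (intro add_mono mult_right_mono) (auto simp: A_def)
   also have "... = A * (h * ((1 + norm y) * (1 + u)))" by (simp add: algebra_simps)
   finally show ?thesis .
  qed
  have Y2: "(1 + norm y)^2 <= 2 * Y"
   using sum_squares_bound[of 1 "norm y"] by (simp add: Y_def power2_eq_square algebra_simps)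
  have yY: "norm y * (1 + norm y) <= 2 * Y"
  proof -
   have "norm y * (1 + norm y) <= (1 + norm y) * (1 + norm y)" by (intro mult_right_mono) auto
   then show ?thesis using Y2 by (simp add: power2_eq_square)
  qed
  define e where "e = (2 * (y \<bullet> q) + (norm q)^2) / Y"
  have stp: "1 + (norm (stp s s' xi y))^2 = Y * (1 + e)"
  proof -
   have "stp s s' xi y = y + q" by (simp add: q_def)
   then have "(norm (stp s s' xi y))^2 = (norm y)^2 + (2 * (y \<bullet> q) + (norm q)^2)"
    by (simp add: power2_norm_eq_inner inner_add_left inner_add_right inner_commute)
   moreover have "Y * e = 2 * (y \<bullet> q) + (norm q)^2" using Y1 by (simp add: e_def)
   ultimately show ?thesis by (simp add: Y_def algebra_simps)
  qed
  have e1: "0 <= 1 + e"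
  proof -
   have "0 <= Y * (1 + e)" unfolding stp[symmetric] by simp
   then show ?thesis using Y1 by (simp add: zero_le_mult_iff)
  qed
  have q2: "(norm q)^2 / Y <= 2 * A^2 * u^2"
  proof -
   have "(norm q)^2 <= (A * (u * (1 + norm y)))^2" using q1 by (intro power_mono) auto
   also have "... = A^2 * u^2 * (1 + norm y)^2" by (simp add: power_mult_distrib)
   also have "... <= A^2 * u^2 * (2 * Y)" using Y2 by (intro mult_left_mono) auto
   finally show ?thesis using Y1 by (simp add: field_simps)
  qed
  have yq: "\<bar>y \<bullet> q\<bar> / Y <= 2 * A * u"
  proof -
   have "\<bar>y \<bullet> q\<bar> <= norm y * norm q" by (rule Cauchy_Schwarz_ineq2)
   also have "... <= norm y * (A * (u * (1 + norm y)))" using q1 by (intro mult_left_mono) auto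
   also have "... = A * u * (norm y * (1 + norm y))" by simp
   also have "... <= A * u * (2 * Y)" using yY A1 u0 by (intro mult_left_mono) auto
   finally show ?thesis using Y1 by (simp add: field_simps)
  qed
  have yg: "(y \<bullet> g) / Y <= 2 * A * (u^2 * (1 + u))"
  proof -
   have "y \<bullet> g <= norm y * norm g" by (rule norm_cauchy_schwarz)
   also have "... <= norm y * (A * (h * ((1 + norm y) * (1 + u))))" using g1 by (intro mult_left_mono) auto
   also have "... = A * (h * (1 + u)) * (norm y * (1 + norm y))" by simp
   also have "... <= A * (h * (1 + u)) * (2 * Y)" by (rule mult_left_mono[OF yY]) (use A1 u0 h in auto)
   also have "... <= A * (u^2 * (1 + u)) * (2 * Y)"
    by (intro mult_right_mono mult_left_mono hu) (use A1 u0 Y1 in auto)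
   finally show ?thesis using Y1 by (simp add: field_simps)
  qed
  have ea: "\<bar>e\<bar> <= E * (u * (1 + u))"
  proof -
   have "\<bar>e\<bar> <= 2 * (\<bar>y \<bullet> q\<bar> / Y) + (norm q)^2 / Y"
   proof -
    have "\<bar>2 * (y \<bullet> q) + (norm q)^2\<bar> <= 2 * \<bar>y \<bullet> q\<bar> + (norm q)^2"
     using abs_triangle_ineq[of "2 * (y \<bullet> q)" "(norm q)^2"] by (simp add: abs_mult)
    then have "\<bar>e\<bar> <= (2 * \<bar>y \<bullet> q\<bar> + (norm q)^2) / Y"
     unfolding e_def abs_divide using Y1 by (simp add: divide_right_mono)
    then show ?thesis by (simp add: add_divide_distrib)
   qed
   also have "... <= 4 * A * u + 2 * A^2 * u^2" using q2 yq by simp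
   also have "... <= E * u + E * u^2" using A1 u0 by (intro add_mono mult_right_mono) (auto simp: E_def)
   finally show ?thesis by (simp add: power2_eq_square algebra_simps)
  qed
  have er: "e <= 2 * (y \<bullet> N) / Y + E * (u^2 * (1 + u))"
  proof -
   have "e = 2 * (y \<bullet> N) / Y + (2 * ((y \<bullet> g) / Y) + (norm q)^2 / Y)"
    using Y1 by (simp add: e_def g_def inner_diff_right field_simps)
   also have "2 * ((y \<bullet> g) / Y) + (norm q)^2 / Y <= 4 * A * (u^2 * (1 + u)) + 2 * A^2 * u^2" using yg q2 by simp
   also have "... <= 4 * A * (u^2 * (1 + u)) + 4 * A^2 * (u^2 * (1 + u))"
   proof (intro add_left_mono)
    have "2 * A^2 * (u^2 * 1) <= 4 * A^2 * (u^2 * (1 + u))" using u0 by (intro mult_mono) auto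
    then show "2 * A^2 * u^2 <= 4 * A^2 * (u^2 * (1 + u))" by simp
   qed
   also have "... = E * (u^2 * (1 + u))" by (simp add: E_def algebra_simps)
   finally show ?thesis by simp
  qed
  have up: "1 <= 1 + u" using u0 by simp
  have p1: "(1 + \<bar>e\<bar>) ^ r <= (1 + E) ^ r * (1 + u) ^ (2 * r)"
  proof -
   have "1 + \<bar>e\<bar> <= (1 + E) * (1 + u)^2"
   proof -
    have "1 + \<bar>e\<bar> <= 1 + E * (u * (1 + u))" using ea by simp
    also have "... <= (1 + E) * (1 + u)^2"
     using u0 E0 mult_nonneg_nonneg[OF E0 u0] by (simp add: power2_eq_square algebra_simps)
    finally show ?thesis .
   qed
   then have "(1 + \<bar>e\<bar>) ^ r <= ((1 + E) * (1 + u)^2) ^ r" by (intro power_mono) auto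
   then show ?thesis by (simp add: power_mult_distrib power_mult)
  qed
  have p2: "e^2 <= E^2 * u^2 * (1 + u)^2"
  proof -
   have "\<bar>e\<bar>\<^sup>2 <= (E * (u * (1 + u)))^2" using ea by (intro power_mono) auto
   then show ?thesis by (simp add: power_mult_distrib)
  qed
  have "(1 + e) ^ r <= 1 + real r * e + (real r)^2 * e^2 * (1 + \<bar>e\<bar>) ^ r" by (rule one_plus_power_le[OF e1])
  also have "... <= 1 + real r * (2 * (y \<bullet> N) / Y + E * (u^2 * (1 + u)))
    + (real r)^2 * (E^2 * u^2 * (1 + u)^2) * ((1 + E) ^ r * (1 + u) ^ (2 * r))"
   using er p1 p2 by (intro add_mono mult_mono mult_left_mono) auto
  also have "... = 1 + (2 * real r / Y) * (y \<bullet> N) + real r * E * (u^2 * (1 + u) ^ 1)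
    + (real r)^2 * E^2 * (1 + E) ^ r * (u^2 * (1 + u) ^ (2 * r + 2))"
   by (simp add: power_add power2_eq_square field_simps)
  also have "... <= 1 + (2 * real r / Y) * (y \<bullet> N) + real r * E * (u^2 * (1 + u) ^ (2 * r + 2))
    + (real r)^2 * E^2 * (1 + E) ^ r * (u^2 * (1 + u) ^ (2 * r + 2))"
   using E0 up Y1 by (intro add_mono mult_left_mono power_increasing) auto
  also have "... = 1 + (2 * real r / Y) * (y \<bullet> N) + c * (u^2 * (1 + u) ^ (2 * r + 2))"
   by (simp add: c_def algebra_simps)
  finally have fin: "(1 + e) ^ r <= 1 + (2 * real r / Y) * (y \<bullet> N) + c * (u^2 * (1 + u) ^ (2 * r + 2))" .
  have "w r (stp s s' xi y) = Y ^ r * (1 + e) ^ r" unfolding wR_def stp power_mult_distrib ..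
  also have "... <= Y ^ r * (1 + (2 * real r / Y) * (y \<bullet> N) + c * (u^2 * (1 + u) ^ (2 * r + 2)))"
   using fin Y1 by (intro mult_left_mono) auto
  finally show ?thesis unfolding wR_def Y_def N_def u_def h_def .
 qed
 moreover have "0 <= c" using E0 by (simp add: c_def)
 ultimately show ?thesis by blast
qed

subsection \<open>Continuity\<close>

lemma continuous_nz: "continuous_on UNIV (%xi. nz M (%m. xi m - et m))"
 unfolding nz_def by (intro continuous_intros continuous_on_product_coordinates)

text \<open>\<open>stp_diff\<close> is a Lipschitz bound in state and noise together. Continuity
  supplies the measurability of the steps, whose implicit stage has no explicit formula.\<close>

lemma continuous_stp:
 assumes "admissible s s'"
 shows "continuous_on UNIV (%z. stp s s' (fst z) (snd z))"
 unfolding continuous_on_def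
proof
 fix z0 :: "(nat => real) \<times> 'a \<times> 'b"
 note ad = admissibleD[OF assms]
 have bd: "dist (stp s s' (fst z) (snd z)) (stp s s' (fst z0) (snd z0)) <= 2 * norm (snd z - snd z0) + 2 * K * n (%m. fst z m - fst z0 m)" for z
 proof -
  have "norm (stp s s' (fst z) (snd z) - stp s s' (fst z0) (snd z0)) <= norm (snd z - snd z0) + (2 * ((s' - s) * K) * norm (snd z - snd z0) + 2 * K * n (%m. fst z m - fst z0 m))"
   using stp_diff[OF assms, of "fst z" "snd z" "fst z0" "snd z0"] norm_triangle_sub[of "stp s s' (fst z) (snd z) - stp s s' (fst z0) (snd z0)" "snd z - snd z0"] by linarith
  also have "2 * ((s' - s) * K) * norm (snd z - snd z0) <= 1 * norm (snd z - snd z0)"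
   using ad by (intro mult_right_mono) auto
  finally show ?thesis by (simp add: dist_norm)
 qed
 have "continuous_on UNIV (%z. 2 * norm (snd z - snd z0) + 2 * K * n (%m. fst z m - fst z0 m))"
  by (intro continuous_intros continuous_on_compose2[OF continuous_nz]) auto
 then have "((%z. 2 * norm (snd z - snd z0) + 2 * K * n (%m. fst z m - fst z0 m)) \<longlongrightarrow> 2 * norm (snd z0 - snd z0) + 2 * K * n (%m. fst z0 m - fst z0 m)) (at z0 within UNIV)"
  unfolding continuous_on_def by blast
 then have lim: "((%z. 2 * norm (snd z - snd z0) + 2 * K * n (%m. fst z m - fst z0 m)) \<longlongrightarrow> 0) (at z0 within UNIV)" by simp
 have "((%z. dist (stp s s' (fst z) (snd z)) (stp s s' (fst z0) (snd z0))) \<longlongrightarrow> 0) (at z0 within UNIV)"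
  by (rule tendsto_sandwich[OF _ _ tendsto_const lim]) (use bd in auto)
 then show "((%z. stp s s' (fst z) (snd z)) \<longlongrightarrow> stp s s' (fst z0) (snd z0)) (at z0 within UNIV)"
  by (subst tendsto_dist_iff)
qed

lemma continuous_stp' [continuous_intros]:
 assumes "admissible s s'" "continuous_on S f" "continuous_on S g"
 shows "continuous_on S (%x. stp s s' (f x) (g x))"
proof -
 have "continuous_on S (%x. (f x, g x))" by (intro continuous_intros assms)
 from continuous_on_compose2[OF continuous_stp[OF assms(1)] this] show ?thesis by simp
qed

end

lemma continuous_fun_add [continuous_intros]:
 fixes f g :: "'z::topological_space => nat => real"
 assumes "continuous_on S f" "continuous_on S g"
 shows "continuous_on S (%x m. f x m + g x m)"
 by (rule continuous_on_coordinatewise_then_product, rule continuous_on_add;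
   rule continuous_on_product_then_coordinatewise, fact)

lemma continuous_fun_uminus [continuous_intros]:
 fixes f :: "'z::topological_space => nat => real"
 assumes "continuous_on S f"
 shows "continuous_on S (%x m. - f x m)"
 by (rule continuous_on_coordinatewise_then_product, rule continuous_on_minus,
   rule continuous_on_product_then_coordinatewise, fact)

lemma wcl_continuous:
 fixes ph :: "'v::real_normed_vector => real"
 assumes "wcl r C ph"
 shows "continuous_on UNIV ph"
 unfolding continuous_on_def
proof
 fix x0 :: 'v
 have "continuous_on UNIV (%x. C * (w r x + w r x0) * norm (x - x0))"
  unfolding wR_def by (intro continuous_intros)
 then have "((%x. C * (w r x + w r x0) * norm (x - x0)) \<longlongrightarrow> C * (w r x0 + w r x0) * norm (x0 - x0)) (at x0 within UNIV)"
  unfolding continuous_on_def by blast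
 then have lim: "((%x. C * (w r x + w r x0) * norm (x - x0)) \<longlongrightarrow> 0) (at x0 within UNIV)" by simp
 have "((%x. dist (ph x) (ph x0)) \<longlongrightarrow> 0) (at x0 within UNIV)"
  by (rule tendsto_sandwich[OF _ _ tendsto_const lim]) (use wcl_diff[OF assms] in \<open>auto simp: dist_real_def\<close>)
 then show "(ph \<longlongrightarrow> ph x0) (at x0 within UNIV)" by (subst tendsto_dist_iff)
qed

lemma power_sum_le:
 fixes a b :: real assumes "0 <= a" "0 <= b"
 shows "(a + b) ^ p <= 2 ^ p * (a ^ p + b ^ p)"
proof -
 have "(a + b) ^ p <= (2 * max a b) ^ p" using assms by (intro power_mono) auto
 also have "... = 2 ^ p * max a b ^ p" by (simp add: power_mult_distrib)
 also have "max a b ^ p <= a ^ p + b ^ p" using assms by (auto simp: max_def)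
 finally show ?thesis by simp
qed

section \<open>Moments and symmetries of the noise\<close>

definition noise_mom :: "'o measure => nat => (nat => real) => real => ('o => nat => real) => bool" where
 "noise_mom P M cm h xi \<longleftrightarrow> xi \<in> borel_measurable P \<and>
   (\<forall>p. integrable P (%om. nz M (xi om) ^ p) \<and> (\<integral>om. nz M (xi om) ^ p \<partial>P) <= cm p * sqrt h ^ p) \<and>
   distr P borel (%om m. - xi om m) = distr P borel xi"

text \<open>The two invariances of the joint law generate all eight symmetries of the pair.\<close>

definition half_step_noise ::
 "'o measure => nat => (nat => real) => real => ('o => nat => real) => ('o => nat => real) => bool" where
 "half_step_noise P M cm k xi1 xi2 \<longleftrightarrow> noise_mom P M cm k xi1 \<and> noise_mom P M cm k xi2 \<and>
   distr P borel (%om. (xi2 om, xi1 om)) = distr P borel (%om. (xi1 om, xi2 om)) \<and>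
   distr P borel (%om. (xi1 om, %m. - xi2 om m)) = distr P borel (%om. (xi1 om, xi2 om))"

lemma nz_measurable [measurable]: "nz M \<in> borel_measurable borel"
proof -
 have "continuous_on UNIV (nz M)"
  unfolding nz_def by (intro continuous_intros continuous_on_product_coordinates)
 then show ?thesis by (rule borel_measurable_continuous_onI)
qed

context prob_space
begin

text \<open>After expansion every term contains at least \<open>p\<close> factors of the size of
  sqrt h; the surplus powers are bounded because \<open>h <= 1\<close>.\<close>

lemma moment_bound:
 fixes cm :: "nat => real"
 assumes cm: "\<And>p. 0 <= cm p"
 shows "\<exists>C\<ge>0. \<forall>h N. 0 <= h --> h <= 1 --> (\<forall>om. 0 <= N om) -->
  (\<forall>p. integrable M (%om. N om ^ p) \<and> expectation (%om. N om ^ p) <= cm p * sqrt h ^ p) -->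
  integrable M (%om. (sqrt h + N om) ^ p * (1 + (sqrt h + N om)) ^ q) \<and>
  expectation (%om. (sqrt h + N om) ^ p * (1 + (sqrt h + N om)) ^ q) <= C * sqrt h ^ p"
proof (intro exI conjI allI impI)
 let ?C = "2 ^ (p + q) * (2 ^ q + cm q + 2 ^ q * cm p + cm (p + q))"
 show "0 <= ?C" using cm by auto
 fix h :: real and N :: "'a => real"
 assume h: "0 <= h" "h <= 1" and N0: "\<forall>om. 0 <= N om"
  and mom: "\<forall>p. integrable M (%om. N om ^ p) \<and> expectation (%om. N om ^ p) <= cm p * sqrt h ^ p"
 let ?s = "sqrt h"
 let ?F = "%om. (?s + N om) ^ p * (1 + (?s + N om)) ^ q"
 let ?G = "%om. 2 ^ (p + q) * (2 ^ q * ?s ^ p + ?s ^ p * N om ^ q + 2 ^ q * N om ^ p + N om ^ (p + q))"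
 have s: "0 <= ?s" "?s <= 1" using h by auto
 have meas: "N \<in> borel_measurable M" using mom[rule_format, of 1] by (simp add: borel_measurable_integrable)
 have le: "?F om <= ?G om" for om
 proof -
  have n: "0 <= N om" using N0 by simp
  have "(1 + (?s + N om)) ^ q <= (2 + N om) ^ q" using s n by (intro power_mono) auto
  also have "... <= 2 ^ q * (2 ^ q + N om ^ q)" using n by (intro power_sum_le) auto
  finally have "?F om <= (2 ^ p * (?s ^ p + N om ^ p)) * (2 ^ q * (2 ^ q + N om ^ q))"
   using s n by (intro mult_mono power_sum_le) auto
  also have "... = ?G om" by (simp add: power_add algebra_simps)
  finally show ?thesis .
 qed
 have F0: "0 <= ?F om" for om using s N0 by simp
 have iG: "integrable M ?G" using mom by (intro integrable_mult_right integrable_add) auto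
 show iF: "integrable M ?F"
  by (rule Bochner_Integration.integrable_bound[OF iG]) (use le F0 meas in \<open>auto intro!: AE_I2 order_trans[OF le] abs_ge_self\<close>)
 have "expectation ?F <= expectation ?G" by (rule integral_mono[OF iF iG le])
 also have "... = 2 ^ (p + q) * (2 ^ q * ?s ^ p + ?s ^ p * expectation (%om. N om ^ q) + 2 ^ q * expectation (%om. N om ^ p) + expectation (%om. N om ^ (p + q)))"
  using mom by (simp add: prob_space)
 also have "... <= 2 ^ (p + q) * (2 ^ q * ?s ^ p + ?s ^ p * (cm q * 1) + 2 ^ q * (cm p * ?s ^ p) + cm (p + q) * (?s ^ p * 1))"
 proof -
  have sq: "?s ^ q <= 1" using s by (intro power_le_one) auto
  have "expectation (%om. N om ^ q) <= cm q * 1" using mom[rule_format, of q] mult_left_mono[OF sq cm[of q]] by linarith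
  moreover have "expectation (%om. N om ^ (p + q)) <= cm (p + q) * (?s ^ p * 1)"
  proof -
   have "cm (p + q) * (?s ^ p * ?s ^ q) <= cm (p + q) * (?s ^ p * 1)" using sq s cm by (intro mult_left_mono) auto
   then show ?thesis using mom[rule_format, of "p + q"] by (simp add: power_add)
  qed
  ultimately show ?thesis using mom s by (intro mult_left_mono add_mono) auto
 qed
 also have "... = ?C * ?s ^ p" by (simp add: algebra_simps)
 finally show "expectation ?F <= ?C * ?s ^ p" .
qed

end

locale noisy_scheme = scheme M g01 g1 g02 g2 T K + prob_space P
 for M and g01 :: "'a::euclidean_space => 'b::euclidean_space => real => 'a" and g1 g02 g2 T K and P :: "'o measure" +
 fixes cm :: "nat => real"
 assumes cm_nonneg: "\<And>p. 0 <= cm p"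
begin

lemma half_step_noiseD:
 assumes "half_step_noise P M cm k xi1 xi2"
 shows "xi1 \<in> borel_measurable P" "xi2 \<in> borel_measurable P"
 using assms by (auto simp: half_step_noise_def noise_mom_def)

lemma half_step_moments:
 "\<exists>C\<ge>0. \<forall>k xi1 xi2. 0 <= k --> k <= 1 --> half_step_noise P M cm k xi1 xi2 -->
  integrable P (%om. (sqrt k + (n (xi1 om) + n (xi2 om))) ^ p * (1 + (sqrt k + (n (xi1 om) + n (xi2 om)))) ^ q) \<and>
  expectation (%om. (sqrt k + (n (xi1 om) + n (xi2 om))) ^ p * (1 + (sqrt k + (n (xi1 om) + n (xi2 om)))) ^ q) <= C * sqrt k ^ p"
proof -
 define cm2 where "cm2 p = 2 ^ p * (cm p + cm p)" for p
 have cm2: "\<And>p. 0 <= cm2 p" using cm_nonneg by (simp add: cm2_def)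
 from moment_bound[where cm=cm2 and p=p and q=q, OF cm2] obtain C where C0: "C \<ge> 0" and C: "\<And>h N. 0 <= h ==> h <= 1 ==> (\<forall>om. 0 <= N om) ==>
  (\<forall>p. integrable P (%om. N om ^ p) \<and> expectation (%om. N om ^ p) <= cm2 p * sqrt h ^ p) ==>
  integrable P (%om. (sqrt h + N om) ^ p * (1 + (sqrt h + N om)) ^ q) \<and>
  expectation (%om. (sqrt h + N om) ^ p * (1 + (sqrt h + N om)) ^ q) <= C * sqrt h ^ p" by blast
 show ?thesis
 proof (rule exI[of _ C], intro conjI C0 allI impI)
  fix k xi1 xi2 assume k: "0 <= k" "k <= 1" and H: "half_step_noise P M cm k xi1 xi2"
  have [measurable]: "xi1 \<in> borel_measurable P" "xi2 \<in> borel_measurable P" using half_step_noiseD[OF H] by auto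
  have m: "integrable P (%om. n (xi1 om) ^ p)" "expectation (%om. n (xi1 om) ^ p) <= cm p * sqrt k ^ p"
   "integrable P (%om. n (xi2 om) ^ p)" "expectation (%om. n (xi2 om) ^ p) <= cm p * sqrt k ^ p" for p
   using H by (auto simp: half_step_noise_def noise_mom_def)
  have mom: "integrable P (%om. (n (xi1 om) + n (xi2 om)) ^ p) \<and> expectation (%om. (n (xi1 om) + n (xi2 om)) ^ p) <= cm2 p * sqrt k ^ p" for p
  proof
   have iG: "integrable P (%om. 2 ^ p * (n (xi1 om) ^ p + n (xi2 om) ^ p))" by (intro integrable_mult_right Bochner_Integration.integrable_add m)
   show iF: "integrable P (%om. (n (xi1 om) + n (xi2 om)) ^ p)"
    by (rule Bochner_Integration.integrable_bound[OF iG]) (auto intro!: AE_I2 order_trans[OF power_sum_le] abs_ge_self)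
   have "expectation (%om. (n (xi1 om) + n (xi2 om)) ^ p) <= expectation (%om. 2 ^ p * (n (xi1 om) ^ p + n (xi2 om) ^ p))"
    by (intro integral_mono iF iG power_sum_le) auto
   also have "... = 2 ^ p * (expectation (%om. n (xi1 om) ^ p) + expectation (%om. n (xi2 om) ^ p))" using m by simp
   also have "... <= 2 ^ p * (cm p * sqrt k ^ p + cm p * sqrt k ^ p)" by (intro mult_left_mono add_mono m) auto
   finally show "expectation (%om. (n (xi1 om) + n (xi2 om)) ^ p) <= cm2 p * sqrt k ^ p" by (simp add: cm2_def algebra_simps)
  qed
  show "integrable P (%om. (sqrt k + (n (xi1 om) + n (xi2 om))) ^ p * (1 + (sqrt k + (n (xi1 om) + n (xi2 om)))) ^ q)"
   "expectation (%om. (sqrt k + (n (xi1 om) + n (xi2 om))) ^ p * (1 + (sqrt k + (n (xi1 om) + n (xi2 om)))) ^ q) <= C * sqrt k ^ p"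
   using C[OF k, of "%om. n (xi1 om) + n (xi2 om)"] mom by simp_all
 qed
qed

lemma rho_power_le:
 assumes "0 <= k"
 shows "rho k y x1 x2 ^ p * (1 + rho k y x1 x2) ^ q <= (1 + norm y) ^ (p + q) * ((sqrt k + (n x1 + n x2)) ^ p * (1 + (sqrt k + (n x1 + n x2))) ^ q)"
proof -
 let ?s = "sqrt k + (n x1 + n x2)"
 have s: "0 <= ?s" using assms by simp
 have r: "rho k y x1 x2 = ?s * (1 + norm y)" by (simp add: rho_def add.assoc)
 have "1 + ?s * (1 + norm y) <= (1 + ?s) * (1 + norm y)" using s by (simp add: algebra_simps)
 then have "rho k y x1 x2 ^ p * (1 + rho k y x1 x2) ^ q <= (?s * (1 + norm y)) ^ p * ((1 + ?s) * (1 + norm y)) ^ q"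
  unfolding r using s by (intro mult_left_mono power_mono) auto
 also have "... = (1 + norm y) ^ (p + q) * (?s ^ p * (1 + ?s) ^ q)" by (simp add: power_mult_distrib power_add)
 finally show ?thesis .
qed

text \<open>Turns an order \<open>p\<close> into the power \<open>p\<close> of sqrt k in the mean,
  at the price of a polynomial in \<open>norm y\<close>. The constant is chosen first, so it serves
  all integrands, times and states.\<close>

lemma expectation_pathwise:
 fixes F :: "real => real => 'a \<times> 'b => (nat => real) => (nat => real) => 'w::{banach, second_countable_topology}"
 shows "\<exists>C\<ge>0. \<forall>F B t k y xi1 xi2. 0 <= B --> 0 <= k --> admissible t (t + 2 * k) --> half_step_noise P M cm k xi1 xi2 -->
   (%om. F (xi1 om) (xi2 om) :: 'w) \<in> borel_measurable P -->
   (\<forall>x1 x2. norm (F x1 x2) <= B * (rho k y x1 x2 ^ p * (1 + rho k y x1 x2) ^ q)) -->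
   integrable P (%om. F (xi1 om) (xi2 om)) \<and> expectation (%om. norm (F (xi1 om) (xi2 om))) <= C * B * sqrt k ^ p * (1 + norm y) ^ (p + q)"
proof -
 obtain C where C0: "C \<ge> 0" and C: "\<And>k xi1 xi2. 0 <= k ==> k <= 1 ==> half_step_noise P M cm k xi1 xi2 ==>
  integrable P (%om. (sqrt k + (n (xi1 om) + n (xi2 om))) ^ p * (1 + (sqrt k + (n (xi1 om) + n (xi2 om)))) ^ q) \<and>
  expectation (%om. (sqrt k + (n (xi1 om) + n (xi2 om))) ^ p * (1 + (sqrt k + (n (xi1 om) + n (xi2 om)))) ^ q) <= C * sqrt k ^ p"
  using half_step_moments[of p q] by blast
 show ?thesis
 proof (rule exI[of _ C], intro conjI C0 allI impI)
  fix F :: "(nat => real) => (nat => real) => 'w" and B t k y xi1 xi2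
  assume B: "0 <= B" and k: "0 <= k" "admissible t (t + 2 * k)" and H: "half_step_noise P M cm k xi1 xi2"
   and meas: "(%om. F (xi1 om) (xi2 om)) \<in> borel_measurable P"
   and bd: "\<forall>x1 x2. norm (F x1 x2) <= B * (rho k y x1 x2 ^ p * (1 + rho k y x1 x2) ^ q)"
  have k1: "k <= 1" using admissibleD(5)[OF k(2)] by simp
  let ?s = "%om. (sqrt k + (n (xi1 om) + n (xi2 om))) ^ p * (1 + (sqrt k + (n (xi1 om) + n (xi2 om)))) ^ q"
  let ?G = "%om. (B * (1 + norm y) ^ (p + q)) * ?s om"
  note S = C[OF k(1) k1 H]
  have iG: "integrable P ?G" using S by (intro integrable_mult_right) auto
  have le: "norm (F (xi1 om) (xi2 om)) <= ?G om" for om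
   using bd[rule_format, of "xi1 om" "xi2 om"] mult_left_mono[OF rho_power_le[OF k(1), of y "xi1 om" "xi2 om" p q] B] by (simp add: mult_ac)
  show iF: "integrable P (%om. F (xi1 om) (xi2 om))"
   by (rule Bochner_Integration.integrable_bound[OF iG meas]) (auto intro!: AE_I2 order_trans[OF le])
  have "expectation (%om. norm (F (xi1 om) (xi2 om))) <= expectation ?G"
   by (intro integral_mono le iG integrable_norm iF)
  also have "... = (B * (1 + norm y) ^ (p + q)) * expectation ?s" by simp
  also have "... <= (B * (1 + norm y) ^ (p + q)) * (C * sqrt k ^ p)" using S B by (intro mult_left_mono) auto
  finally show "expectation (%om. norm (F (xi1 om) (xi2 om))) <= C * B * sqrt k ^ p * (1 + norm y) ^ (p + q)" by (simp add: mult_ac)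
 qed
qed

lemma law_invariant_expectation:
 fixes f :: "(nat => real) \<times> (nat => real) => 'w::{banach, second_countable_topology}"
 assumes H: "half_step_noise P M cm k xi1 xi2" and f: "f \<in> borel_measurable borel"
 shows "expectation (%om. f (xi2 om, xi1 om)) = expectation (%om. f (xi1 om, xi2 om))"
  "expectation (%om. f (xi1 om, ng (xi2 om))) = expectation (%om. f (xi1 om, xi2 om))"
  "integrable P (%om. f (xi2 om, xi1 om)) = integrable P (%om. f (xi1 om, xi2 om))"
  "integrable P (%om. f (xi1 om, ng (xi2 om))) = integrable P (%om. f (xi1 om, xi2 om))"
proof -
 have [measurable]: "xi1 \<in> borel_measurable P" "xi2 \<in> borel_measurable P" using half_step_noiseD[OF H] by auto
 have ngm: "ng \<in> borel_measurable borel" by (intro borel_measurable_continuous_onI continuous_intros)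
 have m: "(%om. (xi1 om, xi2 om)) \<in> borel_measurable P" "(%om. (xi2 om, xi1 om)) \<in> borel_measurable P"
  "(%om. (xi1 om, ng (xi2 om))) \<in> borel_measurable P"
  using measurable_compose[OF _ ngm, of xi2 P] by (auto intro!: borel_measurable_Pair)
 have d: "distr P borel (%om. (xi2 om, xi1 om)) = distr P borel (%om. (xi1 om, xi2 om))"
   "distr P borel (%om. (xi1 om, ng (xi2 om))) = distr P borel (%om. (xi1 om, xi2 om))"
  using H by (auto simp: half_step_noise_def)
 show "expectation (%om. f (xi2 om, xi1 om)) = expectation (%om. f (xi1 om, xi2 om))"
  "expectation (%om. f (xi1 om, ng (xi2 om))) = expectation (%om. f (xi1 om, xi2 om))"
  using integral_distr[OF m(1) f] integral_distr[OF m(2) f] integral_distr[OF m(3) f] d by auto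
 show "integrable P (%om. f (xi2 om, xi1 om)) = integrable P (%om. f (xi1 om, xi2 om))"
  "integrable P (%om. f (xi1 om, ng (xi2 om))) = integrable P (%om. f (xi1 om, xi2 om))"
  using integrable_distr_eq[OF m(1) f] integrable_distr_eq[OF m(2) f] integrable_distr_eq[OF m(3) f] d by auto
qed

text \<open>The law of the pair is invariant under two generators of the group, hence under the
  group; \<open>good\<close> collects the integrands that are reached from \<open>f\<close> by
  applying them.\<close>

lemma expectation_sym8:
 fixes f :: "(nat => real) => (nat => real) => 'w::{banach, second_countable_topology}"
 assumes H: "half_step_noise P M cm k xi1 xi2" and f: "continuous_on UNIV (%z. f (fst z) (snd z))"
  and i: "integrable P (%om. f (xi1 om) (xi2 om))"
 shows "expectation (%om. sym8 f (xi1 om) (xi2 om)) = 8 *R expectation (%om. f (xi1 om) (xi2 om))"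
proof -
 define good where "good F \<longleftrightarrow> continuous_on UNIV (%z. F (fst z) (snd z)) \<and> integrable P (%om. F (xi1 om) (xi2 om)) \<and>
  expectation (%om. F (xi1 om) (xi2 om)) = expectation (%om. f (xi1 om) (xi2 om))" for F :: "(nat => real) => (nat => real) => 'w"
 have sw: "good (%x1 x2. F x2 x1)" if "good F" for F
 proof -
  have c: "continuous_on UNIV (%z. F (fst z) (snd z))" using that by (simp add: good_def)
  have "continuous_on UNIV (%z :: (nat => real) \<times> (nat => real). F (fst (snd z, fst z)) (snd (snd z, fst z)))"
   by (rule continuous_on_compose2[OF c])
    (intro continuous_on_Pair continuous_on_snd continuous_on_fst continuous_fun_uminus continuous_on_id, simp)
  moreover note law_invariant_expectation[OF H borel_measurable_continuous_onI[OF c]]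
  ultimately show ?thesis using that by (simp add: good_def)
 qed
 have fl: "good (%x1 x2. F x1 (ng x2))" if "good F" for F
 proof -
  have c: "continuous_on UNIV (%z. F (fst z) (snd z))" using that by (simp add: good_def)
  have "continuous_on UNIV (%z :: (nat => real) \<times> (nat => real). F (fst (fst z, ng (snd z))) (snd (fst z, ng (snd z))))"
   by (rule continuous_on_compose2[OF c])
    (intro continuous_on_Pair continuous_on_snd continuous_on_fst continuous_fun_uminus continuous_on_id, simp)
  moreover note law_invariant_expectation[OF H borel_measurable_continuous_onI[OF c]]
  ultimately show ?thesis using that by (simp add: good_def)
 qed
 have g: "good f" using f i by (simp add: good_def)
 have g1: "good (%x1 x2. f x2 x1)" by (rule sw[OF g])
 have g2: "good (%x1 x2. f x1 (ng x2))" by (rule fl[OF g])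
 have g3: "good (%x1 x2. f (ng x2) x1)" by (rule fl[OF g1])
 have g4: "good (%x1 x2. f (ng x1) x2)" using sw[OF g3] .
 have g5: "good (%x1 x2. f x2 (ng x1))" using sw[OF g2] .
 have g6: "good (%x1 x2. f (ng x1) (ng x2))" using fl[OF g4] .
 have g7: "good (%x1 x2. f (ng x2) (ng x1))" using sw[OF g6] .
 show ?thesis
  using g g1 g2 g3 g4 g5 g6 g7 unfolding sym8_def good_def
  by (simp add: scaleR_left.add[of 1 7, simplified] flip: scaleR_2)
qed

section \<open>The local difference in the mean\<close>

lemma one_plus_norm_le_w: "(1 + norm y) ^ e <= 2 ^ e * w e y"
proof -
 have "2 * norm y <= 1 + (norm y)^2" using sum_squares_bound[of 1 "norm y"] by simp
 moreover have lin: "1 + x <= 2 * (1 + q)" if "2 * x <= 1 + q" "0 <= q" for x q :: real using that by simp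
 ultimately have "1 + norm y <= 2 * (1 + (norm y)^2)" by (intro lin) simp_all
 then have "(1 + norm y) ^ e <= (2 * (1 + (norm y)^2)) ^ e" by (intro power_mono) auto
 then show ?thesis unfolding wR_def power_mult_distrib .
qed

lemma sqrt_power6: "0 <= k ==> sqrt k ^ 6 = k ^ 3"
proof -
 assume "0 <= k"
 have "sqrt k ^ 6 = (sqrt k ^ 2) ^ 3" by (simp only: power_mult[symmetric]) simp
 then show ?thesis using \<open>0 <= k\<close> by simp
qed

lemma ord_Psi: "ord 1 (%t k y x1 x2. Psi t k y x1 x2 - y)"
 by (rule ord_cong[OF ord_add[OF ord_Phi(1) ord_mono[OF ord_del(1)]]]) (auto simp: del_def)

lemma w_polynomial:
 assumes "ord 1 (%t k y x1 x2. f t k y x1 x2 - y)"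
 shows "\<exists>B\<ge>0. \<exists>q. \<forall>t k y x1 x2. 0 <= k --> admissible t (t + 2 * k) -->
  w r (f t k y x1 x2) <= (B * (1 + norm y) ^ (2 * r)) * (rho k y x1 x2 ^ 0 * (1 + rho k y x1 x2) ^ q)"
proof -
 obtain C q where C: "0 <= C" "\<And>t k y x1 x2. 0 <= k ==> admissible t (t + 2 * k) ==>
   norm (f t k y x1 x2 - y) <= C * rho k y x1 x2 ^ 1 * (1 + rho k y x1 x2) ^ q"
  using assms by (erule_tac ordE) blast
 have "w r (f t k y x1 x2) <= ((1 + C) ^ (2 * r) * (1 + norm y) ^ (2 * r)) * (rho k y x1 x2 ^ 0 * (1 + rho k y x1 x2) ^ ((q + 1) * (2 * r)))"
  if k: "0 <= k" "admissible t (t + 2 * k)" for t k y x1 x2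
 proof -
  let ?r = "rho k y x1 x2" and ?x = "f t k y x1 x2"
  have r0: "0 <= ?r" using rho_nonneg[OF k(1)] by simp
  have p1: "1 <= (1 + ?r) ^ (q + 1)" using r0 by (intro one_le_power) auto
  have "norm (?x - y) <= C * ?r ^ 1 * (1 + ?r) ^ q" by (rule C(2)[OF k])
  also have "... <= C * (1 + ?r) * (1 + ?r) ^ q" using r0 C by (intro mult_right_mono mult_left_mono) auto
  finally have d: "norm (?x - y) <= C * (1 + ?r) ^ (q + 1)" by (simp add: mult_ac)
  have "1 + norm ?x <= 1 + norm y + norm (?x - y)" using norm_triangle_sub[of ?x y] by simp
  also have "... <= (1 + norm y) * (1 + norm (?x - y))" by (simp add: algebra_simps)
  also have "... <= (1 + norm y) * ((1 + C) * (1 + ?r) ^ (q + 1))"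
   using d p1 by (intro mult_left_mono) (auto simp: algebra_simps)
  finally have x: "1 + norm ?x <= (1 + C) * (1 + norm y) * (1 + ?r) ^ (q + 1)" by (simp add: mult_ac)
  have "1 + (norm ?x)^2 <= (1 + norm ?x)^2" by (simp add: power2_eq_square algebra_simps)
  then have "w r ?x <= ((1 + norm ?x)^2) ^ r" unfolding wR_def by (intro power_mono) auto
  also have "... = (1 + norm ?x) ^ (2 * r)" by (simp add: power_mult)
  also have "... <= ((1 + C) * (1 + norm y) * (1 + ?r) ^ (q + 1)) ^ (2 * r)" using x by (intro power_mono) auto
  also have "... = ((1 + C) ^ (2 * r) * (1 + norm y) ^ (2 * r)) * (?r ^ 0 * (1 + ?r) ^ ((q + 1) * (2 * r)))"
   by (simp only: power_mult_distrib power_mult[symmetric] power_0 mult_1)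
  finally show ?thesis .
 qed
 moreover have "0 <= (1 + C) ^ (2 * r)" using C(1) by simp
 ultimately show ?thesis by blast
qed

lemma continuous_Phi_Psi:
 assumes "0 <= k" "admissible t (t + 2 * k)"
 shows "continuous_on UNIV (%z. Psi t k y (fst z) (snd z))" "continuous_on UNIV (%z. Phi t k y (fst z) (snd z))"
 unfolding Psi_def Phi_def half_def
 by (intro continuous_stp' admissible_halves[OF assms] assms(2) continuous_on_const continuous_on_fst continuous_on_snd continuous_fun_add continuous_on_id)+

lemma continuous_imp_measurable_pair:
 assumes "half_step_noise P M cm k xi1 xi2" "continuous_on UNIV (%z. f (fst z) (snd z))"
 shows "(%om. f (xi1 om) (xi2 om)) \<in> borel_measurable P"
proof -
 have "(%om. (xi1 om, xi2 om)) \<in> borel_measurable P"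
  using half_step_noiseD[OF assms(1)] by (auto intro!: borel_measurable_Pair)
 from measurable_compose[OF this borel_measurable_continuous_onI[OF assms(2)]] show ?thesis by simp
qed

lemma integrable_wcl_of_ord:
 assumes "ord 1 (%t k y x1 x2. f t k y x1 x2 - y)" "wcl r C ph" "0 <= k" "admissible t (t + 2 * k)"
  "half_step_noise P M cm k xi1 xi2" "continuous_on UNIV (%z. f t k y (fst z) (snd z))"
 shows "integrable P (%om. ph (f t k y (xi1 om) (xi2 om)))"
proof -
 obtain B q where B: "B \<ge> 0" "\<And>t k y x1 x2. 0 <= k ==> admissible t (t + 2 * k) ==>
  w r (f t k y x1 x2) <= (B * (1 + norm y) ^ (2 * r)) * (rho k y x1 x2 ^ 0 * (1 + rho k y x1 x2) ^ q)"
  using w_polynomial[OF assms(1), of r] by blast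
 note C0 = wcl_nonneg[OF assms(2)]
 obtain E where E: "\<And>F B t k y xi1 xi2. 0 <= B ==> 0 <= k ==> admissible t (t + 2 * k) ==> half_step_noise P M cm k xi1 xi2 ==>
   (%om. F (xi1 om) (xi2 om) :: real) \<in> borel_measurable P ==>
   (\<forall>x1 x2. norm (F x1 x2) <= B * (rho k y x1 x2 ^ 0 * (1 + rho k y x1 x2) ^ q)) ==>
   integrable P (%om. F (xi1 om) (xi2 om)) \<and> expectation (%om. norm (F (xi1 om) (xi2 om))) <= E * B * sqrt k ^ 0 * (1 + norm y) ^ (0 + q)"
  using expectation_pathwise[of 0 q, where 'w=real] by blast
 have bd: "norm (ph (f t k y x1 x2)) <= (C * (B * (1 + norm y) ^ (2 * r))) * (rho k y x1 x2 ^ 0 * (1 + rho k y x1 x2) ^ q)" for x1 x2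
  using wcl_abs[OF assms(2), of "f t k y x1 x2"] mult_left_mono[OF B(2)[OF assms(3,4), of y x1 x2] C0] by (simp add: mult_ac)
 have c: "continuous_on UNIV (%z. ph (f t k y (fst z) (snd z)))"
  by (rule continuous_on_compose2[OF wcl_continuous[OF assms(2)] assms(6)]) simp
 have m: "(%om. ph (f t k y (xi1 om) (xi2 om))) \<in> borel_measurable P"
  by (rule continuous_imp_measurable_pair[OF assms(5), where f="%x1 x2. ph (f t k y x1 x2)", OF c])
 have "0 <= C * (B * (1 + norm y) ^ (2 * r))" using C0 B(1) by simp
 then show ?thesis using E[OF _ assms(3-5) m allI[OF allI[OF bd]]] by simp
qed

text \<open>Order six and the invariance of the law give k^3, and the number of steps, of the size 1
  / k, turns this into the weak order 2.\<close>

theorem weak_step: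
 "\<exists>C\<ge>0. \<exists>e. \<forall>ph Cph t k y xi1 xi2. wcl r Cph ph --> 0 <= k --> admissible t (t + 2 * k) --> half_step_noise P M cm k xi1 xi2 -->
  integrable P (%om. ph (Psi t k y (xi1 om) (xi2 om))) \<and> integrable P (%om. ph (Phi t k y (xi1 om) (xi2 om))) \<and>
  \<bar>expectation (%om. ph (Psi t k y (xi1 om) (xi2 om))) - expectation (%om. ph (Phi t k y (xi1 om) (xi2 om)))\<bar> <= Cph * C * k ^ 3 * w e y"
proof -
 obtain c e b where c: "0 <= c" "\<And>ph C t k y x1 x2. wcl r C ph ==> 0 <= k ==> admissible t (t + 2 * k) ==>
   \<bar>sym8 (D ph t k y) x1 x2\<bar> <= C * c * (1 + norm y) ^ e * (rho k y x1 x2 ^ 6 * (1 + rho k y x1 x2) ^ b)"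
  using weak_pathwise[of r] by blast
 obtain E where E: "E \<ge> 0" "\<And>F B t k y xi1 xi2. 0 <= B ==> 0 <= k ==> admissible t (t + 2 * k) ==> half_step_noise P M cm k xi1 xi2 ==>
   (%om. F (xi1 om) (xi2 om) :: real) \<in> borel_measurable P ==>
   (\<forall>x1 x2. norm (F x1 x2) <= B * (rho k y x1 x2 ^ 6 * (1 + rho k y x1 x2) ^ b)) ==>
   integrable P (%om. F (xi1 om) (xi2 om)) \<and> expectation (%om. norm (F (xi1 om) (xi2 om))) <= E * B * sqrt k ^ 6 * (1 + norm y) ^ (6 + b)"
  using expectation_pathwise[of 6 b, where 'w=real] by blast
 show ?thesis
 proof (rule exI[of _ "E * c * 2 ^ (e + (6 + b))"], intro conjI exI[of _ "e + (6 + b)"] allI impI)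
  show "0 <= E * c * 2 ^ (e + (6 + b))" using E(1) c(1) by simp
  fix ph :: "'a \<times> 'b => real" and Cph t k y xi1 xi2
  assume cl: "wcl r Cph ph" and k: "0 <= k" "admissible t (t + 2 * k)" and H: "half_step_noise P M cm k xi1 xi2"
  note C0 = wcl_nonneg[OF cl]
  show i1: "integrable P (%om. ph (Psi t k y (xi1 om) (xi2 om)))"
   by (rule integrable_wcl_of_ord[OF ord_Psi cl k H continuous_Phi_Psi(1)[OF k]])
  show i2: "integrable P (%om. ph (Phi t k y (xi1 om) (xi2 om)))"
   by (rule integrable_wcl_of_ord[OF ord_Phi(1) cl k H continuous_Phi_Psi(2)[OF k]])
  have cD: "continuous_on UNIV (%z. D ph t k y (fst z) (snd z))"
   unfolding D_def by (intro continuous_on_diff continuous_on_compose2[OF wcl_continuous[OF cl]] continuous_Phi_Psi k) auto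
  have iD: "integrable P (%om. D ph t k y (xi1 om) (xi2 om))"
   unfolding D_def by (intro Bochner_Integration.integrable_diff i1 i2)
  have eD: "expectation (%om. D ph t k y (xi1 om) (xi2 om)) = expectation (%om. ph (Psi t k y (xi1 om) (xi2 om))) - expectation (%om. ph (Phi t k y (xi1 om) (xi2 om)))"
   unfolding D_def by (rule Bochner_Integration.integral_diff[OF i1 i2])
  have c8: "continuous_on UNIV (%z. sym8 (D ph t k y) (fst z) (snd z))"
  proof -
   have cc: "continuous_on UNIV (%z :: (nat => real) \<times> (nat => real). D ph t k y (f z) (g z))" if "continuous_on UNIV f" "continuous_on UNIV g" for f g
    using continuous_on_compose2[OF cD continuous_on_Pair[OF that]] by simp
   show ?thesis unfolding sym8_def
    by (intro continuous_on_add cc continuous_on_fst continuous_on_snd continuous_fun_uminus continuous_on_id)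
  qed
  have m8: "(%om. sym8 (D ph t k y) (xi1 om) (xi2 om)) \<in> borel_measurable P"
   by (rule continuous_imp_measurable_pair[OF H c8])
  have b8: "\<forall>x1 x2. norm (sym8 (D ph t k y) x1 x2) <= (Cph * c * (1 + norm y) ^ e) * (rho k y x1 x2 ^ 6 * (1 + rho k y x1 x2) ^ b)"
   using c(2)[OF cl k] by simp
  have "0 <= Cph * c * (1 + norm y) ^ e" using C0 c(1) by simp
  note e8 = E(2)[OF this k H m8 b8]
  have "8 * \<bar>expectation (%om. D ph t k y (xi1 om) (xi2 om))\<bar> = \<bar>expectation (%om. sym8 (D ph t k y) (xi1 om) (xi2 om))\<bar>"
   unfolding expectation_sym8[OF H cD iD] by (simp add: abs_mult)
  also have "... <= expectation (%om. norm (sym8 (D ph t k y) (xi1 om) (xi2 om)))"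
   using integral_norm_bound[of P "%om. sym8 (D ph t k y) (xi1 om) (xi2 om)"] by simp
  also have "... <= E * (Cph * c * (1 + norm y) ^ e) * sqrt k ^ 6 * (1 + norm y) ^ (6 + b)" using e8 by simp
  also have "... = Cph * (E * c) * k ^ 3 * (1 + norm y) ^ (e + (6 + b))" unfolding sqrt_power6[OF k(1)] power_add by (simp add: mult_ac)
  also have "... <= Cph * (E * c) * k ^ 3 * (2 ^ (e + (6 + b)) * w (e + (6 + b)) y)"
   using C0 E(1) c(1) k(1) by (intro mult_left_mono one_plus_norm_le_w) auto
  finally have "8 * \<bar>expectation (%om. D ph t k y (xi1 om) (xi2 om))\<bar> <= Cph * (E * c * 2 ^ (e + (6 + b))) * k ^ 3 * w (e + (6 + b)) y" by (simp add: mult_ac)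
  then show "\<bar>expectation (%om. ph (Psi t k y (xi1 om) (xi2 om))) - expectation (%om. ph (Phi t k y (xi1 om) (xi2 om)))\<bar>
   <= Cph * (E * c * 2 ^ (e + (6 + b))) * k ^ 3 * w (e + (6 + b)) y"
   unfolding eD[symmetric] by linarith
 qed
qed

text \<open>Two separate reasons: the second moment is O(k^3) as the square of order three, the mean
  is O(k^3) because the sum over the symmetries is of order six. Differences of size k^(3/2) without
  cancellation in the mean would only accumulate to order 1 / 2.\<close>

theorem strong_step:
 "\<exists>C\<ge>0. \<exists>e. \<forall>t k y xi1 xi2. 0 <= k --> admissible t (t + 2 * k) --> half_step_noise P M cm k xi1 xi2 -->
  integrable P (%om. del t k y (xi1 om) (xi2 om)) \<and> integrable P (%om. (norm (del t k y (xi1 om) (xi2 om)))\<^sup>2) \<and>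
  expectation (%om. (norm (del t k y (xi1 om) (xi2 om)))\<^sup>2) <= C * k ^ 3 * w e y \<and>
  norm (expectation (%om. del t k y (xi1 om) (xi2 om))) <= C * k ^ 3 * w e y"
proof -
 have s8: "ord 6 (%t k y x1 x2. sym8 (del t k y) x1 x2)"
  by (rule ord_cong[OF ord_del(4)]) (simp add: sym8_def algebra_simps)
 have d2: "ord 6 (%t k y x1 x2. (norm (del t k y x1 x2))\<^sup>2)"
  unfolding power2_eq_square by (rule ord_mult[OF ord_norm[OF ord_del(1)] ord_norm[OF ord_del(1)]]) simp
 have "ord 6 (%t k y x1 x2. norm (sym8 (del t k y) x1 x2) + (norm (del t k y x1 x2))^2)"
  by (intro ord_add ord_norm s8 d2)
 then obtain c b where c: "0 <= c" "\<And>t k y x1 x2. 0 <= k ==> admissible t (t + 2 * k) ==>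
   norm (norm (sym8 (del t k y) x1 x2) + (norm (del t k y x1 x2))^2) <= c * rho k y x1 x2 ^ 6 * (1 + rho k y x1 x2) ^ b"
  by (erule_tac ordE) blast
 obtain E where E: "E \<ge> 0" "\<And>F B t k y xi1 xi2. 0 <= B ==> 0 <= k ==> admissible t (t + 2 * k) ==> half_step_noise P M cm k xi1 xi2 ==>
   (%om. F (xi1 om) (xi2 om) :: real) \<in> borel_measurable P ==>
   (\<forall>x1 x2. norm (F x1 x2) <= B * (rho k y x1 x2 ^ 6 * (1 + rho k y x1 x2) ^ b)) ==>
   integrable P (%om. F (xi1 om) (xi2 om)) \<and> expectation (%om. norm (F (xi1 om) (xi2 om))) <= E * B * sqrt k ^ 6 * (1 + norm y) ^ (6 + b)"
  using expectation_pathwise[of 6 b, where 'w=real] by blast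
 obtain E' where E': "E' \<ge> 0" "\<And>F B t k y xi1 xi2. 0 <= B ==> 0 <= k ==> admissible t (t + 2 * k) ==> half_step_noise P M cm k xi1 xi2 ==>
   (%om. F (xi1 om) (xi2 om) :: 'a \<times> 'b) \<in> borel_measurable P ==>
   (\<forall>x1 x2. norm (F x1 x2) <= B * (rho k y x1 x2 ^ 6 * (1 + rho k y x1 x2) ^ b)) ==>
   integrable P (%om. F (xi1 om) (xi2 om)) \<and> expectation (%om. norm (F (xi1 om) (xi2 om))) <= E' * B * sqrt k ^ 6 * (1 + norm y) ^ (6 + b)"
  using expectation_pathwise[of 6 b, where 'w="'a \<times> 'b"] by blast
 let ?C = "(E + E') * c * 2 ^ (6 + b)"
 show ?thesis
 proof (rule exI[of _ ?C], intro conjI exI[of _ "6 + b"] allI impI)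
  show "0 <= ?C" using E(1) E'(1) c(1) by simp
  fix t k y xi1 xi2
  assume k: "0 <= k" "admissible t (t + 2 * k)" and H: "half_step_noise P M cm k xi1 xi2"
  let ?d = "%om. del t k y (xi1 om) (xi2 om)"
  have cd: "continuous_on UNIV (%z. del t k y (fst z) (snd z))"
   unfolding del_def by (intro continuous_on_diff continuous_Phi_Psi k)
  have c8: "continuous_on UNIV (%z. sym8 (del t k y) (fst z) (snd z))"
  proof -
   have cc: "continuous_on UNIV (%z :: (nat => real) \<times> (nat => real). del t k y (f z) (g z))" if "continuous_on UNIV f" "continuous_on UNIV g" for f g
    using continuous_on_compose2[OF cd continuous_on_Pair[OF that]] by simp
   show ?thesis unfolding sym8_def
    by (intro continuous_on_add cc continuous_on_fst continuous_on_snd continuous_fun_uminus continuous_on_id)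
  qed
  have md: "?d \<in> borel_measurable P" by (rule continuous_imp_measurable_pair[OF H cd])
  have m8: "(%om. sym8 (del t k y) (xi1 om) (xi2 om)) \<in> borel_measurable P" by (rule continuous_imp_measurable_pair[OF H c8])
  have b8: "norm (sym8 (del t k y) x1 x2) <= c * (rho k y x1 x2 ^ 6 * (1 + rho k y x1 x2) ^ b)"
   and bd: "norm ((norm (del t k y x1 x2))^2) <= c * (rho k y x1 x2 ^ 6 * (1 + rho k y x1 x2) ^ b)" for x1 x2
   using c(2)[OF k, of y x1 x2] norm_ge_zero[of "sym8 (del t k y) x1 x2"] zero_le_power2[of "norm (del t k y x1 x2)"]
   unfolding mult.assoc real_norm_def by linarith+
  have md2: "(%om. (norm (?d om))\<^sup>2) \<in> borel_measurable P" using md by simp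
  note e2 = E(2)[OF c(1) k H md2, of y, OF allI[OF allI[OF bd]]]
  note e8 = E'(2)[OF c(1) k H m8, of y, OF allI[OF allI[OF b8]]]
  show i2: "integrable P (%om. (norm (?d om))\<^sup>2)" using e2 by simp
  show id: "integrable P ?d"
  proof (rule Bochner_Integration.integrable_bound[OF _ md])
   show "integrable P (%om. 1 + (norm (?d om))^2)" using i2 by simp
   have "norm (?d om) <= 1 + (norm (?d om))^2" for om
   proof -
    have "2 * norm (?d om) <= 1 + (norm (?d om))^2" using sum_squares_bound[of 1 "norm (?d om)"] by simp
    then show ?thesis using norm_ge_zero[of "?d om"] by linarith
   qed
   then show "AE om in P. norm (?d om) <= norm (1 + (norm (?d om))^2)" by auto
  qed
  have fin: "F * c * sqrt k ^ 6 * (1 + norm y) ^ (6 + b) <= ?C * k ^ 3 * w (6 + b) y" if "0 <= F" "F <= E + E'" for F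
  proof -
   have "F * c * sqrt k ^ 6 * (1 + norm y) ^ (6 + b) <= F * c * k ^ 3 * (2 ^ (6 + b) * w (6 + b) y)"
    unfolding sqrt_power6[OF k(1)] using that c(1) k(1) by (intro mult_left_mono one_plus_norm_le_w) auto
   also have "... = F * (c * k ^ 3 * (2 ^ (6 + b) * w (6 + b) y))" by simp
   also have "... <= (E + E') * (c * k ^ 3 * (2 ^ (6 + b) * w (6 + b) y))" using that c(1) k(1) by (intro mult_right_mono) auto
   finally show ?thesis by (simp add: mult_ac)
  qed
  show "expectation (%om. (norm (?d om))\<^sup>2) <= ?C * k ^ 3 * w (6 + b) y"
   using e2 fin[of E] E(1) E'(1) by simp
  have "8 * norm (expectation ?d) = norm (expectation (%om. sym8 (del t k y) (xi1 om) (xi2 om)))"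
   unfolding expectation_sym8[OF H cd id] by simp
  also have "... <= expectation (%om. norm (sym8 (del t k y) (xi1 om) (xi2 om)))" by (rule integral_norm_bound)
  also have "... <= ?C * k ^ 3 * w (6 + b) y" using e8 fin[of E'] E(1) E'(1) by simp
  finally show "norm (expectation ?d) <= ?C * k ^ 3 * w (6 + b) y" using norm_ge_zero[of "expectation ?d"] by linarith
 qed
qed

end

section \<open>Propagation of observables by one step\<close>

lemma b2_growth:
 fixes al1 al2 be ka :: real
 assumes "0 <= al1" "0 <= al2" "0 <= be" "0 <= ka" "ka <= 10"
 shows "(be + ka * (be + al1 * al2)) + ((1 + ka) * al1) * ((1 + ka) * al2) <= (1 + 200 * ka) * (be + al1 * al2)"
proof -
 define p where "p = al1 * al2"
 have p: "0 <= p" using assms by (simp add: p_def)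
 have "ka * ka <= 10 * ka" using assms by (intro mult_right_mono) auto
 then have "(ka * ka) * p <= (10 * ka) * p" using p by (rule mult_right_mono)
 moreover have "0 <= ka * p" "0 <= ka * be" using p assms by auto
 moreover have "((1 + ka) * al1) * ((1 + ka) * al2) = p + 2 * (ka * p) + (ka * ka) * p" by (simp add: p_def algebra_simps)
 ultimately show ?thesis unfolding p_def[symmetric] by (simp add: algebra_simps)
qed

text \<open>The combination \<open>b3\<close> is stable under the simultaneous growth of edges, face
  defects and third difference. With \<open>ka <= 10\<close> the worst coefficient, that of the
  product of the edges, is 7 + 6 * 10 + 100 = 167, which explains the 200.\<close>

lemma b3_growth:
 fixes al1 al2 al3 be12 be13 be23 ga ka :: real
 assumes "0 <= al1" "0 <= al2" "0 <= al3" "0 <= be12" "0 <= be13" "0 <= be23" "0 <= ga" "0 <= ka" "ka <= 10"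
 shows "b3 ((1 + ka) * al1) ((1 + ka) * al2) ((1 + ka) * al3) (be12 + ka * (be12 + al1 * al2)) (be13 + ka * (be13 + al1 * al3))
   (be23 + ka * (be23 + al2 * al3)) (ga + ka * b3 al1 al2 al3 be12 be13 be23 ga)
  <= (1 + 200 * ka) * b3 al1 al2 al3 be12 be13 be23 ga" (is "?L <= ?R")
proof -
 define p s where "p = al1 * al2 * al3" and "s = al1 * be23 + al2 * be13 + al3 * be12"
 have p: "0 <= p" and s: "0 <= s" using assms by (auto simp: p_def s_def)
 have k2: "ka * ka <= 10 * ka" using assms by (intro mult_right_mono) auto
 have k3: "ka * ka * ka <= 100 * ka" using mult_right_mono[OF k2, of ka] k2 assms by simp
 have "(ka * ka) * p <= (10 * ka) * p" "(ka * ka) * s <= (10 * ka) * s" "(ka * ka * ka) * p <= (100 * ka) * p"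
  using p s k2 k3 by (auto intro: mult_right_mono)
 moreover have "0 <= ka * p" "0 <= ka * s" "0 <= ka * ga" using p s assms by auto
 moreover have "?L = ga + ka * ga + s + 3 * (ka * s) + (ka * ka) * s + p + 7 * (ka * p) + 6 * ((ka * ka) * p) + (ka * ka * ka) * p"
  by (simp add: p_def s_def algebra_simps)
 moreover have "?R = ga + s + p + 200 * (ka * ga) + 200 * (ka * s) + 200 * (ka * p)"
  by (simp add: p_def s_def algebra_simps)
 ultimately show ?thesis by linarith
qed

context noisy_scheme
begin

lemma noise_momD:
 assumes "noise_mom P M cm h xi"
 shows "xi \<in> borel_measurable P" "integrable P (%om. n (xi om) ^ p)" "integrable P (%om. n (xi om))"
  "distr P borel (%om m. - xi om m) = distr P borel xi"
proof -
 have *: "integrable P (%om. n (xi om) ^ p)" for p using assms by (simp add: noise_mom_def)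
 show "integrable P (%om. n (xi om) ^ p)" "integrable P (%om. n (xi om))" using *[of p] *[of 1] by auto
qed (use assms in \<open>auto simp: noise_mom_def\<close>)

lemma measurable_stp:
 assumes "admissible s s'" "xi \<in> borel_measurable P"
 shows "(%om. stp s s' (xi om) y) \<in> borel_measurable P"
proof -
 have "continuous_on UNIV (%x. stp s s' x y)"
  by (intro continuous_stp' assms(1) continuous_on_id continuous_on_const)
 from measurable_compose[OF assms(2) borel_measurable_continuous_onI[OF this]] show ?thesis by simp
qed

lemma measurable_w [measurable]: "(%x. w r x) \<in> borel_measurable borel"
 unfolding wR_def by measurable

text \<open>In \<open>growth_pathwise\<close> the term of first order is odd in the noise, so the
  symmetric law gives it mean zero. The second order moments that remain are of the size of the
  step.\<close>

lemma growth_step: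
 "\<exists>C\<ge>0. \<forall>s s' xi y. admissible s s' --> noise_mom P M cm (s' - s) xi -->
  integrable P (%om. w r (stp s s' (xi om) y)) \<and>
  expectation (%om. w r (stp s s' (xi om) y)) <= (1 + C * (s' - s)) * w r y"
proof -
 obtain c b where c: "0 <= c" and cb: "\<And>s s' xi y. admissible s s' ==>
  w r (stp s s' xi y) <= w r y * (1 + (2 * real r / (1 + (norm y)^2)) * (y \<bullet> ((1/2) *R (Sg s xi + Sg s' xi)))
    + c * ((sqrt (s' - s) + n xi)^2 * (1 + (sqrt (s' - s) + n xi)) ^ b))"
  using growth_pathwise[of r] by blast
 obtain C where C0: "0 <= C" and C: "\<And>h N. 0 <= h ==> h <= 1 ==> (\<forall>om. 0 <= N om) ==>
  (\<forall>p. integrable P (%om. N om ^ p) \<and> expectation (%om. N om ^ p) <= cm p * sqrt h ^ p) ==>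
  integrable P (%om. (sqrt h + N om) ^ 2 * (1 + (sqrt h + N om)) ^ b) \<and>
  expectation (%om. (sqrt h + N om) ^ 2 * (1 + (sqrt h + N om)) ^ b) <= C * sqrt h ^ 2"
  using moment_bound[where cm=cm and p=2 and q=b, OF cm_nonneg] by blast
 show ?thesis
 proof (rule exI[of _ "c * C"], intro conjI allI impI)
  show "0 <= c * C" using c C0 by simp
  fix s s' xi y assume ad: "admissible s s'" and nm: "noise_mom P M cm (s' - s) xi"
  note ad' = admissibleD[OF ad] and nm' = noise_momD[OF nm]
  let ?h = "s' - s"
  have h: "0 <= ?h" "?h <= 1" using ad' by auto
  let ?u = "%om. (sqrt ?h + n (xi om))\<^sup>2 * (1 + (sqrt ?h + n (xi om))) ^ b"
  have U: "integrable P ?u" "expectation ?u <= C * ?h"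
   using C[OF h, of "%om. n (xi om)"] nm h by (auto simp: noise_mom_def)
  define f where "f x = y \<bullet> ((1/2) *R (Sg s x + Sg s' x))" for x
  have fc: "continuous_on UNIV f"
   unfolding f_def noise_def by (intro continuous_intros continuous_on_product_coordinates)
  have fm: "f \<in> borel_measurable borel" by (rule borel_measurable_continuous_onI[OF fc])
  have fn: "\<bar>f x\<bar> <= norm y * (K * n x)" for x
   unfolding f_def using Cauchy_Schwarz_ineq2[of y] norm_half_noise[OF ad'(1,2)]
   by (meson mult_left_mono norm_ge_zero order_trans)
  have fi: "integrable P (%om. f (xi om))"
  proof (rule Bochner_Integration.integrable_bound)
   show "integrable P (%om. norm y * (K * n (xi om)))" using nm'(3) by simp
   show "(%om. f (xi om)) \<in> borel_measurable P" using measurable_compose[OF nm'(1) fm] .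
   show "AE om in P. norm (f (xi om)) <= norm (norm y * (K * n (xi om)))"
    using fn by (auto intro!: AE_I2 order_trans[OF fn] abs_ge_self)
  qed
  have ngm: "(%om. ng (xi om)) \<in> borel_measurable P"
  proof -
   have "ng \<in> borel_measurable borel" by (intro borel_measurable_continuous_onI continuous_fun_uminus continuous_on_id)
   from measurable_compose[OF nm'(1) this] show ?thesis .
  qed
  have "expectation (%om. f (ng (xi om))) = expectation (%om. f (xi om))"
   using integral_distr[OF nm'(1) fm] integral_distr[OF ngm fm] nm'(4) by simp
  moreover have "f (ng x) = - f x" for x
   unfolding f_def noise_uminus inner_scaleR_right inner_add_right inner_minus_right by (simp add: field_simps)
  ultimately have f0: "expectation (%om. f (xi om)) = 0" by simp
  let ?G = "%om. w r y * (1 + (2 * real r / (1 + (norm y)^2)) * f (xi om) + c * ?u om)"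
  have le: "w r (stp s s' (xi om) y) <= ?G om" for om unfolding f_def by (rule cb[OF ad])
  have iG: "integrable P ?G"
   by (intro integrable_mult_right Bochner_Integration.integrable_add fi U(1)) simp
  have m: "(%om. w r (stp s s' (xi om) y)) \<in> borel_measurable P"
   using measurable_compose[OF measurable_stp[OF ad nm'(1)] measurable_w] .
  show i: "integrable P (%om. w r (stp s s' (xi om) y))"
   by (rule Bochner_Integration.integrable_bound[OF iG m]) (auto intro!: AE_I2 order_trans[OF le] abs_ge_self)
  have "expectation (%om. w r (stp s s' (xi om) y)) <= expectation ?G"
   by (rule integral_mono[OF i iG le])
  also have "... = w r y * (1 + (2 * real r / (1 + (norm y)^2)) * 0 + c * expectation ?u)"
   using fi U(1) f0 by (simp add: prob_space)
  also have "... <= w r y * (1 + (2 * real r / (1 + (norm y)^2)) * 0 + c * (C * ?h))"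
   using U(2) c by (intro mult_left_mono add_left_mono) auto
  finally show "expectation (%om. w r (stp s s' (xi om) y)) <= (1 + c * C * (s' - s)) * w r y" by (simp add: mult_ac)
 qed
qed

text \<open>The factor 40 of the third differences is used for edges and squares too, so that a
  single parameter \<open>ka\<close> enters the growth lemmas.\<close>

lemma stp_sqb:
 assumes "admissible s s'" "sqb y al1 al2 be"
 shows "sqb (%i j. stp s s' xi (y i j)) ((1 + 40 * ((s' - s) * K)) * al1) ((1 + 40 * ((s' - s) * K)) * al2)
   (be + 40 * ((s' - s) * K) * (be + al1 * al2))"
proof -
 note ad = admissibleD[OF assms(1)]
 note nn = sqb_nonneg[OF assms(2)]
 let ?k = "(s' - s) * K"
 have lip: "norm (stp s s' xi u - stp s s' xi v) <= (1 + 40 * ?k) * e" if "norm (u - v) <= e" for u v e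
 proof -
  have "norm (stp s s' xi u - stp s s' xi v) <= (1 + 2 * ?k) * norm (u - v)" by (rule stp_lip[OF assms(1)])
  also have "... <= (1 + 40 * ?k) * e"
  proof -
   have "0 <= ?k" using ad(4) K_ge1 ad(3) by simp
   moreover have "0 <= e" using that norm_ge_zero order_trans by blast
   ultimately show ?thesis using that norm_ge_zero[of "u - v"] by (intro mult_mono) linarith+
  qed
  finally show ?thesis .
 qed
 have "norm (d2 (%i j. stp s s' xi (y i j))) <= norm (d2 y) + 8 * ?k * (be + al1 * al2)"
  using stp_d2[OF assms, of xi] norm_triangle_sub[of "d2 (%i j. stp s s' xi (y i j))" "d2 y"] by linarith
 also have "... <= be + 40 * ?k * (be + al1 * al2)"
  using assms(2) ad nn by (intro add_mono mult_right_mono) (auto simp: sqb_def)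
 finally show ?thesis using assms(2) lip by (simp add: sqb_def)
qed

lemma stp_cubeb:
 assumes "admissible s s'" "cubeb y al1 al2 al3 be12 be13 be23 ga"
 shows "cubeb (%i j k. stp s s' xi (y i j k)) ((1 + 40 * ((s' - s) * K)) * al1) ((1 + 40 * ((s' - s) * K)) * al2) ((1 + 40 * ((s' - s) * K)) * al3)
   (be12 + 40 * ((s' - s) * K) * (be12 + al1 * al2)) (be13 + 40 * ((s' - s) * K) * (be13 + al1 * al3)) (be23 + 40 * ((s' - s) * K) * (be23 + al2 * al3))
   (ga + 40 * ((s' - s) * K) * b3 al1 al2 al3 be12 be13 be23 ga)"
proof -
 have "norm (d3 (%i j k. stp s s' xi (y i j k))) <= norm (d3 y) + 40 * ((s' - s) * K) * b3 al1 al2 al3 be12 be13 be23 ga"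
  using stp_d3[OF assms, of xi] norm_triangle_sub[of "d3 (%i j k. stp s s' xi (y i j k))" "d3 y"] by linarith
 also have "norm (d3 y) <= ga" using assms(2) by (simp add: cubeb_def)
 finally have d: "norm (d3 (%i j k. stp s s' xi (y i j k))) <= ga + 40 * ((s' - s) * K) * b3 al1 al2 al3 be12 be13 be23 ga" by simp
 show ?thesis unfolding cubeb_def
 proof (intro conjI allI d)
  fix l :: bool
  show "sqb (%i j. stp s s' xi (y i j l)) ((1 + 40 * ((s' - s) * K)) * al1) ((1 + 40 * ((s' - s) * K)) * al2) (be12 + 40 * ((s' - s) * K) * (be12 + al1 * al2))"
   "sqb (%i k. stp s s' xi (y i l k)) ((1 + 40 * ((s' - s) * K)) * al1) ((1 + 40 * ((s' - s) * K)) * al3) (be13 + 40 * ((s' - s) * K) * (be13 + al1 * al3))"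
   "sqb (%j k. stp s s' xi (y l j k)) ((1 + 40 * ((s' - s) * K)) * al2) ((1 + 40 * ((s' - s) * K)) * al3) (be23 + 40 * ((s' - s) * K) * (be23 + al2 * al3))"
   by (rule stp_sqb[OF assms(1)], use assms(2) in \<open>simp add: cubeb_def\<close>)+
 qed
qed

text \<open>Two sources of growth multiply: the mean weight of the moved vertices, and the
  differences between them. All vertices are moved with the same noise, so the differences are
  stable path by path, before the mean is taken.\<close>

theorem Q_step:
 "\<exists>c\<ge>0. \<forall>ph C s s' xi. wcl r C ph --> admissible s s' --> noise_mom P M cm (s' - s) xi -->
  (\<forall>y. integrable P (%om. ph (stp s s' (xi om) y))) \<and>
  wcl r (C * (1 + c * (s' - s))) (%y. expectation (%om. ph (stp s s' (xi om) y)))"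
proof -
 obtain G where G0: "0 <= G" and G: "\<And>s s' xi y. admissible s s' ==> noise_mom P M cm (s' - s) xi ==>
  integrable P (%om. w r (stp s s' (xi om) y)) \<and>
  expectation (%om. w r (stp s s' (xi om) y)) <= (1 + G * (s' - s)) * w r y"
  using growth_step[of r] by blast
 \<comment> \<open>8000 = 200 * 40; the product of the two growth terms is made linear in the step
   by h <= 1.\<close>
 let ?c = "G + 8000 * K + G * (8000 * K)"
 show ?thesis
 proof (rule exI[of _ ?c], intro conjI allI impI)
  show "0 <= ?c" using G0 K_ge1 by simp
  fix ph :: "'a \<times> 'b => real" and C s s' xi
  assume cl: "wcl r C ph" and ad: "admissible s s'" and nm: "noise_mom P M cm (s' - s) xi"
  note C0 = wcl_nonneg[OF cl] and ad' = admissibleD[OF ad]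
  define h ka where "h = s' - s" and "ka = 40 * (h * K)"
  have h: "0 <= h" "h <= 1" using ad' by (auto simp: h_def)
  have k: "0 <= ka" "ka <= 10" using ad'(4,6) unfolding h_def ka_def by linarith+
  define F where "F = (1 + G * h) * (1 + 200 * ka)"
  have F: "F <= 1 + ?c * h"
  proof -
   have "(G * 8000 * K * h) * h <= (G * 8000 * K * h) * 1" using h G0 K_ge1 by (intro mult_left_mono) auto
   then show ?thesis by (simp add: F_def ka_def algebra_simps)
  qed
  have F1: "1 + G * h <= F" "0 <= F"
   using G0 h k mult_left_mono[of 1 "1 + 200 * ka" "1 + G * h"] by (auto simp: F_def)
  let ?X = "%y om. stp s s' (xi om) y"
  define Q where "Q y = expectation (%om. ph (?X y om))" for y
  have iw: "integrable P (%om. w r (?X y om))" and ew: "expectation (%om. w r (?X y om)) <= (1 + G * h) * w r y" for y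
   using G[OF ad nm, of y] by (auto simp: h_def)
  have i: "integrable P (%om. ph (?X y om))" for y
  proof (rule Bochner_Integration.integrable_bound)
   show "integrable P (%om. C * w r (?X y om))" using iw by simp
   show "(%om. ph (?X y om)) \<in> borel_measurable P"
    using measurable_compose[OF measurable_stp[OF ad noise_momD(1)[OF nm]] borel_measurable_continuous_onI[OF wcl_continuous[OF cl]]] .
   show "AE om in P. norm (ph (?X y om)) <= norm (C * w r (?X y om))"
    using wcl_abs[OF cl] by (auto intro!: AE_I2 order_trans[OF wcl_abs[OF cl]] abs_ge_self)
  qed
  show "integrable P (%om. ph (?X y om))" for y by (rule i)
  have eb: "\<bar>expectation f\<bar> <= C * (1 + ?c * h) * S0 * B"
   if f: "integrable P f" "\<And>om. \<bar>f om\<bar> <= C * S om * ((1 + 200 * ka) * B)" and S: "integrable P S" "expectation S <= (1 + G * h) * S0" and B: "0 <= B" "0 <= S0" for f S S0 B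
  proof -
   have "\<bar>expectation f\<bar> <= expectation (%om. \<bar>f om\<bar>)" using integral_norm_bound[of P f] by simp
   also have "... <= expectation (%om. C * S om * ((1 + 200 * ka) * B))"
    using f S by (intro integral_mono) auto
   also have "... = (C * ((1 + 200 * ka) * B)) * expectation S" by (simp add: mult_ac)
   also have "... <= (C * ((1 + 200 * ka) * B)) * ((1 + G * h) * S0)" using S(2) C0 k B by (intro mult_left_mono) auto
   also have "... = F * (C * (S0 * B))" by (simp add: F_def)
   also have "... <= (1 + ?c * h) * (C * (S0 * B))" using F C0 B by (intro mult_right_mono) auto
   finally show ?thesis by (simp add: mult_ac)
  qed
  have k1: "1 <= 1 + 200 * ka" using k by simp
  have "wcl r (C * (1 + ?c * h)) Q"
   unfolding wcl_def
  proof (intro conjI allI impI)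
   show "0 <= C * (1 + ?c * h)" using C0 F F1(2) by (intro mult_nonneg_nonneg) linarith+
   fix y
   have "\<bar>Q y\<bar> <= C * (1 + ?c * h) * w r y * 1"
    unfolding Q_def
   proof (rule eb[OF i _ iw ew])
    fix om
    have "C * w r (?X y om) * 1 <= C * w r (?X y om) * ((1 + 200 * ka) * 1)" using C0 k by (intro mult_left_mono) auto
    then show "\<bar>ph (?X y om)\<bar> <= C * w r (?X y om) * ((1 + 200 * ka) * 1)"
     using wcl_abs[OF cl, of "?X y om"] by simp
   qed auto
   then show "\<bar>Q y\<bar> <= C * (1 + ?c * h) * w r y" by simp
   fix x
   have "\<bar>expectation (%om. ph (?X y om) - ph (?X x om))\<bar> <= C * (1 + ?c * h) * (w r y + w r x) * norm (y - x)"
   proof (rule eb)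
    show "integrable P (%om. ph (?X y om) - ph (?X x om))" using i by simp
    show "integrable P (%om. w r (?X y om) + w r (?X x om))" using iw by simp
    show "expectation (%om. w r (?X y om) + w r (?X x om)) <= (1 + G * h) * (w r y + w r x)"
     using ew[of y] ew[of x] iw by (simp add: distrib_left)
    fix om
    have "\<bar>ph (?X y om) - ph (?X x om)\<bar> <= C * (w r (?X y om) + w r (?X x om)) * norm (?X y om - ?X x om)"
     by (rule wcl_diff[OF cl])
    also have "norm (?X y om - ?X x om) <= (1 + 2 * (h * K)) * norm (y - x)" unfolding h_def by (rule stp_lip[OF ad])
    also have "... <= (1 + 200 * ka) * norm (y - x)" using h K_ge1 by (intro mult_right_mono) (auto simp: ka_def)
    finally show "\<bar>ph (?X y om) - ph (?X x om)\<bar> <= C * (w r (?X y om) + w r (?X x om)) * ((1 + 200 * ka) * norm (y - x))"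
     using C0 by (simp add: mult_left_mono)
   qed auto
   then show "\<bar>Q y - Q x\<bar> <= C * (1 + ?c * h) * (w r y + w r x) * norm (y - x)"
    unfolding Q_def using i by simp
  next
   fix x :: "bool => bool => 'a \<times> 'b" and al1 al2 be assume sq: "sqb x al1 al2 be"
   note nn = sqb_nonneg[OF sq]
   have "\<bar>expectation (%om. d2 (%i j. ph (?X (x i j) om)))\<bar> <= C * (1 + ?c * h) * (\<Sum>i\<in>UNIV. \<Sum>j\<in>UNIV. w r (x i j)) * (be + al1 * al2)"
   proof (rule eb)
    show "integrable P (%om. d2 (%i j. ph (?X (x i j) om)))" unfolding d2_def using i by simp
    show "integrable P (%om. \<Sum>i\<in>UNIV. \<Sum>j\<in>UNIV. w r (?X (x i j) om))" using iw by simp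
    have "expectation (%om. \<Sum>i\<in>UNIV. \<Sum>j\<in>UNIV. w r (?X (x i j) om)) = (\<Sum>i\<in>UNIV. \<Sum>j\<in>UNIV. expectation (%om. w r (?X (x i j) om)))"
     using iw by simp
    also have "... <= (\<Sum>i\<in>UNIV. \<Sum>j\<in>UNIV. (1 + G * h) * w r (x i j))" by (intro sum_mono ew)
    finally show "expectation (%om. \<Sum>i\<in>UNIV. \<Sum>j\<in>UNIV. w r (?X (x i j) om)) <= (1 + G * h) * (\<Sum>i\<in>UNIV. \<Sum>j\<in>UNIV. w r (x i j))"
     by (simp add: sum_distrib_left)
    show "0 <= be + al1 * al2" using nn by simp
    show "0 <= (\<Sum>i\<in>UNIV. \<Sum>j\<in>UNIV. w r (x i j))" by (intro sum_nonneg) simp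
    fix om
    have "\<bar>d2 (%i j. ph (?X (x i j) om))\<bar> <= C * (\<Sum>i\<in>UNIV. \<Sum>j\<in>UNIV. w r (?X (x i j) om)) * ((be + ka * (be + al1 * al2)) + ((1 + ka) * al1) * ((1 + ka) * al2))"
     using wcl_sq[OF cl stp_sqb[OF ad sq, of "xi om"]] unfolding ka_def h_def .
    also have "... <= C * (\<Sum>i\<in>UNIV. \<Sum>j\<in>UNIV. w r (?X (x i j) om)) * ((1 + 200 * ka) * (be + al1 * al2))"
     using nn k C0 by (intro mult_left_mono b2_growth mult_nonneg_nonneg sum_nonneg) auto
    finally show "\<bar>d2 (%i j. ph (?X (x i j) om))\<bar> <= C * (\<Sum>i\<in>UNIV. \<Sum>j\<in>UNIV. w r (?X (x i j) om)) * ((1 + 200 * ka) * (be + al1 * al2))" .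
   qed
   then show "\<bar>d2 (%i j. Q (x i j))\<bar> <= C * (1 + ?c * h) * (\<Sum>i\<in>UNIV. \<Sum>j\<in>UNIV. w r (x i j)) * (be + al1 * al2)"
    unfolding Q_def d2_def using i by simp
  next
   fix x :: "bool => bool => bool => 'a \<times> 'b" and al1 al2 al3 be12 be13 be23 ga assume cb: "cubeb x al1 al2 al3 be12 be13 be23 ga"
   note nn = cubeb_nonneg[OF cb]
   let ?S = "%f. \<Sum>i\<in>(UNIV::bool set). \<Sum>j\<in>(UNIV::bool set). \<Sum>k\<in>(UNIV::bool set). f (x i j k) :: real"
   have "\<bar>expectation (%om. d3 (%i j k. ph (?X (x i j k) om)))\<bar> <= C * (1 + ?c * h) * ?S (w r) * b3 al1 al2 al3 be12 be13 be23 ga"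
   proof (rule eb)
    show "integrable P (%om. d3 (%i j k. ph (?X (x i j k) om)))" unfolding d3_def d2_def using i by simp
    show "integrable P (%om. ?S (%y. w r (?X y om)))" using iw by simp
    have "expectation (%om. ?S (%y. w r (?X y om))) = ?S (%y. expectation (%om. w r (?X y om)))"
     using iw by simp
    also have "... <= ?S (%y. (1 + G * h) * w r y)" by (intro sum_mono ew)
    finally show "expectation (%om. ?S (%y. w r (?X y om))) <= (1 + G * h) * ?S (w r)"
     by (simp add: sum_distrib_left)
    show "0 <= b3 al1 al2 al3 be12 be13 be23 ga" using nn by simp
    show "0 <= ?S (w r)" by (intro sum_nonneg) simp
    fix om
    have S0: "0 <= ?S (%y. w r (?X y om))" by (intro sum_nonneg) simp
    have "\<bar>d3 (%i j k. ph (?X (x i j k) om))\<bar> <= C * ?S (%y. w r (?X y om)) *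
      b3 ((1 + ka) * al1) ((1 + ka) * al2) ((1 + ka) * al3) (be12 + ka * (be12 + al1 * al2)) (be13 + ka * (be13 + al1 * al3))
       (be23 + ka * (be23 + al2 * al3)) (ga + ka * b3 al1 al2 al3 be12 be13 be23 ga)"
     using wcl_cube[OF cl stp_cubeb[OF ad cb, of "xi om"]] unfolding ka_def h_def .
    also have "... <= C * ?S (%y. w r (?X y om)) * ((1 + 200 * ka) * b3 al1 al2 al3 be12 be13 be23 ga)"
     by (rule mult_left_mono[OF b3_growth[OF nn k] mult_nonneg_nonneg[OF C0 S0]])
    finally show "\<bar>d3 (%i j k. ph (?X (x i j k) om))\<bar> <= C * ?S (%y. w r (?X y om)) * ((1 + 200 * ka) * b3 al1 al2 al3 be12 be13 be23 ga)" .
   qed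
   then show "\<bar>d3 (%i j k. Q (x i j k))\<bar> <= C * (1 + ?c * h) * ?S (w r) * b3 al1 al2 al3 be12 be13 be23 ga"
    unfolding Q_def d3_def d2_def using i by simp
  qed
  then show "wcl r (C * (1 + ?c * (s' - s))) (%y. expectation (%om. ph (?X y om)))"
   unfolding Q_def[abs_def] h_def .
 qed
qed

end

section \<open>Increments of the Wiener processes\<close>

lemma (in prob_space) indep_set_commute: "indep_set A B ==> indep_set B A"
 unfolding indep_sets2_eq
proof (elim conjE, intro conjI ballI)
 fix a b assume "\<forall>a\<in>A. \<forall>b\<in>B. prob (a \<inter> b) = prob a * prob b" "a \<in> B" "b \<in> A"
 then have "prob (b \<inter> a) = prob b * prob a" by blast
 then show "prob (a \<inter> b) = prob a * prob b" by (simp only: Int_commute[of a] mult.commute[of "prob a"])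
qed

lemma (in prob_space) indep_var_commute: "indep_var S X T' Y ==> indep_var T' Y S X"
 unfolding indep_var_eq using indep_set_commute by blast

locale wiener = prob_space P for P :: "'o measure" +
 fixes M :: nat and W :: "nat => real => 'o => real"
 assumes iwp: "independent_wiener_processes P M W"
begin

lemma wiener_proc: "m \<in> {1..M} ==> wiener_process P (W m)"
 using conjunct1[OF iwp[unfolded independent_wiener_processes_def]] by (rule bspec)

lemma measurable_W:
 assumes "m \<in> {1..M}" "0 <= t"
 shows "W m t \<in> borel_measurable P"
 using conjunct1[OF wiener_proc[OF assms(1), unfolded wiener_process_def]] assms(2) by blast

lemma indep_W:
 assumes "m \<in> {1..M}" "0 <= s 0" "\<And>i. i < n ==> s i <= s (Suc i)"
 shows "indep_vars (%_. borel) (%i om. W m (s (Suc i)) om - W m (s i) om) {..<n}"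
proof -
 have "\<forall>n. \<forall>s::nat => real. 0 <= s 0 \<and> (\<forall>i<n. s i <= s (Suc i)) -->
    indep_vars (%_. borel) (%i om. W m (s (Suc i)) om - W m (s i) om) {..<n}"
  by (rule conjunct1[OF conjunct2[OF conjunct2[OF wiener_proc[OF assms(1), unfolded wiener_process_def]]]])
 then show ?thesis using assms(2,3) by blast
qed

text \<open>Components outside 1 to \<open>M\<close> are set to 0: nothing is known about
  \<open>W\<close> there, and a step does not read them.\<close>

definition inc :: "real => real => 'o => nat => real" where
 "inc s s' om = (%m. if m \<in> {1..M} then W m s' om - W m s om else 0)"

lemma measurable_inc:
 assumes "0 <= s" "0 <= s'"
 shows "inc s s' \<in> borel_measurable P"
proof (rule measurable_coordinatewise_then_product)
 fix m show "(%om. inc s s' om m) \<in> borel_measurable P"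
 proof (cases "m \<in> {1..M}")
  case True
  then have "(%om. W m s' om - W m s om) \<in> borel_measurable P"
   using assms by (intro borel_measurable_diff measurable_W)
  then show ?thesis unfolding inc_def if_P[OF True] .
 next
  case False
  then show ?thesis unfolding inc_def if_not_P[OF False] by simp
 qed
qed

lemma inc_add: "inc s s' om m + inc s' s'' om m = inc s s'' om m"
 by (simp add: inc_def)

lemma indep_W_compose:
 assumes "\<And>m. m \<in> {1..M} ==> h m \<in> measurable (PiM {0..} (%_. borel)) (N m)"
 shows "indep_vars N (%m om. h m (\<lambda>t\<in>{0..}. W m t om)) {1..M}"
proof -
 have "indep_vars (%_. PiM {0..} (%_. borel)) (%m om. \<lambda>t\<in>{0..}. W m t om) {1..M}"
  by (rule conjunct2[OF iwp[unfolded independent_wiener_processes_def]])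
 from indep_vars_compose2[OF this assms] show ?thesis .
qed

text \<open>Combines two kinds of independence, between the processes as whole paths and between the
  increments of each process: the probability of a box factorises first over \<open>m\<close> and
  then over time.\<close>

lemma joint_indep:
 assumes s: "0 <= s 0" "\<And>i. i < n ==> s i <= s (Suc i)"
 defines "X \<equiv> %j om. W (fst j) (s (Suc (snd j))) om - W (fst j) (s (snd j)) om"
 shows "indep_vars (%_. borel) X ({1..M} \<times> {..<n})"
proof (cases "{1..M} \<times> {..<n} = {}")
 case True
 show ?thesis unfolding True indep_vars_def indep_sets_def by auto
next
 case False
 have s0: "0 <= s i" if "i <= n" for i
  using that
 proof (induction i)
  case (Suc i) then show ?case using s(2)[of i] by linarith
 qed (use s in simp)
 have ne: "{1..M} \<noteq> {}" "{..<n} \<noteq> {}" using False by auto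
 have X: "X j \<in> borel_measurable P" if "j \<in> {1..M} \<times> {..<n}" for j
  unfolding X_def by (rule borel_measurable_diff; rule measurable_W) (use that s0 in auto)
 define V where "V m om = (\<lambda>i\<in>{..<n}. X (m, i) om)" for m om
 define h where "h = (%x::real=>real. \<lambda>i\<in>{..<n}. x (s (Suc i)) - x (s i))"
 have h: "h \<in> measurable (PiM {0..} (%_. borel)) (PiM {..<n} (%_. borel))"
  unfolding h_def using s0 by (intro measurable_restrict borel_measurable_diff measurable_component_singleton) auto
 have hV: "h (\<lambda>t\<in>{0..}. W m t om) = V m om" for m om
  unfolding h_def V_def X_def by (rule restrict_ext) (use s0 in simp)
 have iV: "indep_vars (%_. PiM {..<n} (%_. borel)) V {1..M}"
  using indep_W_compose[of "%_. h" "%_. PiM {..<n} (%_. borel)"] h unfolding hV by simp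
 have product: "prob (\<Inter>j\<in>{1..M} \<times> {..<n}. X j -` A j \<inter> space P) = (\<Prod>j\<in>{1..M} \<times> {..<n}. prob (X j -` A j \<inter> space P))"
  if A: "\<And>j. j \<in> {1..M} \<times> {..<n} ==> A j \<in> sets borel" for A
 proof -
  define B where "B m = PiE {..<n} (%i. A (m, i))" for m
  have B: "B m \<in> sets (PiM {..<n} (%_. borel))" if "m \<in> {1..M}" for m
   unfolding B_def using A that by (intro sets_PiM_I_finite) auto
  have VB: "V m om \<in> B m \<longleftrightarrow> (\<forall>i\<in>{..<n}. X (m, i) om \<in> A (m, i))" for m om
   unfolding V_def B_def restrict_PiE_iff ..
  have bex_conj: "I \<noteq> {} ==> (\<forall>i\<in>I. Q i) \<and> R \<longleftrightarrow> (\<forall>i\<in>I. Q i \<and> R)" for I :: "nat set" and Q R by blast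
  have eq1: "V m -` B m \<inter> space P = (\<Inter>i\<in>{..<n}. X (m, i) -` A (m, i) \<inter> space P)" for m
  proof (rule set_eqI)
   fix om show "om \<in> V m -` B m \<inter> space P \<longleftrightarrow> om \<in> (\<Inter>i\<in>{..<n}. X (m, i) -` A (m, i) \<inter> space P)"
    unfolding Int_iff vimage_eq INT_iff VB using ne(2) by (rule bex_conj)
  qed
  have "(\<Inter>j\<in>{1..M} \<times> {..<n}. X j -` A j \<inter> space P) = (\<Inter>m\<in>{1..M}. V m -` B m \<inter> space P)"
  proof (rule set_eqI)
   fix om show "om \<in> (\<Inter>j\<in>{1..M} \<times> {..<n}. X j -` A j \<inter> space P) \<longleftrightarrow> om \<in> (\<Inter>m\<in>{1..M}. V m -` B m \<inter> space P)"
    unfolding eq1 INT_iff by (simp only: split_paired_Ball_Sigma)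
  qed
  then have "prob (\<Inter>j\<in>{1..M} \<times> {..<n}. X j -` A j \<inter> space P) = (\<Prod>m\<in>{1..M}. prob (V m -` B m \<inter> space P))"
   using indep_varsD_finite[OF iV ne(1), of B] B by simp
  also have "... = (\<Prod>m\<in>{1..M}. \<Prod>i\<in>{..<n}. prob (X (m, i) -` A (m, i) \<inter> space P))"
  proof (rule prod.cong[OF refl])
   fix m assume m: "m \<in> {1..M}"
   have "indep_vars (%_. borel) (%i. X (m, i)) {..<n}"
    using indep_W[OF m s] unfolding X_def fst_conv snd_conv .
   from indep_varsD_finite[OF this ne(2), of "%i. A (m, i)"] A m
   show "prob (V m -` B m \<inter> space P) = (\<Prod>i\<in>{..<n}. prob (X (m, i) -` A (m, i) \<inter> space P))"
    unfolding eq1 by simp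
  qed
  also have "... = (\<Prod>j\<in>{1..M} \<times> {..<n}. prob (X j -` A j \<inter> space P))"
   unfolding prod.cartesian_product by (rule prod.cong) auto
  finally show ?thesis .
 qed
 show ?thesis
 proof (rule indep_vars_finite[where E="%_. sets borel", OF False, THEN iffD2])
  show "\<forall>A\<in>{1..M} \<times> {..<n} \<rightarrow> sets borel. prob (\<Inter>j\<in>{1..M} \<times> {..<n}. X j -` A j \<inter> space P)
   = (\<Prod>j\<in>{1..M} \<times> {..<n}. prob (X j -` A j \<inter> space P))"
   using product Pi_mem[of _ "{1..M} \<times> {..<n}" "%_. sets borel"] by blast
 qed (use X sets.Int_stable sets.sigma_sets_eq[of "borel :: real measure"] in simp_all)
qed

text \<open>The independent real increments are regrouped by time into vectors.\<close>

lemma indep_inc: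
 assumes s: "0 <= s 0" "\<And>i. i < n ==> s i <= s (Suc i)"
 shows "indep_vars (%_. borel) (%i. inc (s i) (s (Suc i))) {..<n}"
proof -
 let ?X = "%j om. W (fst j) (s (Suc (snd j))) om - W (fst j) (s (snd j)) om"
 have "indep_vars (%i. PiM ({1..M} \<times> {i}) (%_. borel)) (%i om. restrict (%j. ?X j om) ({1..M} \<times> {i})) {..<n}"
  by (rule indep_vars_restrict[OF joint_indep[OF s]]) (auto simp: disjoint_family_on_def)
 then have "indep_vars (%_. borel) (%i om m. if m \<in> {1..M} then (restrict (%j. ?X j om) ({1..M} \<times> {i})) (m, i) else 0) {..<n}"
 proof (rule indep_vars_compose2[where Y="%i x m. if m \<in> {1..M} then x (m, i) else 0"])
  fix i assume "i \<in> {..<n}"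
  show "(%x m. if m \<in> {1..M} then x (m, i) else 0) \<in> borel_measurable (PiM ({1..M} \<times> {i}) (%_. borel :: real measure))"
  proof (rule measurable_coordinatewise_then_product)
   fix m show "(%x. if m \<in> {1..M} then x (m, i) else 0) \<in> borel_measurable (PiM ({1..M} \<times> {i}) (%_. borel :: real measure))"
    by (cases "m \<in> {1..M}") auto
  qed
 qed
 moreover have "(%i om m. if m \<in> {1..M} then (restrict (%j. ?X j om) ({1..M} \<times> {i})) (m, i) else 0) = (%i. inc (s i) (s (Suc i)))"
  by (auto simp: inc_def fun_eq_iff)
 ultimately show ?thesis by simp
qed

lemma past_future_indep:
 assumes "0 <= s 0" "\<And>i. i < l ==> s i <= s (Suc i)" "j <= l"
 shows "indep_var (PiM {..<j} (%_. borel)) (%om. \<lambda>i\<in>{..<j}. inc (s i) (s (Suc i)) om)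
   (PiM {j..<l} (%_. borel)) (%om. \<lambda>i\<in>{j..<l}. inc (s i) (s (Suc i)) om)"
 by (rule indep_var_restrict[OF indep_inc[where n=l]]) (use assms in auto)

text \<open>The law of a vector with independent components is the product of their laws.\<close>

lemma distr_vector_eq:
 fixes X Y :: "nat => 'o => real"
 assumes "indep_vars (%_. borel) X {1..M}" "indep_vars (%_. borel) Y {1..M}"
  and "\<And>m. m \<in> {1..M} ==> distr P borel (X m) = distr P borel (Y m)"
 shows "distr P borel (%om m. if m \<in> {1..M} then X m om else 0) = distr P borel (%om m. if m \<in> {1..M} then Y m om else 0)"
proof (cases "M = 0")
 case False
 then have ne: "{1..M} \<noteq> {}" by auto
 let ?e = "%x m. if m \<in> {1..M} then x m else (0::real)"
 let ?N = "PiM {1..M} (%_. borel :: real measure)"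
 have e: "?e \<in> borel_measurable ?N"
 proof (rule measurable_coordinatewise_then_product)
  fix m show "(%x. ?e x m) \<in> borel_measurable ?N" by (cases "m \<in> {1..M}") auto
 qed
 have *: "distr P borel (%om m. if m \<in> {1..M} then Z m om else 0) = distr (PiM {1..M} (%m. distr P borel (Z m))) borel ?e"
  if Z: "indep_vars (%_. borel) Z {1..M}" for Z
 proof -
  have rv: "random_variable borel (Z m)" if "m \<in> {1..M}" for m using Z that by (auto simp: indep_vars_def)
  then have r: "(%om. \<lambda>m\<in>{1..M}. Z m om) \<in> measurable P ?N" by (intro measurable_restrict)
  have "distr (PiM {1..M} (%m. distr P borel (Z m))) borel ?e = distr (distr P ?N (%om. \<lambda>m\<in>{1..M}. Z m om)) borel ?e"
   using indep_vars_iff_distr_eq_PiM'[OF ne rv] Z by simp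
  also have "... = distr P borel (?e \<circ> (%om. \<lambda>m\<in>{1..M}. Z m om))" by (rule distr_distr[OF e r])
  also have "?e \<circ> (%om. \<lambda>m\<in>{1..M}. Z m om) = (%om m. if m \<in> {1..M} then Z m om else 0)" by (auto simp: fun_eq_iff)
  finally show ?thesis by simp
 qed
 have "PiM {1..M} (%m. distr P borel (X m)) = PiM {1..M} (%m. distr P borel (Y m))"
  by (rule PiM_cong) (use assms(3) in auto)
 then show ?thesis using *[OF assms(1)] *[OF assms(2)] by simp
qed simp

lemma indep_inc_components:
 assumes "0 <= s" "0 <= s'"
 shows "indep_vars (%_. borel) (%m om. c * (W m s' om - W m s om)) {1..M}"
proof -
 have "(%x::real=>real. c * (x s' - x s)) \<in> borel_measurable (PiM {0..} (%_. borel))"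
  using assms by (intro borel_measurable_times borel_measurable_diff measurable_component_singleton) auto
 from indep_W_compose[of "%_. (%x::real=>real. c * (x s' - x s))" "%_. borel", OF this] assms
 show ?thesis by simp
qed

lemma distributed_increment:
 assumes "m \<in> {1..M}" "0 <= s" "s < s'"
 shows "distributed P lborel (%om. W m s' om - W m s om) (normal_density 0 (sqrt (s' - s)))"
 using conjunct1[OF conjunct2[OF conjunct2[OF conjunct2[OF wiener_proc[OF assms(1), unfolded wiener_process_def]]]]] assms(2,3)
 by blast

lemma distr_increment:
 assumes "m \<in> {1..M}" "0 <= s" "0 <= k" "0 <= s'" "c = 1 \<or> c = -1"
 shows "distr P borel (%om. c * (W m (s' + k) om - W m s' om)) = distr P borel (%om. W m (s + k) om - W m s om)"
proof (cases "k = 0")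
 case False
 let ?N = "density lborel (normal_density 0 (sqrt k))"
 have d: "distributed P lborel (%om. W m (s + k) om - W m s om) (normal_density 0 (sqrt k))"
  using distributed_increment[of m s "s + k"] assms False by simp
 have d': "distributed P lborel (%om. W m (s' + k) om - W m s' om) (normal_density 0 (sqrt k))"
  using distributed_increment[of m s' "s' + k"] assms False by simp
 have "distributed P lborel (%om. 0 + c * (W m (s' + k) om - W m s' om)) (normal_density (0 + c * 0) (\<bar>c\<bar> * sqrt k))"
  by (rule normal_density_affine[OF d']) (use assms False in auto)
 then have d'': "distributed P lborel (%om. c * (W m (s' + k) om - W m s' om)) (normal_density 0 (sqrt k))"
  using assms(5) by auto
 have "distr P lborel (%om. c * (W m (s' + k) om - W m s' om)) = distr P lborel (%om. W m (s + k) om - W m s om)"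
  using distributed_distr_eq_density[OF d] distributed_distr_eq_density[OF d''] by simp
 moreover have "distr P lborel f = distr P borel f" for f :: "'o => real" by (rule distr_cong) auto
 ultimately show ?thesis by simp
qed simp

text \<open>For \<open>c = 1\<close> this is the stationarity of the increments; for
  \<open>c = -1\<close> it includes their symmetry.\<close>

lemma distr_inc:
 assumes "0 <= s" "0 <= k" "0 <= s'" "c = 1 \<or> c = -1"
 shows "distr P borel (%om m. c * inc s' (s' + k) om m) = distr P borel (inc s (s + k))"
proof -
 have "distr P borel (%om m. if m \<in> {1..M} then c * (W m (s' + k) om - W m s' om) else 0)
   = distr P borel (%om m. if m \<in> {1..M} then 1 * (W m (s + k) om - W m s om) else 0)"
 proof (rule distr_vector_eq)
  show "indep_vars (%_. borel) (%m om. c * (W m (s' + k) om - W m s' om)) {1..M}"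
   "indep_vars (%_. borel) (%m om. 1 * (W m (s + k) om - W m s om)) {1..M}"
   by (rule indep_inc_components; use assms in simp)+
  fix m assume "m \<in> {1..M}"
  from distr_increment[OF this assms]
  show "distr P borel (%om. c * (W m (s' + k) om - W m s' om)) = distr P borel (%om. 1 * (W m (s + k) om - W m s om))" by simp
 qed
 moreover have "(%om m. if m \<in> {1..M} then c * (W m (s' + k) om - W m s' om) else 0) = (%om m. c * inc s' (s' + k) om m)"
  "(%om m. if m \<in> {1..M} then 1 * (W m (s + k) om - W m s om) else 0) = inc s (s + k)"
  by (auto simp: inc_def fun_eq_iff)
 ultimately show ?thesis by simp
qed

text \<open>The absolute moment of order \<open>p\<close> of a standard normal variable.\<close>

definition abs_moment :: "nat => real" where
 "abs_moment p = (if even p then fact p / (2 ^ (p div 2) * fact (p div 2)) else 2 ^ (p div 2) * fact (p div 2) * sqrt (2 / pi))"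

lemma abs_moment_nonneg: "0 <= abs_moment p" by (simp add: abs_moment_def)

lemma increment_moment:
 assumes "m \<in> {1..M}" "0 <= s" "s <= s'" "0 < p"
 shows "integrable P (%om. \<bar>W m s' om - W m s om\<bar> ^ p)"
  "expectation (%om. \<bar>W m s' om - W m s om\<bar> ^ p) = abs_moment p * sqrt (s' - s) ^ p"
proof -
 let ?s = "sqrt (s' - s)"
 have "integrable P (%om. \<bar>W m s' om - W m s om\<bar> ^ p) \<and>
  expectation (%om. \<bar>W m s' om - W m s om\<bar> ^ p) = abs_moment p * ?s ^ p"
 proof (cases "s = s'")
  case True then show ?thesis using assms by (simp add: power_0_left)
 next
  case False
  then have sp: "0 < ?s" "s < s'" using assms by auto
  have hb: "has_bochner_integral lborel (%x. normal_density 0 ?s x * \<bar>x\<bar> ^ p) (abs_moment p * ?s ^ p)"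
  proof (cases "even p")
   case True
   then obtain k where k: "p = 2 * k" by auto
   have "fact (2 * k) / ((2 / ?s^2) ^ k * fact k) = abs_moment p * ?s ^ p"
    using sp by (simp add: k abs_moment_def power_divide power_mult)
   then show ?thesis using normal_moment_even[OF sp(1), of 0 k] True by (simp add: k power_even_abs)
  next
   case False
   then obtain k where k: "p = 2 * k + 1" by (metis oddE)
   have e: "2 ^ k * ?s ^ p * fact k * sqrt (2 / pi) = abs_moment p * ?s ^ p"
    by (simp add: k abs_moment_def)
   show ?thesis using normal_moment_abs_odd[OF sp(1), of 0 k] unfolding k[symmetric] e diff_0_right .
  qed
  note d = distributed_increment[OF assms(1,2) sp(2)]
  have "integrable P (%om. \<bar>W m s' om - W m s om\<bar> ^ p)"
   using distributed_integrable[OF d, of "%x. \<bar>x\<bar> ^ p"] hb by (auto simp: has_bochner_integral_iff)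
  moreover have "expectation (%om. \<bar>W m s' om - W m s om\<bar> ^ p) = abs_moment p * ?s ^ p"
   using distributed_integral[OF d, of "%x. \<bar>x\<bar> ^ p"] hb by (auto simp: has_bochner_integral_iff)
  ultimately show ?thesis by simp
 qed
 then show "integrable P (%om. \<bar>W m s' om - W m s om\<bar> ^ p)"
  "expectation (%om. \<bar>W m s' om - W m s om\<bar> ^ p) = abs_moment p * ?s ^ p" by auto
qed

text \<open>\<open>real M ^ p\<close> comes from \<open>sum_power_le\<close>, the further factor
  \<open>real M\<close> from the number of summands. The case 0 is separate: for
  \<open>M = 0\<close> the formula would give 0 instead of the total mass 1.\<close>

definition noise_moment :: "nat => real" where
 "noise_moment p = (if p = 0 then 1 else real M ^ Suc p * abs_moment p)"

lemma noise_moment_nonneg: "0 <= noise_moment p"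
 by (simp add: noise_moment_def abs_moment_nonneg)

lemma sum_power_le:
 fixes x :: "nat => real"
 assumes "\<And>m. m \<in> {1..M} ==> 0 <= x m" "0 < p"
 shows "(\<Sum>m=1..M. x m) ^ p <= real M ^ p * (\<Sum>m=1..M. x m ^ p)"
proof (cases "M = 0")
 case True then show ?thesis using assms by (simp add: power_0_left)
next
 case False
 let ?m = "Max (x ` {1..M})"
 have fin: "finite (x ` {1..M})" "x ` {1..M} \<noteq> {}" using False by auto
 obtain i where i: "i \<in> {1..M}" "?m = x i" using Max_in[OF fin] by auto
 have "(\<Sum>m=1..M. x m) <= (\<Sum>m=1..M. ?m)" using fin by (intro sum_mono) auto
 then have "(\<Sum>m=1..M. x m) ^ p <= (real M * ?m) ^ p" using assms by (intro power_mono sum_nonneg) auto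
 also have "... = real M ^ p * x i ^ p" using i by (simp add: power_mult_distrib)
 also have "... <= real M ^ p * (\<Sum>m=1..M. x m ^ p)"
  using assms i by (intro mult_left_mono member_le_sum) auto
 finally show ?thesis .
qed

lemma noise_mom_inc:
 assumes "0 <= s" "s <= s'"
 shows "noise_mom P M noise_moment (s' - s) (inc s s')"
 unfolding noise_mom_def
proof (intro conjI allI)
 show rv: "inc s s' \<in> borel_measurable P" using assms by (intro measurable_inc) auto
 have [measurable]: "(%om. nz M (inc s s' om)) \<in> borel_measurable P" using measurable_compose[OF rv nz_measurable] .
 have "distr P borel (%om m. (-1) * inc s (s + (s' - s)) om m) = distr P borel (inc s (s + (s' - s)))"
  by (rule distr_inc) (use assms in auto)
 then show "distr P borel (%om m. - inc s s' om m) = distr P borel (inc s s')" by simp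
 fix p
 have "integrable P (%om. nz M (inc s s' om) ^ p) \<and> expectation (%om. nz M (inc s s' om) ^ p) <= noise_moment p * sqrt (s' - s) ^ p"
 proof (cases "p = 0")
  case True then show ?thesis by (simp add: noise_moment_def prob_space)
 next
  case False
  let ?G = "%om. real M ^ p * (\<Sum>m=1..M. \<bar>W m s' om - W m s om\<bar> ^ p)"
  have "nz M (inc s s' om) = (\<Sum>m=1..M. \<bar>W m s' om - W m s om\<bar>)" for om
   unfolding nz_def inc_def by (intro sum.cong) auto
  then have le: "nz M (inc s s' om) ^ p <= ?G om" for om
   using sum_power_le[of "%m. \<bar>W m s' om - W m s om\<bar>" p] False by simp
  have iG: "integrable P ?G"
   by (intro integrable_mult_right Bochner_Integration.integrable_sum increment_moment) (use assms False in auto)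
  have i: "integrable P (%om. nz M (inc s s' om) ^ p)"
   by (rule Bochner_Integration.integrable_bound[OF iG]) (auto intro!: AE_I2 order_trans[OF le] abs_ge_self)
  have "expectation (%om. nz M (inc s s' om) ^ p) <= expectation ?G" by (rule integral_mono[OF i iG le])
  also have "... = real M ^ p * (\<Sum>m=1..M. abs_moment p * sqrt (s' - s) ^ p)"
   using increment_moment[OF _ assms, where p=p] False by simp
  also have "... = noise_moment p * sqrt (s' - s) ^ p" using False by (simp add: noise_moment_def)
  finally show ?thesis using i by simp
 qed
 then show "integrable P (%om. nz M (inc s s' om) ^ p)" "expectation (%om. nz M (inc s s' om) ^ p) <= noise_moment p * sqrt (s' - s) ^ p" by auto
qed

text \<open>By independence the joint law is the product of two equal symmetric laws.\<close>

lemma half_step_noise_inc: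
 assumes "0 <= t" "0 <= k"
 shows "half_step_noise P M noise_moment k (inc t (t + k)) (inc (t + k) (t + 2 * k))"
proof -
 let ?x = "inc t (t + k)" and ?y = "inc (t + k) (t + 2 * k)"
 define s where "s i = t + real i * k" for i
 have 1: "indep_var (PiM {..<1} (%_. borel)) (%om. \<lambda>i\<in>{..<1}. inc (s i) (s (Suc i)) om)
   (PiM {1..<2} (%_. borel)) (%om. \<lambda>i\<in>{1..<2}. inc (s i) (s (Suc i)) om)"
  by (rule past_future_indep) (use assms in \<open>auto simp: s_def algebra_simps\<close>)
 have "indep_var borel ((%x. x 0) \<circ> (%om. \<lambda>i\<in>{..<1}. inc (s i) (s (Suc i)) om))
   borel ((%x. x 1) \<circ> (%om. \<lambda>i\<in>{1..<2}. inc (s i) (s (Suc i)) om))"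
  by (rule indep_var_compose[OF 1]) auto
 then have xy: "indep_var borel ?x borel ?y" by (simp add: s_def comp_def add.assoc)
 have neg: "(%x m. - x m) \<in> borel_measurable (borel :: (nat => real) measure)"
  by (intro borel_measurable_continuous_onI continuous_on_coordinatewise_then_product continuous_on_minus continuous_on_product_coordinates)
 have yx: "indep_var borel ?y borel ?x" by (rule indep_var_commute[OF xy])
 have xn: "indep_var borel ?x borel (%om m. - ?y om m)"
  using indep_var_compose[OF xy measurable_ident neg] by (simp add: comp_def id_def)
 have eq: "distr P borel ?y = distr P borel ?x"
  using distr_inc[of t k "t + k" 1] assms by (simp add: algebra_simps)
 have eqn: "distr P borel (%om m. - ?y om m) = distr P borel ?x"
  using distr_inc[of t k "t + k" "-1"] assms by (simp add: algebra_simps)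
 have "noise_mom P M noise_moment k ?x" "noise_mom P M noise_moment k ?y"
  using noise_mom_inc[of t "t + k"] noise_mom_inc[of "t + k" "t + 2 * k"] assms by auto
 then show ?thesis
  unfolding half_step_noise_def
  using xy[unfolded indep_var_distribution_eq] yx[unfolded indep_var_distribution_eq] xn[unfolded indep_var_distribution_eq]
  by (simp add: eq eqn borel_prod)
qed

text \<open>Freezing lemma: by independence and Fubini's theorem the past variable may be held fixed
  while the mean over the new one is taken. The function \<open>B\<close> dominates the first
  absolute moments at fixed past and thereby gives the joint integrability.\<close>

lemma markov_step:
 fixes ps :: "'u \<times> 'u => real"
 assumes UV: "indep_var N1 U N2 V" and ps: "ps \<in> borel_measurable (N1 \<Otimes>\<^sub>M N2)"
  and int: "\<And>u. u \<in> space N1 ==> integrable P (%om. ps (u, V om))"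
  and bound: "\<And>u. u \<in> space N1 ==> expectation (%om. \<bar>ps (u, V om)\<bar>) <= B u" and B: "integrable P (%om. B (U om))"
 shows "integrable P (%om. ps (U om, V om))"
  "expectation (%om. ps (U om, V om)) = expectation (%om. expectation (%om'. ps (U om, V om')))"
  "integrable P (%om. expectation (%om'. ps (U om, V om')))"
  "\<bar>expectation (%om. ps (U om, V om))\<bar> <= expectation (%om. B (U om))"
proof -
 note [measurable] = indep_var_rv1[OF UV] indep_var_rv2[OF UV] ps
 let ?D1 = "distr P N1 U" and ?D2 = "distr P N2 V"
 interpret D1: prob_space ?D1 by (rule prob_space_distr) simp
 interpret D2: prob_space ?D2 by (rule prob_space_distr) simp
 interpret pair_sigma_finite ?D1 ?D2 ..
 have D: "?D1 \<Otimes>\<^sub>M ?D2 = distr P (N1 \<Otimes>\<^sub>M N2) (%om. (U om, V om))" using UV unfolding indep_var_distribution_eq by simp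
 have U: "U om \<in> space N1" if "om \<in> space P" for om using that indep_var_rv1[OF UV] by (rule measurable_space[rotated])
 have e2: "(\<integral>v. f (ps (u, v)) \<partial>?D2) = expectation (%om. f (ps (u, V om)))" if "u \<in> space N1" "f \<in> borel_measurable borel" for u and f :: "real => real"
  by (rule integral_distr[OF _ measurable_compose[OF measurable_Pair2[OF ps that(1)] that(2)]]) simp
 have int2: "integrable ?D2 (%v. ps (u, v))" if "u \<in> space N1" for u
  using int[OF that] that by (subst integrable_distr_eq) auto
 have m1: "(%u. \<integral>v. norm (ps (u, v)) \<partial>?D2) \<in> borel_measurable N1"
  by (rule D2.borel_measurable_lebesgue_integral) measurable
 have m2: "(%u. \<integral>v. ps (u, v) \<partial>?D2) \<in> borel_measurable N1"
  by (rule D2.borel_measurable_lebesgue_integral) measurable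
 have iU: "integrable P (%om. \<integral>v. norm (ps (U om, v)) \<partial>?D2)"
 proof (rule Bochner_Integration.integrable_bound[OF B])
  show "(%om. \<integral>v. norm (ps (U om, v)) \<partial>?D2) \<in> borel_measurable P" using measurable_compose[OF indep_var_rv1[OF UV] m1] .
  show "AE om in P. norm (\<integral>v. norm (ps (U om, v)) \<partial>?D2) <= norm (B (U om))"
  proof (rule AE_I2)
   fix om assume om: "om \<in> space P"
   have "(\<integral>v. norm (ps (U om, v)) \<partial>?D2) <= B (U om)" using bound[OF U[OF om]] e2[OF U[OF om], of abs] by simp
   then show "norm (\<integral>v. norm (ps (U om, v)) \<partial>?D2) <= norm (B (U om))"
    using Bochner_Integration.integral_nonneg[of ?D2 "%v. norm (ps (U om, v))"] by (simp only: real_norm_def) auto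
  qed
 qed
 have iD: "integrable (?D1 \<Otimes>\<^sub>M ?D2) ps"
 proof (rule Fubini_integrable)
  show "ps \<in> borel_measurable (?D1 \<Otimes>\<^sub>M ?D2)" by simp
  show "integrable ?D1 (%u. \<integral>v. norm (ps (u, v)) \<partial>?D2)"
   using iU m1 by (subst integrable_distr_eq) auto
  show "AE u in ?D1. integrable ?D2 (%v. ps (u, v))" by (rule AE_I2) (use int2 in simp)
 qed
 show I: "integrable P (%om. ps (U om, V om))"
  using iD unfolding D by (subst (asm) integrable_distr_eq) auto
 have "expectation (%om. ps (U om, V om)) = integral\<^sup>L (?D1 \<Otimes>\<^sub>M ?D2) ps"
  unfolding D by (rule integral_distr[symmetric]) auto
 also have "... = (\<integral>u. (\<integral>v. ps (u, v) \<partial>?D2) \<partial>?D1)" by (rule integral_fst'[OF iD, symmetric])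
 also have "... = expectation (%om. \<integral>v. ps (U om, v) \<partial>?D2)" using m2 by (intro integral_distr) auto
 also have "... = expectation (%om. expectation (%om'. ps (U om, V om')))"
  using e2[OF U, of _ "%x. x"] by (intro Bochner_Integration.integral_cong) auto
 finally show E: "expectation (%om. ps (U om, V om)) = expectation (%om. expectation (%om'. ps (U om, V om')))" .
 have "integrable P (%om. \<integral>v. ps (U om, v) \<partial>?D2)"
  using integrable_fst'[OF iD] m2 by (subst (asm) integrable_distr_eq) auto
 moreover have "integrable P (%om. \<integral>v. ps (U om, v) \<partial>?D2) \<longleftrightarrow> integrable P (%om. expectation (%om'. ps (U om, V om')))"
  using e2[OF U, of _ "%x. x"] by (intro Bochner_Integration.integrable_cong) auto
 ultimately show J: "integrable P (%om. expectation (%om'. ps (U om, V om')))" by simp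
 show "\<bar>expectation (%om. ps (U om, V om))\<bar> <= expectation (%om. B (U om))"
  unfolding E
 proof (rule order_trans[OF integral_abs_bound])
  show "expectation (%om. \<bar>expectation (%om'. ps (U om, V om'))\<bar>) <= expectation (%om. B (U om))"
  proof (rule integral_mono_AE[OF integrable_abs[OF J] B], rule AE_I2)
   fix om assume "om \<in> space P"
   then show "\<bar>expectation (%om'. ps (U om, V om'))\<bar> <= B (U om)"
    by (rule order_trans[OF integral_abs_bound bound[OF U]])
  qed
 qed
qed

end

section \<open>The method as a Markov chain on a mesh\<close>

lemma discrete_gronwall:
 fixes x h d :: "nat => real"
 assumes "0 <= C" and h: "\<And>i. i < n ==> 0 <= h i" and d: "\<And>i. i < n ==> 0 <= d i"
  and step: "\<And>i. i < n ==> x (Suc i) <= (1 + C * h i) * x i + d i" and x0: "0 <= x 0"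
 shows "x n <= exp (C * (\<Sum>i<n. h i)) * (x 0 + (\<Sum>i<n. d i))"
 using h d step
proof (induction n)
 case 0 then show ?case by simp
next
 case (Suc n)
 let ?S = "\<Sum>i<n. h i" and ?D = "x 0 + (\<Sum>i<n. d i)"
 have hn: "0 <= h n" "0 <= d n" and S: "0 <= ?S" and D: "0 <= ?D" using Suc.prems x0 by (auto intro!: sum_nonneg add_nonneg_nonneg)
 have nn: "0 <= exp (C * ?S) * ?D" using D by simp
 have "x (Suc n) <= (1 + C * h n) * x n + d n" using Suc.prems by simp
 also have "... <= (1 + C * h n) * (exp (C * ?S) * ?D) + d n"
  using Suc assms(1) hn by (intro add_right_mono mult_left_mono) auto
 also have "... <= exp (C * h n) * (exp (C * ?S) * ?D) + exp (C * h n) * exp (C * ?S) * d n"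
 proof (rule add_mono[OF mult_right_mono[OF exp_ge_add_one_self nn]])
  have "1 <= exp (C * h n) * exp (C * ?S)" using assms(1) hn S by (simp add: mult_exp_exp)
  then show "d n <= exp (C * h n) * exp (C * ?S) * d n"
   using mult_right_mono[of 1 "exp (C * h n) * exp (C * ?S)" "d n"] hn by simp
 qed
 also have "... = exp (C * (\<Sum>i<Suc n. h i)) * (x 0 + (\<Sum>i<Suc n. d i))"
  by (simp add: distrib_left distrib_right exp_add mult_ac)
 finally show ?case .
qed

text \<open>The state as a function of the vector of all inputs. In this form a state is a
  measurable function of the increments before it, to which independence of past and future
  applies.\<close>

primrec state_path :: "(nat => 'x => 'z => 'z) => 'z => nat => 'x => 'z" where
 "state_path f y 0 v = y"
| "state_path f y (Suc k) v = f k v (state_path f y k v)"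

lemma path_measurable:
 fixes y :: "'z::topological_space"
 assumes "\<And>i. i < k ==> (%p. f i (fst p) (snd p)) \<in> borel_measurable (N \<Otimes>\<^sub>M borel)"
 shows "state_path f y k \<in> borel_measurable N"
 using assms
proof (induction k)
 case 0 then show ?case by (simp add: measurable_def)
next
 case (Suc k)
 have "(%v. (v, state_path f y k v)) \<in> measurable N (N \<Otimes>\<^sub>M borel)"
  using Suc by (intro measurable_Pair measurable_ident) (auto simp: id_def)
 from measurable_compose[OF this Suc.prems[of k]] show ?case by simp
qed

lemma measurable_w_borel: "(%x. w r x) \<in> borel_measurable borel"
 unfolding wR_def by measurable

lemma w_continuous [continuous_intros]: "continuous_on S f ==> continuous_on S (%x. w r (f x))"
 unfolding wR_def by (intro continuous_intros)

definition bisect :: "(nat => real) => nat => real" where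
 "bisect t i = (if even i then t (i div 2) else t (i div 2) + (t (Suc (i div 2)) - t (i div 2)) / 2)"

lemma midpoint_cancel: "x + 2 * ((y - x) / 2) = (y :: real)"
 by (simp add: field_simps)

lemma bisect_even [simp]: "bisect t (2 * i) = t i" by (simp add: bisect_def)
lemma bisect_odd: "bisect t (Suc (2 * i)) = t i + (t (Suc i) - t i) / 2" by (simp add: bisect_def)

lemma (in scheme) stp_cong:
 assumes "\<And>m. m \<in> {1..M} ==> x m = x' m"
 shows "stp s s' x y = stp s s' x' y"
proof -
 have "(\<Sum>m=1..M. x m *R g2 m s) = (\<Sum>m=1..M. x' m *R g2 m s)"
  "(\<Sum>m=1..M. (x m / 2) *R (g1 m s + g1 m s')) = (\<Sum>m=1..M. (x' m / 2) *R (g1 m s + g1 m s'))"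
  "(\<Sum>m=1..M. (x m / 2) *R (g2 m s + g2 m s')) = (\<Sum>m=1..M. (x' m / 2) *R (g2 m s + g2 m s'))"
  using assms by (auto intro!: sum.cong)
 then show ?thesis unfolding sprk_step_def by (simp only:)
qed

text \<open>The start is any nonnegative time, so that pieces of a mesh are again meshes.\<close>

definition (in scheme) mesh :: "nat => (nat => real) => bool" where
 "mesh N s \<longleftrightarrow> 0 <= s 0 \<and> (\<forall>i<N. admissible (s i) (s (Suc i)))"

lemma (in scheme) meshD:
 assumes "mesh N s"
 shows "0 <= s 0" "i < N ==> admissible (s i) (s (Suc i))" "i < N ==> s i <= s (Suc i)"
 using assms admissibleD(3) by (auto simp: mesh_def)

lemma (in scheme) mesh_mono: "mesh N s ==> i <= j ==> j <= N ==> s i <= s j"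
proof (induction j)
 case (Suc j) then show ?case using meshD(3)[of N s j] by (cases "i = Suc j") auto
qed simp

lemma (in scheme) mesh_range:
 assumes "mesh N s" "j <= N"
 shows "0 <= s j" "s j - s 0 <= T"
proof -
 show "0 <= s j" using mesh_mono[OF assms(1), of 0 j] meshD(1)[OF assms(1)] assms(2) by simp
 show "s j - s 0 <= T"
 proof (cases j)
  case (Suc k)
  then have "s j \<in> {0..T}" using admissibleD(2)[OF meshD(2)[OF assms(1), of k]] assms(2) by simp
  then show ?thesis using meshD(1)[OF assms(1)] by simp
 qed (use T_pos in simp)
qed

lemma (in scheme) mesh_bisect:
 assumes "mesh N t"
 shows "mesh (2 * N) (bisect t)"
 unfolding mesh_def
proof (intro conjI allI impI)
 show "0 <= bisect t 0" using meshD(1)[OF assms] by (simp add: bisect_def)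
 fix i assume i: "i < 2 * N"
 let ?j = "i div 2" let ?k = "(t (Suc ?j) - t ?j) / 2"
 have j: "?j < N" using i by auto
 have k: "0 <= ?k" using meshD(3)[OF assms j] by simp
 have k: "0 <= ?k" "admissible (t ?j) (t ?j + 2 * ?k)" unfolding midpoint_cancel by (fact k, fact meshD(2)[OF assms j])
 show "admissible (bisect t i) (bisect t (Suc i))"
 proof (cases "even i")
  case True
  then have "bisect t i = t ?j" "bisect t (Suc i) = t ?j + ?k" by (auto simp: bisect_def)
  then show ?thesis using admissible_halves(1)[OF k] by simp
 next
  case False
  then have "Suc i = 2 * Suc ?j" by presburger
  then have "bisect t i = t ?j + ?k" "bisect t (Suc i) = t ?j + 2 * ?k" using False bisect_even[of t "Suc ?j"] midpoint_cancel[of "t ?j" "t (Suc ?j)"] by (auto simp: bisect_def)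
  then show ?thesis using admissible_halves(2)[OF k] by simp
 qed
qed

locale wiener_scheme = scheme M g01 g1 g02 g2 T K + wiener P M W
 for M and g01 :: "'a::euclidean_space => 'b::euclidean_space => real => 'a" and g1 g02 g2 T K and P :: "'o measure" and W

sublocale wiener_scheme \<subseteq> noisy_scheme M g01 g1 g02 g2 T K P noise_moment
 by unfold_locales (rule noise_moment_nonneg)

context wiener_scheme
begin

abbreviation "Y y s k \<equiv> sprk M g01 g1 g02 g2 W y s k"

lemma Y_Suc: "Y y s (Suc k) om = stp (s k) (s (Suc k)) (inc (s k) (s (Suc k)) om) (Y y s k om)"
 unfolding sprk.simps by (rule stp_cong) (simp add: inc_def)

abbreviation "incs s J om \<equiv> (\<lambda>i\<in>J. inc (s i) (s (Suc i)) om)"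

lemma measurable_incs:
 assumes "mesh N s" "J \<subseteq> {..<N}"
 shows "incs s J \<in> measurable P (PiM J (%_. borel))"
 using assms mesh_range(1)[OF assms(1)] by (intro measurable_restrict measurable_inc) (auto simp: subset_eq Suc_le_eq less_imp_le)

lemma Y_path:
 assumes "k <= j"
 shows "Y y s k om = state_path (%i v. stp (s i) (s (Suc i)) (v i)) y k (incs s {..<j} om)"
 using assms by (induction k) (simp_all add: Y_Suc del: sprk.simps(2))

lemma path_Y_measurable:
 assumes "mesh N s" "k <= j" "j <= N"
 shows "state_path (%i v. stp (s i) (s (Suc i)) (v i)) y k \<in> borel_measurable (PiM {..<j} (%_. borel))"
proof (rule path_measurable)
 fix i assume "i < k"
 then have i: "i < N" "i \<in> {..<j}" using assms by auto
 have "continuous_on UNIV (%z. stp (s i) (s (Suc i)) (fst z) (snd z))"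
  by (intro continuous_stp' meshD(2)[OF assms(1) i(1)] continuous_intros)
 then have 1: "(%z. stp (s i) (s (Suc i)) (fst z) (snd z)) \<in> borel_measurable (borel \<Otimes>\<^sub>M borel)"
  unfolding borel_prod by (rule borel_measurable_continuous_onI)
 have 2: "(%p. (fst p i, snd p)) \<in> measurable (PiM {..<j} (%_. borel) \<Otimes>\<^sub>M (borel :: ('a \<times> 'b) measure)) ((borel :: (nat => real) measure) \<Otimes>\<^sub>M borel)"
  using i(2) by (intro measurable_Pair measurable_compose[OF measurable_fst measurable_component_singleton] measurable_snd)
 show "(%p. stp (s i) (s (Suc i)) (fst p i) (snd p)) \<in> borel_measurable (PiM {..<j} (%_. borel) \<Otimes>\<^sub>M borel)"
  using measurable_compose[OF 2 1] by simp
qed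

lemma Y_measurable:
 assumes "mesh N s" "k <= N"
 shows "Y y s k \<in> borel_measurable P"
proof -
 have "Y y s k = (%om. state_path (%i v. stp (s i) (s (Suc i)) (v i)) y k (incs s {..<k} om))"
  by (rule ext) (rule Y_path, simp)
 then show ?thesis
  using measurable_compose[OF measurable_incs[OF assms(1), of "{..<k}"] path_Y_measurable[OF assms(1) order_refl assms(2), of y]] assms by simp
qed

text \<open>\<open>U\<close> depends only on the increments before index \<open>j\<close> and
  \<open>V\<close> only on those from \<open>j\<close> up to \<open>l\<close>; continuity of
  \<open>ps\<close> supplies the joint measurability that \<open>markov_step\<close> asks
  for.\<close>

lemma chain_markov:
 fixes ps :: "'z::{second_countable_topology} \<times> 'x::{second_countable_topology} => real"
 assumes s: "mesh N s" "j <= l" "l <= N"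
  and F: "F \<in> borel_measurable (PiM {..<j} (%_. borel))" and G: "G \<in> borel_measurable (PiM {j..<l} (%_. borel))"
  and U: "\<And>om. U om = F (incs s {..<j} om)" and V: "\<And>om. V om = G (incs s {j..<l} om)"
  and ps: "continuous_on UNIV ps"
  and int: "\<And>z. integrable P (%om. ps (z, V om))" and bound: "\<And>z. expectation (%om. \<bar>ps (z, V om)\<bar>) <= B z"
  and B: "integrable P (%om. B (U om))"
 shows "integrable P (%om. ps (U om, V om))"
  "expectation (%om. ps (U om, V om)) = expectation (%om. expectation (%om'. ps (U om, V om')))"
  "integrable P (%om. expectation (%om'. ps (U om, V om')))"
  "\<bar>expectation (%om. ps (U om, V om))\<bar> <= expectation (%om. B (U om))"
proof -
 let ?N1 = "PiM {..<j} (%_. borel :: (nat => real) measure)" and ?N2 = "PiM {j..<l} (%_. borel :: (nat => real) measure)"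
 have UV: "indep_var ?N1 (incs s {..<j}) ?N2 (incs s {j..<l})"
  by (rule past_future_indep) (use meshD[OF s(1)] s in auto)
 have m: "(%p. ps (F (fst p), G (snd p))) \<in> borel_measurable (?N1 \<Otimes>\<^sub>M ?N2)"
 proof -
  have "(%p. (F (fst p), G (snd p))) \<in> measurable (?N1 \<Otimes>\<^sub>M ?N2) (borel \<Otimes>\<^sub>M borel)"
   by (intro measurable_Pair measurable_compose[OF measurable_fst F] measurable_compose[OF measurable_snd G])
  then show ?thesis
   using measurable_compose[of _ _ "borel \<Otimes>\<^sub>M borel" ps borel] borel_measurable_continuous_onI[OF ps] unfolding borel_prod by blast
 qed
 note M = markov_step[OF UV m, where B="%v. B (F v)", unfolded fst_conv snd_conv, folded U V, OF int bound B]
 show "integrable P (%om. ps (U om, V om))"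
  "expectation (%om. ps (U om, V om)) = expectation (%om. expectation (%om'. ps (U om, V om')))"
  "integrable P (%om. expectation (%om'. ps (U om, V om')))"
  "\<bar>expectation (%om. ps (U om, V om))\<bar> <= expectation (%om. B (U om))"
  by (rule M)+
qed

lemma one_step_markov:
 fixes ph :: "'a \<times> 'b => real"
 assumes s: "mesh N s" "k < N" and ph: "continuous_on UNIV ph"
  and int: "\<And>z. integrable P (%om. ph (stp (s k) (s (Suc k)) (inc (s k) (s (Suc k)) om) z))"
  and bound: "\<And>z. expectation (%om. \<bar>ph (stp (s k) (s (Suc k)) (inc (s k) (s (Suc k)) om) z)\<bar>) <= B z"
  and B: "integrable P (%om. B (Y y s k om))"
 shows "integrable P (%om. ph (Y y s (Suc k) om))"
  "expectation (%om. ph (Y y s (Suc k) om)) = expectation (%om. expectation (%om'. ph (stp (s k) (s (Suc k)) (inc (s k) (s (Suc k)) om') (Y y s k om))))"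
  "\<bar>expectation (%om. ph (Y y s (Suc k) om))\<bar> <= expectation (%om. B (Y y s k om))"
proof -
 have c: "continuous_on UNIV (%p. ph (stp (s k) (s (Suc k)) (snd p) (fst p)))"
  by (rule continuous_on_compose2[OF ph]) (intro continuous_stp' meshD(2)[OF s] continuous_intros, simp)
 have k: "k <= Suc k" "Suc k <= N" using s by auto
 have G: "(%v. v k) \<in> borel_measurable (PiM {k..<Suc k} (%_. borel :: (nat => real) measure))"
  by (rule measurable_component_singleton) simp
 have V: "inc (s k) (s (Suc k)) om = (incs s {k..<Suc k} om) k" for om by simp
 note M = chain_markov[OF s(1) k path_Y_measurable[OF s(1) order_refl less_imp_le[OF s(2)]] G Y_path[OF order_refl] V c, unfolded fst_conv snd_conv, OF int bound B]
 show "integrable P (%om. ph (Y y s (Suc k) om))"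
  "expectation (%om. ph (Y y s (Suc k) om)) = expectation (%om. expectation (%om'. ph (stp (s k) (s (Suc k)) (inc (s k) (s (Suc k)) om') (Y y s k om))))"
  "\<bar>expectation (%om. ph (Y y s (Suc k) om))\<bar> <= expectation (%om. B (Y y s k om))"
  unfolding Y_Suc using M(1,2,4) .
qed

lemma noise_mom_mesh: "mesh N s ==> k < N ==> noise_mom P M noise_moment (s (Suc k) - s k) (inc (s k) (s (Suc k)))"
 using mesh_range(1)[of N s k] meshD(3)[of N s k] by (intro noise_mom_inc) auto

lemma moments:
 "\<exists>C\<ge>0. \<forall>y s N k. mesh N s --> k <= N -->
  integrable P (%om. w r (Y y s k om)) \<and> expectation (%om. w r (Y y s k om)) <= exp (C * (s k - s 0)) * w r y"
proof -
 obtain C where C0: "0 <= C" and C: "\<And>s s' xi y. admissible s s' ==> noise_mom P M noise_moment (s' - s) xi ==>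
  integrable P (%om. w r (stp s s' (xi om) y)) \<and>
  expectation (%om. w r (stp s s' (xi om) y)) <= (1 + C * (s' - s)) * w r y"
  using growth_step[of r] by blast
 show ?thesis
 proof (rule exI[of _ C], intro conjI C0 allI impI)
  fix y s N k assume s: "mesh N s" and k: "k <= N"
  have "integrable P (%om. w r (Y y s k om)) \<and> expectation (%om. w r (Y y s k om)) <= exp (C * (s k - s 0)) * w r y"
   using k
  proof (induction k)
   case 0 then show ?case by (simp add: prob_space)
  next
   case (Suc k)
   then have k: "k < N" and IH: "integrable P (%om. w r (Y y s k om))" "expectation (%om. w r (Y y s k om)) <= exp (C * (s k - s 0)) * w r y"
    by auto
   let ?h = "s (Suc k) - s k"
   note st = C[OF meshD(2)[OF s k] noise_mom_mesh[OF s k]]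
   have wc: "continuous_on UNIV (%x :: 'a \<times> 'b. w r x)" by (intro continuous_intros)
   have bd: "expectation (%om. \<bar>w r (stp (s k) (s (Suc k)) (inc (s k) (s (Suc k)) om) z)\<bar>) <= (1 + C * ?h) * w r z" for z
    using st[of z] by simp
   have iB: "integrable P (%om. (1 + C * ?h) * w r (Y y s k om))" using IH(1) by simp
   note M = one_step_markov[OF s k wc conjunct1[OF st] bd iB]
   have "expectation (%om. w r (Y y s (Suc k) om)) <= (1 + C * ?h) * expectation (%om. w r (Y y s k om))"
    using M(3) by simp
   also have "... <= exp (C * ?h) * (exp (C * (s k - s 0)) * w r y)"
    using IH(2) exp_ge_add_one_self[of "C * ?h"] by (intro mult_mono) auto
   also have "... = exp (C * (s (Suc k) - s 0)) * w r y"
    by (simp add: mult_exp_exp algebra_simps flip: mult.assoc)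
   finally show ?case using M(1) by simp
  qed
  then show "integrable P (%om. w r (Y y s k om))" "expectation (%om. w r (Y y s k om)) <= exp (C * (s k - s 0)) * w r y" by auto
 qed
qed

text \<open>Translates one coarse interval into the local setting. The coarse increment is the sum
  of the two fine ones, so both chains move by \<open>Psi\<close> and \<open>Phi\<close> with the
  same noise.\<close>

lemma two_steps:
 assumes "mesh N t" "k < N"
 defines "h \<equiv> (t (Suc k) - t k) / 2"
 shows "0 <= h" "admissible (t k) (t k + 2 * h)" "t k + 2 * h = t (Suc k)" "0 <= t k"
  "half_step_noise P M noise_moment h (inc (t k) (t k + h)) (inc (t k + h) (t k + 2 * h))"
  "Y y (bisect t) (2 * Suc k) om = Psi (t k) h (Y y (bisect t) (2 * k) om) (inc (t k) (t k + h) om) (inc (t k + h) (t k + 2 * h) om)"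
  "Y y t (Suc k) om = Phi (t k) h (Y y t k om) (inc (t k) (t k + h) om) (inc (t k + h) (t k + 2 * h) om)"
proof -
 show h: "0 <= h" using meshD(3)[OF assms(1,2)] by (simp add: h_def)
 show t2: "t k + 2 * h = t (Suc k)" unfolding h_def by (rule midpoint_cancel)
 show "admissible (t k) (t k + 2 * h)" unfolding t2 by (rule meshD(2)[OF assms(1,2)])
 show t0: "0 <= t k" using mesh_range(1)[OF assms(1)] assms(2) by simp
 show "half_step_noise P M noise_moment h (inc (t k) (t k + h)) (inc (t k + h) (t k + 2 * h))"
  by (rule half_step_noise_inc[OF t0 h])
 have b: "bisect t (2 * k) = t k" "bisect t (Suc (2 * k)) = t k + h" "bisect t (Suc (Suc (2 * k))) = t k + 2 * h"
  using bisect_even[of t "Suc k"] t2 by (auto simp: bisect_odd h_def)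
 have e: "2 * Suc k = Suc (Suc (2 * k))" by simp
 show "Y y (bisect t) (2 * Suc k) om = Psi (t k) h (Y y (bisect t) (2 * k) om) (inc (t k) (t k + h) om) (inc (t k + h) (t k + 2 * h) om)"
  unfolding e Y_Suc b Psi_def half_def ..
 show "Y y t (Suc k) om = Phi (t k) h (Y y t k om) (inc (t k) (t k + h) om) (inc (t k + h) (t k + 2 * h) om)"
  unfolding Y_Suc Phi_def t2 by (rule stp_cong) (simp only: inc_add)
qed

end

section \<open>Effect of bisecting a mesh\<close>

lemma wR_double: "wR e R * wR e R = wR (2 * e) R"
 by (simp add: wR_def mult_2 flip: power_add)

lemma wR_le_double: "wR e R <= wR (2 * e) R"
 using mult_left_mono[of 1 "wR e R" "wR e R"] by (simp flip: wR_double)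

context noisy_scheme
begin

text \<open>Write the new difference as d + q, with the local difference \<open>d\<close> at
  \<open>v\<close> and the propagated part \<open>q\<close> of \<open>p = v - u\<close>. As
  \<open>p\<close> is deterministic here, the scalar product of \<open>d\<close> and
  \<open>p\<close> contributes only through the mean of \<open>d\<close>, which is O(k^3); splitting
  it by Young's inequality leaves k times the square of \<open>p\<close> and a term of size k^5. The
  rest \<open>q - p\<close> is O(k) times \<open>p\<close> and is paired with \<open>d\<close> in
  squares.\<close>

lemma strong_pair:
 "\<exists>C\<ge>0. \<exists>e. \<forall>t k u v xi1 xi2. 0 <= k --> admissible t (t + 2 * k) --> half_step_noise P M cm k xi1 xi2 -->
  integrable P (%om. (norm (Psi t k v (xi1 om) (xi2 om) - Phi t k u (xi1 om) (xi2 om)))\<^sup>2) \<and>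
  expectation (%om. (norm (Psi t k v (xi1 om) (xi2 om) - Phi t k u (xi1 om) (xi2 om)))\<^sup>2)
   <= (1 + C * k) * (norm (v - u))^2 + C * k * (k^2 * w e v)"
proof -
 obtain A e where A0: "0 <= A" and A: "\<And>t k y xi1 xi2. 0 <= k ==> admissible t (t + 2 * k) ==> half_step_noise P M cm k xi1 xi2 ==>
  integrable P (%om. del t k y (xi1 om) (xi2 om)) \<and> integrable P (%om. (norm (del t k y (xi1 om) (xi2 om)))\<^sup>2) \<and>
  expectation (%om. (norm (del t k y (xi1 om) (xi2 om)))\<^sup>2) <= A * k ^ 3 * w e y \<and>
  norm (expectation (%om. del t k y (xi1 om) (xi2 om))) <= A * k ^ 3 * w e y"
  using strong_step by blast
 let ?C = "1 + 12 * K + 2 * A + A^2"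
 show ?thesis
 proof (rule exI[of _ ?C], intro conjI exI[of _ "2 * e"] allI impI)
  show "0 <= ?C" using A0 K_ge1 by simp
  fix t k u v xi1 xi2 assume k: "0 <= k" "admissible t (t + 2 * k)" and H: "half_step_noise P M cm k xi1 xi2"
  note D = A[OF k H, of v]
  define d where "d om = del t k v (xi1 om) (xi2 om)" for om
  define p where "p = v - u"
  \<comment> \<open>The factor of \<open>stp_diff\<close> for the full step 2 k.\<close>
  define ka where "ka = 4 * (k * K)"
  have ka: "0 <= ka" "ka <= 1 / 2" and k1: "k <= 1" using admissibleD(4,5,6)[OF k(2)] k(1) by (auto simp: ka_def)
  let ?f = "%om. (norm (Psi t k v (xi1 om) (xi2 om) - Phi t k u (xi1 om) (xi2 om)))\<^sup>2"
  let ?G = "%om. 2 * (norm (d om))^2 + 2 * (d om \<bullet> p) + (1 + 3 * ka) * (norm p)^2"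
  have le: "?f om <= ?G om" for om
  proof -
   define q where "q = Phi t k v (xi1 om) (xi2 om) - Phi t k u (xi1 om) (xi2 om)"
   have r: "norm (q - p) <= ka * norm p"
    using stp_diff[OF k(2), of "%m. xi1 om m + xi2 om m" v "%m. xi1 om m + xi2 om m" u]
    by (simp add: q_def p_def Phi_def ka_def nz_def)
   then have r2: "(norm (q - p))^2 <= ka^2 * (norm p)^2" by (metis norm_ge_zero power_mono power_mult_distrib)
   have "norm q <= (1 + ka) * norm p" using r norm_triangle_ineq[of "q - p" p] by (simp add: algebra_simps)
   then have q2: "(norm q)^2 <= (1 + ka)^2 * (norm p)^2" by (metis norm_ge_zero power_mono power_mult_distrib)
   have "?f om = (norm (d om + q))^2" by (simp add: d_def q_def del_def)
   also have "... = (norm (d om))^2 + 2 * (d om \<bullet> p) + 2 * (d om \<bullet> (q - p)) + (norm q)^2"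
    by (simp add: power2_norm_eq_inner inner_add_left inner_add_right inner_diff_right inner_commute)
   also have "2 * (d om \<bullet> (q - p)) <= (norm (d om))^2 + (norm (q - p))^2"
    using norm_cauchy_schwarz[of "d om" "q - p"] sum_squares_bound[of "norm (d om)" "norm (q - p)"] by linarith
   finally have "?f om <= 2 * (norm (d om))^2 + 2 * (d om \<bullet> p) + (ka^2 + (1 + ka)^2) * (norm p)^2"
    using r2 q2 by (simp add: algebra_simps)
   also have "(ka^2 + (1 + ka)^2) * (norm p)^2 <= (1 + 3 * ka) * (norm p)^2"
   proof (rule mult_right_mono)
    have "ka * ka <= ka * (1 / 2)" using ka by (intro mult_left_mono) auto
    then show "ka^2 + (1 + ka)^2 <= 1 + 3 * ka" by (simp add: power2_eq_square algebra_simps)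
   qed simp
   finally show ?thesis by simp
  qed
  have di: "integrable P d" "integrable P (%om. (norm (d om))\<^sup>2)" using D by (auto simp: d_def[abs_def])
  have iG: "integrable P ?G"
   by (intro Bochner_Integration.integrable_add integrable_mult_right integrable_inner_left di) simp_all
  have m: "?f \<in> borel_measurable P"
   by (rule continuous_imp_measurable_pair[OF H, where f="%x1 x2. (norm (Psi t k v x1 x2 - Phi t k u x1 x2))\<^sup>2"])
    (intro continuous_intros continuous_Phi_Psi k)
  show i: "integrable P ?f"
   by (rule Bochner_Integration.integrable_bound[OF iG m]) (auto intro!: AE_I2 order_trans[OF le] abs_ge_self)
  have "expectation ?f <= expectation ?G" by (rule integral_mono[OF i iG le])
  also have "... = 2 * expectation (%om. (norm (d om))\<^sup>2) + 2 * (expectation d \<bullet> p) + (1 + 3 * ka) * (norm p)^2"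
   using di by (simp add: prob_space)
  also have "... <= 2 * (A * k ^ 3 * w e v) + (k * (norm p)^2 + k * (A * k^2 * w e v)^2) + (1 + 3 * ka) * (norm p)^2"
  proof (intro add_right_mono add_mono)
   show "2 * expectation (%om. (norm (d om))\<^sup>2) <= 2 * (A * k ^ 3 * w e v)" using D by (simp add: d_def[abs_def])
   have "expectation d \<bullet> p <= norm (expectation d) * norm p" by (rule norm_cauchy_schwarz)
   also have "... <= (A * k ^ 3 * w e v) * norm p" using D by (intro mult_right_mono) (auto simp: d_def[abs_def])
   finally have "2 * (expectation d \<bullet> p) <= k * (2 * (A * k^2 * w e v) * norm p)" by (simp add: power3_eq_cube power2_eq_square mult_ac)
   also have "... <= k * ((A * k^2 * w e v)^2 + (norm p)^2)" using sum_squares_bound k(1) by (intro mult_left_mono) auto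
   finally show "2 * (expectation d \<bullet> p) <= k * (norm p)^2 + k * (A * k^2 * w e v)^2" by (simp add: algebra_simps)
  qed
  also have "k * (A * k^2 * w e v)^2 = A^2 * (k ^ 3 * w (2 * e) v) * k^2"
   unfolding wR_double[symmetric] by (simp add: power2_eq_square power3_eq_cube mult_ac)
  also have "A^2 * (k ^ 3 * w (2 * e) v) * k^2 <= A^2 * (k ^ 3 * w (2 * e) v) * 1"
   using k(1) k1 by (intro mult_left_mono) (auto simp: power_le_one)
  also have "2 * (A * k ^ 3 * w e v) <= 2 * (A * k ^ 3 * w (2 * e) v)"
   using A0 k(1) wR_le_double by (intro mult_left_mono) auto
  finally have "expectation ?f <= 2 * (A * k ^ 3 * w (2 * e) v) + (k * (norm p)^2 + A^2 * (k ^ 3 * w (2 * e) v) * 1) + (1 + 3 * ka) * (norm p)^2" by simp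
  also have "... = (1 + (1 + 12 * K) * k) * (norm p)^2 + (2 * A + A^2) * (k ^ 3 * w (2 * e) v)"
   by (simp add: ka_def algebra_simps)
  also have "... <= (1 + ?C * k) * (norm p)^2 + ?C * (k ^ 3 * w (2 * e) v)"
  proof -
   have "0 <= A^2" by simp
   then have c: "1 + 12 * K <= ?C" "2 * A + A^2 <= ?C" using A0 K_ge1 by linarith+
   show ?thesis
    by (rule add_mono[OF mult_right_mono[OF add_left_mono[OF mult_right_mono[OF c(1) k(1)]]] mult_right_mono[OF c(2)]])
     (use k(1) in auto)
  qed
  finally show "expectation ?f <= (1 + ?C * k) * (norm (v - u))^2 + ?C * k * (k^2 * w (2 * e) v)"
   by (simp add: p_def power3_eq_cube power2_eq_square mult_ac)
 qed
qed

end

context wiener_scheme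
begin

text \<open>The coarse chain is read off the fine increments, summed in pairs, so that both chains
  are functions of one common past.\<close>

lemma Y_coarse_path:
 assumes "mesh N t" "i <= k" "k <= N"
 shows "Y y t i om = state_path (%i v. stp (t i) (t (Suc i)) (%m. v (2 * i) m + v (Suc (2 * i)) m)) y i (incs (bisect t) {..<2 * k} om)"
 using assms(2)
proof (induction i)
 case (Suc i)
 have b: "bisect t (2 * i) = t i" "bisect t (Suc (Suc (2 * i))) = t (Suc i)" using bisect_even[of t "Suc i"] by auto
 have "stp (t i) (t (Suc i)) (inc (t i) (t (Suc i)) om) z
   = stp (t i) (t (Suc i)) (%m. incs (bisect t) {..<2 * k} om (2 * i) m + incs (bisect t) {..<2 * k} om (Suc (2 * i)) m) z" for z
  by (rule stp_cong) (use Suc.prems b in \<open>simp add: inc_add\<close>)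
 then show ?case using Suc by (simp add: Y_Suc del: sprk.simps(2))
qed simp

lemma coarse_path_measurable:
 assumes "mesh N t" "k <= N"
 shows "state_path (%i v. stp (t i) (t (Suc i)) (%m. v (2 * i) m + v (Suc (2 * i)) m)) y k \<in> borel_measurable (PiM {..<2 * k} (%_. borel))"
proof (rule path_measurable)
 fix i assume "i < k"
 then have i: "i < N" "2 * i \<in> {..<2 * k}" "Suc (2 * i) \<in> {..<2 * k}" using assms by auto
 have "continuous_on UNIV (%z. stp (t i) (t (Suc i)) (%m. fst (fst z) m + snd (fst z) m) (snd z))"
  by (intro continuous_stp' meshD(2)[OF assms(1) i(1)] continuous_fun_add continuous_intros)
 then have 1: "(%z. stp (t i) (t (Suc i)) (%m. fst (fst z) m + snd (fst z) m) (snd z)) \<in> borel_measurable ((borel \<Otimes>\<^sub>M borel) \<Otimes>\<^sub>M borel)"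
  unfolding borel_prod by (rule borel_measurable_continuous_onI)
 have 2: "(%p. ((fst p (2 * i), fst p (Suc (2 * i))), snd p)) \<in> measurable (PiM {..<2 * k} (%_. borel) \<Otimes>\<^sub>M (borel :: ('a \<times> 'b) measure))
   (((borel :: (nat => real) measure) \<Otimes>\<^sub>M (borel :: (nat => real) measure)) \<Otimes>\<^sub>M borel)"
  using i by (intro measurable_Pair measurable_compose[OF measurable_fst measurable_component_singleton] measurable_snd)
 show "(%p. stp (t i) (t (Suc i)) (%m. fst p (2 * i) m + fst p (Suc (2 * i)) m) (snd p)) \<in> borel_measurable (PiM {..<2 * k} (%_. borel) \<Otimes>\<^sub>M borel)"
  using measurable_compose[OF 2 1] by simp
qed

lemma pair_markov:
 fixes ps :: "(('a \<times> 'b) \<times> ('a \<times> 'b)) \<times> ((nat => real) \<times> (nat => real)) => real" and y :: "'a \<times> 'b" and t :: "nat => real" and k N :: nat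
 assumes t: "mesh N t" "k < N"
 defines "h \<equiv> (t (Suc k) - t k) / 2"
 defines "U \<equiv> %om. (Y y t k om, Y y (bisect t) (2 * k) om)" and "V \<equiv> %om. (inc (t k) (t k + h) om, inc (t k + h) (t k + 2 * h) om)"
 assumes ps: "continuous_on UNIV ps"
  and int: "\<And>z. integrable P (%om. ps (z, V om))" and bound: "\<And>z. expectation (%om. \<bar>ps (z, V om)\<bar>) <= B z"
  and B: "integrable P (%om. B (U om))"
 shows "integrable P (%om. ps (U om, V om))"
  "expectation (%om. ps (U om, V om)) = expectation (%om. expectation (%om'. ps (U om, V om')))"
  "integrable P (%om. expectation (%om'. ps (U om, V om')))"
  "\<bar>expectation (%om. ps (U om, V om))\<bar> <= expectation (%om. B (U om))"
proof -
 let ?s = "bisect t"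
 have kN: "k <= N" "2 * k <= 2 * N" "2 * k <= 2 * Suc k" "2 * Suc k <= 2 * N" using t by auto
 have b: "bisect t (2 * k) = t k" "bisect t (Suc (2 * k)) = t k + h" "bisect t (Suc (Suc (2 * k))) = t k + 2 * h"
  using bisect_even[of t "Suc k"] two_steps(3)[OF t] by (auto simp: bisect_odd h_def)
 let ?F = "%v. (state_path (%i v. stp (t i) (t (Suc i)) (%m. v (2 * i) m + v (Suc (2 * i)) m)) y k v,
   state_path (%i v. stp (?s i) (?s (Suc i)) (v i)) y (2 * k) v)"
 let ?G = "%v :: nat => nat => real. (v (2 * k), v (Suc (2 * k)))"
 have F: "?F \<in> borel_measurable (PiM {..<2 * k} (%_. borel))"
  by (intro borel_measurable_Pair coarse_path_measurable[OF t(1) kN(1)] path_Y_measurable[OF mesh_bisect[OF t(1)] order_refl kN(2)])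
 have G: "?G \<in> borel_measurable (PiM {2 * k..<2 * Suc k} (%_. borel))"
  by (intro borel_measurable_Pair measurable_component_singleton) auto
 have U: "U om = ?F (incs ?s {..<2 * k} om)" for om
  unfolding U_def using Y_coarse_path[OF t(1) order_refl kN(1)] Y_path[of "2 * k" "2 * k" y ?s om] by simp
 have V: "V om = ?G (incs ?s {2 * k..<2 * Suc k} om)" for om
  unfolding V_def by (simp add: b)
 note M = chain_markov[OF mesh_bisect[OF t(1)] kN(3,4) F G U V ps int bound B]
 show "integrable P (%om. ps (U om, V om))"
  "expectation (%om. ps (U om, V om)) = expectation (%om. expectation (%om'. ps (U om, V om')))"
  "integrable P (%om. expectation (%om'. ps (U om, V om')))"
  "\<bar>expectation (%om. ps (U om, V om))\<bar> <= expectation (%om. B (U om))"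
  by (rule M)+
qed

lemma uniform_moments:
 "\<exists>C\<ge>0. \<forall>y s N k. mesh N s --> k <= N -->
  integrable P (%om. w r (Y y s k om)) \<and> expectation (%om. w r (Y y s k om)) <= C * w r y"
proof -
 obtain C where C: "0 <= C" "\<And>y s N k. mesh N s ==> k <= N ==>
  integrable P (%om. w r (Y y s k om)) \<and> expectation (%om. w r (Y y s k om)) <= exp (C * (s k - s 0)) * w r y"
  using moments[of r] by blast
 show ?thesis
 proof (rule exI[of _ "exp (C * T)"], intro conjI allI impI)
  fix y s N k assume s: "mesh N s" "k <= N"
  show "integrable P (%om. w r (Y y s k om))" using C(2)[OF s] by blast
  have "exp (C * (s k - s 0)) * w r y <= exp (C * T) * w r y"
   using C(1) mesh_range(2)[OF s] by (intro mult_right_mono) (auto intro: mult_left_mono)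
  then show "expectation (%om. w r (Y y s k om)) <= exp (C * T) * w r y" using C(2)[OF s, of y] by linarith
 qed simp
qed

text \<open>Gronwall's lemma over the coarse steps: each step adds at most a multiple of its length
  times et^2, because \<open>strong_pair\<close> contributes k * k^2 and the moments of the fine
  chain are bounded uniformly.\<close>

theorem strong_bisect:
 "\<exists>C\<ge>0. \<forall>t N et k. mesh N t --> (\<forall>i<N. t (Suc i) - t i <= et) --> k <= N -->
  integrable P (%om. (norm (Y y (bisect t) (2 * k) om - Y y t k om))\<^sup>2) \<and>
  expectation (%om. (norm (Y y (bisect t) (2 * k) om - Y y t k om))\<^sup>2) <= C * et^2"
proof -
 obtain C e where C0: "0 <= C" and C: "\<And>t k u v xi1 xi2. 0 <= k ==> admissible t (t + 2 * k) ==> half_step_noise P M noise_moment k xi1 xi2 ==>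
  integrable P (%om. (norm (Psi t k v (xi1 om) (xi2 om) - Phi t k u (xi1 om) (xi2 om)))\<^sup>2) \<and>
  expectation (%om. (norm (Psi t k v (xi1 om) (xi2 om) - Phi t k u (xi1 om) (xi2 om)))\<^sup>2)
   <= (1 + C * k) * (norm (v - u))^2 + C * k * (k^2 * w e v)"
  using strong_pair by blast
 obtain A where A0: "0 <= A" and A: "\<And>y s N k. mesh N s ==> k <= N ==>
  integrable P (%om. w e (Y y s k om)) \<and> expectation (%om. w e (Y y s k om)) <= A * w e y"
  using uniform_moments[of e] by blast
 show ?thesis
 proof (rule exI[of _ "exp (C * T) * (C * (A * w e y) * T)"], intro conjI allI impI)
  show "0 <= exp (C * T) * (C * (A * w e y) * T)" using C0 A0 T_pos by simp
  fix t N et k assume t: "mesh N t" and et: "\<forall>i<N. t (Suc i) - t i <= et" and k: "k <= N"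
  let ?e = "%k om. (norm (Y y (bisect t) (2 * k) om - Y y t k om))\<^sup>2"
  let ?D = "C * (et^2 * (A * w e y))"
  have step: "integrable P (?e (Suc i)) \<and> expectation (?e (Suc i)) <= (1 + C * (t (Suc i) - t i)) * expectation (?e i) + ?D * (t (Suc i) - t i)"
   if i: "i < N" and IH: "integrable P (?e i)" for i
  proof -
   define h where "h = (t (Suc i) - t i) / 2"
   note ts = two_steps[OF t i, folded h_def]
   let ?ps = "%q. (norm (Psi (t i) h (snd (fst q)) (fst (snd q)) (snd (snd q)) - Phi (t i) h (fst (fst q)) (fst (snd q)) (snd (snd q))))\<^sup>2"
   let ?B = "%z. (1 + C * h) * (norm (snd z - fst z))^2 + C * h * (h^2 * w e (snd z))"
   have "continuous_on UNIV ?ps" unfolding Psi_def Phi_def half_def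
    by (intro continuous_intros continuous_stp' continuous_fun_add admissible_halves[OF ts(1,2)] ts(2))
   note pm = pair_markov[OF t i, folded h_def, where B="?B" and ps="?ps" and y=y, OF this, unfolded fst_conv snd_conv]
   have w': "integrable P (%om. w e (Y y (bisect t) (2 * i) om))" "expectation (%om. w e (Y y (bisect t) (2 * i) om)) <= A * w e y"
    using A[OF mesh_bisect[OF t], of "2 * i"] i by auto
   have iB: "integrable P (%om. (1 + C * h) * ?e i om + C * h * (h^2 * w e (Y y (bisect t) (2 * i) om)))"
    using IH w' by (intro Bochner_Integration.integrable_add integrable_mult_right) auto
   have bd: "expectation (%om. \<bar>(norm (Psi (t i) h (snd z) (inc (t i) (t i + h) om) (inc (t i + h) (t i + 2 * h) om) -
      Phi (t i) h (fst z) (inc (t i) (t i + h) om) (inc (t i + h) (t i + 2 * h) om)))\<^sup>2\<bar>)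
     <= (1 + C * h) * (norm (snd z - fst z))^2 + C * h * (h^2 * w e (snd z))" for z
    using C[OF ts(1,2,5)] by (simp only: abs_power2 abs_norm_cancel power2_abs)
   note R = pm[OF conjunct1[OF C[OF ts(1,2,5)]] bd iB, folded ts(6,7)]
   have "expectation (?e (Suc i)) <= (1 + C * h) * expectation (?e i) + C * h * (h^2 * expectation (%om. w e (Y y (bisect t) (2 * i) om)))"
    using R(4) IH w' by simp
   also have "... <= (1 + C * (t (Suc i) - t i)) * expectation (?e i) + C * (t (Suc i) - t i) * (et^2 * (A * w e y))"
   proof (rule add_mono)
    have h: "0 <= h" "h <= t (Suc i) - t i" "C * h <= C * (t (Suc i) - t i)" using ts(1) C0 by (auto simp: h_def intro: mult_left_mono)
    show "(1 + C * h) * expectation (?e i) <= (1 + C * (t (Suc i) - t i)) * expectation (?e i)"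
     using h by (intro mult_right_mono) auto
    have "h^2 <= et^2" using h et[rule_format, OF i] by (intro power_mono) auto
    then have "h^2 * expectation (%om. w e (Y y (bisect t) (2 * i) om)) <= et^2 * (A * w e y)"
     using w'(2) A0 by (intro mult_mono) auto
    then show "C * h * (h^2 * expectation (%om. w e (Y y (bisect t) (2 * i) om))) <= C * (t (Suc i) - t i) * (et^2 * (A * w e y))"
     by (rule mult_mono[OF h(3)]) (use h C0 in auto)
   qed
   finally show ?thesis using R(1) by (simp add: mult_ac)
  qed
  have int: "integrable P (?e i)" if "i <= N" for i
   using that by (induction i) (use step in auto)
  show "integrable P (?e k)" by (rule int[OF k])
  have "expectation (?e k) <= exp (C * (\<Sum>i<k. t (Suc i) - t i)) * (expectation (?e 0) + ?D * (\<Sum>i<k. t (Suc i) - t i))"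
   unfolding sum_distrib_left[of ?D]
   by (rule discrete_gronwall) (use C0 A0 step int k meshD(3)[OF t] in \<open>auto intro!: mult_nonneg_nonneg\<close>)
  also have "... <= exp (C * T) * (0 + ?D * T)"
   using mesh_range(2)[OF t k] mesh_mono[OF t, of 0 k] C0 A0 k unfolding sum_lessThan_telescope
   by (intro mult_mono add_mono) (auto intro!: mult_left_mono mult_nonneg_nonneg)
  finally show "expectation (?e k) <= exp (C * T) * (C * (A * w e y) * T) * et^2" by (simp add: mult_ac)
 qed
qed

lemma integrable_wcl_Y:
 fixes ph :: "'a \<times> 'b => real"
 assumes "wcl r C ph" "mesh N s" "k <= N"
 shows "integrable P (%om. ph (Y y s k om))"
proof -
 have i: "integrable P (%om. C * w r (Y y s k om))" using uniform_moments[of r] assms(2,3) by (intro integrable_mult_right) blast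
 have m: "(%om. ph (Y y s k om)) \<in> borel_measurable P"
  by (rule measurable_compose[OF Y_measurable[OF assms(2,3)] borel_measurable_continuous_onI[OF wcl_continuous[OF assms(1)]]])
 show ?thesis
  by (rule Bochner_Integration.integrable_bound[OF i m])
   (auto intro!: AE_I2 order_trans[OF wcl_abs[OF assms(1)]] simp: wcl_nonneg[OF assms(1)])
qed

lemma abs_expectation_le:
 fixes f g :: "'o => real"
 assumes "integrable P f" "integrable P g" "\<And>om. \<bar>f om\<bar> <= g om"
 shows "expectation (%om. \<bar>f om\<bar>) <= expectation g" "\<bar>expectation f\<bar> <= expectation g"
proof -
 show 1: "expectation (%om. \<bar>f om\<bar>) <= expectation g" using assms by (intro integral_mono) auto
 show "\<bar>expectation f\<bar> <= expectation g" using integral_abs_bound[of P f] 1 by linarith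
qed

text \<open>Induction over the coarse steps with a varying observable. The last two half steps are
  replaced by one coarse step, at the cost of \<open>weak_step\<close>. What remains compares the
  two chains one coarse step earlier on the observable \<open>?Q\<close>, which lies in the same
  class with a constant larger by the factor 1 + c H. This is a discrete counterpart of propagating
  the observable backwards in time.\<close>

theorem weak_bisect:
 "\<exists>C\<ge>0. \<forall>ph Cph t N et k. wcl r Cph ph --> mesh N t --> (\<forall>i<N. t (Suc i) - t i <= et) --> k <= N -->
  \<bar>expectation (%om. ph (Y y (bisect t) (2 * k) om)) - expectation (%om. ph (Y y t k om))\<bar> <= Cph * C * et^2"
proof -
 obtain c where c0: "0 <= c" and c: "\<And>(ph :: 'a \<times> 'b => real) C s s' xi. wcl r C ph ==> admissible s s' ==> noise_mom P M noise_moment (s' - s) xi ==>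
  (\<forall>y. integrable P (%om. ph (stp s s' (xi om) y))) \<and>
  wcl r (C * (1 + c * (s' - s))) (%y. expectation (%om. ph (stp s s' (xi om) y)))"
  using Q_step[of r] by blast
 obtain C e where C0: "0 <= C" and C: "\<And>(ph :: 'a \<times> 'b => real) Cph t k y xi1 xi2. wcl r Cph ph ==> 0 <= k ==> admissible t (t + 2 * k) ==> half_step_noise P M noise_moment k xi1 xi2 ==>
  integrable P (%om. ph (Psi t k y (xi1 om) (xi2 om))) \<and> integrable P (%om. ph (Phi t k y (xi1 om) (xi2 om))) \<and>
  \<bar>expectation (%om. ph (Psi t k y (xi1 om) (xi2 om))) - expectation (%om. ph (Phi t k y (xi1 om) (xi2 om)))\<bar> <= Cph * C * k ^ 3 * w e y"
  using weak_step[of r] by blast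
 obtain A where A0: "0 <= A" and A: "\<And>y s N k. mesh N s ==> k <= N ==>
  integrable P (%om. w e (Y y s k om)) \<and> expectation (%om. w e (Y y s k om)) <= A * w e y"
  using uniform_moments[of e] by blast
 obtain D where D0: "0 <= D" and D: "\<And>y s N k. mesh N s ==> k <= N ==>
  integrable P (%om. w r (Y y s k om)) \<and> expectation (%om. w r (Y y s k om)) <= D * w r y"
  using uniform_moments[of r] by blast
 let ?A = "C * (A * w e y)"
 have main: "\<bar>expectation (%om. ph (Y y (bisect t) (2 * k) om)) - expectation (%om. ph (Y y t k om))\<bar>
   <= Cph * (?A * et^2) * (t k - t 0) * exp (c * (t k - t 0))"
  if t: "mesh N t" and et: "\<forall>i<N. t (Suc i) - t i <= et" and k: "k <= N" and cl: "wcl r Cph ph"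
  for ph :: "'a \<times> 'b => real" and Cph t N et k
  using k cl
 proof (induction k arbitrary: ph Cph)
  case 0 then show ?case by simp
 next
  case (Suc k)
  note cl = Suc.prems(2) and Cph0 = wcl_nonneg[OF Suc.prems(2)]
  have k: "k < N" using Suc.prems by simp
  define h H where "h = (t (Suc k) - t k) / 2" and "H = t (Suc k) - t k"
  note ts = two_steps[OF t k, folded h_def]
  have hH: "0 <= H" "h <= H" "h <= et" "0 <= h" using ts(1) et[rule_format, OF k] by (auto simp: h_def H_def)
  let ?x1 = "inc (t k) (t k + h)" and ?x2 = "inc (t k + h) (t k + 2 * h)"
  let ?Q = "%z. expectation (%om. ph (stp (t k) (t (Suc k)) (inc (t k) (t (Suc k)) om) z))"
  note cs = c[OF cl meshD(2)[OF t k] noise_mom_mesh[OF t k]]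
  have clQ: "wcl r (Cph * (1 + c * H)) ?Q" using cs by (simp add: H_def)
  have phc: "continuous_on UNIV ph" by (rule wcl_continuous[OF cl])
  \<comment> \<open>The single coarse step, and below the two half steps, are viewed as meshes of
    their own, so that the moment bounds apply from an arbitrary state \<open>z\<close>.\<close>
  have m1: "mesh 1 (%i. t (k + i))" using meshD(2)[OF t k] admissibleD(1) by (auto simp: mesh_def)
  have m2: "mesh 2 (%i. bisect t (2 * k + i))"
   unfolding mesh_def
  proof (intro conjI allI impI)
   show "0 <= bisect t (2 * k + 0)" using mesh_range(1)[OF mesh_bisect[OF t], of "2 * k"] k by simp
   fix i :: nat assume "i < 2"
   then have "2 * k + i < 2 * N" using k by simp
   from meshD(2)[OF mesh_bisect[OF t] this] show "admissible (bisect t (2 * k + i)) (bisect t (2 * k + Suc i))" by simp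
  qed
  have b: "bisect t (2 * k) = t k" "bisect t (Suc (2 * k)) = t k + h" "bisect t (Suc (Suc (2 * k))) = t k + 2 * h"
   using bisect_even[of t "Suc k"] ts(3) by (auto simp: bisect_odd h_def)
  have Y1: "Y z (%i. t (k + i)) 1 om = stp (t k) (t (Suc k)) (inc (t k) (t (Suc k)) om) z" for z om
   unfolding One_nat_def Y_Suc by simp
  have Y2: "Y z (%i. bisect t (2 * k + i)) 2 om = Psi (t k) h z (?x1 om) (?x2 om)" for z om
  proof -
   have "Y z (%i. bisect t (2 * k + i)) (Suc (Suc 0)) om = Psi (t k) h z (?x1 om) (?x2 om)"
    unfolding Y_Suc Psi_def half_def by (simp add: b)
   then show ?thesis unfolding numeral_2_eq_2[symmetric] .
  qed
  have dom1: "expectation (%om. \<bar>ph (stp (t k) (t (Suc k)) (inc (t k) (t (Suc k)) om) z)\<bar>) <= Cph * (D * w r z)" for z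
  proof -
   note d = D[OF m1 order_refl, of z, unfolded Y1]
   have "expectation (%om. \<bar>ph (stp (t k) (t (Suc k)) (inc (t k) (t (Suc k)) om) z)\<bar>)
     <= expectation (%om. Cph * w r (stp (t k) (t (Suc k)) (inc (t k) (t (Suc k)) om) z))"
    by (rule abs_expectation_le(1)[OF spec[OF conjunct1[OF cs]]]) (use d wcl_abs[OF cl] in simp_all)
   also have "... <= Cph * (D * w r z)" using d Cph0 by (simp add: mult_left_mono)
   finally show ?thesis .
  qed
  have dom2: "expectation (%om. \<bar>ph (Psi (t k) h z (?x1 om) (?x2 om))\<bar>) <= Cph * (D * w r z)" for z
  proof -
   note d = D[OF m2 order_refl, of z, unfolded Y2]
   have "expectation (%om. \<bar>ph (Psi (t k) h z (?x1 om) (?x2 om))\<bar>) <= expectation (%om. Cph * w r (Psi (t k) h z (?x1 om) (?x2 om)))"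
    by (rule abs_expectation_le(1)[OF conjunct1[OF C[OF cl ts(1,2,5)]]]) (use d wcl_abs[OF cl] in simp_all)
   also have "... <= Cph * (D * w r z)" using d Cph0 by (simp add: mult_left_mono)
   finally show ?thesis .
  qed
  have iB1: "integrable P (%om. Cph * (D * w r (Y y t k om)))"
   using D[OF t, of k] k by (intro integrable_mult_right) simp
  have iB2: "integrable P (%om. Cph * (D * w r (Y y (bisect t) (2 * k) om)))"
   using D[OF mesh_bisect[OF t], of "2 * k"] k by (intro integrable_mult_right) simp
  have E1: "expectation (%om. ph (Y y t (Suc k) om)) = expectation (%om. ?Q (Y y t k om))"
   by (rule one_step_markov(2)[OF t k phc _ dom1 iB1]) (use cs in blast)
  let ?ps = "%q. ph (Psi (t k) h (snd (fst q)) (fst (snd q)) (snd (snd q)))"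
  have "continuous_on UNIV ?ps" unfolding Psi_def half_def
   by (rule continuous_on_compose2[OF phc]) (intro continuous_intros continuous_stp' admissible_halves[OF ts(1,2)], simp)
  note pm = pair_markov[OF t k, folded h_def, where B="%z. Cph * (D * w r (snd z))" and ps="?ps" and y=y, OF this, unfolded fst_conv snd_conv]
  note R = pm[OF conjunct1[OF C[OF cl ts(1,2,5)]] dom2 iB2, folded ts(6)]
  have QPhi: "?Q z = expectation (%om. ph (Phi (t k) h z (?x1 om) (?x2 om)))" for z
  proof (rule arg_cong[where f="%f. expectation f"], rule ext)
   fix om
   have "stp (t k) (t (Suc k)) (inc (t k) (t (Suc k)) om) z = Phi (t k) h z (?x1 om) (?x2 om)"
    unfolding Phi_def ts(3) by (rule stp_cong) (simp only: inc_add)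
   then show "ph (stp (t k) (t (Suc k)) (inc (t k) (t (Suc k)) om) z) = ph (Phi (t k) h z (?x1 om) (?x2 om))" by simp
  qed
  have w': "integrable P (%om. w e (Y y (bisect t) (2 * k) om))" "expectation (%om. w e (Y y (bisect t) (2 * k) om)) <= A * w e y"
   using A[OF mesh_bisect[OF t], of "2 * k"] k by auto
  have iQ: "integrable P (%om. ?Q (Y y (bisect t) (2 * k) om))"
   by (rule integrable_wcl_Y[OF clQ mesh_bisect[OF t]]) (use k in simp)
  have "\<bar>expectation (%om. ph (Y y (bisect t) (2 * Suc k) om)) - expectation (%om. ?Q (Y y (bisect t) (2 * k) om))\<bar>
    = \<bar>expectation (%om. expectation (%om'. ph (Psi (t k) h (Y y (bisect t) (2 * k) om) (?x1 om') (?x2 om'))) - ?Q (Y y (bisect t) (2 * k) om))\<bar>"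
   unfolding R(2) by (simp add: Bochner_Integration.integral_diff[OF R(3) iQ])
  also have "... <= expectation (%om. Cph * C * h ^ 3 * w e (Y y (bisect t) (2 * k) om))"
  proof (rule abs_expectation_le(2)[OF Bochner_Integration.integrable_diff[OF R(3) iQ]])
   show "integrable P (%om. Cph * C * h ^ 3 * w e (Y y (bisect t) (2 * k) om))" using w' by simp
  qed (unfold QPhi, use C[OF cl ts(1,2,5)] in blast)
  also have "... <= Cph * C * h ^ 3 * (A * w e y)" using w' Cph0 C0 hH by (simp add: mult_left_mono)
  also have "... <= Cph * C * (H * et^2) * (A * w e y)"
  proof (intro mult_right_mono mult_left_mono)
   have "h * h^2 <= H * et^2" using hH by (intro mult_mono power_mono) auto
   then show "h ^ 3 <= H * et^2" by (simp add: power3_eq_cube power2_eq_square)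
  qed (use Cph0 C0 A0 in auto)
  finally have loc: "\<bar>expectation (%om. ph (Y y (bisect t) (2 * Suc k) om)) - expectation (%om. ?Q (Y y (bisect t) (2 * k) om))\<bar> <= Cph * (?A * et^2) * H"
   by (simp add: mult_ac)
  let ?x = "t k - t 0" and ?X = "Cph * (?A * et^2)"
  have x0: "0 <= ?x" using mesh_mono[OF t, of 0 k] k by simp
  have X0: "0 <= ?X" using Cph0 C0 A0 by simp
  \<comment> \<open>The larger constant of the propagated observable is paid for by the longer time
    in the exponential.\<close>
  have ex: "exp (c * ?x) * (1 + c * H) <= exp (c * (?x + H))"
  proof -
   have "exp (c * ?x) * (1 + c * H) <= exp (c * ?x) * exp (c * H)" by (rule mult_left_mono[OF exp_ge_add_one_self]) simp
   also have "... = exp (c * (?x + H))" by (simp add: distrib_left exp_add)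
   finally show ?thesis .
  qed
  have "\<bar>expectation (%om. ?Q (Y y (bisect t) (2 * k) om)) - expectation (%om. ?Q (Y y t k om))\<bar> <= Cph * (1 + c * H) * (?A * et^2) * ?x * exp (c * ?x)"
   using Suc.IH[OF less_imp_le[OF k] clQ] .
  also have "... = ?X * ?x * (exp (c * ?x) * (1 + c * H))" by (simp add: mult_ac)
  also have "... <= ?X * ?x * exp (c * (?x + H))" using ex X0 x0 by (intro mult_left_mono) auto
  finally have g: "\<bar>expectation (%om. ?Q (Y y (bisect t) (2 * k) om)) - expectation (%om. ?Q (Y y t k om))\<bar> <= ?X * ?x * exp (c * (?x + H))" .
  have "?X * H <= ?X * H * exp (c * (?x + H))"
   using mult_left_mono[of 1 "exp (c * (?x + H))" "?X * H"] X0 hH(1) x0 c0 by simp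
  then have "\<bar>expectation (%om. ph (Y y (bisect t) (2 * Suc k) om)) - expectation (%om. ph (Y y t (Suc k) om))\<bar>
    <= ?X * H * exp (c * (?x + H)) + ?X * ?x * exp (c * (?x + H))"
   using loc g unfolding E1 by linarith
  also have "... = ?X * (?x + H) * exp (c * (?x + H))" by (simp add: algebra_simps)
  also have "?x + H = t (Suc k) - t 0" by (simp add: H_def)
  finally show ?case .
 qed
 show ?thesis
 proof (rule exI[of _ "?A * T * exp (c * T)"], intro conjI allI impI)
  show "0 <= ?A * T * exp (c * T)" using C0 A0 T_pos by simp
  fix ph :: "'a \<times> 'b => real" and Cph t N et k
  assume cl: "wcl r Cph ph" and t: "mesh N t" and et: "\<forall>i<N. t (Suc i) - t i <= et" and k: "k <= N"
  note main[OF t et k cl]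
  also have "Cph * (?A * et^2) * (t k - t 0) * exp (c * (t k - t 0)) <= Cph * (?A * et^2) * T * exp (c * T)"
   using mesh_range(2)[OF t k] mesh_mono[OF t, of 0 k] k wcl_nonneg[OF cl] C0 A0 c0 T_pos
   by (intro mult_mono) (auto intro!: mult_left_mono)
  finally show "\<bar>expectation (%om. ph (Y y (bisect t) (2 * k) om)) - expectation (%om. ph (Y y t k om))\<bar> <= Cph * (?A * T * exp (c * T)) * et^2"
   by (simp add: mult_ac)
 qed
qed

end

section \<open>Wiener integrals of deterministic functions\<close>

lemma norm_sum_sq:
 fixes v :: "'i => 'v::real_inner"
 shows "(norm (\<Sum>i\<in>A. x i *R v i))^2 = (\<Sum>i\<in>A. \<Sum>j\<in>A. (x i * x j) * (v i \<bullet> v j))"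
 unfolding power2_norm_eq_inner inner_sum_left inner_sum_right by (intro sum.cong refl) (simp add: inner_commute)

lemma norm_sq_triangle:
 fixes a b c :: "'v::real_normed_vector"
 shows "(norm (a - b))^2 <= 2 * (norm (a - c))^2 + 2 * (norm (c - b))^2"
proof -
 have "norm (a - b) <= norm (a - c) + norm (c - b)" by (rule norm_diff_triangle_ineq[of a c c b, simplified])
 then have "(norm (a - b))^2 <= (norm (a - c) + norm (c - b))^2" by (intro power_mono) auto
 also have "... <= 2 * (norm (a - c))^2 + 2 * (norm (c - b))^2"
  using sum_squares_bound[of "norm (a - c)" "norm (c - b)"] by (simp add: power2_sum)
 finally show ?thesis .
qed

lemma interval_overlap:
 fixes a b c d :: real
 assumes "a <= b" "c <= d"
 shows "integrable lborel (%u. indicator {a<..b} u * indicator {c<..d} u :: real)"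
  "(\<integral>u. indicator {a<..b} u * indicator {c<..d} u \<partial>lborel) = max 0 (min b d - max a c)"
proof -
 have *: "(%u. indicator {a<..b} u * indicator {c<..d} u :: real) = indicator {max a c<..min b d}"
  by (auto simp: fun_eq_iff indicator_def)
 have e: "emeasure lborel {max a c<..min b d} = ennreal (max 0 (min b d - max a c))"
  by (cases "max a c <= min b d") (auto simp: max_def)
 show "integrable lborel (%u. indicator {a<..b} u * indicator {c<..d} u :: real)"
  unfolding * using e by (intro integrable_real_indicator) auto
 show "(\<integral>u. indicator {a<..b} u * indicator {c<..d} u \<partial>lborel) = max 0 (min b d - max a c)"
 proof -
  have "measure lborel {max a c<..min b d} = max 0 (min b d - max a c)" unfolding measure_def e by (rule enn2real_ennreal) simp
  then show ?thesis unfolding * by (simp only: Bochner_Integration.integral_indicator space_lborel space_borel Int_UNIV_right)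
 qed
qed

lemma chain_le:
 fixes f :: "nat => real"
 assumes "\<And>i. i < n ==> f i <= f (Suc i)" "i <= j" "j <= n"
 shows "f i <= f j"
 using assms(2,3)
proof (induction j)
 case (Suc j) then show ?case using assms(1)[of j] by (cases "i = Suc j") auto
qed simp

text \<open>The means are summable, so the sum of the variables is finite almost surely and its
  terms tend to zero; an argument in the manner of Borel and Cantelli.\<close>

lemma AE_tendsto_zero:
 fixes A :: "nat => 'o => real"
 assumes "\<And>j. A j \<in> borel_measurable P" "\<And>j om. 0 <= A j om" "0 <= C"
  and "\<And>j. (\<integral>\<^sup>+om. ennreal (A j om) \<partial>P) <= ennreal (C * (1 / 2) ^ j)"
 shows "AE om in P. (%j. A j om) \<longlonglongrightarrow> 0"
proof -
 have "(\<integral>\<^sup>+om. (\<Sum>j. ennreal (A j om)) \<partial>P) = (\<Sum>j. \<integral>\<^sup>+om. ennreal (A j om) \<partial>P)"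
  using assms(1) by (intro nn_integral_suminf) auto
 also have "... <= (\<Sum>j. ennreal (C * (1 / 2) ^ j))" by (intro suminf_le assms(4)) auto
 also have "... = ennreal (\<Sum>j. C * (1 / 2) ^ j)"
  using assms(3) by (intro suminf_ennreal2) (auto intro!: summable_mult summable_geometric)
 finally have "(\<integral>\<^sup>+om. (\<Sum>j. ennreal (A j om)) \<partial>P) \<noteq> \<infinity>" by (auto simp: top_unique)
 then have "AE om in P. (\<Sum>j. ennreal (A j om)) \<noteq> \<infinity>"
  using assms(1) by (intro nn_integral_PInf_AE) auto
 then show ?thesis
 proof (rule AE_mp, intro AE_I2 impI)
  fix om assume "(\<Sum>j. ennreal (A j om)) \<noteq> \<infinity>"
  then have "summable (%j. A j om)" using assms(2) by (intro summable_suminf_not_top) auto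
  then show "(%j. A j om) \<longlonglongrightarrow> 0" by (rule summable_LIMSEQ_zero)
 qed
qed

context wiener
begin

lemma sq_increment:
 assumes "m \<in> {1..M}" "0 <= x" "0 <= y"
 shows "integrable P (%om. (W m x om - W m y om)\<^sup>2)" "expectation (%om. (W m x om - W m y om)\<^sup>2) = \<bar>x - y\<bar>"
proof -
 have a: "abs_moment 2 = 1" by (simp add: abs_moment_def)
 have *: "integrable P (%om. (W m x om - W m y om)\<^sup>2) \<and> expectation (%om. (W m x om - W m y om)\<^sup>2) = x - y"
  if "0 <= y" "y <= x" for x y
  using increment_moment[OF assms(1) that, of 2] that a by simp
 have s: "(%om. (W m x om - W m y om)\<^sup>2) = (%om. (W m y om - W m x om)\<^sup>2)"
  by (simp add: power2_commute)
 show "integrable P (%om. (W m x om - W m y om)\<^sup>2)" "expectation (%om. (W m x om - W m y om)\<^sup>2) = \<bar>x - y\<bar>"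
  using *[of y x] *[of x y] assms s by (cases "y <= x"; simp)+
qed

text \<open>Polarisation: the product is a combination of four squared increments, whose means are
  distances of times. Overlapping and disjoint intervals are thus treated alike.\<close>

lemma increment_cov:
 assumes m: "m \<in> {1..M}" and "0 <= a" "a <= b" "0 <= c" "c <= d"
 shows "integrable P (%om. (W m b om - W m a om) * (W m d om - W m c om))"
  "expectation (%om. (W m b om - W m a om) * (W m d om - W m c om)) = max 0 (min b d - max a c)"
proof -
 define q where "q x y om = (W m x om - W m y om)^2" for x y om
 have q: "integrable P (q x y)" "expectation (q x y) = \<bar>x - y\<bar>" if "0 <= x" "0 <= y" for x y
  using sq_increment[OF m that] by (simp_all add: q_def[abs_def])
 have eq: "(%om. (W m b om - W m a om) * (W m d om - W m c om)) = (%om. (1/2) * (q b c om + q a d om - q b d om - q a c om))"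
  by (simp add: fun_eq_iff q_def power2_eq_square algebra_simps)
 have nn: "0 <= a" "0 <= b" "0 <= c" "0 <= d" using assms by auto
 have i: "integrable P (%om. q b c om + q a d om)" "integrable P (%om. q b c om + q a d om - q b d om)"
  "integrable P (%om. q b c om + q a d om - q b d om - q a c om)"
  by (intro Bochner_Integration.integrable_diff Bochner_Integration.integrable_add q nn)+
 show "integrable P (%om. (W m b om - W m a om) * (W m d om - W m c om))"
  unfolding eq by (intro integrable_mult_right i(3))
 have "expectation (%om. q b c om + q a d om - q b d om - q a c om) = \<bar>b - c\<bar> + \<bar>a - d\<bar> - \<bar>b - d\<bar> - \<bar>a - c\<bar>"
  using i q nn by simp
 then have "expectation (%om. (1/2) * (q b c om + q a d om - q b d om - q a c om)) = (1/2) * (\<bar>b - c\<bar> + \<bar>a - d\<bar> - \<bar>b - d\<bar> - \<bar>a - c\<bar>)"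
  by (simp only: integral_mult_right_zero)
 also have "... = max 0 (min b d - max a c)" using assms by (auto simp: max_def min_def abs_if)
 finally show "expectation (%om. (W m b om - W m a om) * (W m d om - W m c om)) = max 0 (min b d - max a c)"
  unfolding eq .
qed

text \<open>The intervals may overlap, so that step functions on different grids can be compared
  without passing to a common refinement.\<close>

lemma wiener_isometry:
 fixes v :: "'i => 'v::euclidean_space"
 assumes m: "m \<in> {1..M}" and A: "finite A" and pq: "\<And>i. i \<in> A ==> 0 <= p i \<and> p i <= q i"
 shows "(\<integral>\<^sup>+om. ennreal ((norm (\<Sum>i\<in>A. (W m (q i) om - W m (p i) om) *R v i))^2) \<partial>P)
  = (\<integral>\<^sup>+u. ennreal ((norm (\<Sum>i\<in>A. indicator {p i<..q i} u *R v i))^2) \<partial>lborel)"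
proof -
 let ?X = "%i om. W m (q i) om - W m (p i) om" and ?J = "%i u. indicator {p i<..q i} u :: real"
 let ?c = "%i j. max 0 (min (q i) (q j) - max (p i) (p j))"
 let ?V = "\<Sum>i\<in>A. \<Sum>j\<in>A. ?c i j * (v i \<bullet> v j)"
 have X: "integrable P (%om. ?X i om * ?X j om)" "expectation (%om. ?X i om * ?X j om) = ?c i j" if "i \<in> A" "j \<in> A" for i j
  using increment_cov[OF m, of "p i" "q i" "p j" "q j"] pq that by auto
 have J: "integrable lborel (%u. ?J i u * ?J j u)" "(\<integral>u. ?J i u * ?J j u \<partial>lborel) = ?c i j" if "i \<in> A" "j \<in> A" for i j
  using interval_overlap[of "p i" "q i" "p j" "q j"] pq that by auto
 have "(\<integral>\<^sup>+om. ennreal (\<Sum>i\<in>A. \<Sum>j\<in>A. (?X i om * ?X j om) * (v i \<bullet> v j)) \<partial>P)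
   = ennreal (expectation (%om. \<Sum>i\<in>A. \<Sum>j\<in>A. (?X i om * ?X j om) * (v i \<bullet> v j)))"
  by (rule nn_integral_eq_integral)
   (intro Bochner_Integration.integrable_sum integrable_mult_left X, assumption+, simp flip: norm_sum_sq)
 also have "expectation (%om. \<Sum>i\<in>A. \<Sum>j\<in>A. (?X i om * ?X j om) * (v i \<bullet> v j)) = ?V"
  using X by (simp add: Bochner_Integration.integral_sum)
 finally have 1: "(\<integral>\<^sup>+om. ennreal ((norm (\<Sum>i\<in>A. ?X i om *R v i))^2) \<partial>P) = ennreal ?V" unfolding norm_sum_sq .
 have "(\<integral>\<^sup>+u. ennreal (\<Sum>i\<in>A. \<Sum>j\<in>A. (?J i u * ?J j u) * (v i \<bullet> v j)) \<partial>lborel)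
   = ennreal (\<integral>u. (\<Sum>i\<in>A. \<Sum>j\<in>A. (?J i u * ?J j u) * (v i \<bullet> v j)) \<partial>lborel)"
  by (rule nn_integral_eq_integral)
   (intro Bochner_Integration.integrable_sum integrable_mult_left J, assumption+, simp flip: norm_sum_sq)
 also have "(\<integral>u. (\<Sum>i\<in>A. \<Sum>j\<in>A. (?J i u * ?J j u) * (v i \<bullet> v j)) \<partial>lborel) = ?V"
  using J by (simp add: Bochner_Integration.integral_sum)
 finally have 2: "(\<integral>\<^sup>+u. ennreal ((norm (\<Sum>i\<in>A. ?J i u *R v i))^2) \<partial>lborel) = ennreal ?V" unfolding norm_sum_sq .
 show ?thesis unfolding 1 2 ..
qed

lemma step_isometry:
 fixes c :: "nat => 'v::euclidean_space"
 assumes m: "m \<in> {1..M}" and s: "\<And>i. i < k ==> 0 <= s i \<and> s i <= s (Suc i)" and s': "\<And>i. i < k' ==> 0 <= s' i \<and> s' i <= s' (Suc i)"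
 shows "(\<integral>\<^sup>+om. ennreal ((norm (step_integral (W m) k s c om - step_integral (W m) k' s' c' om))^2) \<partial>P)
  = (\<integral>\<^sup>+u. ennreal ((norm (step_function k s c u - step_function k' s' c' u))^2) \<partial>lborel)"
proof -
 \<comment> \<open>The disjoint union of both index sets, with negated coefficients on the
   second.\<close>
 let ?A = "{..<k} <+> {..<k'}" let ?p = "case_sum s s'" and ?q = "case_sum (%i. s (Suc i)) (%i. s' (Suc i))"
 let ?v = "case_sum c (%i. - c' i)"
 have 1: "step_integral (W m) k s c om - step_integral (W m) k' s' c' om = (\<Sum>i\<in>?A. (W m (?q i) om - W m (?p i) om) *R ?v i)" for om
  by (simp add: sum.Plus step_integral_def sum_negf comp_def)
 have 2: "step_function k s c u - step_function k' s' c' u = (\<Sum>i\<in>?A. indicator {?p i<..?q i} u *R ?v i)" for u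
  by (simp only: step_function_def sum.Plus finite_lessThan comp_def sum.case scaleR_minus_right sum_negf diff_conv_add_uminus)
 show ?thesis unfolding 1 2 by (rule wiener_isometry[OF m]) (use s s' in auto)
qed

lemma step_function_measurable [measurable]: "step_function k s c \<in> borel_measurable lborel"
 for c :: "nat => 'v::euclidean_space"
 unfolding step_function_def[abs_def] by measurable

lemma step_function_outside:
 assumes "\<And>i. i < k ==> 0 <= s i \<and> s (Suc i) <= t" "u \<notin> {0<..t}"
 shows "step_function k s c u = 0"
 unfolding step_function_def
proof (rule sum.neutral, rule ballI)
 fix i assume "i \<in> {..<k}"
 then have "u \<notin> {s i<..s (Suc i)}" using assms(1)[of i] assms(2) by auto
 then show "indicator {s i<..s (Suc i)} u *R c i = 0" by simp
qed

text \<open>The definition of the integral provides only some approximating step functions. The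
  isometry compares these with the given one, and then the approximation is refined; the constant 4
  comes from using the squared triangle inequality twice.\<close>

lemma wiener_integral_error:
 fixes c :: "nat => 'v::euclidean_space"
 assumes m: "m \<in> {1..M}" and I: "has_wiener_integral P (W m) sg t I" and t: "0 <= t"
  and s: "\<And>i. i < k ==> 0 <= s i \<and> s i <= s (Suc i) \<and> s (Suc i) <= t"
  and B: "\<And>u. u \<in> {0<..t} ==> norm (sg u - step_function k s c u) <= B"
 shows "(\<integral>\<^sup>+om. ennreal ((norm (I om - step_integral (W m) k s c om))^2) \<partial>P) <= ennreal (4 * B^2 * t)"
proof -
 obtain n' s' c' where sk: "\<And>k. s' k 0 = 0 \<and> s' k (n' k) = t \<and> (\<forall>i<n' k. s' k i <= s' k (Suc i))"
  and b: "(%k. \<integral>\<^sup>+u\<in>{0..t}. ennreal ((norm (sg u - step_function (n' k) (s' k) (c' k) u))^2) \<partial>lborel) \<longlonglongrightarrow> 0"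
  and a: "(%k. \<integral>\<^sup>+om. ennreal ((norm (I om - step_integral (W m) (n' k) (s' k) (c' k) om))^2) \<partial>P) \<longlonglongrightarrow> 0"
  using I unfolding has_wiener_integral_def by blast
 have Im [measurable]: "I \<in> borel_measurable P" and sgm [measurable]: "(%u. indicator {0..t} u *R sg u) \<in> borel_measurable lborel"
  using I by (auto simp: has_wiener_integral_def set_borel_measurable_def)
 let ?S = "step_integral (W m) k s c" and ?f = "step_function k s c"
 let ?J = "%k. step_integral (W m) (n' k) (s' k) (c' k)" and ?g = "%k. step_function (n' k) (s' k) (c' k)"
 have r: "0 <= s' k i \<and> s' k i <= s' k (Suc i) \<and> s' k (Suc i) <= t" if "i < n' k" for k i
  using chain_le[of "n' k" "s' k" 0 i] chain_le[of "n' k" "s' k" "Suc i" "n' k"] sk[of k] that by auto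
 have SM: "step_integral (W m) k s c \<in> borel_measurable P" if "\<And>i. i < k ==> 0 <= s i \<and> s i <= s (Suc i) \<and> s (Suc i) <= t" for k s and c :: "nat => 'v"
 proof -
  have "W m (s i) \<in> borel_measurable P" "W m (s (Suc i)) \<in> borel_measurable P" if "i < k" for i
   using \<open>\<And>i. i < k ==> _\<close>[OF that] m by (auto intro: measurable_W order_trans)
  then show ?thesis unfolding step_integral_def[abs_def]
   by (intro borel_measurable_sum borel_measurable_scaleR borel_measurable_diff borel_measurable_const) auto
 qed
 have Sm [measurable]: "?S \<in> borel_measurable P" by (rule SM) (rule s)
 have Jm [measurable]: "?J k \<in> borel_measurable P" for k by (rule SM) (rule r)
 define a' b' where "a' k = (\<integral>\<^sup>+om. ennreal ((norm (I om - ?J k om))^2) \<partial>P)"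
  and "b' k = (\<integral>\<^sup>+u\<in>{0..t}. ennreal ((norm (sg u - ?g k u))^2) \<partial>lborel)" for k
 have sq: "ennreal ((norm (x - z))^2) <= 2 * ennreal ((norm (x - y))^2) + 2 * ennreal ((norm (y - z))^2)" for x y z :: 'v
  using norm_sq_triangle[of x z y] by (simp flip: ennreal_plus ennreal_numeral ennreal_mult'' add: ennreal_leI)
 have le: "(\<integral>\<^sup>+om. ennreal ((norm (I om - ?S om))^2) \<partial>P) <= 2 * a' k + 2 * (2 * b' k + 2 * ennreal (B^2 * t))" for k
 proof -
  have "(\<integral>\<^sup>+om. ennreal ((norm (I om - ?S om))^2) \<partial>P)
    <= (\<integral>\<^sup>+om. 2 * ennreal ((norm (I om - ?J k om))^2) + 2 * ennreal ((norm (?J k om - ?S om))^2) \<partial>P)"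
   by (intro nn_integral_mono sq)
  also have "... = 2 * a' k + 2 * (\<integral>\<^sup>+om. ennreal ((norm (?J k om - ?S om))^2) \<partial>P)"
   by (simp add: nn_integral_add nn_integral_cmult a'_def)
  also have "(\<integral>\<^sup>+om. ennreal ((norm (?J k om - ?S om))^2) \<partial>P) = (\<integral>\<^sup>+u. ennreal ((norm (?g k u - ?f u))^2) \<partial>lborel)"
   by (rule step_isometry[OF m]) (use r s in auto)
  also have "... <= (\<integral>\<^sup>+u. 2 * (ennreal ((norm (sg u - ?g k u))^2) * indicator {0..t} u) + 2 * (ennreal (B^2) * indicator {0..t} u) \<partial>lborel)"
  proof (rule nn_integral_mono)
   fix u :: real
   show "ennreal ((norm (?g k u - ?f u))^2) <= 2 * (ennreal ((norm (sg u - ?g k u))^2) * indicator {0..t} u) + 2 * (ennreal (B^2) * indicator {0..t} u)"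
   proof (cases "u \<in> {0<..t}")
    case True
    have "ennreal ((norm (?g k u - ?f u))^2) <= 2 * ennreal ((norm (?g k u - sg u))^2) + 2 * ennreal ((norm (sg u - ?f u))^2)" by (rule sq)
    also have "... <= 2 * ennreal ((norm (?g k u - sg u))^2) + 2 * ennreal (B^2)"
     using B[OF True] by (intro add_left_mono mult_left_mono ennreal_leI power_mono) auto
    finally show ?thesis using True by (simp add: norm_minus_commute)
   next
    case False
    have "?g k u = 0" "?f u = 0" using step_function_outside[OF _ False] r s by blast+
    then show ?thesis by simp
   qed
  qed
  also have "... = 2 * b' k + 2 * ennreal (B^2 * t)"
  proof -
   have "(%u. ennreal ((norm (sg u - ?g k u))^2) * indicator {0..t} u) = (%u. ennreal ((norm (indicator {0..t} u *R sg u - indicator {0..t} u *R ?g k u))^2))"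
    by (auto simp: fun_eq_iff indicator_def)
   moreover have "(%u. ennreal ((norm (indicator {0..t} u *R sg u - indicator {0..t} u *R ?g k u))^2)) \<in> borel_measurable lborel" by measurable
   ultimately have "(%u. ennreal ((norm (sg u - ?g k u))^2) * indicator {0..t} u) \<in> borel_measurable lborel" by simp
   then show ?thesis using t
    by (simp add: nn_integral_add nn_integral_cmult nn_integral_cmult_indicator b'_def ennreal_mult'')
  qed
  finally show ?thesis by (simp add: mult_left_mono add_left_mono)
 qed
 have "(%k. 2 * a' k + 2 * (2 * b' k + 2 * ennreal (B^2 * t))) \<longlonglongrightarrow> 2 * 0 + 2 * (2 * 0 + 2 * ennreal (B^2 * t))"
  using a b unfolding a'_def[symmetric] b'_def[symmetric] by (intro tendsto_add ennreal_tendsto_cmult tendsto_const) auto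
 then have "(\<integral>\<^sup>+om. ennreal ((norm (I om - ?S om))^2) \<partial>P) <= 2 * 0 + 2 * (2 * 0 + 2 * ennreal (B^2 * t))"
  by (rule LIMSEQ_le_const) (use le in auto)
 also have "... = ennreal (4 * B^2 * t)"
  using t by (simp flip: ennreal_numeral ennreal_mult'' add: mult_ac)
 finally show ?thesis .
qed

end

section \<open>Pathwise convergence of dyadic refinements\<close>

text \<open>A deterministic estimate for a single path: \<open>S\<close> is the noise accumulated by
  the method and \<open>z\<close> that of the solution. The regularity of \<open>x\<close> enters
  only through its oscillation \<open>ep\<close>. This gives consistency without a rate, which is
  enough to identify the limit.\<close>

lemma (in scheme) pathwise_error:
 fixes y z S :: "nat => 'a \<times> 'b" and x :: "real => 'a \<times> 'b"
 assumes s: "mesh N s" and j: "j <= N"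
  and y: "\<And>i. i < N ==> y (Suc i) = stp (s i) (s (Suc i)) (xi i) (y i)"
  and x: "\<And>i. i < N ==> x (s (Suc i)) - x (s i) = integral {s i..s (Suc i)} (%u. a (x u) u) + (z (Suc i) - z i)"
  and S: "\<And>i. i < N ==> S (Suc i) = S i + (1/2) *R (Sg (s i) (xi i) + Sg (s (Suc i)) (xi i))"
  and init: "y 0 - x (s 0) = S 0 - z 0" and cont: "continuous_on {0..T} (%u. a (x u) u)"
  and R: "\<And>i. i <= N ==> norm (x (s i)) <= R" and ep: "0 <= ep" "ep <= 1"
  and osc: "\<And>i u. i < N ==> u \<in> {s i..s (Suc i)} ==> norm (x u - x (s i)) <= ep"
  and small: "\<And>i. i < N ==> n (xi i) <= ep" "\<And>i. i < N ==> s (Suc i) - s i <= ep"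
 shows "norm (y j - x (s j)) <= exp (10 * K^2 * T) * (10 * K^2 * ((\<Sum>i<j. (s (Suc i) - s i) * norm (S i - z i)) + T * (ep * (1 + R)))) + norm (S j - z j)"
proof -
 \<comment> \<open>With the noise error \<open>S i - z i\<close> removed, the recursion contains
   differences of the drift only. The noise error re-enters through the arguments of the drift,
   multiplied by the step size.\<close>
 define D where "D i = y i - x (s i) - (S i - z i)" for i
 let ?C = "10 * K^2"
 have R0: "0 <= R" using R[of 0] norm_ge_zero[of "x (s 0)"] by linarith
 have "K <= K^2" using K_ge1 mult_left_mono[of 1 K K] by (simp add: power2_eq_square)
 then have KK: "K <= K^2" "1 <= K^2" using K_ge1 by linarith+
 have step: "norm (D (Suc i)) <= (1 + ?C * (s (Suc i) - s i)) * norm (D i) + ?C * ((s (Suc i) - s i) * (norm (S i - z i) + ep * (1 + R)))"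
  if i: "i < N" for i
 proof -
  note ad = admissibleD[OF meshD(2)[OF s i]]
  define h where "h = s (Suc i) - s i"
  define g where "g = stg (s i) (s (Suc i)) (xi i) (y i)"
  define e where "e = norm (y i - x (s i))"
  have h: "0 <= h" "h <= ep" using ad(3) small(2)[OF i] by (auto simp: h_def)
  have e: "0 <= e" "e <= norm (D i) + norm (S i - z i)"
   using norm_triangle_ineq[of "D i" "S i - z i"] by (auto simp: e_def D_def)
  have ny: "norm (y i) <= e + R" using norm_triangle_ineq[of "y i - x (s i)" "x (s i)"] R[of i] i by (simp add: e_def)
  let ?A = "(h / 2) *R (a g (s (Suc i)) - a (y i) (s i))" and ?B = "h *R (a (y i) (s i) - a (x (s i)) (s i))"
  let ?E = "integral {s i..s (Suc i)} (%u. a (x u) u - a (x (s i)) (s i))"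
  have cs: "continuous_on {s i..s (Suc i)} (%u. a (x u) u)"
   by (rule continuous_on_subset[OF cont]) (use ad in auto)
  have int: "(%u. a (x u) u) integrable_on {s i..s (Suc i)}"
   using integrable_continuous[of "s i" "s (Suc i)"] cs by (simp add: cbox_interval)
  have E: "?E = integral {s i..s (Suc i)} (%u. a (x u) u) - h *R a (x (s i)) (s i)"
   using int ad(3) by (subst Henstock_Kurzweil_Integration.integral_diff) (auto simp: h_def)
  have "D (Suc i) = D i + (?A + ?B - ?E)"
   unfolding D_def E using x[OF i] y[OF i] S[OF i] stp_eq[OF meshD(2)[OF s i], of "xi i" "y i"]
   by (simp add: g_def h_def algebra_simps flip: scaleR_add_left)
  then have "norm (D (Suc i)) <= norm (D i) + (norm ?A + norm ?B + norm ?E)"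
   by (smt (verit) norm_triangle_ineq norm_triangle_ineq4)
  moreover have "norm ?A <= h * (K^2 * (2 * e + 5 * (ep * (1 + R))))"
  proof -
   have g: "norm (g - y i) <= 4 * K * (ep * (1 + (e + R)) + ep)"
   proof -
    have "norm (g - y i) <= 4 * K * (h * (1 + norm (y i)) + n (xi i))"
     using stg_disp[OF meshD(2)[OF s i], of "xi i" "y i"] by (simp add: g_def h_def)
    also have "... <= 4 * K * (ep * (1 + (e + R)) + ep)"
     using h ny small(1)[OF i] K_ge1 ep by (intro mult_left_mono add_mono mult_mono) auto
    finally show ?thesis .
   qed
   have "norm (a g (s (Suc i)) - a (y i) (s i)) <= K * (norm (g - y i) + h)"
    using drift_lipschitz[OF ad(2,1), of g "y i"] h(1) by (simp add: h_def)
   also have "... <= K * (4 * K * (ep * (1 + (e + R)) + ep) + K * ep)"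
   proof (intro mult_left_mono add_mono g)
    show "h <= K * ep" using h K_ge1 ep mult_right_mono[of 1 K ep] by linarith
   qed (use K_ge1 in auto)
   also have "... = K^2 * (4 * (ep * e) + 4 * (ep * R) + 9 * ep)" by (simp add: power2_eq_square algebra_simps)
   also have "... <= K^2 * (2 * (2 * e + 5 * (ep * (1 + R))))"
   proof (rule mult_left_mono)
    have "ep * e <= 1 * e" "0 <= ep * R" by (rule mult_right_mono[OF ep(2) e(1)], rule mult_nonneg_nonneg[OF ep(1) R0])
    then show "4 * (ep * e) + 4 * (ep * R) + 9 * ep <= 2 * (2 * e + 5 * (ep * (1 + R)))" using ep by (simp add: algebra_simps)
   qed simp
   finally have "(h / 2) * norm (a g (s (Suc i)) - a (y i) (s i)) <= (h / 2) * (K^2 * (2 * (2 * e + 5 * (ep * (1 + R)))))"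
    using h by (intro mult_left_mono) auto
   also have "... = h * (K^2 * (2 * e + 5 * (ep * (1 + R))))" by simp
   finally show ?thesis unfolding norm_scaleR using h by simp
  qed
  moreover have "norm ?B <= h * (K^2 * e)"
  proof -
   have "norm (a (y i) (s i) - a (x (s i)) (s i)) <= K * e" using drift_lipschitz[OF ad(1,1), of "y i" "x (s i)"] by (simp add: e_def)
   also have "... <= K^2 * e" using KK e by (intro mult_right_mono) auto
   finally show ?thesis using h by (simp add: mult_left_mono)
  qed
  moreover have "norm ?E <= h * (K^2 * (2 * (ep * (1 + R))))"
  proof -
   have "norm ?E <= (K * (ep + ep)) * (s (Suc i) - s i)"
   proof (rule integral_bound[OF ad(3)])
    show "continuous_on {s i..s (Suc i)} (%u. a (x u) u - a (x (s i)) (s i))" by (intro continuous_intros cs)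
    fix u assume u: "u \<in> {s i..s (Suc i)}"
    then have "norm (a (x u) u - a (x (s i)) (s i)) <= K * (norm (x u - x (s i)) + \<bar>u - s i\<bar>)" using ad by (intro drift_lipschitz) auto
    also have "... <= K * (ep + ep)" using osc[OF i u] u h K_ge1 by (intro mult_left_mono add_mono) (auto simp: h_def)
    finally show "norm (a (x u) u - a (x (s i)) (s i)) <= K * (ep + ep)" .
   qed
   also have "... = h * (K * (2 * ep))" by (simp add: h_def)
   also have "... <= h * (K^2 * (2 * (ep * (1 + R))))"
   proof (intro mult_left_mono[OF mult_mono] KK(1))
    show "2 * ep <= 2 * (ep * (1 + R))" using ep R0 by (simp add: algebra_simps)
   qed (use h ep in auto)
   finally show ?thesis .
  qed
  ultimately have "norm (D (Suc i)) <= norm (D i) + h * (K^2 * (3 * e + 7 * (ep * (1 + R))))" by (simp add: algebra_simps)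
  also have "... <= norm (D i) + h * (K^2 * (10 * (norm (D i) + norm (S i - z i)) + 10 * (ep * (1 + R))))"
  proof -
   have nn: "0 <= ep * (1 + R)" using ep R0 by simp
   have "3 * v + 7 * p <= 10 * u + 10 * p" if "0 <= p" "0 <= v" "v <= u" for p u v :: real using that by linarith
   from this[OF nn e] have "3 * e + 7 * (ep * (1 + R)) <= 10 * (norm (D i) + norm (S i - z i)) + 10 * (ep * (1 + R))" .
   then show ?thesis using h by (intro add_left_mono mult_left_mono) auto
  qed
  also have "... = (1 + ?C * h) * norm (D i) + ?C * (h * (norm (S i - z i) + ep * (1 + R)))" by (simp add: algebra_simps)
  finally show ?thesis unfolding h_def .
 qed
 let ?q = "%i. norm (S i - z i) + ep * (1 + R)" and ?h = "%i. s (Suc i) - s i"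
 have hT: "0 <= (\<Sum>i<j. ?h i)" "(\<Sum>i<j. ?h i) <= T"
  unfolding sum_lessThan_telescope using mesh_range(2)[OF s j] mesh_mono[OF s, of 0 j] j by auto
 have er: "0 <= ep * (1 + R)" using ep R0 by simp
 have D0: "D 0 = 0" using init by (simp add: D_def)
 have "norm (D j) <= exp (?C * (\<Sum>i<j. ?h i)) * (norm (D 0) + (\<Sum>i<j. ?C * (?h i * ?q i)))"
  by (rule discrete_gronwall[where x="%i. norm (D i)"]) (use step meshD(3)[OF s] j er in \<open>auto intro!: mult_nonneg_nonneg add_nonneg_nonneg\<close>)
 also have "... <= exp (?C * T) * (?C * ((\<Sum>i<j. ?h i * norm (S i - z i)) + T * (ep * (1 + R))))"
 proof (rule mult_mono)
  show "exp (?C * (\<Sum>i<j. ?h i)) <= exp (?C * T)" using hT by (simp add: mult_left_mono)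
  have "(\<Sum>i<j. ?h i * ?q i) = (\<Sum>i<j. ?h i * norm (S i - z i)) + (\<Sum>i<j. ?h i) * (ep * (1 + R))"
   by (simp add: distrib_left sum.distrib sum_distrib_right)
  also have "... <= (\<Sum>i<j. ?h i * norm (S i - z i)) + T * (ep * (1 + R))"
   using hT er by (intro add_left_mono mult_right_mono) auto
  finally show "norm (D 0) + (\<Sum>i<j. ?C * (?h i * ?q i)) <= ?C * ((\<Sum>i<j. ?h i * norm (S i - z i)) + T * (ep * (1 + R)))"
   unfolding D0 sum_distrib_left[symmetric] by (simp add: mult_left_mono)
 qed (use meshD(3)[OF s] j er in \<open>auto intro!: sum_nonneg mult_nonneg_nonneg add_nonneg_nonneg\<close>)
 finally show ?thesis using norm_triangle_ineq[of "D j" "S j - z j"] by (simp add: D_def)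
qed

definition refine :: "(nat => real) => nat => nat => real" where
 "refine t j = (bisect ^^ j) t"

lemma refine_0 [simp]: "refine t 0 = t" by (simp add: refine_def)
lemma refine_Suc: "refine t (Suc j) = bisect (refine t j)" by (simp add: refine_def)

lemma refine_point [simp]: "refine t j (2 ^ j * i) = t i"
 by (induction j) (simp_all add: refine_Suc mult.assoc)

lemma bisect_step: "bisect t (Suc i) - bisect t i = (t (Suc (i div 2)) - t (i div 2)) / 2"
proof (cases "even i")
 case True then show ?thesis by (simp add: bisect_def)
next
 case False
 then have "Suc i = 2 * Suc (i div 2)" by presburger
 then have "bisect t (Suc i) = t (Suc (i div 2))" using bisect_even[of t "Suc (i div 2)"] by simp
 then show ?thesis using False by (simp add: bisect_def field_simps)
qed

lemma refine_step:
 assumes "\<And>i. i < N ==> t (Suc i) - t i <= et" "i < 2 ^ j * N"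
 shows "refine t j (Suc i) - refine t j i <= et * (1 / 2) ^ j"
 using assms(2)
proof (induction j arbitrary: i)
 case 0 then show ?case using assms(1) by simp
next
 case (Suc j)
 then have "i div 2 < 2 ^ j * N" by auto
 from Suc.IH[OF this] show ?case unfolding refine_Suc bisect_step by simp
qed

lemma (in scheme) mesh_refine: "mesh N t ==> mesh (2 ^ j * N) (refine t j)"
proof (induction j)
 case (Suc j) then show ?case using mesh_bisect[of "2 ^ j * N" "refine t j"] by (simp add: refine_Suc mult.assoc)
qed simp

text \<open>A weighted triangle inequality for squares; the weights 2^i are harmless because the
  squared changes under bisection decay like 4^-i.\<close>

lemma telescope_sq:
 fixes u :: "nat => 'v::real_normed_vector"
 shows "(norm (u j - u 0))^2 <= 2 * (\<Sum>i<j. 2 ^ i * (norm (u (Suc i) - u i))^2)"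
proof (induction j arbitrary: u)
 case (Suc j)
 have "(norm (u (Suc j) - u 0))^2 <= 2 * (norm (u (Suc j) - u 1))^2 + 2 * (norm (u 1 - u 0))^2" by (rule norm_sq_triangle)
 also have "(norm (u (Suc j) - u 1))^2 <= 2 * (\<Sum>i<j. 2 ^ i * (norm (u (Suc (Suc i)) - u (Suc i)))^2)"
  using Suc.IH[of "%i. u (Suc i)"] by simp
 finally have "(norm (u (Suc j) - u 0))^2 <= 2 * (norm (u 1 - u 0))^2 + 2 * (2 * (\<Sum>i<j. 2 ^ i * (norm (u (Suc (Suc i)) - u (Suc i)))^2))" by simp
 also have "... = 2 * (\<Sum>i<Suc j. 2 ^ i * (norm (u (Suc i) - u i))^2)"
  unfolding sum.lessThan_Suc_shift by (simp add: sum_distrib_left mult_ac)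
 finally show ?case .
qed simp

lemma geometric_half: "(\<Sum>i<j. (1 / 2) ^ i :: real) <= 2"
 by (simp add: geometric_sum)

lemma fatou_bound:
 fixes f :: "nat => 'o => real"
 assumes "\<And>j. integrable P (f j)" "\<And>j om. 0 <= f j om" "\<And>j. (\<integral>om. f j om \<partial>P) <= B"
  and g: "g \<in> borel_measurable P" "\<And>om. 0 <= g om" and lim: "AE om in P. (%j. f j om) \<longlonglongrightarrow> g om"
 shows "integrable P g" "(\<integral>om. g om \<partial>P) <= B"
proof -
 have B0: "0 <= B" using assms(3)[of 0] Bochner_Integration.integral_nonneg[of P "f 0"] assms(2) by (meson order_trans)
 have "(\<integral>\<^sup>+om. ennreal (g om) \<partial>P) = (\<integral>\<^sup>+om. liminf (%j. ennreal (f j om)) \<partial>P)"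
 proof (rule nn_integral_cong_AE, rule AE_mp[OF lim], intro AE_I2 impI)
  fix om assume "(%j. f j om) \<longlonglongrightarrow> g om"
  then have "(%j. ennreal (f j om)) \<longlonglongrightarrow> ennreal (g om)" by (rule tendsto_ennrealI)
  from lim_imp_Liminf[OF _ this] show "ennreal (g om) = liminf (%j. ennreal (f j om))" by simp
 qed
 also have "... <= liminf (%j. \<integral>\<^sup>+om. ennreal (f j om) \<partial>P)"
  using assms(1) by (intro nn_integral_liminf) auto
 also have "... <= liminf (%j. ennreal B)"
 proof (rule Liminf_mono, rule always_eventually, rule allI)
  fix j show "(\<integral>\<^sup>+om. ennreal (f j om) \<partial>P) <= ennreal B"
   using nn_integral_eq_integral[OF assms(1)[of j]] assms(2,3) by (simp add: ennreal_leI)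
 qed
 also have "... = ennreal B" by (simp add: Liminf_const)
 finally have le: "(\<integral>\<^sup>+om. ennreal (g om) \<partial>P) <= ennreal B" .
 show i: "integrable P g"
  using le_less_trans[OF le ennreal_less_top] g by (intro integrableI_nonneg) auto
 then have "ennreal (\<integral>om. g om \<partial>P) <= ennreal B" using le nn_integral_eq_integral[OF i] g(2) by simp
 then show "(\<integral>om. g om \<partial>P) <= B" using B0 by (simp add: ennreal_le_iff)
qed

lemma interval_of_point:
 fixes s :: "nat => real"
 assumes "s 0 < u" "u <= s i"
 shows "\<exists>l<i. u \<in> {s l<..s (Suc l)}"
 using assms(2)
proof (induction i)
 case 0 then show ?case using assms(1) by simp
next
 case (Suc i) then show ?case by (cases "u <= s i") (auto intro: less_SucI)
qed

lemma step_function_value: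
 assumes "\<And>i. i < k ==> s i <= s (Suc i)" "l < k" "u \<in> {s l<..s (Suc l)}"
 shows "step_function k s c u = c l"
proof -
 have "step_function k s c u = (\<Sum>i<k. if i = l then c l else 0)"
  unfolding step_function_def
 proof (rule sum.cong[OF refl])
  fix i assume i: "i \<in> {..<k}"
  have "u \<notin> {s i<..s (Suc i)}" if "i \<noteq> l"
  proof (cases "i < l")
   case True
   then have "s (Suc i) <= s l" using chain_le[of k s "Suc i" l] assms by simp
   then show ?thesis using assms(3) by auto
  next
   case False
   then have "s (Suc l) <= s i" using chain_le[of k s "Suc l" i] assms i that by simp
   then show ?thesis using assms(3) by auto
  qed
  then show "indicator {s i<..s (Suc i)} u *R c i = (if i = l then c l else 0)" using assms(3) by (cases "i = l") auto
 qed
 then show ?thesis using assms(2) by simp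
qed

text \<open>The step function takes the mean of the two end values on each subinterval, which is
  exactly the weight that the method gives to the increment.\<close>

lemma trapezoid_error:
 fixes sg :: "real => 'v::real_normed_vector"
 assumes lip: "\<And>u v. u \<in> {0..T} ==> v \<in> {0..T} ==> norm (sg u - sg v) <= K * \<bar>u - v\<bar>" and K: "0 <= K"
  and s: "s 0 = 0" "\<And>i. i < k ==> s i <= s (Suc i) \<and> s (Suc i) - s i <= et \<and> s (Suc i) <= T" and u: "u \<in> {0<..s k}"
 shows "norm (sg u - step_function k s (%l. (1/2) *R (sg (s l) + sg (s (Suc l)))) u) <= K * et"
proof -
 obtain l where l: "l < k" "u \<in> {s l<..s (Suc l)}" using interval_of_point[of s u k] u s(1) by auto
 have sl: "0 <= s l" using chain_le[of k s 0 l] s l by simp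
 have f: "step_function k s (%l. (1/2) *R (sg (s l) + sg (s (Suc l)))) u = (1/2) *R (sg (s l) + sg (s (Suc l)))"
  by (rule step_function_value[OF _ l]) (use s in auto)
 have r: "s l \<in> {0..T}" "s (Suc l) \<in> {0..T}" "u \<in> {0..T}" using sl l s(2)[OF l(1)] by auto
 have "norm (sg u - sg (s l)) <= K * et" "norm (sg u - sg (s (Suc l))) <= K * et"
  using lip[OF r(3,1)] lip[OF r(3,2)] l s(2)[OF l(1)] K
  by (auto intro: order_trans[OF _ mult_left_mono[OF _ K]])
 moreover have "sg u - (1/2) *R (sg (s l) + sg (s (Suc l))) = (1/2) *R ((sg u - sg (s l)) + (sg u - sg (s (Suc l))))"
  by (simp add: algebra_simps flip: scaleR_add_left)
 ultimately show ?thesis unfolding f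
  using norm_triangle_ineq[of "sg u - sg (s l)" "sg u - sg (s (Suc l))"] by simp
qed

lemma eventually_modulus:
 fixes f :: "real => 'v::real_normed_vector"
 assumes "continuous_on {0..T} f" "0 < e" "et \<longlonglongrightarrow> 0"
 shows "eventually (%j. \<forall>u\<in>{0..T}. \<forall>v\<in>{0..T}. \<bar>u - v\<bar> <= et j --> norm (f u - f v) <= e) sequentially"
proof -
 have "uniformly_continuous_on {0..T} f" by (rule compact_uniformly_continuous[OF assms(1)]) simp
 then obtain d where d: "0 < d" "\<And>u v. u \<in> {0..T} ==> v \<in> {0..T} ==> dist v u < d ==> dist (f v) (f u) < e"
  unfolding uniformly_continuous_on_def using assms(2) by metis
 have "eventually (%j. et j < d) sequentially" using order_tendstoD(2)[OF assms(3) d(1)] .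
 then show ?thesis
 proof eventually_elim
  case (elim j)
  show ?case
  proof (intro ballI impI)
   fix u v assume "u \<in> {0..T}" "v \<in> {0..T}" "\<bar>u - v\<bar> <= et j"
   then show "norm (f u - f v) <= e" using d(2)[of v u] elim by (simp add: dist_norm)
  qed
 qed
qed

lemma (in scheme) drift_continuous:
 assumes "continuous_on {0..T} x"
 shows "continuous_on {0..T} (%u. a (x u) u)"
 unfolding continuous_on_def
proof
 fix v assume v: "v \<in> {0..T}"
 have "((%u. a (x u) u - a (x v) v) \<longlongrightarrow> 0) (at v within {0..T})"
 proof (rule Lim_null_comparison)
  show "eventually (%u. norm (a (x u) u - a (x v) v) <= K * (norm (x u - x v) + \<bar>u - v\<bar>)) (at v within {0..T})"
   unfolding eventually_at_filter using drift_lipschitz v by (auto intro!: always_eventually)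
  have "((%u. K * (norm (x u - x v) + \<bar>u - v\<bar>)) \<longlongrightarrow> K * (norm (x v - x v) + \<bar>v - v\<bar>)) (at v within {0..T})"
   using assms v by (intro tendsto_intros) (auto simp: continuous_on_def)
  then show "((%u. K * (norm (x u - x v) + \<bar>u - v\<bar>)) \<longlongrightarrow> 0) (at v within {0..T})" by simp
 qed
 then show "((%u. a (x u) u) \<longlongrightarrow> a (x v) v) (at v within {0..T})" by (rule LIM_zero_cancel)
qed

lemma (in scheme) coefficient_lipschitz:
 assumes "m \<in> {1..M}" "u \<in> {0..T}" "v \<in> {0..T}"
 shows "norm (g1 m u - g1 m v) <= K * \<bar>u - v\<bar>" "norm (g2 m u - g2 m v) <= K * \<bar>u - v\<bar>"
proof -
 let ?de = "%i. if i = m then 1 else 0 :: real"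
 have "Sg u ?de = (g1 m u, g2 m u)" for u
 proof -
  have "Sg u ?de = (\<Sum>i=1..M. if i = m then (g1 m u, g2 m u) else 0)" unfolding noise_def by (intro sum.cong) (auto simp: zero_prod_def)
  then show ?thesis using assms(1) by simp
 qed
 moreover have "n ?de = 1"
 proof -
  have "n ?de = (\<Sum>i=1..M. if i = m then 1 else 0)" unfolding nz_def by (intro sum.cong) auto
  then show ?thesis using assms(1) by simp
 qed
 ultimately have "norm (g1 m u - g1 m v, g2 m u - g2 m v) <= K * \<bar>u - v\<bar>"
  using noise_lipschitz[OF assms(2,3), of ?de] by simp
 then show "norm (g1 m u - g1 m v) <= K * \<bar>u - v\<bar>" "norm (g2 m u - g2 m v) <= K * \<bar>u - v\<bar>"
  using norm_fst_le[of "g1 m u - g1 m v" "g2 m u - g2 m v"] norm_snd_le[of "g2 m u - g2 m v" "g1 m u - g1 m v"] by linarith+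
qed

text \<open>Uses x <= x^2 / et + et, a form of Young's inequality scaled so that both terms are of
  size \<open>et\<close> after integration.\<close>

lemma (in wiener) L1_from_L2:
 fixes f :: "'o => 'v::euclidean_space"
 assumes "f \<in> borel_measurable P" "(\<integral>\<^sup>+om. ennreal ((norm (f om))^2) \<partial>P) <= ennreal (C * et^2)" "0 < et" "0 <= C"
 shows "(\<integral>\<^sup>+om. ennreal (norm (f om)) \<partial>P) <= ennreal ((C + 1) * et)"
proof -
 have x: "x <= (1 / et) * x^2 + et" if "0 <= x" for x :: real
 proof (cases "x <= et")
  case True then show ?thesis using assms(3) by (smt (verit) divide_nonneg_pos mult_nonneg_nonneg zero_le_power2)
 next
  case False
  then have "x * et <= x * x" using that by (intro mult_left_mono) auto
  then have "x <= (1 / et) * x^2" using assms(3) by (simp add: power2_eq_square pos_le_divide_eq)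
  then show ?thesis using assms(3) by simp
 qed
 have "(\<integral>\<^sup>+om. ennreal (norm (f om)) \<partial>P) <= (\<integral>\<^sup>+om. ennreal (1 / et) * ennreal ((norm (f om))^2) + ennreal et \<partial>P)"
 proof (rule nn_integral_mono)
  fix om
  have "ennreal (norm (f om)) <= ennreal ((1 / et) * (norm (f om))^2 + et)" by (rule ennreal_leI[OF x]) simp
  also have "... = ennreal (1 / et) * ennreal ((norm (f om))^2) + ennreal et"
   using assms(3) by (simp only: ennreal_plus ennreal_mult zero_le_divide_1_iff less_imp_le zero_le_power2 mult_nonneg_nonneg)
  finally show "ennreal (norm (f om)) <= ennreal (1 / et) * ennreal ((norm (f om))^2) + ennreal et" .
 qed
 also have "... = ennreal (1 / et) * (\<integral>\<^sup>+om. ennreal ((norm (f om))^2) \<partial>P) + ennreal et"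
  using assms(1) by (simp add: nn_integral_add nn_integral_cmult emeasure_space_1)
 also have "... <= ennreal (1 / et) * ennreal (C * et^2) + ennreal et" using assms(2) by (intro add_right_mono mult_left_mono) auto
 also have "... = ennreal (1 / et * (C * et^2) + et)"
  using assms(3,4) by (simp only: ennreal_plus ennreal_mult zero_le_divide_1_iff less_imp_le zero_le_power2 mult_nonneg_nonneg)
 also have "1 / et * (C * et^2) + et = (C + 1) * et" using assms(3) by (simp add: power2_eq_square algebra_simps)
 finally show ?thesis .
qed

text \<open>\<open>X1\<close>, \<open>X2\<close> is any solution in the sense of the definitions. It
  is not constructed here but identified as the limit of the method.\<close>

locale sde = wiener_scheme M g01 g1 g02 g2 T K P W
 for M and g01 :: "'a::euclidean_space => 'b::euclidean_space => real => 'a" and g1 g02 g2 T K and P :: "'o measure" and W +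
 fixes x1 :: 'a and x2 :: 'b and X1 :: "real => 'o => 'a" and X2 :: "real => 'o => 'b"
 assumes dyn1: "additive_noise_dynamics P M W T (%t om. g01 (X1 t om) (X2 t om) t) g1 x1 X1"
  and dyn2: "additive_noise_dynamics P M W T (%t om. g02 (X1 t om) (X2 t om) t) g2 x2 X2"
begin

abbreviation "x0 \<equiv> (x1, x2)"
abbreviation "X t om \<equiv> (X1 t om, X2 t om)"

lemma X_measurable: "t \<in> {0..T} ==> X t \<in> borel_measurable P"
 using dyn1 dyn2 by (intro borel_measurable_Pair) (auto simp: additive_noise_dynamics_def)

text \<open>The L1 distance between the noise sums of the method and the Wiener integrals is
  geometric in the level \<open>j\<close>, so it tends to zero almost surely. Along such a path
  \<open>pathwise_error\<close> applies; uniform continuity of the solution and of the Wiener paths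
  on the compact interval provides its small parameter.\<close>

theorem refinement_converges:
 assumes t: "mesh N t" "t 0 = 0" and k: "k <= N"
 shows "AE om in P. (%j. Y x0 (refine t j) (2 ^ j * k) om) \<longlonglongrightarrow> X (t k) om"
proof -
 obtain I1 where I1: "\<And>m t. m \<in> {1..M} ==> t \<in> {0..T} ==> has_wiener_integral P (W m) (g1 m) t (I1 m t)"
  and e1: "\<And>t. t \<in> {0..T} ==> AE om in P. (%u. g01 (X1 u om) (X2 u om) u) integrable_on {0..t} \<and>
    X1 t om = x1 + integral {0..t} (%u. g01 (X1 u om) (X2 u om) u) + (\<Sum>m=1..M. I1 m t om)"
  using dyn1 unfolding additive_noise_dynamics_def by blast
 obtain I2 where I2: "\<And>m t. m \<in> {1..M} ==> t \<in> {0..T} ==> has_wiener_integral P (W m) (g2 m) t (I2 m t)"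
  and e2: "\<And>t. t \<in> {0..T} ==> AE om in P. (%u. g02 (X1 u om) (X2 u om) u) integrable_on {0..t} \<and>
    X2 t om = x2 + integral {0..t} (%u. g02 (X1 u om) (X2 u om) u) + (\<Sum>m=1..M. I2 m t om)"
  using dyn2 unfolding additive_noise_dynamics_def by blast
 define s where "s j = refine t j" for j
 \<comment> \<open>The steps of a mesh are at most 1 / 4 because \<open>1 <= K\<close>; each
   refinement halves this bound.\<close>
 define et where "et j = 1 / 4 * (1 / 2 :: real) ^ j" for j :: nat
 define c1 where "c1 j m l = (1/2) *R (g1 m (s j l) + g1 m (s j (Suc l)))" for j m l
 define c2 where "c2 j m l = (1/2) *R (g2 m (s j l) + g2 m (s j (Suc l)))" for j m l
 define S where "S j i om = (\<Sum>m=1..M. step_integral (W m) i (s j) (c1 j m) om, \<Sum>m=1..M. step_integral (W m) i (s j) (c2 j m) om)" for j i om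
 define Z where "Z u om = (\<Sum>m=1..M. I1 m u om, \<Sum>m=1..M. I2 m u om)" for u om
 define q where "q j i om = norm (S j i om - Z (s j i) om)" for j i om
 \<comment> \<open>The noise error in the form in which it enters \<open>pathwise_error\<close>: its
   integral over time plus its value at the end point.\<close>
 define A where "A j om = (\<Sum>i<2 ^ j * k. (s j (Suc i) - s j i) * q j i om) + q j (2 ^ j * k) om" for j om
 have sm: "mesh (2 ^ j * N) (s j)" for j unfolding s_def by (rule mesh_refine[OF t(1)])
 have s0: "s j 0 = 0" for j using refine_point[of t j 0] t(2) by (simp add: s_def)
 have et0: "0 < et j" for j by (simp add: et_def)
 have etlim: "et \<longlonglongrightarrow> 0" unfolding et_def by (intro tendsto_mult_right_zero LIMSEQ_power_zero) simp
 have step: "s j (Suc i) - s j i <= et j" if "i < 2 ^ j * N" for i j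
  unfolding s_def et_def by (rule refine_step[OF _ that]) (use admissibleD(5)[OF meshD(2)[OF t(1)]] in auto)
 have kj: "2 ^ j * k <= 2 ^ j * N" for j using k by simp
 have sT: "s j i \<in> {0..T}" if "i <= 2 ^ j * N" for j i using mesh_range[OF sm that] s0[of j] by simp
 have E: "(\<integral>\<^sup>+om. ennreal (norm (I om - step_integral (W m) i (s j) (%l. (1/2) *R (sg (s j l) + sg (s j (Suc l)))) om)) \<partial>P) <= ennreal ((4 * K^2 * T + 1) * et j)"
  and Em: "step_integral (W m) i (s j) c \<in> borel_measurable P"
  if m: "m \<in> {1..M}" and I: "has_wiener_integral P (W m) sg (s j i) I" and i: "i <= 2 ^ j * N"
   and lip: "\<And>u v. u \<in> {0..T} ==> v \<in> {0..T} ==> norm (sg u - sg v) <= K * \<bar>u - v\<bar>"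
  for m i j I and sg :: "real => 'v::euclidean_space" and c :: "nat => 'v::euclidean_space"
 proof -
  have ss: "0 <= s j l \<and> s j l <= s j (Suc l) \<and> s j (Suc l) <= s j i" if "l < i" for l
   using mesh_mono[OF sm, of "Suc l" i j] meshD(3)[OF sm, of l j] sT[of l j] that i by auto
  show M: "step_integral (W m) i (s j) c \<in> borel_measurable P" for c :: "nat => 'v"
   unfolding step_integral_def[abs_def]
  proof (intro borel_measurable_sum borel_measurable_scaleR borel_measurable_diff borel_measurable_const)
   fix l assume "l \<in> {..<i}"
   then show "W m (s j l) \<in> borel_measurable P" "W m (s j (Suc l)) \<in> borel_measurable P"
    using ss[of l] by (auto intro!: measurable_W[OF m])
  qed
  have Im: "I \<in> borel_measurable P" using I by (simp add: has_wiener_integral_def)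
  have "(\<integral>\<^sup>+om. ennreal ((norm (I om - step_integral (W m) i (s j) (%l. (1/2) *R (sg (s j l) + sg (s j (Suc l)))) om))^2) \<partial>P) <= ennreal (4 * (K * et j)^2 * s j i)"
  proof (rule wiener_integral_error[OF m I])
   show "0 <= s j i" using sT[OF i] by simp
   show "0 <= s j l \<and> s j l <= s j (Suc l) \<and> s j (Suc l) <= s j i" if "l < i" for l by (rule ss[OF that])
   show "norm (sg u - step_function i (s j) (%l. (1/2) *R (sg (s j l) + sg (s j (Suc l)))) u) <= K * et j" if "u \<in> {0<..s j i}" for u
   proof (rule trapezoid_error[where T=T, OF lip _ s0 _ that])
    show "0 <= K" using K_ge1 by simp
    fix l assume l: "l < i"
    show "s j l <= s j (Suc l) \<and> s j (Suc l) - s j l <= et j \<and> s j (Suc l) <= T" using ss[OF l] step[of l j] sT[OF i] l i by auto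
   qed
  qed
  also have "4 * (K * et j)^2 * s j i <= 4 * (K * et j)^2 * T" using sT[OF i] by (intro mult_left_mono) auto
  also have "4 * (K * et j)^2 * T = 4 * K^2 * T * (et j)^2" by (simp add: power2_eq_square)
  finally have L2: "(\<integral>\<^sup>+om. ennreal ((norm (I om - step_integral (W m) i (s j) (%l. (1/2) *R (sg (s j l) + sg (s j (Suc l)))) om))^2) \<partial>P)
    <= ennreal (4 * K^2 * T * (et j)^2)" by (simp add: ennreal_leI)
  show "(\<integral>\<^sup>+om. ennreal (norm (I om - step_integral (W m) i (s j) (%l. (1/2) *R (sg (s j l) + sg (s j (Suc l)))) om)) \<partial>P) <= ennreal ((4 * K^2 * T + 1) * et j)"
   by (rule L1_from_L2[OF borel_measurable_diff[OF Im M] L2 et0]) (use T_pos in simp)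
 qed
 let ?C = "real M * (2 * (4 * K^2 * T + 1))"
 have C0: "0 <= ?C" using T_pos by simp
 have qm: "q j i \<in> borel_measurable P" and qE: "(\<integral>\<^sup>+om. ennreal (q j i om) \<partial>P) <= ennreal (?C * et j)" if i: "i <= 2 ^ j * N" for i j
 proof -
  have m1: "step_integral (W m) i (s j) (c1 j m) \<in> borel_measurable P" "I1 m (s j i) \<in> borel_measurable P"
   and m2: "step_integral (W m) i (s j) (c2 j m) \<in> borel_measurable P" "I2 m (s j i) \<in> borel_measurable P" if "m \<in> {1..M}" for m
   using Em[OF that I1[OF that sT[OF i]] i coefficient_lipschitz(1)[OF that]] Em[OF that I2[OF that sT[OF i]] i coefficient_lipschitz(2)[OF that]]
    I1[OF that sT[OF i]] I2[OF that sT[OF i]] by (auto simp: has_wiener_integral_def)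
  have "(%om. S j i om) \<in> borel_measurable P" unfolding S_def
   by (rule borel_measurable_Pair; rule borel_measurable_sum; (rule m1 | rule m2); assumption)
  moreover have "(%om. Z (s j i) om) \<in> borel_measurable P" unfolding Z_def
   by (rule borel_measurable_Pair; rule borel_measurable_sum; (rule m1 | rule m2); assumption)
  ultimately show "q j i \<in> borel_measurable P"
   unfolding q_def[abs_def] by (rule measurable_compose[OF borel_measurable_diff borel_measurable_norm])
  let ?d1 = "%m om. norm (I1 m (s j i) om - step_integral (W m) i (s j) (c1 j m) om)"
  let ?d2 = "%m om. norm (I2 m (s j i) om - step_integral (W m) i (s j) (c2 j m) om)"
  have "q j i om <= (\<Sum>m=1..M. ?d1 m om + ?d2 m om)" for om
  proof -
   have "q j i om <= norm (\<Sum>m=1..M. step_integral (W m) i (s j) (c1 j m) om - I1 m (s j i) om) + norm (\<Sum>m=1..M. step_integral (W m) i (s j) (c2 j m) om - I2 m (s j i) om)"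
    using norm_Pair_le by (simp add: q_def S_def Z_def sum_subtractf)
   also have "... <= (\<Sum>m=1..M. ?d1 m om) + (\<Sum>m=1..M. ?d2 m om)"
    by (intro add_mono sum_norm_le) (simp_all add: norm_minus_commute)
   finally show ?thesis by (simp add: sum.distrib)
  qed
  then have "(\<integral>\<^sup>+om. ennreal (q j i om) \<partial>P) <= (\<integral>\<^sup>+om. (\<Sum>m=1..M. ennreal (?d1 m om) + ennreal (?d2 m om)) \<partial>P)"
  proof (intro nn_integral_mono)
   fix om
   have "ennreal (q j i om) <= ennreal (\<Sum>m=1..M. ?d1 m om + ?d2 m om)" by (rule ennreal_leI) fact
   also have "... = (\<Sum>m=1..M. ennreal (?d1 m om + ?d2 m om))" by (rule sum_ennreal[symmetric]) simp
   also have "... = (\<Sum>m=1..M. ennreal (?d1 m om) + ennreal (?d2 m om))" by (intro sum.cong refl ennreal_plus) simp_all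
   finally show "ennreal (q j i om) <= (\<Sum>m=1..M. ennreal (?d1 m om) + ennreal (?d2 m om))" .
  qed
  also have "... = (\<Sum>m=1..M. (\<integral>\<^sup>+om. ennreal (?d1 m om) \<partial>P) + (\<integral>\<^sup>+om. ennreal (?d2 m om) \<partial>P))"
   using m1 m2 by (subst nn_integral_sum) (auto intro!: sum.cong nn_integral_add)
  also have "... <= (\<Sum>m=1..M. ennreal ((4 * K^2 * T + 1) * et j) + ennreal ((4 * K^2 * T + 1) * et j))"
  proof (intro sum_mono add_mono)
   fix m assume m: "m \<in> {1..M}"
   show "(\<integral>\<^sup>+om. ennreal (?d1 m om) \<partial>P) <= ennreal ((4 * K^2 * T + 1) * et j)"
    using E[OF m I1[OF m sT[OF i]] i coefficient_lipschitz(1)[OF m]] by (simp add: c1_def[abs_def])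
   show "(\<integral>\<^sup>+om. ennreal (?d2 m om) \<partial>P) <= ennreal ((4 * K^2 * T + 1) * et j)"
    using E[OF m I2[OF m sT[OF i]] i coefficient_lipschitz(2)[OF m]] by (simp add: c2_def[abs_def])
  qed
  also have "... = ennreal (?C * et j)"
  proof -
   have "0 <= (4 * K^2 * T + 1) * et j" using et0[of j] T_pos by simp
   then have "ennreal ((4 * K^2 * T + 1) * et j) + ennreal ((4 * K^2 * T + 1) * et j) = ennreal (2 * ((4 * K^2 * T + 1) * et j))"
    by (simp only: mult_2 ennreal_plus)
   then have "(\<Sum>m=1..M. ennreal ((4 * K^2 * T + 1) * et j) + ennreal ((4 * K^2 * T + 1) * et j)) = (\<Sum>m=1..M. ennreal (2 * ((4 * K^2 * T + 1) * et j)))"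
    by (simp only:)
   also have "... = ennreal (\<Sum>m=1..M. 2 * ((4 * K^2 * T + 1) * et j))"
    by (rule sum_ennreal) (use \<open>0 <= (4 * K^2 * T + 1) * et j\<close> in simp)
   finally have "(\<Sum>m=1..M. ennreal ((4 * K^2 * T + 1) * et j) + ennreal ((4 * K^2 * T + 1) * et j)) = ennreal (\<Sum>m=1..M. 2 * ((4 * K^2 * T + 1) * et j))" .
   then show ?thesis by (simp add: mult_ac)
  qed
  finally show "(\<integral>\<^sup>+om. ennreal (q j i om) \<partial>P) <= ennreal (?C * et j)" .
 qed
 have q0: "0 <= q j i om" for j i om by (simp add: q_def)
 have h0: "0 <= s j (Suc i) - s j i" if "i < 2 ^ j * k" for i j by (rule meshD(3)[OF sm less_le_trans[OF that kj], THEN diff_ge_0_iff_ge[THEN iffD2]])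
 have ik: "i <= 2 ^ j * N" if "i < 2 ^ j * k" for i j by (rule order_trans[OF less_imp_le[OF that] kj])
 have A_lim: "AE om in P. (%j. A j om) \<longlonglongrightarrow> 0"
 proof (rule AE_tendsto_zero)
  show "A j \<in> borel_measurable P" for j unfolding A_def
   by (rule borel_measurable_add[OF borel_measurable_sum[OF borel_measurable_times[OF borel_measurable_const qm[OF ik]]] qm[OF kj]]) simp
  show "0 <= A j om" for j om unfolding A_def using h0 q0 by (intro add_nonneg_nonneg sum_nonneg mult_nonneg_nonneg) auto
  show "0 <= (T + 1) * ?C * (1 / 4)" using T_pos C0 by simp
  fix j
  have "(\<integral>\<^sup>+om. ennreal (A j om) \<partial>P) = (\<integral>\<^sup>+om. (\<Sum>i<2 ^ j * k. ennreal (s j (Suc i) - s j i) * ennreal (q j i om)) + ennreal (q j (2 ^ j * k) om) \<partial>P)"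
  proof (rule nn_integral_cong)
   fix om
   have "(\<Sum>i<2 ^ j * k. ennreal (s j (Suc i) - s j i) * ennreal (q j i om)) = (\<Sum>i<2 ^ j * k. ennreal ((s j (Suc i) - s j i) * q j i om))"
    using h0 q0 by (intro sum.cong refl ennreal_mult[symmetric]) auto
   also have "... = ennreal (\<Sum>i<2 ^ j * k. (s j (Suc i) - s j i) * q j i om)" using h0 q0 by (intro sum_ennreal mult_nonneg_nonneg) auto
   finally show "ennreal (A j om) = (\<Sum>i<2 ^ j * k. ennreal (s j (Suc i) - s j i) * ennreal (q j i om)) + ennreal (q j (2 ^ j * k) om)"
    unfolding A_def using h0 q0 by (subst ennreal_plus) (auto intro!: sum_nonneg mult_nonneg_nonneg)
  qed
  also have "... = (\<Sum>i<2 ^ j * k. ennreal (s j (Suc i) - s j i) * (\<integral>\<^sup>+om. ennreal (q j i om) \<partial>P)) + (\<integral>\<^sup>+om. ennreal (q j (2 ^ j * k) om) \<partial>P)"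
  proof -
   have m: "(%om. ennreal (q j i om)) \<in> borel_measurable P" if "i <= 2 ^ j * N" for i
    by (rule measurable_compose[OF qm[OF that] measurable_ennreal])
   have m': "(%om. ennreal (s j (Suc i) - s j i) * ennreal (q j i om)) \<in> borel_measurable P" if "i \<in> {..<2 ^ j * k}" for i
    using m[OF ik[of i j]] that by (intro borel_measurable_times_ennreal borel_measurable_const) auto
   have "(\<integral>\<^sup>+om. (\<Sum>i<2 ^ j * k. ennreal (s j (Suc i) - s j i) * ennreal (q j i om)) + ennreal (q j (2 ^ j * k) om) \<partial>P)
    = (\<integral>\<^sup>+om. (\<Sum>i<2 ^ j * k. ennreal (s j (Suc i) - s j i) * ennreal (q j i om)) \<partial>P) + (\<integral>\<^sup>+om. ennreal (q j (2 ^ j * k) om) \<partial>P)"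
    by (rule nn_integral_add[OF borel_measurable_sum[OF m'] m[OF kj]])
   also have "(\<integral>\<^sup>+om. (\<Sum>i<2 ^ j * k. ennreal (s j (Suc i) - s j i) * ennreal (q j i om)) \<partial>P) = (\<Sum>i<2 ^ j * k. (\<integral>\<^sup>+om. ennreal (s j (Suc i) - s j i) * ennreal (q j i om) \<partial>P))"
    by (rule nn_integral_sum[OF m'])
   also have "... = (\<Sum>i<2 ^ j * k. ennreal (s j (Suc i) - s j i) * (\<integral>\<^sup>+om. ennreal (q j i om) \<partial>P))"
    by (rule sum.cong[OF refl], rule nn_integral_cmult[OF m[OF ik]]) simp
   finally show ?thesis .
  qed
  also have "... <= (\<Sum>i<2 ^ j * k. ennreal (s j (Suc i) - s j i) * ennreal (?C * et j)) + ennreal (?C * et j)"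
   by (rule add_mono[OF sum_mono[OF mult_left_mono[OF qE[OF ik]]] qE[OF kj]]) simp_all
  also have "... = ennreal ((\<Sum>i<2 ^ j * k. (s j (Suc i) - s j i) * (?C * et j)) + ?C * et j)"
  proof -
   have "(\<Sum>i<2 ^ j * k. ennreal (s j (Suc i) - s j i) * ennreal c) + ennreal c = ennreal ((\<Sum>i<2 ^ j * k. (s j (Suc i) - s j i) * c) + c)"
    if c: "0 <= c" for c
   proof -
    have "(\<Sum>i<2 ^ j * k. ennreal (s j (Suc i) - s j i) * ennreal c) = (\<Sum>i<2 ^ j * k. ennreal ((s j (Suc i) - s j i) * c))"
     using h0 c by (intro sum.cong refl ennreal_mult[symmetric]) auto
    also have "... = ennreal (\<Sum>i<2 ^ j * k. (s j (Suc i) - s j i) * c)" using h0 c by (intro sum_ennreal mult_nonneg_nonneg) auto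
    finally show ?thesis
     using h0 c by (subst ennreal_plus) (auto intro!: sum_nonneg mult_nonneg_nonneg)
   qed
   then show ?thesis using mult_nonneg_nonneg[OF C0 less_imp_le[OF et0]] by blast
  qed
  also have "... <= ennreal ((T + 1) * ?C * (1 / 4) * (1 / 2) ^ j)"
  proof (rule ennreal_leI)
   have "(\<Sum>i<2 ^ j * k. s j (Suc i) - s j i) <= T"
    unfolding sum_lessThan_telescope by (rule mesh_range(2)[OF sm kj])
   then have "(\<Sum>i<2 ^ j * k. s j (Suc i) - s j i) * (?C * et j) <= T * (?C * et j)"
    using mult_nonneg_nonneg[OF C0 less_imp_le[OF et0[of j]]] by (rule mult_right_mono)
   then show "(\<Sum>i<2 ^ j * k. (s j (Suc i) - s j i) * (?C * et j)) + ?C * et j <= (T + 1) * ?C * (1 / 4) * (1 / 2) ^ j"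
    unfolding sum_distrib_right[symmetric] by (simp add: et_def algebra_simps)
  qed
  finally show "(\<integral>\<^sup>+om. ennreal (A j om) \<partial>P) <= ennreal ((T + 1) * ?C * (1 / 4) * (1 / 2) ^ j)" .
 qed
 \<comment> \<open>The equation of the solution holds almost surely at each time; the countably many
   grid points of all levels share one null set.\<close>
 have eq: "AE om in P. \<forall>j i. i <= 2 ^ j * N --> X1 (s j i) om = x1 + integral {0..s j i} (%u. g01 (X1 u om) (X2 u om) u) + (\<Sum>m=1..M. I1 m (s j i) om)
   \<and> X2 (s j i) om = x2 + integral {0..s j i} (%u. g02 (X1 u om) (X2 u om) u) + (\<Sum>m=1..M. I2 m (s j i) om)"
  unfolding AE_all_countable
 proof (intro allI)
  fix j i
  show "AE om in P. i <= 2 ^ j * N --> X1 (s j i) om = x1 + integral {0..s j i} (%u. g01 (X1 u om) (X2 u om) u) + (\<Sum>m=1..M. I1 m (s j i) om)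
   \<and> X2 (s j i) om = x2 + integral {0..s j i} (%u. g02 (X1 u om) (X2 u om) u) + (\<Sum>m=1..M. I2 m (s j i) om)"
  proof (cases "i <= 2 ^ j * N")
   case True
   from e1[OF sT[OF True]] e2[OF sT[OF True]] show ?thesis by eventually_elim blast
  qed simp
 qed
 have Wc: "AE om in P. \<forall>m\<in>{1..M}. continuous_on {0..} (%t. W m t om)"
  using wiener_proc by (intro AE_finite_allI) (auto simp: wiener_process_def)
 have Xc: "AE om in P. continuous_on {0..T} (%t. X1 t om)" "AE om in P. continuous_on {0..T} (%t. X2 t om)"
  and Xi: "AE om in P. X1 0 om = x1" "AE om in P. X2 0 om = x2"
  using dyn1 dyn2 by (auto simp: additive_noise_dynamics_def)
 from A_lim eq Wc Xc Xi show ?thesis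
 proof eventually_elim
  case (elim om)
  let ?x = "%u. X u om" and ?z = "%j i. Z (s j i) om"
  have xc: "continuous_on {0..T} ?x" using elim by (intro continuous_on_Pair)
  note ac = drift_continuous[OF xc]
  have "bounded (?x ` {0..T})" by (rule compact_imp_bounded[OF compact_continuous_image[OF xc]]) simp
  then obtain R where "\<forall>u\<in>{0..T}. norm (?x u) <= R" unfolding bounded_iff by blast
  then have R: "norm (?x u) <= R" if "u \<in> {0..T}" for u using that by blast
  have R0: "0 <= R" using order_trans[OF norm_ge_zero R[of 0]] T_pos by simp
  have xeq: "?x (s j i) = x0 + integral {0..s j i} (%u. a (?x u) u) + ?z j i" if i: "i <= 2 ^ j * N" for j i
  proof -
   have "continuous_on {0..s j i} (%u. a (?x u) u)" by (rule continuous_on_subset[OF ac]) (use sT[OF i] in auto)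
   then have int: "(%u. a (?x u) u) integrable_on {0..s j i}" using integrable_continuous[of 0 "s j i"] by (simp add: cbox_interval)
   have "fst (integral {0..s j i} (%u. a (?x u) u)) = integral {0..s j i} (%u. g01 (X1 u om) (X2 u om) u)"
    "snd (integral {0..s j i} (%u. a (?x u) u)) = integral {0..s j i} (%u. g02 (X1 u om) (X2 u om) u)"
    using integral_linear[OF int bounded_linear_fst] integral_linear[OF int bounded_linear_snd] by (simp_all add: comp_def drift_def)
   then show ?thesis using elim(2)[rule_format, OF i] by (simp add: prod_eq_iff Z_def)
  qed
  let ?E = "exp (10 * K^2 * T) * (10 * K^2)"
  have E0: "0 <= ?E" by simp
  have E1: "0 < ?E + 1" by (rule add_nonneg_pos[OF E0]) simp
  show "(%j. Y x0 (refine t j) (2 ^ j * k) om) \<longlonglongrightarrow> X (t k) om"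
  proof (rule metric_LIMSEQ_I)
   fix r :: real assume r: "0 < r"
   \<comment> \<open>Makes the part of the estimate proportional to \<open>ep\<close> at most r / 2;
     the cap at 1 is the condition of \<open>pathwise_error\<close>.\<close>
   define ep where "ep = min 1 (r / (2 * (?E * T * (1 + R) + 1)))"
   have den: "0 < ?E * T * (1 + R) + 1" using E0 T_pos R0 by (intro add_nonneg_pos mult_nonneg_nonneg) auto
   then have ep: "0 < ep" "ep <= 1" using r by (auto simp: ep_def)
   have epr: "?E * (T * (ep * (1 + R))) <= r / 2"
   proof -
    have "?E * (T * (ep * (1 + R))) = ep * (?E * T * (1 + R))" by (simp add: mult_ac)
    also have "... <= ep * (?E * T * (1 + R) + 1)" using ep by (intro mult_left_mono) auto
    also have "... <= (r / (2 * (?E * T * (1 + R) + 1))) * (?E * T * (1 + R) + 1)"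
     using den by (intro mult_right_mono) (auto simp: ep_def)
    also have "... = r / 2" using den by (simp add: field_simps)
    finally show ?thesis .
   qed
   have ev1: "eventually (%j. \<forall>u\<in>{0..T}. \<forall>v\<in>{0..T}. \<bar>u - v\<bar> <= et j --> norm (?x u - ?x v) <= ep) sequentially"
    by (rule eventually_modulus[OF xc ep(1) etlim])
   \<comment> \<open>Dividing by \<open>real M + 1\<close> keeps the sum over all components below
     \<open>ep\<close> and is safe for \<open>M = 0\<close>.\<close>
   have ev2: "eventually (%j. \<forall>m\<in>{1..M}. \<forall>u\<in>{0..T}. \<forall>v\<in>{0..T}. \<bar>u - v\<bar> <= et j --> norm (W m u om - W m v om) <= ep / (real M + 1)) sequentially"
   proof (rule eventually_ball_finite, simp, rule ballI)
    fix m assume m: "m \<in> {1..M}"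
    have "continuous_on {0..} (%u. W m u om)" using elim(3) m by blast
    then have "continuous_on {0..T} (%u. W m u om)" by (rule continuous_on_subset) auto
    moreover have "0 < ep / (real M + 1)" using ep(1) by simp
    ultimately show "eventually (%j. \<forall>u\<in>{0..T}. \<forall>v\<in>{0..T}. \<bar>u - v\<bar> <= et j --> norm (W m u om - W m v om) <= ep / (real M + 1)) sequentially"
     using eventually_modulus[OF _ _ etlim] by blast
   qed
   have ev3: "eventually (%j. A j om < r / (2 * (?E + 1))) sequentially"
    by (rule order_tendstoD(2)[OF elim(1) divide_pos_pos[OF r mult_pos_pos[OF zero_less_numeral E1]]])
   have ev4: "eventually (%j. et j < ep) sequentially" by (rule order_tendstoD(2)[OF etlim ep(1)])
   from ev1 ev2 ev3 ev4 have "eventually (%j. dist (Y x0 (refine t j) (2 ^ j * k) om) (X (t k) om) < r) sequentially"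
   proof eventually_elim
    case (elim j)
    let ?xi = "%i. inc (s j i) (s j (Suc i)) om"
    have close: "\<bar>s j (Suc i) - s j i\<bar> <= et j" "s j i \<in> {0..T}" "s j (Suc i) \<in> {0..T}" if "i < 2 ^ j * N" for i
     using meshD(3)[OF sm that] step[OF that] sT[of i j] sT[of "Suc i" j] that by auto
    have "norm (Y x0 (s j) (2 ^ j * k) om - ?x (s j (2 ^ j * k)))
     <= exp (10 * K^2 * T) * (10 * K^2 * ((\<Sum>i<2 ^ j * k. (s j (Suc i) - s j i) * norm (S j i om - ?z j i)) + T * (ep * (1 + R)))) + norm (S j (2 ^ j * k) om - ?z j (2 ^ j * k))"
    proof (rule pathwise_error[OF sm kj, where xi="?xi" and y="%i. Y x0 (s j) i om" and S="%i. S j i om"])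
     show "Y x0 (s j) (Suc i) om = stp (s j i) (s j (Suc i)) (?xi i) (Y x0 (s j) i om)" for i by (rule Y_Suc)
     show "?x (s j (Suc i)) - ?x (s j i) = integral {s j i..s j (Suc i)} (%u. a (?x u) u) + (?z j (Suc i) - ?z j i)" if i: "i < 2 ^ j * N" for i
     proof -
      have "continuous_on {0..s j (Suc i)} (%u. a (?x u) u)" by (rule continuous_on_subset[OF ac]) (use close[OF i] in auto)
      then have int: "(%u. a (?x u) u) integrable_on {0..s j (Suc i)}" using integrable_continuous[of 0 "s j (Suc i)"] by (simp add: cbox_interval)
      have "integral {0..s j i} (%u. a (?x u) u) + integral {s j i..s j (Suc i)} (%u. a (?x u) u) = integral {0..s j (Suc i)} (%u. a (?x u) u)"
       by (rule Henstock_Kurzweil_Integration.integral_combine[OF _ _ int]) (use close[OF i] meshD(3)[OF sm i] in auto)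
      then show ?thesis using xeq[of i j] xeq[of "Suc i" j] i by (simp add: algebra_simps)
     qed
     show "S j (Suc i) om = S j i om + (1/2) *R (Sg (s j i) (?xi i) + Sg (s j (Suc i)) (?xi i))" for i
     proof -
      have "(\<Sum>m=1..M. (W m (s j (Suc i)) om - W m (s j i) om) *R c1 j m i) = (1/2) *R fst (Sg (s j i) (?xi i) + Sg (s j (Suc i)) (?xi i))"
       "(\<Sum>m=1..M. (W m (s j (Suc i)) om - W m (s j i) om) *R c2 j m i) = (1/2) *R snd (Sg (s j i) (?xi i) + Sg (s j (Suc i)) (?xi i))"
       unfolding noise_def fst_add snd_add fst_sum snd_sum sum.distrib[symmetric] scaleR_sum_right
       by (intro sum.cong; simp add: c1_def c2_def inc_def scaleR_add_right mult.commute)+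
      then show ?thesis by (simp add: S_def step_integral_def sum.distrib prod_eq_iff)
     qed
     show "Y x0 (s j) 0 om - ?x (s j 0) = S j 0 om - ?z j 0"
      using xeq[of 0 j] s0[of j] by (simp add: S_def step_integral_def zero_prod_def[symmetric])
     show "norm (?x (s j i)) <= R" if "i <= 2 ^ j * N" for i by (rule R[OF sT[OF that]])
     show "norm (?x u - ?x (s j i)) <= ep" if i: "i < 2 ^ j * N" and u: "u \<in> {s j i..s j (Suc i)}" for i u
     proof -
      have "u \<in> {0..T}" "\<bar>u - s j i\<bar> <= et j" using u close[OF i] by auto
      then show ?thesis using elim(1) close(2)[OF i] by blast
     qed
     show "n (?xi i) <= ep" if i: "i < 2 ^ j * N" for i
     proof -
      have "n (?xi i) <= (\<Sum>m=1..M. ep / (real M + 1))" unfolding nz_def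
       using elim(2) close[OF i] by (intro sum_mono) (auto simp: inc_def)
      also have "... <= ep" using ep(1) by (simp add: pos_divide_le_eq)
      finally show ?thesis .
     qed
     show "s j (Suc i) - s j i <= ep" if "i < 2 ^ j * N" for i using step[OF that] elim(4) by simp
    qed (use ep ac in auto)
    also have "... = ?E * (\<Sum>i<2 ^ j * k. (s j (Suc i) - s j i) * q j i om) + q j (2 ^ j * k) om + ?E * (T * (ep * (1 + R)))"
     by (simp add: q_def algebra_simps)
    also have "... <= (?E + 1) * A j om + r / 2"
    proof (rule add_mono[OF _ epr])
     have 1: "0 <= (\<Sum>i<2 ^ j * k. (s j (Suc i) - s j i) * q j i om)" using h0 q0 by (intro sum_nonneg mult_nonneg_nonneg) auto
     have 2: "0 <= ?E * q j (2 ^ j * k) om" by (rule mult_nonneg_nonneg[OF E0 q0])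
     show "?E * (\<Sum>i<2 ^ j * k. (s j (Suc i) - s j i) * q j i om) + q j (2 ^ j * k) om <= (?E + 1) * A j om"
      unfolding A_def using 1 2 by (simp only: distrib_left distrib_right mult_1)
    qed
    also have "... < (?E + 1) * (r / (2 * (?E + 1))) + r / 2"
     by (rule add_strict_right_mono[OF mult_strict_left_mono[OF elim(3)]]) (use E0 in linarith)
    also have "... = r"
    proof -
     have "?E + 1 \<noteq> 0" using E0 by linarith
     then show ?thesis by (simp add: field_simps)
    qed
    finally show ?case using refine_point[of t j k] by (simp add: dist_norm s_def)
   qed
   then show "\<exists>no. \<forall>j\<ge>no. dist (Y x0 (refine t j) (2 ^ j * k) om) (X (t k) om) < r" unfolding eventually_sequentially .
  qed
 qed
qed

end

section \<open>Passage to the limit of infinitely many bisections\<close>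

context sde
begin

text \<open>Bisect the given mesh forever. The mean square change at level \<open>j\<close> is at
  most C et^2 4^-j; \<open>telescope_sq\<close> contributes a factor 2 and the geometric series
  another, hence 4 * C. Fatou's lemma carries the bound to the almost sure limit, which is the
  solution.\<close>

theorem strong_error:
 "\<exists>C\<ge>0. \<forall>t N et k. mesh N t --> t 0 = 0 --> (\<forall>i<N. t (Suc i) - t i <= et) --> k <= N -->
  integrable P (%om. (norm (Y x0 t k om - X (t k) om))\<^sup>2) \<and>
  expectation (%om. (norm (Y x0 t k om - X (t k) om))\<^sup>2) <= C * et^2"
proof -
 obtain C where C0: "0 <= C" and C: "\<And>t N et k. mesh N t ==> \<forall>i<N. t (Suc i) - t i <= et ==> k <= N ==>
  integrable P (%om. (norm (Y x0 (bisect t) (2 * k) om - Y x0 t k om))\<^sup>2) \<and>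
  expectation (%om. (norm (Y x0 (bisect t) (2 * k) om - Y x0 t k om))\<^sup>2) <= C * et^2"
  using strong_bisect[of x0] by blast
 show ?thesis
 proof (rule exI[of _ "4 * C"], intro conjI allI impI)
  show "0 <= 4 * C" using C0 by simp
  fix t N et k assume t: "mesh N t" "t 0 = 0" and et: "\<forall>i<N. t (Suc i) - t i <= et" and k: "k <= N"
  define U where "U j om = Y x0 (refine t j) (2 ^ j * k) om" for j om
  have kj: "2 ^ j * k <= 2 ^ j * N" for j using k by simp
  have Um: "U j \<in> borel_measurable P" for j
   unfolding U_def[abs_def] by (rule Y_measurable[OF mesh_refine[OF t(1)] kj])
  have U0: "U 0 = Y x0 t k" by (simp add: U_def[abs_def])
  have Xm: "X (t k) \<in> borel_measurable P" using mesh_range[OF t(1) k] t(2) by (intro X_measurable) simp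
  have d: "integrable P (%om. (norm (U (Suc j) om - U j om))\<^sup>2)" "expectation (%om. (norm (U (Suc j) om - U j om))\<^sup>2) <= C * (et * (1 / 2) ^ j)^2" for j
  proof -
   have r: "\<forall>i<2 ^ j * N. refine t j (Suc i) - refine t j i <= et * (1 / 2) ^ j" using refine_step[of N t et] et by blast
   show "integrable P (%om. (norm (U (Suc j) om - U j om))\<^sup>2)" "expectation (%om. (norm (U (Suc j) om - U j om))\<^sup>2) <= C * (et * (1 / 2) ^ j)^2"
    using C[OF mesh_refine[OF t(1)] r kj] by (simp_all add: U_def refine_Suc mult.assoc)
  qed
  let ?G = "%j om. 2 * (\<Sum>i<j. 2 ^ i * (norm (U (Suc i) om - U i om))^2)"
  have iG: "integrable P (?G j)" for j
   by (intro integrable_mult_right Bochner_Integration.integrable_sum d)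
  have le: "(norm (U j om - U 0 om))^2 <= ?G j om" for j om by (rule telescope_sq)
  have i: "integrable P (%om. (norm (U j om - U 0 om))\<^sup>2)" for j
  proof (rule Bochner_Integration.integrable_bound[OF iG[of j]])
   show "(%om. (norm (U j om - U 0 om))\<^sup>2) \<in> borel_measurable P" using Um by measurable
   show "AE om in P. norm ((norm (U j om - U 0 om))^2) <= norm (?G j om)"
    using le by (intro AE_I2) (auto intro: order_trans[OF _ abs_ge_self])
  qed
  have E: "expectation (%om. (norm (U j om - U 0 om))\<^sup>2) <= 4 * C * et^2" for j
  proof -
   have "expectation (%om. (norm (U j om - U 0 om))\<^sup>2) <= expectation (?G j)" by (rule integral_mono[OF i iG le])
   also have "... = 2 * (\<Sum>i<j. 2 ^ i * expectation (%om. (norm (U (Suc i) om - U i om))\<^sup>2))"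
    using d(1) by (simp add: Bochner_Integration.integral_sum)
   also have "... <= 2 * (\<Sum>i<j. 2 ^ i * (C * (et * (1 / 2) ^ i)^2))"
    using d(2) by (intro mult_left_mono sum_mono) auto
   also have "... = 2 * (\<Sum>i<j. C * et^2 * (1 / 2) ^ i)"
   proof -
    have "2 ^ i * (C * (et * (1 / 2) ^ i)^2) = C * et^2 * (1 / 2) ^ i" for i :: nat
     by (simp add: power_mult_distrib power2_eq_square power_divide)
    then show ?thesis by (simp only:)
   qed
   also have "... = 2 * (C * et^2 * (\<Sum>i<j. (1 / 2) ^ i))" by (simp only: sum_distrib_left)
   also have "... <= 2 * (C * et^2 * 2)" using C0 geometric_half by (intro mult_left_mono) auto
   finally show ?thesis by simp
  qed
  have lim: "AE om in P. (%j. (norm (U j om - U 0 om))\<^sup>2) \<longlonglongrightarrow> (norm (Y x0 t k om - X (t k) om))\<^sup>2"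
   using refinement_converges[OF t k]
  proof eventually_elim
   case (elim om)
   have "(%j. (norm (U j om - U 0 om))\<^sup>2) \<longlonglongrightarrow> (norm (X (t k) om - U 0 om))\<^sup>2"
    unfolding U_def by (intro tendsto_intros elim)
   then show ?case by (simp add: U0 norm_minus_commute)
  qed
  have gm: "(%om. (norm (Y x0 t k om - X (t k) om))\<^sup>2) \<in> borel_measurable P"
   using Um[of 0] Xm unfolding U0 by measurable
  note F = fatou_bound[OF i _ E gm _ lim]
  show "integrable P (%om. (norm (Y x0 t k om - X (t k) om))\<^sup>2)" by (rule F(1)) simp_all
  show "expectation (%om. (norm (Y x0 t k om - X (t k) om))\<^sup>2) <= 4 * C * et^2" by (rule F(2)) simp_all
 qed
qed

lemma solution_moments:
 "\<exists>C\<ge>0. \<forall>t N k. mesh N t --> t 0 = 0 --> k <= N -->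
  integrable P (%om. w r (X (t k) om)) \<and> expectation (%om. w r (X (t k) om)) <= C"
proof -
 obtain C where C0: "0 <= C" and C: "\<And>y s N k. mesh N s ==> k <= N ==>
  integrable P (%om. w r (Y y s k om)) \<and> expectation (%om. w r (Y y s k om)) <= C * w r y"
  using uniform_moments[of r] by blast
 show ?thesis
 proof (rule exI[of _ "C * w r x0"], intro conjI allI impI)
  show "0 <= C * w r x0" using C0 by simp
  fix t N k assume t: "mesh N t" "t 0 = 0" and k: "k <= N"
  have kj: "2 ^ j * k <= 2 ^ j * N" for j using k by simp
  have Xm: "X (t k) \<in> borel_measurable P" using mesh_range[OF t(1) k] t(2) by (intro X_measurable) simp
  have lim: "AE om in P. (%j. w r (Y x0 (refine t j) (2 ^ j * k) om)) \<longlonglongrightarrow> w r (X (t k) om)"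
   using refinement_converges[OF t k] by eventually_elim (unfold wR_def, intro tendsto_intros)
  have i: "integrable P (%om. w r (Y x0 (refine t j) (2 ^ j * k) om))" "expectation (%om. w r (Y x0 (refine t j) (2 ^ j * k) om)) <= C * w r x0" for j
   using C[OF mesh_refine[OF t(1)] kj] by blast+
  note F = fatou_bound[OF i(1) _ i(2) measurable_compose[OF Xm measurable_w_borel] _ lim]
  show "integrable P (%om. w r (X (t k) om))" by (rule F(1)) simp_all
  show "expectation (%om. w r (X (t k) om)) <= C * w r x0" by (rule F(2)) simp_all
 qed
qed

text \<open>The weak changes under bisection sum up to O(et^2). That the expectations tend to that
  of the solution follows from \<open>strong_error\<close> at each level, as \<open>wcl_diff\<close>
  makes the observable locally Lipschitz with polynomial weights; the speed of this last convergence
  does not enter the result.\<close>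

theorem weak_error:
 fixes ph :: "'a \<times> 'b => real"
 assumes cl: "wcl r Cph ph"
 shows "\<exists>C\<ge>0. \<forall>t N et k. mesh N t --> t 0 = 0 --> (\<forall>i<N. t (Suc i) - t i <= et) --> k <= N -->
  integrable P (%om. ph (Y x0 t k om)) \<and> integrable P (%om. ph (X (t k) om)) \<and>
  \<bar>expectation (%om. ph (Y x0 t k om)) - expectation (%om. ph (X (t k) om))\<bar> <= C * et^2"
proof -
 note Cph0 = wcl_nonneg[OF cl]
 obtain C where C0: "0 <= C" and C: "\<And>(ph :: 'a \<times> 'b => real) Cph t N et k. wcl r Cph ph ==> mesh N t ==> \<forall>i<N. t (Suc i) - t i <= et ==> k <= N ==>
  \<bar>expectation (%om. ph (Y x0 (bisect t) (2 * k) om)) - expectation (%om. ph (Y x0 t k om))\<bar> <= Cph * C * et^2"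
  using weak_bisect[of r x0] by blast
 obtain S where S0: "0 <= S" and S: "\<And>t N et k. mesh N t ==> t 0 = 0 ==> \<forall>i<N. t (Suc i) - t i <= et ==> k <= N ==>
  integrable P (%om. (norm (Y x0 t k om - X (t k) om))\<^sup>2) \<and>
  expectation (%om. (norm (Y x0 t k om - X (t k) om))\<^sup>2) <= S * et^2"
  using strong_error by blast
 obtain A where A: "\<And>t N k. mesh N t ==> t 0 = 0 ==> k <= N ==>
  integrable P (%om. w (2 * r) (X (t k) om)) \<and> expectation (%om. w (2 * r) (X (t k) om)) <= A"
  using solution_moments[of "2 * r"] by blast
 obtain B where B: "\<And>t N k. mesh N t ==> t 0 = 0 ==> k <= N ==>
  integrable P (%om. w r (X (t k) om)) \<and> expectation (%om. w r (X (t k) om)) <= B"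
  using solution_moments[of r] by blast
 obtain D where D: "\<And>y s N k. mesh N s ==> k <= N ==>
  integrable P (%om. w (2 * r) (Y y s k om)) \<and> expectation (%om. w (2 * r) (Y y s k om)) <= D * w (2 * r) y"
  using uniform_moments[of "2 * r"] by blast
 show ?thesis
 proof (rule exI[of _ "2 * Cph * C"], intro conjI allI impI)
  show "0 <= 2 * Cph * C" using Cph0 C0 by simp
  fix t N et k assume t: "mesh N t" "t 0 = 0" and et: "\<forall>i<N. t (Suc i) - t i <= et" and k: "k <= N"
  define U where "U j om = Y x0 (refine t j) (2 ^ j * k) om" for j om
  have kj: "2 ^ j * k <= 2 ^ j * N" for j using k by simp
  have U0: "U 0 = Y x0 t k" by (simp add: U_def[abs_def])
  have r0: "refine t j 0 = 0" for j using refine_point[of t j 0] t(2) by simp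
  have r: "\<forall>i<2 ^ j * N. refine t j (Suc i) - refine t j i <= et * (1 / 2) ^ j" for j using refine_step[of N t et] et by blast
  have Xm: "X (t k) \<in> borel_measurable P" using mesh_range[OF t(1) k] t(2) by (intro X_measurable) simp
  have iU: "integrable P (%om. ph (U j om))" for j unfolding U_def by (rule integrable_wcl_Y[OF cl mesh_refine[OF t(1)] kj])
  show "integrable P (%om. ph (Y x0 t k om))" using iU[of 0] by (simp add: U0)
  show iX: "integrable P (%om. ph (X (t k) om))"
  proof (rule Bochner_Integration.integrable_bound)
   show "integrable P (%om. Cph * w r (X (t k) om))" using B[OF t k] by simp
   show "(%om. ph (X (t k) om)) \<in> borel_measurable P"
    by (rule measurable_compose[OF Xm borel_measurable_continuous_onI[OF wcl_continuous[OF cl]]])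
  qed (auto intro!: AE_I2 order_trans[OF wcl_abs[OF cl]] simp: Cph0)
  let ?E = "%j. expectation (%om. ph (U j om))" and ?X = "expectation (%om. ph (X (t k) om))"
  have d: "\<bar>?E (Suc j) - ?E j\<bar> <= Cph * C * et^2 * (1 / 2) ^ j" for j
  proof -
   have "\<bar>?E (Suc j) - ?E j\<bar> <= Cph * C * (et * (1 / 2) ^ j)^2"
    using C[OF cl mesh_refine[OF t(1)] r kj] by (simp add: U_def refine_Suc mult.assoc)
   also have "... = Cph * C * et^2 * ((1 / 2) ^ j * (1 / 2) ^ j)" by (simp add: power_mult_distrib power2_eq_square)
   also have "... <= Cph * C * et^2 * ((1 / 2) ^ j * 1)" using Cph0 C0 by (intro mult_left_mono power_le_one) auto
   finally show ?thesis by simp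
  qed
  have tel: "\<bar>?E j - ?E 0\<bar> <= 2 * Cph * C * et^2" for j
  proof -
   have "\<bar>?E j - ?E 0\<bar> = \<bar>\<Sum>i<j. ?E (Suc i) - ?E i\<bar>" using arg_cong[OF sum_lessThan_telescope[of ?E j], of abs] by (rule sym)
   also have "... <= (\<Sum>i<j. Cph * C * et^2 * (1 / 2) ^ i)" by (rule order_trans[OF sum_abs]) (intro sum_mono d)
   also have "... = Cph * C * et^2 * (\<Sum>i<j. (1 / 2) ^ i)" by (simp only: sum_distrib_left)
   also have "... <= Cph * C * et^2 * 2" using Cph0 C0 geometric_half by (intro mult_left_mono) auto
   finally show ?thesis by simp
  qed
  let ?R = "Cph * (2 * (D * w (2 * r) x0) + 2 * A + S * et^2)"
  have lim: "\<bar>?E j - ?X\<bar> <= ?R * (1 / 2) ^ j" for j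
  proof -
   \<comment> \<open>Balances the weights against the strong error: the square of the latter is of
     size 4^-j, so that division by 2^-j still leaves 2^-j.\<close>
   let ?th = "(1 / 2 :: real) ^ j"
   have th: "0 < ?th" by simp
   note Dj = D[OF mesh_refine[OF t(1)] kj[of j], of x0, folded U_def] and Aj = A[OF t k]
   have Sj: "integrable P (%om. (norm (U j om - X (t k) om))\<^sup>2)" "expectation (%om. (norm (U j om - X (t k) om))\<^sup>2) <= S * (et * ?th)^2"
    using S[OF mesh_refine[OF t(1)] r0 r kj, of j] by (simp_all add: U_def)
   let ?g = "%om. Cph * (?th * (2 * w (2 * r) (U j om) + 2 * w (2 * r) (X (t k) om)) + (norm (U j om - X (t k) om))^2 / ?th)"
   have le: "\<bar>ph (U j om) - ph (X (t k) om)\<bar> <= ?g om" for om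
   proof -
    let ?u = "w r (U j om) + w r (X (t k) om)" and ?d = "norm (U j om - X (t k) om)"
    have "?u * ?d <= ?th * ?u^2 + ?d^2 / ?th"
    proof -
     have "2 * (?th * ?u) * ?d <= (?th * ?u)^2 + ?d^2" by (rule sum_squares_bound)
     moreover have "0 <= (?th * ?u)^2 + ?d^2" by simp
     ultimately have "(?th * ?u) * ?d <= (?th * ?u)^2 + ?d^2" by linarith
     then have "((?th * ?u) * ?d) / ?th <= ((?th * ?u)^2 + ?d^2) / ?th" using th by (intro divide_right_mono) auto
     moreover have "((?th * ?u) * ?d) / ?th = ?u * ?d" using th by simp
     moreover have "((?th * ?u)^2 + ?d^2) / ?th = ?th * ?u^2 + ?d^2 / ?th"
      using th by (simp add: add_divide_distrib power2_eq_square)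
     ultimately show ?thesis by simp
    qed
    also have "?u^2 <= 2 * w (2 * r) (U j om) + 2 * w (2 * r) (X (t k) om)"
     using sum_squares_bound[of "w r (U j om)" "w r (X (t k) om)"] unfolding wR_double[symmetric]
     by (simp add: power2_eq_square algebra_simps)
    finally have "?u * ?d <= ?th * (2 * w (2 * r) (U j om) + 2 * w (2 * r) (X (t k) om)) + ?d^2 / ?th"
     using th by (simp add: mult_left_mono)
    from mult_left_mono[OF this Cph0] wcl_diff[OF cl, of "U j om" "X (t k) om"] show ?thesis by (simp only: mult.assoc)
   qed
   have ig: "integrable P ?g" using Dj Aj Sj
    by (intro integrable_mult_right Bochner_Integration.integrable_add integrable_divide) auto
   have "\<bar>?E j - ?X\<bar> = \<bar>expectation (%om. ph (U j om) - ph (X (t k) om))\<bar>" using iU iX by simp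
   also have "... <= expectation ?g" by (rule abs_expectation_le(2)[OF _ ig le]) (use iU iX in simp)
   also have "... = Cph * (?th * (2 * expectation (%om. w (2 * r) (U j om)) + 2 * expectation (%om. w (2 * r) (X (t k) om))) + expectation (%om. (norm (U j om - X (t k) om))\<^sup>2) / ?th)"
    using Dj Aj Sj by simp
   also have "... <= Cph * (?th * (2 * (D * w (2 * r) x0) + 2 * A) + (S * (et * ?th)^2) / ?th)"
    using Dj Aj Sj Cph0 th by (intro mult_left_mono add_mono divide_right_mono) auto
   also have "(S * (et * ?th)^2) / ?th = S * et^2 * ?th" by (simp add: power2_eq_square)
   finally show ?thesis by (simp add: algebra_simps)
  qed
  have "(%j. 2 * Cph * C * et^2 + ?R * (1 / 2) ^ j) \<longlonglongrightarrow> 2 * Cph * C * et^2 + ?R * 0"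
   by (intro tendsto_intros LIMSEQ_power_zero) simp
  moreover have "\<bar>?E 0 - ?X\<bar> <= 2 * Cph * C * et^2 + ?R * (1 / 2) ^ j" for j
   using tel[of j] lim[of j] by linarith
  ultimately have "\<bar>?E 0 - ?X\<bar> <= 2 * Cph * C * et^2 + ?R * 0" by (intro LIMSEQ_le_const) auto
  then show "\<bar>expectation (%om. ph (Y x0 t k om)) - ?X\<bar> <= 2 * Cph * C * et^2" by (simp add: U0)
 qed
qed

end

section \<open>From smooth functions to the abstract conditions\<close>

lemma ex_max_finite:
 fixes f :: "'c::finite => real"
 shows "\<exists>c. \<forall>d. f d <= f c"
proof -
 have "Max (range f) \<in> range f" by (rule Max_in) auto
 then obtain c where "Max (range f) = f c" by (rule rangeE)
 moreover have "f d <= Max (range f)" for d by (rule Max_ge) auto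
 ultimately show ?thesis by metis
qed

lemma norm_power_le_weight: "norm x ^ r <= w r x"
proof -
 have "norm x <= 1 + (norm x)^2"
  using sum_squares_bound[of "norm x" 1] by (simp add: power2_eq_square) (smt (verit) mult_nonneg_nonneg norm_ge_zero)
 then show ?thesis unfolding wR_def by (intro power_mono) auto
qed

lemma wR_mono_exp: "r <= q ==> wR r R <= wR q R"
 unfolding wR_def by (intro power_increasing) auto

lemma polynomial_growth_common:
 fixes D :: "'v::euclidean_space list => 'v => 'w::real_normed_vector"
 assumes "\<forall>is\<in>lists Basis. \<exists>C. \<exists>r::nat. \<forall>x. norm (D is x) <= C * (1 + norm x ^ r)"
 shows "\<exists>C\<ge>0. \<exists>q. \<forall>is\<in>lists Basis. length is <= p --> (\<forall>x. norm (D is x) <= C * w q x)"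
proof -
 obtain c r where cr: "\<And>is x. is \<in> lists Basis ==> norm (D is x) <= c is * (1 + norm x ^ (r is :: nat))"
  using assms by metis
 let ?I = "{is \<in> lists (Basis :: 'v set). length is <= p}"
 have fin: "finite ?I" by (rule finite_lists_Basis)
 let ?C = "\<Sum>is\<in>?I. 2 * \<bar>c is\<bar>" and ?q = "\<Sum>is\<in>?I. r is"
 show ?thesis
 proof (rule exI[of _ ?C], intro conjI exI[of _ ?q] ballI impI allI)
  show "0 <= ?C" by (intro sum_nonneg) auto
  fix "is" :: "'v list" and x assume a: "is \<in> lists Basis" "length is <= p"
  then have I: "is \<in> ?I" by simp
  have "norm (D is x) <= c is * (1 + norm x ^ r is)" by (rule cr[OF a(1)])
  also have "... <= \<bar>c is\<bar> * (1 + norm x ^ r is)" by (intro mult_right_mono) auto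
  also have "... <= \<bar>c is\<bar> * (w (r is) x + w (r is) x)"
   using norm_power_le_weight by (intro mult_left_mono add_mono) auto
  also have "... = (2 * \<bar>c is\<bar>) * w (r is) x" by simp
  also have "... <= ?C * w ?q x"
  proof (rule mult_mono)
   show "2 * \<bar>c is\<bar> <= ?C" by (rule member_le_sum[OF I _ fin]) auto
   have "r is <= ?q" by (rule member_le_sum[OF I _ fin]) auto
   then show "w (r is) x <= w ?q x" by (rule wR_mono_exp)
  qed (auto intro: sum_nonneg)
  finally show "norm (D is x) <= ?C * w ?q x" .
 qed
qed

text \<open>Apply the derivative bounds on the ball whose radius is the largest norm of a vertex.
  The ball is convex and contains all vertices, and the weight at its radius is the weight of one
  vertex, hence below the sum over the vertices.\<close>

lemma wcl_of_smooth:
 fixes f :: "'v::euclidean_space => real"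
 assumes "smooth_polynomial_growth f"
 shows "\<exists>r C. wcl r C f"
proof -
 obtain D where D: "partial_derivatives_on UNIV f D"
  and g: "\<forall>is\<in>lists Basis. \<exists>C. \<exists>r::nat. \<forall>x. norm (D is x) <= C * (1 + norm x ^ r)"
  using assms unfolding smooth_polynomial_growth_def by blast
 obtain C q where C0: "0 <= C" and C: "\<And>is x. is \<in> lists Basis ==> length is <= 3 ==> norm (D is x) <= C * w q x"
  using polynomial_growth_common[OF g, of 3] by blast
 have f: "f x = D [] x" for x using D by (simp add: partial_derivatives_on_def)
 let ?d = "real DIM('v)"
 have d1: "1 <= ?d" using DIM_positive[where 'a='v] by linarith
 have pd: "pd_family (cball (0::'v) R) D 3 (C * wR q R)" for R
 proof
  show "(D is has_derivative (%v. \<Sum>i\<in>Basis. (v \<bullet> i) *R D (i # is) x)) (at x within cball 0 R)" if "is \<in> lists Basis" for "is" x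
  proof -
   have "(D is has_derivative (%v. \<Sum>i\<in>Basis. (v \<bullet> i) *R D (i # is) x)) (at x within UNIV)"
    using D that unfolding partial_derivatives_on_def by blast
   then show ?thesis by (rule has_derivative_subset) simp
  qed
  show "norm (D is x) <= C * wR q R" if "is \<in> lists Basis" "is \<noteq> []" "length is <= 3" "x \<in> cball 0 R" for "is" x
   using C[OF that(1,3), of x] mult_left_mono[OF w_le_wR[of x R q] C0] that(4) by simp
 qed (use C0 in simp_all)
 have dm: "pd_family.dm TYPE('v) = ?d" by (simp add: pd_family.dm_def[OF pd])
 have nil: "[] \<in> lists (Basis :: 'v set)" by simp
 let ?K = "?d ^ 3 * C"
 have K: "C <= ?K" "?d * C <= ?K" "?d^2 * C <= ?K"
  using mult_right_mono[OF one_le_power[OF d1, of 3] C0] mult_right_mono[OF power_increasing[of 1 3 ?d] C0] mult_right_mono[OF power_increasing[of 2 3 ?d] C0] d1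
  by simp_all
 have sum2: "g i j <= (\<Sum>i\<in>UNIV. \<Sum>j\<in>UNIV. g i j)" if "\<And>i j. 0 <= g i j" for g :: "bool => bool => real" and i j
  using that by (intro order_trans[OF member_le_sum[of j UNIV "g i"] member_le_sum[of i UNIV "%i. \<Sum>j\<in>UNIV. g i j"]] sum_nonneg) auto
 have sum3: "g i j k <= (\<Sum>i\<in>UNIV. \<Sum>j\<in>UNIV. \<Sum>k\<in>UNIV. g i j k)" if "\<And>i j k. 0 <= g i j k" for g :: "bool => bool => bool => real" and i j k
  using that by (intro order_trans[OF sum2[of "g i" j k] member_le_sum[of i UNIV "%i. \<Sum>j\<in>UNIV. \<Sum>k\<in>UNIV. g i j k"]] sum_nonneg) auto
 have "wcl q ?K f"
  unfolding wcl_def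
 proof (intro conjI allI impI)
  show "0 <= ?K" using C0 by simp
  show "\<bar>f x\<bar> <= ?K * w q x" for x
  proof -
   have "\<bar>f x\<bar> <= C * w q x" using C[OF nil, of x] by (simp add: f)
   also have "... <= ?K * w q x" by (rule mult_right_mono[OF K(1)]) simp
   finally show ?thesis .
  qed
  show "\<bar>f x - f y\<bar> <= ?K * (w q x + w q y) * norm (x - y)" for x y
  proof -
   let ?R = "max (norm x) (norm y)"
   have "\<bar>f x - f y\<bar> <= norm (x - y) * (?d * (C * wR q ?R))"
    using pd_family.seg_bound[OF pd nil, of y ?R x] by (simp add: f dm)
   also have "... = (?d * C) * wR q ?R * norm (x - y)" by simp
   also have "... <= ?K * (w q x + w q y) * norm (x - y)"
   proof (rule mult_right_mono[OF mult_mono[OF K(2)]])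
    show "wR q ?R <= w q x + w q y" by (simp add: max_def)
   qed (use C0 in auto)
   finally show ?thesis .
  qed
  fix x :: "bool => bool => 'v" and al1 al2 be assume sq: "sqb x al1 al2 be"
  obtain ij where ij: "\<And>i j. norm (x i j) <= norm (x (fst ij) (snd ij))"
   using ex_max_finite[of "%p. norm (x (fst p) (snd p))"] by (metis fst_conv snd_conv)
  let ?R = "norm (x (fst ij) (snd ij))"
  have "norm (d2 (%i j. D [] (x i j))) <= ?d^2 * (C * wR q ?R) * (be + al1 * al2)"
   using pd_family.sq_bound[OF pd nil _ _ sq, of ?R] ij by (simp add: dm)
  also have "... = (?d^2 * C) * wR q ?R * (be + al1 * al2)" by simp
  also have "... <= ?K * (\<Sum>i\<in>UNIV. \<Sum>j\<in>UNIV. w q (x i j)) * (be + al1 * al2)"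
  proof (rule mult_right_mono[OF mult_mono[OF K(3)]])
   show "wR q ?R <= (\<Sum>i\<in>UNIV. \<Sum>j\<in>UNIV. w q (x i j))" by (rule sum2) simp
  qed (use C0 sqb_nonneg[OF sq] in \<open>auto intro!: sum_nonneg\<close>)
  finally show "\<bar>d2 (%i j. f (x i j))\<bar> <= ?K * (\<Sum>i\<in>UNIV. \<Sum>j\<in>UNIV. w q (x i j)) * (be + al1 * al2)" by (simp add: f)
 next
  fix x :: "bool => bool => bool => 'v" and al1 al2 al3 be12 be13 be23 ga assume cb: "cubeb x al1 al2 al3 be12 be13 be23 ga"
  obtain p where p: "\<And>i j k. norm (x i j k) <= norm (x (fst p) (fst (snd p)) (snd (snd p)))"
   using ex_max_finite[of "%p. norm (x (fst p) (fst (snd p)) (snd (snd p)))"] by (metis fst_conv snd_conv)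
  let ?R = "norm (x (fst p) (fst (snd p)) (snd (snd p)))" and ?b = "b3 al1 al2 al3 be12 be13 be23 ga"
  have "norm (d3 (%i j k. D [] (x i j k))) <= ?d ^ 3 * (C * wR q ?R) * ?b"
   using pd_family.cube_bound[OF pd nil _ _ cb, of ?R] p by (simp add: dm)
  also have "... = ?K * wR q ?R * ?b" by simp
  also have "... <= ?K * (\<Sum>i\<in>UNIV. \<Sum>j\<in>UNIV. \<Sum>k\<in>UNIV. w q (x i j k)) * ?b"
  proof (intro mult_right_mono mult_left_mono)
   show "wR q ?R <= (\<Sum>i\<in>UNIV. \<Sum>j\<in>UNIV. \<Sum>k\<in>UNIV. w q (x i j k))" by (rule sum3) simp
   show "0 <= ?K" using C0 by simp
   show "0 <= ?b" using cubeb_nonneg[OF cb] by simp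
  qed
  finally show "\<bar>d3 (%i j k. f (x i j k))\<bar> <= ?K * (\<Sum>i\<in>UNIV. \<Sum>j\<in>UNIV. \<Sum>k\<in>UNIV. w q (x i j k)) * ?b" by (simp add: f)
 qed
 then show ?thesis by blast
qed

text \<open>Transport along a linear map that preserves norms; it serves to pass between different
  bracketings of a product of three spaces.\<close>

lemma quad_approx_compose:
 assumes q: "quad_approx C V A L B" and io: "linear io" "\<And>v. norm (io v) = norm v"
  and A: "\<And>v. v \<in> V' ==> io v \<in> V" "\<And>v. v \<in> V' ==> A' v = A (io v)" and C: "C <= C'"
 shows "quad_approx C' V' A' (%v. L (io v)) (%u v. B (io u) (io v))"
proof -
 have L: "linear L" and B: "bilinear B" and Lb: "\<And>v. norm (L v) <= C * norm v" and Bb: "\<And>u v. norm (B u v) <= C * norm u * norm v"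
  and r3: "\<And>v. v \<in> V ==> norm (A v - L v - B v v) <= C * norm v ^ 3"
  and r4: "\<And>u v. u \<in> V ==> v \<in> V ==> norm ((A u - L u - B u u) + (A v - L v - B v v)) <= C * (norm (u + v) * (norm u + norm v)^2 + (norm u + norm v) ^ 4)"
  using q unfolding quad_approx_def by auto
 have up: "x <= C * y ==> 0 <= y ==> x <= C' * y" for x y using mult_right_mono[OF C, of y] by linarith
 show ?thesis unfolding quad_approx_def
 proof (intro conjI allI ballI)
  show "linear (%v. L (io v))" using linear_compose[OF io(1) L] by (simp add: comp_def)
  show "bilinear (%u v. B (io u) (io v))"
   using B linear_compose[OF io(1)] unfolding bilinear_def comp_def by blast
  show "norm (L (io v)) <= C' * norm v" for v using up[OF Lb[of "io v"]] io(2) by simp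
  show "norm (B (io u) (io v)) <= C' * norm u * norm v" for u v
   using up[of "norm (B (io u) (io v))" "norm u * norm v"] Bb[of "io u" "io v"] io(2) by (simp add: mult.assoc)
  show "norm (A' v - L (io v) - B (io v) (io v)) <= C' * norm v ^ 3" if "v \<in> V'" for v
   using up[OF r3[OF A(1)[OF that]]] A(2)[OF that] io(2) by simp
  show "norm ((A' u - L (io u) - B (io u) (io u)) + (A' v - L (io v) - B (io v) (io v))) <= C' * (norm (u + v) * (norm u + norm v)^2 + (norm u + norm v) ^ 4)"
   if "u \<in> V'" "v \<in> V'" for u v
   using up[OF r4[OF A(1)[OF that(1)] A(1)[OF that(2)]]] A(2)[OF that(1)] A(2)[OF that(2)] io(2) linear_add[OF io(1), of u v, symmetric] by simp
 qed
qed

lemma noise_coefficient_bounds: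
 fixes g1 :: "real => 'a::euclidean_space" and g2 :: "real => 'b::euclidean_space"
 assumes T: "0 < T" and "smooth_bounded_derivatives_on {0..T} g1" "smooth_bounded_derivatives_on {0..T} g2"
 defines "G \<equiv> %s. (g1 s, g2 s)"
 shows "\<exists>C\<ge>0. (\<forall>s\<in>{0..T}. norm (G s) <= C) \<and> (\<forall>s\<in>{0..T}. \<forall>s'\<in>{0..T}. norm (G s - G s') <= C * \<bar>s - s'\<bar>) \<and>
  (\<forall>s k. 0 <= k --> s \<in> {0..T} --> s + 2 * k \<in> {0..T} --> norm (G s - 2 *R G (s + k) + G (s + 2 * k)) <= C * k^2)"
proof -
 have cv: "convex {0..T}" by simp
 obtain D1 K1 where 1: "pd_family {0..T} D1 3 K1" "\<And>s. s \<in> {0..T} ==> D1 [] s = g1 s"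
  using smooth_bounded_pd_family[OF assms(2) cv, of 3] by blast
 obtain D2 K2 where 2: "pd_family {0..T} D2 3 K2" "\<And>s. s \<in> {0..T} ==> D2 [] s = g2 s"
  using smooth_bounded_pd_family[OF assms(3) cv, of 3] by blast
 let ?D = "%is x. (D1 is x, D2 is x)"
 interpret pd: pd_family "{0..T}" ?D 3 "K1 + K2" by (rule pd_family_Pair[OF 1(1) 2(1)])
 have G: "?D [] s = G s" if "s \<in> {0..T}" for s using 1(2) 2(2) that by (simp add: G_def)
 have dm: "pd.dm = 1" by (simp add: pd.dm_def)
 have nil: "[] \<in> lists (Basis :: real set)" by simp
 have lip: "norm (G s - G s') <= (K1 + K2) * \<bar>s - s'\<bar>" if "s \<in> {0..T}" "s' \<in> {0..T}" for s s'
  using pd.seg_bound[OF nil _ that(2,1)] unfolding G[OF that(1)] G[OF that(2)] by (simp add: dm mult.commute)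
 let ?C = "norm (G 0) + (K1 + K2) * (1 + T)"
 have K0: "0 <= K1 + K2" by (rule pd.K_nonneg)
 have KC: "K1 + K2 <= ?C"
 proof -
  have "K1 + K2 <= (K1 + K2) * (1 + T)" using K0 T mult_left_mono[of 1 "1 + T" "K1 + K2"] by simp
  then show ?thesis by (rule add_increasing[OF norm_ge_zero])
 qed
 show ?thesis
 proof (rule exI[of _ ?C], intro conjI ballI allI impI)
  show "0 <= ?C" using K0 KC by linarith
  fix s assume s: "s \<in> {0..T}"
  show "norm (G s) <= ?C"
  proof -
   have "norm (G s) <= norm (G 0) + norm (G s - G 0)" using norm_triangle_ineq[of "G 0" "G s - G 0"] by simp
   also have "norm (G s - G 0) <= (K1 + K2) * \<bar>s - 0\<bar>" using T s by (intro lip) auto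
   also have "... <= (K1 + K2) * (1 + T)" using s K0 by (intro mult_left_mono) auto
   finally show ?thesis by simp
  qed
  fix s' assume s': "s' \<in> {0..T}"
  show "norm (G s - G s') <= ?C * \<bar>s - s'\<bar>"
   by (rule order_trans[OF lip[OF s s'] mult_right_mono[OF KC abs_ge_zero]])
 next
  fix s k :: real assume k: "0 <= k" "s \<in> {0..T}" "s + 2 * k \<in> {0..T}"
  \<comment> \<open>A degenerate parallelogram on the time axis with both edges \<open>k\<close>;
    its mixed difference is the second difference wanted.\<close>
  let ?x = "%i j. s + (if i then k else 0) + (if j then k else 0)"
  have x: "?x i j \<in> {0..T}" for i j using k by auto
  have "sqb ?x k k 0" using k by (simp add: sqb_def d2_def)
  then have "norm (d2 (%i j. ?D [] (?x i j))) <= pd.dm^2 * (K1 + K2) * (0 + k * k)"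
   by (intro pd.sq_bound[OF nil _ x]) simp_all
  moreover have "d2 (%i j. ?D [] (?x i j)) = G s - 2 *R G (s + k) + G (s + 2 * k)"
  proof -
   have e: "s + k + k = s + 2 * k" by simp
   have "?D [] (?x i j) = G (?x i j)" for i j by (rule G[OF x])
   then have "d2 (%i j. ?D [] (?x i j)) = d2 (%i j. G (?x i j))" by (simp only:)
   then show ?thesis by (simp add: d2_def scaleR_2 e)
  qed
  ultimately have "norm (G s - 2 *R G (s + k) + G (s + 2 * k)) <= (K1 + K2) * k^2" by (simp add: dm power2_eq_square)
  then show "norm (G s - 2 *R G (s + k) + G (s + 2 * k)) <= ?C * k^2"
   using mult_right_mono[OF KC, of "k^2"] by simp
 qed
qed

text \<open>The expansion of the drift needs four derivatives in state and time jointly. The noise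
  coefficients depend on time alone and enter through their differences up to the second.\<close>

lemma scheme_exists:
 fixes g01 :: "'a::euclidean_space => 'b::euclidean_space => real => 'a" and g02 :: "'a => 'b => real => 'b"
 assumes T: "0 < T"
  and f1: "smooth_bounded_derivatives_on (UNIV \<times> UNIV \<times> {0..T}) (%(x, y, t). g01 x y t)"
  and f2: "smooth_bounded_derivatives_on (UNIV \<times> UNIV \<times> {0..T}) (%(x, y, t). g02 x y t)"
  and n1: "\<And>m. m \<in> {1..M} ==> smooth_bounded_derivatives_on {0..T} (g1 m)"
  and n2: "\<And>m. m \<in> {1..M} ==> smooth_bounded_derivatives_on {0..T} (g2 m)"
 shows "\<exists>K. scheme M g01 g1 g02 g2 T K"
proof -
 let ?S = "(UNIV :: 'a set) \<times> (UNIV :: 'b set) \<times> {0..T}"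
 have cv: "convex ?S" by (intro convex_Times) auto
 obtain D1 K1 where 1: "pd_family ?S D1 4 K1" "\<And>p. p \<in> ?S ==> D1 [] p = (%(x, y, t). g01 x y t) p"
  using smooth_bounded_pd_family[OF f1 cv, of 4] by blast
 obtain D2 K2 where 2: "pd_family ?S D2 4 K2" "\<And>p. p \<in> ?S ==> D2 [] p = (%(x, y, t). g02 x y t) p"
  using smooth_bounded_pd_family[OF f2 cv, of 4] by blast
 let ?D = "%is p. (D1 is p, D2 is p)"
 define K0 where "K0 = K1 + K2"
 interpret pd: pd_family ?S ?D 4 K0 unfolding K0_def by (rule pd_family_Pair[OF 1(1) 2(1)])
 have nil: "[] \<in> lists (Basis :: ('a \<times> 'b \<times> real) set)" by simp
 \<comment> \<open>Reassociates the product without changing norms: \<open>scheme\<close> pairs the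
   state with the time, the coefficients take a triple.\<close>
 define e :: "('a \<times> 'b) \<times> real => 'a \<times> 'b \<times> real" where "e v = (fst (fst v), snd (fst v), snd v)" for v
 have e_lin: "linear e" unfolding e_def by (rule linearI) auto
 have e_norm: "norm (e v) = norm v" for v by (simp add: e_def norm_prod_def power2_eq_square real_sqrt_mult_self add.assoc)
 have e_diff: "e u - e v = e (u - v)" "e u + e v = e (u + v)" for u v by (auto simp: e_def)
 have e0: "norm (e (y, 0)) = norm y" for y by (simp add: e_norm)
 have eS: "e (y, s) \<in> ?S" if "s \<in> {0..T}" for y s using that by (simp add: e_def)
 have dr: "?D [] (e (y, s)) = drift g01 g02 y s" if "s \<in> {0..T}" for y s
  using 1(2)[OF eS[OF that], of y] 2(2)[OF eS[OF that], of y] by (simp add: e_def drift_def)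
 let ?Q = "pd.dm ^ 4 * K0"
 have dmK: "pd.dm ^ j * K0 <= ?Q" if "j <= 4" for j
  using that pd.dm_ge1 pd.K_nonneg by (intro mult_right_mono power_increasing) auto
 have Q0: "0 <= ?Q" using pd.dm_ge1 pd.K_nonneg by simp
 define bnd where "bnd m c \<longleftrightarrow> c \<ge> 0 \<and> (\<forall>s\<in>{0..T}. norm (g1 m s, g2 m s) <= c) \<and>
   (\<forall>s\<in>{0..T}. \<forall>s'\<in>{0..T}. norm ((g1 m s, g2 m s) - (g1 m s', g2 m s')) <= c * \<bar>s - s'\<bar>) \<and>
   (\<forall>s k. 0 <= k --> s \<in> {0..T} --> s + 2 * k \<in> {0..T} -->
     norm ((g1 m s, g2 m s) - 2 *R (g1 m (s + k), g2 m (s + k)) + (g1 m (s + 2 * k), g2 m (s + 2 * k))) <= c * k^2)" for m c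
 have "\<forall>m\<in>{1..M}. \<exists>c. bnd m c"
 proof
  fix m assume "m \<in> {1..M}"
  from noise_coefficient_bounds[OF T n1[OF this] n2[OF this]] show "\<exists>c. bnd m c" unfolding bnd_def .
 qed
 then obtain C where bC: "\<forall>m\<in>{1..M}. bnd m (C m)" by (rule bchoice[THEN exE])
 have C: "0 <= C m" "s \<in> {0..T} ==> norm (g1 m s, g2 m s) <= C m"
  "s \<in> {0..T} ==> s' \<in> {0..T} ==> norm ((g1 m s, g2 m s) - (g1 m s', g2 m s')) <= C m * \<bar>s - s'\<bar>"
  "0 <= k ==> s \<in> {0..T} ==> s + 2 * k \<in> {0..T} ==>
     norm ((g1 m s, g2 m s) - 2 *R (g1 m (s + k), g2 m (s + k)) + (g1 m (s + 2 * k), g2 m (s + 2 * k))) <= C m * k^2"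
  if "m \<in> {1..M}" for m s s' k
  using bspec[OF bC that] unfolding bnd_def by blast+
 define Cs where "Cs = (\<Sum>m=1..M. C m)"
 have Cs: "0 <= Cs" "m \<in> {1..M} ==> C m <= Cs" for m
  unfolding Cs_def using C(1) by (auto intro!: sum_nonneg member_le_sum)
 \<comment> \<open>A sum that dominates every constant: the drift at the origin and the factor
   \<open>1 + T\<close> for the linear growth, 8 for \<open>quad_approx_D\<close>, \<open>Cs\<close>
   for the noise, and 1 for \<open>1 <= K\<close>.\<close>
 define K where "K = 1 + norm (drift g01 g02 0 0) + 8 * ?Q * (1 + T) + Cs"
 have QT: "8 * ?Q <= 8 * ?Q * (1 + T)" using mult_left_mono[of 1 "1 + T" "8 * ?Q"] Q0 T by simp
 have KQ: "8 * ?Q <= K" "Cs <= K" "1 <= K"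
  unfolding K_def using QT Q0 Cs(1) norm_ge_zero[of "drift g01 g02 0 0"] by linarith+
 have KQ1: "?Q <= K" using KQ(1) Q0 by linarith
 have lip: "norm (drift g01 g02 x s - drift g01 g02 y s') <= ?Q * (norm (x - y) + \<bar>s - s'\<bar>)"
  if s: "s \<in> {0..T}" "s' \<in> {0..T}" for x y s s'
 proof -
  have "norm (drift g01 g02 x s - drift g01 g02 y s') <= norm (e (x, s) - e (y, s')) * (pd.dm ^ 1 * K0)"
   using pd.seg_bound[OF nil _ eS[OF s(2), of y] eS[OF s(1), of x]] unfolding dr[OF s(1)] dr[OF s(2)] by simp
  also have "... <= (norm (x - y) + \<bar>s - s'\<bar>) * ?Q"
  proof (rule mult_mono)
   show "norm (e (x, s) - e (y, s')) <= norm (x - y) + \<bar>s - s'\<bar>"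
    unfolding e_diff e_norm using norm_Pair_le[of "x - y" "s - s'"] by simp
  qed (use dmK[of 1] pd.K_nonneg pd.dm_ge1 in auto)
  finally show ?thesis by (simp add: mult.commute)
 qed
 have noise: "norm (\<Sum>m=1..M. xi m *R v m) <= K * b * nz M xi"
  if "\<And>m. m \<in> {1..M} ==> norm (v m) <= C m * b" "0 <= b" for xi :: "nat => real" and v :: "nat => 'a \<times> 'b" and b
 proof -
  have "norm (\<Sum>m=1..M. xi m *R v m) <= (\<Sum>m=1..M. \<bar>xi m\<bar> * (K * b))"
  proof (rule sum_norm_le)
   fix m assume m: "m \<in> {1..M}"
   have "norm (v m) <= K * b" using that(1)[OF m] mult_right_mono[OF order_trans[OF Cs(2)[OF m] KQ(2)] that(2)] by linarith
   then show "norm (xi m *R v m) <= \<bar>xi m\<bar> * (K * b)" by (simp add: mult_left_mono)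
  qed
  also have "... = K * b * nz M xi" by (simp only: nz_def sum_distrib_right[symmetric] mult.commute)
  finally show ?thesis .
 qed
 have "scheme M g01 g1 g02 g2 T K"
 proof
  show "0 < T" "1 <= K" by (rule T, rule KQ(3))
  show "norm (drift g01 g02 x s - drift g01 g02 y s') <= K * (norm (x - y) + \<bar>s - s'\<bar>)" if "s \<in> {0..T}" "s' \<in> {0..T}" for x y s s'
   by (rule order_trans[OF lip[OF that] mult_right_mono[OF KQ1 add_nonneg_nonneg[OF norm_ge_zero abs_ge_zero]]])
  show "norm (drift g01 g02 y s) <= K * (1 + norm y)" if s: "s \<in> {0..T}" for y s
  proof -
   have "norm (drift g01 g02 y s) <= norm (drift g01 g02 0 0) + norm (drift g01 g02 y s - drift g01 g02 0 0)"
    using norm_triangle_ineq[of "drift g01 g02 0 0" "drift g01 g02 y s - drift g01 g02 0 0"] by simp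
   also have "norm (drift g01 g02 y s - drift g01 g02 0 0) <= ?Q * (norm (y - 0) + \<bar>s - 0\<bar>)" using T s by (intro lip) auto
   also have "... <= (?Q * (1 + T)) * (1 + norm y)"
   proof -
    have "0 <= T * norm y" using T by simp
    moreover have "0 <= s" "s <= T" using s by auto
    moreover have "(1 + T) * (1 + norm y) = 1 + T + norm y + T * norm y" by (simp add: algebra_simps)
    moreover have "norm (y - 0) + \<bar>s - 0\<bar> = norm y + s" using s by simp
    ultimately have "norm (y - 0) + \<bar>s - 0\<bar> <= (1 + T) * (1 + norm y)" by linarith
    from mult_left_mono[OF this Q0] show ?thesis by (simp only: mult.assoc)
   qed
   also have "norm (drift g01 g02 0 0) <= norm (drift g01 g02 0 0) * (1 + norm y)" by (simp add: algebra_simps)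
   finally have "norm (drift g01 g02 y s) <= (norm (drift g01 g02 0 0) + ?Q * (1 + T)) * (1 + norm y)" by (simp only: distrib_right)
   also have "... <= K * (1 + norm y)"
   proof (rule mult_right_mono)
    have "0 <= ?Q * (1 + T)" using Q0 T by simp
    then show "norm (drift g01 g02 0 0) + ?Q * (1 + T) <= K" unfolding K_def using Cs(1) by (simp only: mult.assoc)
   qed simp
   finally show ?thesis .
  qed
  show "norm (d2 (%i j. drift g01 g02 (x i j) s)) <= K * (be + al1 * al2)" if s: "s \<in> {0..T}" and sq: "sqb x al1 al2 be" for x s al1 al2 be
  proof -
   have "d2 (%i j. e (x i j, s)) = e (d2 x, 0)" by (simp add: d2_def e_def)
   then have "sqb (%i j. e (x i j, s)) al1 al2 be" using sq by (simp add: sqb_def e_diff e0)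
   from pd.sq_bound[OF nil _ eS[OF s] this]
   have "norm (d2 (%i j. drift g01 g02 (x i j) s)) <= pd.dm^2 * K0 * (be + al1 * al2)" using dr[OF s] by simp
   also have "... <= K * (be + al1 * al2)" using order_trans[OF dmK[of 2] KQ1] sqb_nonneg[OF sq] by (intro mult_right_mono) auto
   finally show ?thesis .
  qed
  show "norm (d3 (%i j k. drift g01 g02 (x i j k) s)) <= K * b3 al1 al2 al3 be12 be13 be23 ga"
   if s: "s \<in> {0..T}" and cb: "cubeb x al1 al2 al3 be12 be13 be23 ga" for x s al1 al2 al3 be12 be13 be23 ga
  proof -
   have "d2 (%i j. e (y i j, s)) = e (d2 y, 0)" for y by (simp add: d2_def e_def)
   then have sq: "sqb (%i j. e (y i j, s)) al al' be = sqb y al al' be" for y al al' be by (simp add: sqb_def e_diff e0)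
   have "d3 (%i j k. e (x i j k, s)) = e (d3 x, 0)" by (simp add: d3_def d2_def e_def)
   then have "cubeb (%i j k. e (x i j k, s)) al1 al2 al3 be12 be13 be23 ga" using cb by (simp add: cubeb_def sq e0)
   from pd.cube_bound[OF nil _ eS[OF s] this]
   have "norm (d3 (%i j k. drift g01 g02 (x i j k) s)) <= pd.dm ^ 3 * K0 * b3 al1 al2 al3 be12 be13 be23 ga" using dr[OF s] by simp
   also have "... <= K * b3 al1 al2 al3 be12 be13 be23 ga" using order_trans[OF dmK[of 3] KQ1] cubeb_nonneg[OF cb] by (intro mult_right_mono) auto
   finally show ?thesis .
  qed
  show "\<exists>L B. quad_approx K {v. s + snd v \<in> {0..T}} (%v. drift g01 g02 (y + fst v) (s + snd v) - drift g01 g02 y s) L B"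
   if s: "s \<in> {0..T}" for y s
  proof -
   obtain L B where LB: "quad_approx (8 * pd.dm ^ 4 * K0) {v. e (y, s) + v \<in> ?S} (%v. ?D [] (e (y, s) + v) - ?D [] (e (y, s))) L B"
    using pd.quad_approx_D[OF _ eS[OF s], of y] by auto
   have "quad_approx K {v. s + snd v \<in> {0..T}} (%v. drift g01 g02 (y + fst v) (s + snd v) - drift g01 g02 y s) (%v. L (e v)) (%u v. B (e u) (e v))"
   proof (rule quad_approx_compose[OF LB e_lin e_norm])
    fix v :: "('a \<times> 'b) \<times> real" assume v: "v \<in> {v. s + snd v \<in> {0..T}}"
    have ev: "e (y, s) + e v = e (y + fst v, s + snd v)" by (simp add: e_def)
    show "e v \<in> {v. e (y, s) + v \<in> ?S}" using v ev eS by simp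
    show "drift g01 g02 (y + fst v) (s + snd v) - drift g01 g02 y s = ?D [] (e (y, s) + e v) - ?D [] (e (y, s))"
     unfolding ev using dr[OF s] dr[of "s + snd v" "y + fst v"] v by simp
   next
    show "8 * pd.dm ^ 4 * K0 <= K" using KQ(1) by (simp only: mult.assoc)
   qed
   then show ?thesis by blast
  qed
  show "norm (noise M g1 g2 s xi) <= K * nz M xi" if s: "s \<in> {0..T}" for s xi
   using noise[of "%m. (g1 m s, g2 m s)" 1 xi] C(2) s by (simp add: noise_def)
  show "norm (noise M g1 g2 s xi - noise M g1 g2 s' xi) <= K * \<bar>s - s'\<bar> * nz M xi" if s: "s \<in> {0..T}" "s' \<in> {0..T}" for s s' xi
  proof -
   have "noise M g1 g2 s xi - noise M g1 g2 s' xi = (\<Sum>m=1..M. xi m *R ((g1 m s, g2 m s) - (g1 m s', g2 m s')))"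
    unfolding noise_def by (simp only: sum_subtractf[symmetric] scaleR_diff_right)
   then show ?thesis using noise[OF C(3)[OF _ s] abs_ge_zero] by (simp only:)
  qed
  show "norm (noise M g1 g2 s xi - 2 *R noise M g1 g2 (s + k) xi + noise M g1 g2 (s + 2 * k) xi) <= K * k^2 * nz M xi"
   if k: "0 <= k" "s \<in> {0..T}" "s + 2 * k \<in> {0..T}" for s k xi
  proof -
   have "noise M g1 g2 s xi - 2 *R noise M g1 g2 (s + k) xi + noise M g1 g2 (s + 2 * k) xi
    = (\<Sum>m=1..M. xi m *R ((g1 m s, g2 m s) - 2 *R (g1 m (s + k), g2 m (s + k)) + (g1 m (s + 2 * k), g2 m (s + 2 * k))))"
    unfolding noise_def scaleR_add_right scaleR_diff_right scaleR_sum_right sum.distrib sum_subtractf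
    by (simp only: scaleR_left_commute)
   then show ?thesis
    using noise[OF C(4)[OF _ k] zero_le_power2] by (simp only:)
  qed
 qed
 then show ?thesis by blast
qed

section \<open>Time grids and orders of convergence\<close>

text \<open>The threshold is the step size condition of \<open>admissible\<close>. As
  \<open>T\<close> is positive the grid has at least one step, so that the maximal step is positive
  and its real powers are the usual ones.\<close>

lemma (in scheme) mesh_of_time_grid:
 assumes "time_grid T N t" "max_step N t <= 1 / (4 * K)"
 shows "mesh N t" "t 0 = 0" "\<forall>i<N. t (Suc i) - t i <= max_step N t" "0 < max_step N t"
proof -
 have g: "t 0 = 0" "t N = T" "\<And>i. i < N ==> t i < t (Suc i)" using assms(1) by (auto simp: time_grid_def)
 have N: "0 < N" using g T_pos by (cases N) auto
 show "t 0 = 0" by (rule g)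
 have st: "t (Suc i) - t i <= max_step N t" if "i < N" for i
  unfolding max_step_def by (rule Max_ge) (use that in auto)
 then show "\<forall>i<N. t (Suc i) - t i <= max_step N t" by blast
 show "0 < max_step N t" using st[OF N] g(3)[OF N] by linarith
 show "mesh N t" unfolding mesh_def
 proof (intro conjI allI impI)
  show "0 <= t 0" using g by simp
  fix i assume i: "i < N"
  have "(t (Suc i) - t i) * K <= (1 / (4 * K)) * K" using st[OF i] assms(2) K_ge1 by (intro mult_right_mono) auto
  then have "(t (Suc i) - t i) * K <= 1 / 4" using K_ge1 by simp
  moreover have "t 0 <= t i" "t (Suc i) <= t N" using chain_le[of N t 0 i] chain_le[of N t "Suc i" N] less_imp_le[OF g(3)] i by auto
  ultimately show "admissible (t i) (t (Suc i))" using g less_imp_le[OF g(3)[OF i]] by (auto simp: admissible_def)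
 qed
qed

theorem (in sde) orders:
 shows "strong_order P T X (Y x0) 1" "weak_order P T X (Y x0) 2"
proof -
 have K0: "0 < 1 / (4 * K)" using K_ge1 by simp
 obtain C where C0: "0 <= C" and C: "\<And>t N et k. mesh N t ==> t 0 = 0 ==> \<forall>i<N. t (Suc i) - t i <= et ==> k <= N ==>
  integrable P (%om. (norm (Y x0 t k om - X (t k) om))\<^sup>2) \<and>
  expectation (%om. (norm (Y x0 t k om - X (t k) om))\<^sup>2) <= C * et^2"
  using strong_error by blast
 show "strong_order P T X (Y x0) 1"
  unfolding strong_order_def
 proof (rule exI[of _ "sqrt C"], rule exI[of _ "1 / (4 * K)"], intro conjI K0 allI impI)
  fix N t assume "time_grid T N t \<and> max_step N t <= 1 / (4 * K)"
  then have m: "mesh N t" "t 0 = 0" "\<forall>i<N. t (Suc i) - t i <= max_step N t" "0 < max_step N t"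
   using mesh_of_time_grid by auto
  note c = C[OF m(1-3)]
  fix k assume k: "k <= N"
  show "Y x0 t k \<in> borel_measurable P" by (rule Y_measurable[OF m(1) k])
  show "integrable P (%om. (norm (Y x0 t k om - X (t k) om))\<^sup>2)" using c[OF k] by blast
 next
  fix N t assume "time_grid T N t \<and> max_step N t <= 1 / (4 * K)"
  then have m: "mesh N t" "t 0 = 0" "\<forall>i<N. t (Suc i) - t i <= max_step N t" "0 < max_step N t"
   using mesh_of_time_grid by auto
  note c = C[OF m(1-3)]
  have "sqrt (expectation (%om. (norm (Y x0 t k om - X (t k) om))\<^sup>2)) <= sqrt C * max_step N t powr 1" if "k <= N" for k
   using real_sqrt_le_mono[OF conjunct2[OF c[OF that]]] m(4) by (simp add: real_sqrt_mult)
  then show "(MAX k\<in>{..N}. sqrt (expectation (%om. (norm (Y x0 t k om - X (t k) om))\<^sup>2))) <= sqrt C * max_step N t powr 1"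
   by (intro Max.boundedI) auto
 qed
 show "weak_order P T X (Y x0) 2"
  unfolding weak_order_def
 proof (intro allI impI)
  fix f :: "'a \<times> 'b => real" assume "smooth_polynomial_growth f"
  then obtain r Cf where cl: "wcl r Cf f" using wcl_of_smooth by blast
  obtain C where C: "\<And>t N et k. mesh N t ==> t 0 = 0 ==> \<forall>i<N. t (Suc i) - t i <= et ==> k <= N ==>
   integrable P (%om. f (Y x0 t k om)) \<and> integrable P (%om. f (X (t k) om)) \<and>
   \<bar>expectation (%om. f (Y x0 t k om)) - expectation (%om. f (X (t k) om))\<bar> <= C * et^2"
   using weak_error[OF cl] by blast
  show "\<exists>C de. 0 < de \<and> (\<forall>N t. time_grid T N t \<and> max_step N t <= de -->
    (\<forall>n\<le>N. integrable P (%om. f (Y x0 t n om)) \<and> integrable P (%om. f (X (t n) om))) \<and>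
    (MAX n\<in>{..N}. \<bar>expectation (%om. f (Y x0 t n om)) - expectation (%om. f (X (t n) om))\<bar>) <= C * max_step N t powr 2)"
  proof (rule exI[of _ C], rule exI[of _ "1 / (4 * K)"], intro conjI K0 allI impI)
   fix N t assume "time_grid T N t \<and> max_step N t <= 1 / (4 * K)"
   then have m: "mesh N t" "t 0 = 0" "\<forall>i<N. t (Suc i) - t i <= max_step N t" "0 < max_step N t"
    using mesh_of_time_grid by auto
   note c = C[OF m(1-3)]
   fix k assume k: "k <= N"
   show "integrable P (%om. f (Y x0 t k om))" "integrable P (%om. f (X (t k) om))" using c[OF k] by blast+
  next
   fix N t assume "time_grid T N t \<and> max_step N t <= 1 / (4 * K)"
   then have m: "mesh N t" "t 0 = 0" "\<forall>i<N. t (Suc i) - t i <= max_step N t" "0 < max_step N t"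
    using mesh_of_time_grid by auto
   note c = C[OF m(1-3)]
   have "\<bar>expectation (%om. f (Y x0 t k om)) - expectation (%om. f (X (t k) om))\<bar> <= C * max_step N t powr 2" if "k <= N" for k
    using c[OF that] m(4) by (simp add: powr_numeral)
   then show "(MAX k\<in>{..N}. \<bar>expectation (%om. f (Y x0 t k om)) - expectation (%om. f (X (t k) om))\<bar>) <= C * max_step N t powr 2"
    by (intro Max.boundedI) auto
  qed
 qed
qed

theorem mainTheorem4:
  fixes P :: "'o measure"
    and M :: nat
    and W :: "nat \<Rightarrow> real \<Rightarrow> 'o \<Rightarrow> real"
    and T :: real
    and g01 :: "real ^ 'd1 \<Rightarrow> real ^ 'd2 \<Rightarrow> real \<Rightarrow> real ^ 'd1"
    and g1 :: "nat \<Rightarrow> real \<Rightarrow> real ^ 'd1"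
    and g02 :: "real ^ 'd1 \<Rightarrow> real ^ 'd2 \<Rightarrow> real \<Rightarrow> real ^ 'd2"
    and g2 :: "nat \<Rightarrow> real \<Rightarrow> real ^ 'd2"
    and x1 :: "real ^ 'd1" and x2 :: "real ^ 'd2"
    and X1 :: "real \<Rightarrow> 'o \<Rightarrow> real ^ 'd1" and X2 :: "real \<Rightarrow> 'o \<Rightarrow> real ^ 'd2"
  assumes "prob_space P"
    and "T > 0"
    and "independent_wiener_processes P M W"
    and "smooth_bounded_derivatives_on (UNIV \<times> UNIV \<times> {0..T}) (\<lambda>(x, y, t). g01 x y t)"
    and "smooth_bounded_derivatives_on (UNIV \<times> UNIV \<times> {0..T}) (\<lambda>(x, y, t). g02 x y t)"
    and "\<And>m. m \<in> {1..M} \<Longrightarrow> smooth_bounded_derivatives_on {0..T} (g1 m)"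
    and "\<And>m. m \<in> {1..M} \<Longrightarrow> smooth_bounded_derivatives_on {0..T} (g2 m)"
    and "additive_noise_dynamics P M W T (\<lambda>t \<omega>. g01 (X1 t \<omega>) (X2 t \<omega>) t) g1 x1 X1"
    and "additive_noise_dynamics P M W T (\<lambda>t \<omega>. g02 (X1 t \<omega>) (X2 t \<omega>) t) g2 x2 X2"
  shows "strong_order P T (\<lambda>t \<omega>. (X1 t \<omega>, X2 t \<omega>)) (sprk M g01 g1 g02 g2 W (x1, x2)) 1
       \<and> weak_order P T (\<lambda>t \<omega>. (X1 t \<omega>, X2 t \<omega>)) (sprk M g01 g1 g02 g2 W (x1, x2)) 2"
proof -
  interpret prob_space P by fact
  have "\<exists>K. scheme M g01 g1 g02 g2 T K"
    by (rule scheme_exists[OF assms(2,4,5)]; erule assms(6,7))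
  then obtain K where "scheme M g01 g1 g02 g2 T K" by blast
  then interpret scheme M g01 g1 g02 g2 T K .
  interpret sde M g01 g1 g02 g2 T K P W x1 x2 X1 X2
    by unfold_locales (fact assms(3), fact assms(8), fact assms(9))
  show ?thesis by (intro conjI orders)
qed

end
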